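(* Consider the constrained system $\Sigma(\theta)$ and its barrier approximation $\Sigma(\theta,\gamma)$ described in the context. Fix $\bar\theta\in\mathbb{R}^r$ and suppose at $\bar\theta$ there is a trajectory $\xi_{\bar\theta}$ with multipliers $(\lambda^{\bar\theta}_{1:T},v^{\bar\theta}_{0:T},w^{\bar\theta}_{0:T})$ such that: (i) the second-order sufficient condition holds for $\Sigma(\bar\theta)$; (ii) the gradients, with respect to the trajectory variables, of all binding constraints of Problem $B(\bar\theta)$ (all equality constraints and all active inequality constraints) at $\xi_{\bar\theta}$ are linearly independent; (iii) strict complementarity holds (every active inequality constraint has positive multiplier). Let $\theta\mapsto\xi_\theta$ be the once continuously differentiable locally unique minimizing trajectory of $\Sigma(\theta)$ near $\bar\theta$ that equals $\xi_{\bar\theta}$ at $\bar\theta$. Then for all $(\theta,\gamma)$ in a neighborhood of $(\bar\theta,0)$ with $\gamma>0$ (in particular, for $\theta=\bar\theta$ and any sufficiently small $\gamma>0$): (a) there exists a local isolated minimizing trajectory $\xi_{(\theta,\gamma)}=\{x^{(\theta,\gamma)}_{0:T},u^{(\theta,\gamma)}_{0:T-1}\}$ solving Problem $SB(\theta,\gamma)$, and $\Sigma(\theta,\gamma)$ is well defined at it, i.e. $g_t(x_t^{(\theta,\gamma)},u_t^{(\theta,\gamma)},\theta)<0$ for all $t=0,\dots,T-1$ and $g_T(x_T^{(\theta,\gamma)},\theta)<0$; (b) $\xi_{(\theta,\gamma)}$ is once continuously differentiable with respect to $(\theta,\gamma)$, and $\xi_{(\theta,\gamma)}\to\xi_\theta$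 and $\frac{\partial\xi_{(\theta,\gamma)}}{\partial\theta}\to\frac{\partial\xi_\theta}{\partial\theta}$ as $\gamma\to0$; (c) the trajectory derivative $\frac{\partial\xi_{(\theta,\gamma)}}{\partial\theta}$ is the globally unique minimizing trajectory of the auxiliary control system $\overline\Sigma(\xi_{(\theta,\gamma)})$ corresponding to $\Sigma(\theta,\gamma)$.
   Context: Setting. $\theta\in\mathbb{R}^r$, horizon $T$, states $x_t\in\mathbb{R}^n$, inputs $u_t\in\mathbb{R}^m$. Three-times continuously differentiable data: $c_t(x,u,\theta)\in\mathbb{R}$, $c_T(x,\theta)\in\mathbb{R}$, $f(x,u,\theta)\in\mathbb{R}^n$, $x_0(\theta)\in\mathbb{R}^n$, $g_t(x,u,\theta)\in\mathbb{R}^{q_t}$, $h_t(x,u,\theta)\in\mathbb{R}^{s_t}$, $g_T(x,\theta)\in\mathbb{R}^{q_T}$, $h_T(x,\theta)\in\mathbb{R}^{s_T}$. Problem $B(\theta)$ (system $\Sigma(\theta)$): minimize $\sum_{t=0}^{T-1}c_t(x_t,u_t,\theta)+c_T(x_T,\theta)$ subject to $x_{t+1}=f(x_t,u_t,\theta)$, $x_0=x_0(\theta)$, $g_t\le0$, $h_t=0$ ($t=0,\dots,T-1$), $g_T(x_T,\theta)\le0$, $h_T(x_T,\theta)=0$. Hamiltonians $L_t=c_t+\lambda_{t+1}'f+v_t'g_t+w_t'h_t$, $L_T=c_T+v_T'g_T+w_T'h_T$; derivatives denoted by superscripts ($L_t^{xx}$, $L_t^{xu}$, $L_t^{x\theta}$,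 $F_t^x$ Jacobian of $f$ in $x$, $H_t^x$ Jacobian of $h_t$ in $x$, etc.). Second-order sufficient condition for $\Sigma(\theta)$: existence of $\lambda_{1:T},v_{0:T},w_{0:T}$ with $x_{t+1}=f(x_t,u_t,\theta)$, $x_0=x_0(\theta)$, $\lambda_t=L_t^x$, $\lambda_T=L_T^x$, $0=L_t^u$, $h_t=0$, $h_T=0$, $g\le0$, $v\ge0$, $v_{t,i}g_{t,i}=0$, $v_{T,i}g_{T,i}=0$, and $\sum_{t=0}^{T-1}[x_t;u_t]'\begin{bmatrix}L_t^{xx}&L_t^{xu}\\L_t^{ux}&L_t^{uu}\end{bmatrix}[x_t;u_t]+x_T'L_T^{xx}x_T>0$ for every nonzero $\{x_{0:T},u_{0:T-1}\}$ satisfying $x_{t+1}=F_t^xx_t+F_t^uu_t$, $x_0=0$, $H_t^xx_t+H_t^uu_t=0$, $H_T^xx_T=0$, linearized constraints of inequality constraints with positive multiplier equal to $0$, and linearized active inequality constraints $\le0$; all derivatives evaluated at the trajectory and multipliers. Barrier system $\Sigma(\theta,\gamma)$, $\gamma>0$ / Problem $SB(\theta,\gamma)$: minimize $J(\theta,\gamma)=\sum_{t=0}^{T-1}\big(c_t(x_t,u_t,\theta)-\gamma\sum_{i=1}^{q_t}\ln(-g_{t,i}(x_t,u_t,\theta))+\frac1{2\gamma}\sum_{i=1}^{s_t}h_{t,i}(x_t,u_t,\theta)^2\big)+c_T(x_T,\theta)-\gamma\sum_{i=1}^{q_T}\ln(-g_{T,i}(x_T,\theta))+\frac1{2\gamma}\sum_{i=1}^{s_T}h_{T,i}(x_T,\theta)^2$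 subject only to $x_{t+1}=f(x_t,u_t,\theta)$, $x_0=x_0(\theta)$. Its Hamiltonians: $\hat L_t=c_t+\lambda_{t+1}'f-\gamma\sum_i\ln(-g_{t,i})+\frac1{2\gamma}\sum_ih_{t,i}^2$, $\hat L_T=c_T-\gamma\sum_i\ln(-g_{T,i})+\frac1{2\gamma}\sum_ih_{T,i}^2$, with costates $\lambda_{1:T}$ satisfying $\lambda_t=\hat L_t^x$, $\lambda_T=\hat L_T^x$ along $\xi_{(\theta,\gamma)}$. Auxiliary control system $\overline\Sigma(\xi_{(\theta,\gamma)})$: variables $X_t\in\mathbb{R}^{n\times r}$, $U_t\in\mathbb{R}^{m\times r}$; minimize $\mathrm{Tr}\sum_{t=0}^{T-1}\big(\tfrac12[X_t;U_t]'\begin{bmatrix}\hat L_t^{xx}&\hat L_t^{xu}\\\hat L_t^{ux}&\hat L_t^{uu}\end{bmatrix}[X_t;U_t]+[\hat L_t^{x\theta};\hat L_t^{u\theta}]'[X_t;U_t]\big)+\mathrm{Tr}\big(\tfrac12X_T'\hat L_T^{xx}X_T+(\hat L_T^{x\theta})'X_T\big)$ subject to $X_{t+1}=F_t^xX_t+F_t^uU_t+F_t^\theta$, $X_0=\partial x_0(\theta)/\partial\theta$, with all coefficients evaluated at $\xi_{(\theta,\gamma)}$ and its costates. A minimizing trajectory $\{X_{0:T},U_{0:T-1}\}$ is identified with $\frac{\partial\xi}{\partial\theta}$ via $X_t=\partial x_t/\partial\theta$, $U_t=\partial u_t/\partial\theta$. *)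

theory Defs
  imports "HOL-Analysis.Analysis"
begin

text \<open>C^k on a set S (meant for open S): k times differentiable with continuous k-th
  derivatives. Since the domain is finite-dimensional, requiring the directional
  derivatives in every direction to be C^(k-1) is the usual notion.\<close>
primrec Ck_on :: "nat \<Rightarrow> 'a::euclidean_space set \<Rightarrow> ('a \<Rightarrow> 'b::real_normed_vector) \<Rightarrow> bool" where
  "Ck_on 0 S f = continuous_on S f"
| "Ck_on (Suc k) S f = ((\<forall>z\<in>S. f differentiable (at z)) \<and>
                         (\<forall>v. Ck_on k S (\<lambda>z. frechet_derivative f (at z) v)))"

definition grad :: "(real^'k \<Rightarrow> real) \<Rightarrow> real^'k \<Rightarrow> real^'k" where
  "grad F z = (\<chi> j. frechet_derivative F (at z) (axis j 1))"

definition jac :: "(real^'k \<Rightarrow> real^'l) \<Rightarrow> real^'k \<Rightarrow> real^'k^'l" where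
  "jac F z = jacobian F (at z)"

definition Dx :: "(real^'n \<Rightarrow> real^'m \<Rightarrow> real^'r \<Rightarrow> real) \<Rightarrow> real^'n \<Rightarrow> real^'m \<Rightarrow> real^'r \<Rightarrow> real^'n" where
  "Dx \<phi> x u \<theta> = grad (\<lambda>x'. \<phi> x' u \<theta>) x"
definition Du :: "(real^'n \<Rightarrow> real^'m \<Rightarrow> real^'r \<Rightarrow> real) \<Rightarrow> real^'n \<Rightarrow> real^'m \<Rightarrow> real^'r \<Rightarrow> real^'m" where
  "Du \<phi> x u \<theta> = grad (\<lambda>u'. \<phi> x u' \<theta>) u"
definition Dxx :: "(real^'n \<Rightarrow> real^'m \<Rightarrow> real^'r \<Rightarrow> real) \<Rightarrow> real^'n \<Rightarrow> real^'m \<Rightarrow> real^'r \<Rightarrow> real^'n^'n" where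
  "Dxx \<phi> x u \<theta> = jac (\<lambda>x'. Dx \<phi> x' u \<theta>) x"
definition Dxu :: "(real^'n \<Rightarrow> real^'m \<Rightarrow> real^'r \<Rightarrow> real) \<Rightarrow> real^'n \<Rightarrow> real^'m \<Rightarrow> real^'r \<Rightarrow> real^'m^'n" where
  "Dxu \<phi> x u \<theta> = jac (\<lambda>u'. Dx \<phi> x u' \<theta>) u"
definition Dux :: "(real^'n \<Rightarrow> real^'m \<Rightarrow> real^'r \<Rightarrow> real) \<Rightarrow> real^'n \<Rightarrow> real^'m \<Rightarrow> real^'r \<Rightarrow> real^'n^'m" where
  "Dux \<phi> x u \<theta> = jac (\<lambda>x'. Du \<phi> x' u \<theta>) x"
definition Duu :: "(real^'n \<Rightarrow> real^'m \<Rightarrow> real^'r \<Rightarrow> real) \<Rightarrow> real^'n \<Rightarrow> real^'m \<Rightarrow> real^'r \<Rightarrow> real^'m^'m" where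
  "Duu \<phi> x u \<theta> = jac (\<lambda>u'. Du \<phi> x u' \<theta>) u"
definition Dxt :: "(real^'n \<Rightarrow> real^'m \<Rightarrow> real^'r \<Rightarrow> real) \<Rightarrow> real^'n \<Rightarrow> real^'m \<Rightarrow> real^'r \<Rightarrow> real^'r^'n" where
  "Dxt \<phi> x u \<theta> = jac (\<lambda>\<theta>'. Dx \<phi> x u \<theta>') \<theta>"
definition Dut :: "(real^'n \<Rightarrow> real^'m \<Rightarrow> real^'r \<Rightarrow> real) \<Rightarrow> real^'n \<Rightarrow> real^'m \<Rightarrow> real^'r \<Rightarrow> real^'r^'m" where
  "Dut \<phi> x u \<theta> = jac (\<lambda>\<theta>'. Du \<phi> x u \<theta>') \<theta>"

definition TDx :: "(real^'n \<Rightarrow> real^'r \<Rightarrow> real) \<Rightarrow> real^'n \<Rightarrow> real^'r \<Rightarrow> real^'n" where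
  "TDx \<phi> x \<theta> = grad (\<lambda>x'. \<phi> x' \<theta>) x"
definition TDxx :: "(real^'n \<Rightarrow> real^'r \<Rightarrow> real) \<Rightarrow> real^'n \<Rightarrow> real^'r \<Rightarrow> real^'n^'n" where
  "TDxx \<phi> x \<theta> = jac (\<lambda>x'. TDx \<phi> x' \<theta>) x"
definition TDxt :: "(real^'n \<Rightarrow> real^'r \<Rightarrow> real) \<Rightarrow> real^'n \<Rightarrow> real^'r \<Rightarrow> real^'r^'n" where
  "TDxt \<phi> x \<theta> = jac (\<lambda>\<theta>'. TDx \<phi> x \<theta>') \<theta>"

definition Fx :: "(real^'n \<Rightarrow> real^'m \<Rightarrow> real^'r \<Rightarrow> real^'n) \<Rightarrow> real^'n \<Rightarrow> real^'m \<Rightarrow> real^'r \<Rightarrow> real^'n^'n" where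
  "Fx F x u \<theta> = jac (\<lambda>x'. F x' u \<theta>) x"
definition Fu :: "(real^'n \<Rightarrow> real^'m \<Rightarrow> real^'r \<Rightarrow> real^'n) \<Rightarrow> real^'n \<Rightarrow> real^'m \<Rightarrow> real^'r \<Rightarrow> real^'m^'n" where
  "Fu F x u \<theta> = jac (\<lambda>u'. F x u' \<theta>) u"
definition Ft :: "(real^'n \<Rightarrow> real^'m \<Rightarrow> real^'r \<Rightarrow> real^'n) \<Rightarrow> real^'n \<Rightarrow> real^'m \<Rightarrow> real^'r \<Rightarrow> real^'r^'n" where
  "Ft F x u \<theta> = jac (\<lambda>\<theta>'. F x u \<theta>') \<theta>"

text \<open>Data of the system Sigma(theta). Inequality constraints g_t have q_t = nq t components
  g_{t,i}, i < q_t; equality constraints h_t have s_t = ns t components; terminal ones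
  have nqT and nsT components.\<close>
record ('n,'m,'r) ocp =
  cst  :: "nat \<Rightarrow> real^'n \<Rightarrow> real^'m \<Rightarrow> real^'r \<Rightarrow> real"
  cstT :: "real^'n \<Rightarrow> real^'r \<Rightarrow> real"
  dyn  :: "real^'n \<Rightarrow> real^'m \<Rightarrow> real^'r \<Rightarrow> real^'n"
  init :: "real^'r \<Rightarrow> real^'n"
  gc   :: "nat \<Rightarrow> nat \<Rightarrow> real^'n \<Rightarrow> real^'m \<Rightarrow> real^'r \<Rightarrow> real"
  nq   :: "nat \<Rightarrow> nat"
  hc   :: "nat \<Rightarrow> nat \<Rightarrow> real^'n \<Rightarrow> real^'m \<Rightarrow> real^'r \<Rightarrow> real"
  ns   :: "nat \<Rightarrow> nat"
  gT   :: "nat \<Rightarrow> real^'n \<Rightarrow> real^'r \<Rightarrow> real"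
  nqT  :: nat
  hT   :: "nat \<Rightarrow> real^'n \<Rightarrow> real^'r \<Rightarrow> real"
  nsT  :: nat

definition smooth_data :: "('n::finite,'m::finite,'r::finite) ocp \<Rightarrow> nat \<Rightarrow> bool" where
  "smooth_data P T \<longleftrightarrow>
     (\<forall>t<T. Ck_on 3 UNIV (\<lambda>(x,u,\<theta>). cst P t x u \<theta>)) \<and>
     Ck_on 3 UNIV (\<lambda>(x,\<theta>). cstT P x \<theta>) \<and>
     Ck_on 3 UNIV (\<lambda>(x,u,\<theta>). dyn P x u \<theta>) \<and>
     Ck_on 3 UNIV (init P) \<and>
     (\<forall>t<T. \<forall>i<nq P t. Ck_on 3 UNIV (\<lambda>(x,u,\<theta>). gc P t i x u \<theta>)) \<and>
     (\<forall>t<T. \<forall>i<ns P t. Ck_on 3 UNIV (\<lambda>(x,u,\<theta>). hc P t i x u \<theta>)) \<and>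
     (\<forall>i<nqT P. Ck_on 3 UNIV (\<lambda>(x,\<theta>). gT P i x \<theta>)) \<and>
     (\<forall>i<nsT P. Ck_on 3 UNIV (\<lambda>(x,\<theta>). hT P i x \<theta>))"

text \<open>A trajectory is x :: nat => state (only x_0..x_T matter), u :: nat => input
  (only u_0..u_{T-1} matter).\<close>
definition same_traj :: "nat \<Rightarrow> (nat \<Rightarrow> 'a) \<Rightarrow> (nat \<Rightarrow> 'b) \<Rightarrow> (nat \<Rightarrow> 'a) \<Rightarrow> (nat \<Rightarrow> 'b) \<Rightarrow> bool" where
  "same_traj T x u x' u' \<longleftrightarrow> (\<forall>t\<le>T. x' t = x t) \<and> (\<forall>t<T. u' t = u t)"

definition traj_near :: "nat \<Rightarrow> real \<Rightarrow> (nat \<Rightarrow> 'a::metric_space) \<Rightarrow> (nat \<Rightarrow> 'b::metric_space)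
                          \<Rightarrow> (nat \<Rightarrow> 'a) \<Rightarrow> (nat \<Rightarrow> 'b) \<Rightarrow> bool" where
  "traj_near T \<epsilon> x u x' u' \<longleftrightarrow> (\<forall>t\<le>T. dist (x' t) (x t) < \<epsilon>) \<and> (\<forall>t<T. dist (u' t) (u t) < \<epsilon>)"

definition dyn_feas :: "('n::finite,'m::finite,'r::finite) ocp \<Rightarrow> nat \<Rightarrow> real^'r \<Rightarrow> (nat \<Rightarrow> real^'n) \<Rightarrow> (nat \<Rightarrow> real^'m) \<Rightarrow> bool" where
  "dyn_feas P T \<theta> x u \<longleftrightarrow> x 0 = init P \<theta> \<and> (\<forall>t<T. x (Suc t) = dyn P (x t) (u t) \<theta>)"

definition B_feas :: "('n::finite,'m::finite,'r::finite) ocp \<Rightarrow> nat \<Rightarrow> real^'r \<Rightarrow> (nat \<Rightarrow> real^'n) \<Rightarrow> (nat \<Rightarrow> real^'m) \<Rightarrow> bool" where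
  "B_feas P T \<theta> x u \<longleftrightarrow> dyn_feas P T \<theta> x u \<and>
     (\<forall>t<T. (\<forall>i<nq P t. gc P t i (x t) (u t) \<theta> \<le> 0) \<and> (\<forall>i<ns P t. hc P t i (x t) (u t) \<theta> = 0)) \<and>
     (\<forall>i<nqT P. gT P i (x T) \<theta> \<le> 0) \<and> (\<forall>i<nsT P. hT P i (x T) \<theta> = 0)"

definition B_cost :: "('n::finite,'m::finite,'r::finite) ocp \<Rightarrow> nat \<Rightarrow> real^'r \<Rightarrow> (nat \<Rightarrow> real^'n) \<Rightarrow> (nat \<Rightarrow> real^'m) \<Rightarrow> real" where
  "B_cost P T \<theta> x u = (\<Sum>t<T. cst P t (x t) (u t) \<theta>) + cstT P (x T) \<theta>"

text \<open>Problem SB(theta,gamma): only the dynamics are constraints; the objective J is defined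
  (the logarithms make sense) exactly when all inequality constraints are strictly negative,
  so the domain of the problem is the set of such trajectories.\<close>
definition SB_feas :: "('n::finite,'m::finite,'r::finite) ocp \<Rightarrow> nat \<Rightarrow> real^'r \<Rightarrow> (nat \<Rightarrow> real^'n) \<Rightarrow> (nat \<Rightarrow> real^'m) \<Rightarrow> bool" where
  "SB_feas P T \<theta> x u \<longleftrightarrow> dyn_feas P T \<theta> x u \<and>
     (\<forall>t<T. \<forall>i<nq P t. gc P t i (x t) (u t) \<theta> < 0) \<and> (\<forall>i<nqT P. gT P i (x T) \<theta> < 0)"

definition SB_cost :: "('n::finite,'m::finite,'r::finite) ocp \<Rightarrow> nat \<Rightarrow> real^'r \<Rightarrow> real \<Rightarrow> (nat \<Rightarrow> real^'n) \<Rightarrow> (nat \<Rightarrow> real^'m) \<Rightarrow> real" where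
  "SB_cost P T \<theta> \<gamma> x u =
     (\<Sum>t<T. cst P t (x t) (u t) \<theta> - \<gamma> * (\<Sum>i<nq P t. ln (- gc P t i (x t) (u t) \<theta>))
             + 1 / (2 * \<gamma>) * (\<Sum>i<ns P t. (hc P t i (x t) (u t) \<theta>)\<^sup>2))
     + cstT P (x T) \<theta> - \<gamma> * (\<Sum>i<nqT P. ln (- gT P i (x T) \<theta>))
     + 1 / (2 * \<gamma>) * (\<Sum>i<nsT P. (hT P i (x T) \<theta>)\<^sup>2)"

definition local_min :: "nat \<Rightarrow> ((nat \<Rightarrow> 'a::metric_space) \<Rightarrow> (nat \<Rightarrow> 'b::metric_space) \<Rightarrow> bool)
     \<Rightarrow> ((nat \<Rightarrow> 'a) \<Rightarrow> (nat \<Rightarrow> 'b) \<Rightarrow> real) \<Rightarrow> (nat \<Rightarrow> 'a) \<Rightarrow> (nat \<Rightarrow> 'b) \<Rightarrow> bool" where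
  "local_min T feas J x u \<longleftrightarrow> feas x u \<and>
     (\<exists>\<epsilon>>0. \<forall>x' u'. feas x' u' \<and> traj_near T \<epsilon> x u x' u' \<longrightarrow> J x u \<le> J x' u')"

definition isolated_local_min :: "nat \<Rightarrow> ((nat \<Rightarrow> 'a::metric_space) \<Rightarrow> (nat \<Rightarrow> 'b::metric_space) \<Rightarrow> bool)
     \<Rightarrow> ((nat \<Rightarrow> 'a) \<Rightarrow> (nat \<Rightarrow> 'b) \<Rightarrow> real) \<Rightarrow> (nat \<Rightarrow> 'a) \<Rightarrow> (nat \<Rightarrow> 'b) \<Rightarrow> bool" where
  "isolated_local_min T feas J x u \<longleftrightarrow> local_min T feas J x u \<and>
     (\<exists>\<epsilon>>0. \<forall>x' u'. traj_near T \<epsilon> x u x' u' \<and> local_min T feas J x' u' \<longrightarrow> same_traj T x u x' u')"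

definition ham :: "('n::finite,'m::finite,'r::finite) ocp \<Rightarrow> nat \<Rightarrow> real^'n \<Rightarrow> (nat \<Rightarrow> real) \<Rightarrow> (nat \<Rightarrow> real)
                   \<Rightarrow> real^'n \<Rightarrow> real^'m \<Rightarrow> real^'r \<Rightarrow> real" where
  "ham P t lamnext vt wt = (\<lambda>x u \<theta>. cst P t x u \<theta> + lamnext \<bullet> dyn P x u \<theta>
      + (\<Sum>i<nq P t. vt i * gc P t i x u \<theta>) + (\<Sum>i<ns P t. wt i * hc P t i x u \<theta>))"

definition hamT :: "('n::finite,'m::finite,'r::finite) ocp \<Rightarrow> (nat \<Rightarrow> real) \<Rightarrow> (nat \<Rightarrow> real)
                   \<Rightarrow> real^'n \<Rightarrow> real^'r \<Rightarrow> real" where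
  "hamT P vT wT = (\<lambda>x \<theta>. cstT P x \<theta>
      + (\<Sum>i<nqT P. vT i * gT P i x \<theta>) + (\<Sum>i<nsT P. wT i * hT P i x \<theta>))"

definition bham :: "('n::finite,'m::finite,'r::finite) ocp \<Rightarrow> nat \<Rightarrow> real \<Rightarrow> real^'n
                   \<Rightarrow> real^'n \<Rightarrow> real^'m \<Rightarrow> real^'r \<Rightarrow> real" where
  "bham P t \<gamma> lamnext = (\<lambda>x u \<theta>. cst P t x u \<theta> + lamnext \<bullet> dyn P x u \<theta>
      - \<gamma> * (\<Sum>i<nq P t. ln (- gc P t i x u \<theta>)) + 1 / (2 * \<gamma>) * (\<Sum>i<ns P t. (hc P t i x u \<theta>)\<^sup>2))"

definition bhamT :: "('n::finite,'m::finite,'r::finite) ocp \<Rightarrow> real \<Rightarrow> real^'n \<Rightarrow> real^'r \<Rightarrow> real" where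
  "bhamT P \<gamma> = (\<lambda>x \<theta>. cstT P x \<theta>
      - \<gamma> * (\<Sum>i<nqT P. ln (- gT P i x \<theta>)) + 1 / (2 * \<gamma>) * (\<Sum>i<nsT P. (hT P i x \<theta>)\<^sup>2))"

text \<open>Multipliers: lam t (t = 1..T), v t i / w t i for t < T, and v T i / w T i for the
  terminal constraints.\<close>
definition KKT :: "('n::finite,'m::finite,'r::finite) ocp \<Rightarrow> nat \<Rightarrow> real^'r \<Rightarrow> (nat \<Rightarrow> real^'n) \<Rightarrow> (nat \<Rightarrow> real^'m)
                   \<Rightarrow> (nat \<Rightarrow> real^'n) \<Rightarrow> (nat \<Rightarrow> nat \<Rightarrow> real) \<Rightarrow> (nat \<Rightarrow> nat \<Rightarrow> real) \<Rightarrow> bool" where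
  "KKT P T \<theta> x u lam v w \<longleftrightarrow>
     B_feas P T \<theta> x u \<and>
     (\<forall>t. 1 \<le> t \<and> t < T \<longrightarrow> lam t = Dx (ham P t (lam (Suc t)) (v t) (w t)) (x t) (u t) \<theta>) \<and>
     lam T = TDx (hamT P (v T) (w T)) (x T) \<theta> \<and>
     (\<forall>t<T. Du (ham P t (lam (Suc t)) (v t) (w t)) (x t) (u t) \<theta> = 0) \<and>
     (\<forall>t<T. \<forall>i<nq P t. v t i \<ge> 0 \<and> v t i * gc P t i (x t) (u t) \<theta> = 0) \<and>
     (\<forall>i<nqT P. v T i \<ge> 0 \<and> v T i * gT P i (x T) \<theta> = 0)"

definition SOSC :: "('n::finite,'m::finite,'r::finite) ocp \<Rightarrow> nat \<Rightarrow> real^'r \<Rightarrow> (nat \<Rightarrow> real^'n) \<Rightarrow> (nat \<Rightarrow> real^'m)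
                   \<Rightarrow> (nat \<Rightarrow> real^'n) \<Rightarrow> (nat \<Rightarrow> nat \<Rightarrow> real) \<Rightarrow> (nat \<Rightarrow> nat \<Rightarrow> real) \<Rightarrow> bool" where
  "SOSC P T \<theta> x u lam v w \<longleftrightarrow> KKT P T \<theta> x u lam v w \<and>
     (\<forall>dx :: nat \<Rightarrow> real^'n. \<forall>du :: nat \<Rightarrow> real^'m.
        ((\<exists>t\<le>T. dx t \<noteq> 0) \<or> (\<exists>t<T. du t \<noteq> 0)) \<and>
        dx 0 = 0 \<and>
        (\<forall>t<T. dx (Suc t) = Fx (dyn P) (x t) (u t) \<theta> *v dx t + Fu (dyn P) (x t) (u t) \<theta> *v du t) \<and>
        (\<forall>t<T. \<forall>i<ns P t. Dx (hc P t i) (x t) (u t) \<theta> \<bullet> dx t + Du (hc P t i) (x t) (u t) \<theta> \<bullet> du t = 0) \<and>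
        (\<forall>i<nsT P. TDx (hT P i) (x T) \<theta> \<bullet> dx T = 0) \<and>
        (\<forall>t<T. \<forall>i<nq P t.
            (v t i > 0 \<longrightarrow> Dx (gc P t i) (x t) (u t) \<theta> \<bullet> dx t + Du (gc P t i) (x t) (u t) \<theta> \<bullet> du t = 0) \<and>
            (gc P t i (x t) (u t) \<theta> = 0 \<longrightarrow> Dx (gc P t i) (x t) (u t) \<theta> \<bullet> dx t + Du (gc P t i) (x t) (u t) \<theta> \<bullet> du t \<le> 0)) \<and>
        (\<forall>i<nqT P.
            (v T i > 0 \<longrightarrow> TDx (gT P i) (x T) \<theta> \<bullet> dx T = 0) \<and>
            (gT P i (x T) \<theta> = 0 \<longrightarrow> TDx (gT P i) (x T) \<theta> \<bullet> dx T \<le> 0))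
      \<longrightarrow>
        (\<Sum>t<T. (let L = ham P t (lam (Suc t)) (v t) (w t) in
                  dx t \<bullet> (Dxx L (x t) (u t) \<theta> *v dx t) + dx t \<bullet> (Dxu L (x t) (u t) \<theta> *v du t)
                + du t \<bullet> (Dux L (x t) (u t) \<theta> *v dx t) + du t \<bullet> (Duu L (x t) (u t) \<theta> *v du t)))
        + dx T \<bullet> (TDxx (hamT P (v T) (w T)) (x T) \<theta> *v dx T) > 0)"

text \<open>Constraints of Problem B: dynamics component j at time t (x_{t+1,j} - f_j(x_t,u_t,theta) = 0),
  initial condition component j (x_{0,j} - x0_j(theta) = 0), h_{t,i}, h_{T,i}, g_{t,i}, g_{T,i}.\<close>
datatype 'n bcon = DynC nat 'n | InitC 'n | EqC nat nat | EqCT nat | InC nat nat | InCT nat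

definition binding :: "('n::finite,'m::finite,'r::finite) ocp \<Rightarrow> nat \<Rightarrow> real^'r \<Rightarrow> (nat \<Rightarrow> real^'n) \<Rightarrow> (nat \<Rightarrow> real^'m) \<Rightarrow> 'n bcon set" where
  "binding P T \<theta> x u =
     {DynC t j | t j. t < T} \<union> range InitC \<union> {EqC t i | t i. t < T \<and> i < ns P t} \<union> {EqCT i | i. i < nsT P}
     \<union> {InC t i | t i. t < T \<and> i < nq P t \<and> gc P t i (x t) (u t) \<theta> = 0}
     \<union> {InCT i | i. i < nqT P \<and> gT P i (x T) \<theta> = 0}"

fun con_grad_x :: "('n::finite,'m::finite,'r::finite) ocp \<Rightarrow> nat \<Rightarrow> real^'r \<Rightarrow> (nat \<Rightarrow> real^'n) \<Rightarrow> (nat \<Rightarrow> real^'m)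
                   \<Rightarrow> 'n bcon \<Rightarrow> nat \<Rightarrow> real^'n" where
  "con_grad_x P T \<theta> x u (DynC t j) \<tau> =
     (if \<tau> = Suc t then axis j 1 else 0) - (if \<tau> = t then Dx (\<lambda>x u \<theta>. dyn P x u \<theta> $ j) (x t) (u t) \<theta> else 0)"
| "con_grad_x P T \<theta> x u (InitC j) \<tau> = (if \<tau> = 0 then axis j 1 else 0)"
| "con_grad_x P T \<theta> x u (EqC t i) \<tau> = (if \<tau> = t then Dx (hc P t i) (x t) (u t) \<theta> else 0)"
| "con_grad_x P T \<theta> x u (EqCT i) \<tau> = (if \<tau> = T then TDx (hT P i) (x T) \<theta> else 0)"
| "con_grad_x P T \<theta> x u (InC t i) \<tau> = (if \<tau> = t then Dx (gc P t i) (x t) (u t) \<theta> else 0)"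
| "con_grad_x P T \<theta> x u (InCT i) \<tau> = (if \<tau> = T then TDx (gT P i) (x T) \<theta> else 0)"

fun con_grad_u :: "('n::finite,'m::finite,'r::finite) ocp \<Rightarrow> nat \<Rightarrow> real^'r \<Rightarrow> (nat \<Rightarrow> real^'n) \<Rightarrow> (nat \<Rightarrow> real^'m)
                   \<Rightarrow> 'n bcon \<Rightarrow> nat \<Rightarrow> real^'m" where
  "con_grad_u P T \<theta> x u (DynC t j) \<tau> = (if \<tau> = t then - Du (\<lambda>x u \<theta>. dyn P x u \<theta> $ j) (x t) (u t) \<theta> else 0)"
| "con_grad_u P T \<theta> x u (InitC j) \<tau> = 0"
| "con_grad_u P T \<theta> x u (EqC t i) \<tau> = (if \<tau> = t then Du (hc P t i) (x t) (u t) \<theta> else 0)"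
| "con_grad_u P T \<theta> x u (EqCT i) \<tau> = 0"
| "con_grad_u P T \<theta> x u (InC t i) \<tau> = (if \<tau> = t then Du (gc P t i) (x t) (u t) \<theta> else 0)"
| "con_grad_u P T \<theta> x u (InCT i) \<tau> = 0"

definition LICQ :: "('n::finite,'m::finite,'r::finite) ocp \<Rightarrow> nat \<Rightarrow> real^'r \<Rightarrow> (nat \<Rightarrow> real^'n) \<Rightarrow> (nat \<Rightarrow> real^'m) \<Rightarrow> bool" where
  "LICQ P T \<theta> x u \<longleftrightarrow>
     (\<forall>c :: 'n bcon \<Rightarrow> real.
        (\<forall>\<tau>\<le>T. (\<Sum>k\<in>binding P T \<theta> x u. c k *\<^sub>R con_grad_x P T \<theta> x u k \<tau>) = 0) \<and>
        (\<forall>\<tau><T. (\<Sum>k\<in>binding P T \<theta> x u. c k *\<^sub>R con_grad_u P T \<theta> x u k \<tau>) = 0)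
        \<longrightarrow> (\<forall>k\<in>binding P T \<theta> x u. c k = 0))"

definition strict_compl :: "('n::finite,'m::finite,'r::finite) ocp \<Rightarrow> nat \<Rightarrow> real^'r \<Rightarrow> (nat \<Rightarrow> real^'n) \<Rightarrow> (nat \<Rightarrow> real^'m)
                   \<Rightarrow> (nat \<Rightarrow> nat \<Rightarrow> real) \<Rightarrow> bool" where
  "strict_compl P T \<theta> x u v \<longleftrightarrow>
     (\<forall>t<T. \<forall>i<nq P t. gc P t i (x t) (u t) \<theta> = 0 \<longrightarrow> v t i > 0) \<and>
     (\<forall>i<nqT P. gT P i (x T) \<theta> = 0 \<longrightarrow> v T i > 0)"

definition barrier_costate :: "('n::finite,'m::finite,'r::finite) ocp \<Rightarrow> nat \<Rightarrow> real^'r \<Rightarrow> real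
      \<Rightarrow> (nat \<Rightarrow> real^'n) \<Rightarrow> (nat \<Rightarrow> real^'m) \<Rightarrow> (nat \<Rightarrow> real^'n) \<Rightarrow> bool" where
  "barrier_costate P T \<theta> \<gamma> x u lam \<longleftrightarrow>
     (\<forall>t. 1 \<le> t \<and> t < T \<longrightarrow> lam t = Dx (bham P t \<gamma> (lam (Suc t))) (x t) (u t) \<theta>) \<and>
     lam T = TDx (bhamT P \<gamma>) (x T) \<theta>"

definition aux_feas :: "('n::finite,'m::finite,'r::finite) ocp \<Rightarrow> nat \<Rightarrow> real^'r
      \<Rightarrow> (nat \<Rightarrow> real^'n) \<Rightarrow> (nat \<Rightarrow> real^'m) \<Rightarrow> (nat \<Rightarrow> real^'r^'n) \<Rightarrow> (nat \<Rightarrow> real^'r^'m) \<Rightarrow> bool" where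
  "aux_feas P T \<theta> x u X U \<longleftrightarrow>
     X 0 = jac (init P) \<theta> \<and>
     (\<forall>t<T. X (Suc t) = Fx (dyn P) (x t) (u t) \<theta> ** X t + Fu (dyn P) (x t) (u t) \<theta> ** U t
                        + Ft (dyn P) (x t) (u t) \<theta>)"

definition aux_cost :: "('n::finite,'m::finite,'r::finite) ocp \<Rightarrow> nat \<Rightarrow> real^'r \<Rightarrow> real
      \<Rightarrow> (nat \<Rightarrow> real^'n) \<Rightarrow> (nat \<Rightarrow> real^'m) \<Rightarrow> (nat \<Rightarrow> real^'n)
      \<Rightarrow> (nat \<Rightarrow> real^'r^'n) \<Rightarrow> (nat \<Rightarrow> real^'r^'m) \<Rightarrow> real" where
  "aux_cost P T \<theta> \<gamma> x u lam X U =
     (\<Sum>t<T. (let L = bham P t \<gamma> (lam (Suc t)); xt = x t; ut = u t in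
        trace ((1/2) *\<^sub>R (transpose (X t) ** Dxx L xt ut \<theta> ** X t + transpose (X t) ** Dxu L xt ut \<theta> ** U t
                         + transpose (U t) ** Dux L xt ut \<theta> ** X t + transpose (U t) ** Duu L xt ut \<theta> ** U t)
               + transpose (Dxt L xt ut \<theta>) ** X t + transpose (Dut L xt ut \<theta>) ** U t)))
     + trace ((1/2) *\<^sub>R (transpose (X T) ** TDxx (bhamT P \<gamma>) (x T) \<theta> ** X T)
              + transpose (TDxt (bhamT P \<gamma>) (x T) \<theta>) ** X T)"

definition aux_unique_min :: "('n::finite,'m::finite,'r::finite) ocp \<Rightarrow> nat \<Rightarrow> real^'r \<Rightarrow> real
      \<Rightarrow> (nat \<Rightarrow> real^'n) \<Rightarrow> (nat \<Rightarrow> real^'m) \<Rightarrow> (nat \<Rightarrow> real^'n)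
      \<Rightarrow> (nat \<Rightarrow> real^'r^'n) \<Rightarrow> (nat \<Rightarrow> real^'r^'m) \<Rightarrow> bool" where
  "aux_unique_min P T \<theta> \<gamma> x u lam X U \<longleftrightarrow>
     aux_feas P T \<theta> x u X U \<and>
     (\<forall>X' U'. aux_feas P T \<theta> x u X' U' \<longrightarrow> aux_cost P T \<theta> \<gamma> x u lam X U \<le> aux_cost P T \<theta> \<gamma> x u lam X' U') \<and>
     (\<forall>X' U'. aux_feas P T \<theta> x u X' U' \<and>
              (\<forall>X'' U''. aux_feas P T \<theta> x u X'' U'' \<longrightarrow> aux_cost P T \<theta> \<gamma> x u lam X' U' \<le> aux_cost P T \<theta> \<gamma> x u lam X'' U'')
              \<longrightarrow> same_traj T X U X' U')"

end

theory Submission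
  imports Defs
begin

text \<open>
  Eliminating the states through the dynamics turns both problems into parametric programs in the
  input sequence alone. At a critical point of the barrier program the quantities
  \<open>- \<gamma> / g\<close> and \<open>h / \<gamma>\<close> act as multipliers. Taking them as additional unknowns \<open>\<mu>\<close>, \<open>\<nu>\<close> and
  multiplying out gives the equations \<open>\<mu> * g + \<gamma> = 0\<close> and \<open>h - \<gamma> * \<nu> = 0\<close> next to stationarity of
  the Lagrangian. This system is smooth across \<open>\<gamma> = 0\<close>, where it becomes the optimality system of the
  constrained program, and second-order sufficiency, linear independence and strict complementarity make it
  regular there. The implicit function theorem yields a continuously differentiable branch through the
  reference solution; for \<open>\<gamma> > 0\<close> it lies in the interior by strict complementarity, and the barrier Hessian
  is positive definite along it by Finsler's lemma. The minimizers of the constrained program form the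
  part of the branch with \<open>\<gamma> = 0\<close>.

  On feasible trajectories, the cost of the auxiliary problem is, up to a constant, a sum over the parameter
  directions of halved second derivatives of the reduced barrier cost. Differentiating the stationarity
  condition along the branch says that the trajectory derivative is a critical point of this strictly
  convex quadratic function.

  Since the horizon is not a type, input sequences live in a finite-dimensional subspace of the Banach
  space of bounded sequences, which is why the calculus is carried out in Banach spaces.
\<close>

section \<open>Calculus of continuously differentiable maps between normed spaces\<close>

text \<open>The unknowns range over a finite-dimensional subspace of a Banach space, while the
  implicit function theorem asks for an invertible derivative on the whole space. Hence
  \<open>opt_sys\<close> is written as the identity plus a map of finite rank: its zeros then lie in
  the subspace automatically, and an injective derivative is already invertible. Full and reduced
  problem are matched by adjoint variables. With a costate, derivatives of a total cost in the
  inputs become sums of derivatives of stage Hamiltonians, even at second order. The same device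
  handles the KKT conditions, carries linear independence of the full gradients over to the reduced
  ones, and evaluates the auxiliary cost. The branch exists for \<gamma> of either sign near 0, so
  both limits as \<gamma> tends to 0 are plain continuity at an interior point. To place the given
  minimizers on the branch, their multipliers must be near the reference ones; directions dual to
  the active gradients provide this estimate.\<close>

definition fderiv :: "('a::real_normed_vector \<Rightarrow> 'b::real_normed_vector) \<Rightarrow> 'a \<Rightarrow> 'a \<Rightarrow>\<^sub>L 'b" where
  "fderiv f q = Blinfun (frechet_derivative f (at q))"

text \<open>Continuity of the derivative is meant in operator norm. Since \<open>fderiv\<close>
  takes values in a normed space, second derivatives are simply \<open>fderiv\<close> of
  \<open>fderiv\<close>.\<close>

definition C1_on :: "'a::real_normed_vector set \<Rightarrow> ('a \<Rightarrow> 'b::real_normed_vector) \<Rightarrow> bool" where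
  "C1_on S f \<longleftrightarrow> (\<forall>q\<in>S. f differentiable (at q)) \<and> continuous_on S (fderiv f)"

definition C2_on :: "'a::real_normed_vector set \<Rightarrow> ('a \<Rightarrow> 'b::real_normed_vector) \<Rightarrow> bool" where
  "C2_on S f \<longleftrightarrow> C1_on S f \<and> C1_on S (fderiv f)"

lemma fderiv_apply:
  assumes "f differentiable (at q)"
  shows "blinfun_apply (fderiv f q) = frechet_derivative f (at q)"
proof -
  have "bounded_linear (frechet_derivative f (at q))"
    using assms frechet_derivative_works has_derivative_bounded_linear by blast
  then show ?thesis by (simp add: fderiv_def bounded_linear_Blinfun_apply)
qed

lemma fderiv_works:
  assumes "f differentiable (at q)"
  shows "(f has_derivative blinfun_apply (fderiv f q)) (at q)"
  using assms by (simp add: fderiv_apply frechet_derivative_works)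

lemma fderiv_eq:
  assumes "(f has_derivative f') (at q)"
  shows "blinfun_apply (fderiv f q) = f'"
  using fderiv_apply[OF differentiableI[OF assms]] frechet_derivative_at[OF assms] by simp

lemma fderiv_eq_blinfun:
  assumes "(f has_derivative blinfun_apply f') (at q)"
  shows "fderiv f q = f'"
  using fderiv_eq[OF assms] by (simp add: blinfun_apply_inject)

lemma fderiv_cong:
  assumes "open S" "q \<in> S" "\<And>q. q \<in> S \<Longrightarrow> f q = g q" "f differentiable (at q)"
  shows "g differentiable (at q)" "fderiv g q = fderiv f q"
proof -
  have "(g has_derivative blinfun_apply (fderiv f q)) (at q)"
    using has_derivative_transform_within_open[OF fderiv_works[OF assms(4)] assms(1,2,3)] .
  then show "g differentiable (at q)" "fderiv g q = fderiv f q"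
    by (auto intro: differentiableI fderiv_eq_blinfun)
qed

lemma C1_onI:
  assumes "\<And>q. q \<in> S \<Longrightarrow> (f has_derivative blinfun_apply (f' q)) (at q)" "continuous_on S f'"
  shows "C1_on S f"
proof -
  have "fderiv f q = f' q" if "q \<in> S" for q using fderiv_eq_blinfun assms(1) that by blast
  then show ?thesis unfolding C1_on_def
    using assms(1) differentiableI continuous_on_eq[OF assms(2)] by (simp, blast)
qed

lemma C1_on_has_derivative:
  assumes "C1_on S f" "q \<in> S"
  shows "(f has_derivative blinfun_apply (fderiv f q)) (at q)"
  using assms fderiv_works unfolding C1_on_def by blast

lemma C1_on_differentiable: "C1_on S f \<Longrightarrow> q \<in> S \<Longrightarrow> f differentiable (at q)"
  by (simp add: C1_on_def)

lemma C1_on_continuous_fderiv: "C1_on S f \<Longrightarrow> continuous_on S (fderiv f)"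
  by (simp add: C1_on_def)

lemma C1_on_isCont: "C1_on S f \<Longrightarrow> q \<in> S \<Longrightarrow> isCont f q"
  using C1_on_differentiable differentiable_imp_continuous_within by blast

lemma C1_on_continuous: "C1_on S f \<Longrightarrow> continuous_on S f"
  by (meson C1_on_isCont continuous_at_imp_continuous_on)

lemma C1_on_subset: "C1_on S f \<Longrightarrow> T \<subseteq> S \<Longrightarrow> C1_on T f"
  unfolding C1_on_def using continuous_on_subset by blast

lemma C1_on_cong:
  assumes "open S" "\<And>q. q \<in> S \<Longrightarrow> f q = g q" "C1_on S f"
  shows "C1_on S g"
  unfolding C1_on_def
proof
  show "\<forall>q\<in>S. g differentiable at q"
    using fderiv_cong(1)[where f = f, OF assms(1) _ assms(2)] C1_on_differentiable[OF assms(3)] by simp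
  have "fderiv g q = fderiv f q" if "q \<in> S" for q
    using fderiv_cong(2)[where f = f, OF assms(1) that assms(2)] C1_on_differentiable[OF assms(3) that] by simp
  then show "continuous_on S (fderiv g)"
    using continuous_on_eq[OF C1_on_continuous_fderiv[OF assms(3)]] by simp
qed

lemma C2_onI:
  assumes "open S" "\<And>q. q \<in> S \<Longrightarrow> (f has_derivative blinfun_apply (f' q)) (at q)" "C1_on S f'"
  shows "C2_on S f"
proof -
  have "fderiv f q = f' q" if "q \<in> S" for q using fderiv_eq_blinfun assms(2) that by blast
  then show ?thesis unfolding C2_on_def
    using C1_on_cong[OF assms(1) _ assms(3), of "fderiv f"] C1_onI[OF assms(2)] C1_on_continuous[OF assms(3)]
    by simp
qed

lemma C2_on_C1: "C2_on S f \<Longrightarrow> C1_on S f"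
  and C2_on_fderiv: "C2_on S f \<Longrightarrow> C1_on S (fderiv f)"
  by (simp_all add: C2_on_def)

lemma C2_on_subset: "C2_on S f \<Longrightarrow> T \<subseteq> S \<Longrightarrow> C2_on T f"
  using C1_on_subset[of S f T] C1_on_subset[of S "fderiv f" T] by (simp add: C2_on_def)

section \<open>Sums, products and compositions of C1 and C2 maps\<close>

lemmas continuous_on_compose_blinfun = bounded_bilinear.continuous_on[OF bounded_bilinear_blinfun_compose]
lemmas continuous_on_apply_blinfun = bounded_bilinear.continuous_on[OF bounded_bilinear_blinfun_apply]

lemma has_derivative_linear_comp:
  assumes "bounded_linear L" "C1_on S f" "q \<in> S"
  shows "((\<lambda>q. L (f q)) has_derivative blinfun_apply (Blinfun L o\<^sub>L fderiv f q)) (at q)"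
  by (rule has_derivative_eq_rhs[OF bounded_linear.has_derivative[OF assms(1) C1_on_has_derivative[OF assms(2,3)]]])
     (simp add: fun_eq_iff bounded_linear_Blinfun_apply[OF assms(1)])

lemma C1_on_linear_comp:
  assumes "bounded_linear L" "C1_on S f"
  shows "C1_on S (\<lambda>q. L (f q))"
  by (rule C1_onI[OF has_derivative_linear_comp[OF assms]], assumption)
     (rule continuous_on_compose_blinfun[OF continuous_on_const C1_on_continuous_fderiv[OF assms(2)]])

lemma C2_on_linear_comp:
  assumes "bounded_linear L" "C2_on S f" "open S"
  shows "C2_on S (\<lambda>q. L (f q))"
  using C2_onI[OF assms(3) has_derivative_linear_comp[OF assms(1) C2_on_C1[OF assms(2)]]]
    C1_on_linear_comp[OF bounded_bilinear.bounded_linear_right[OF bounded_bilinear_blinfun_compose]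
      C2_on_fderiv[OF assms(2)]] by blast

lemma has_derivative_C1_add:
  assumes "C1_on S f" "C1_on S g" "q \<in> S"
  shows "((\<lambda>q. f q + g q) has_derivative blinfun_apply (fderiv f q + fderiv g q)) (at q)"
  by (rule has_derivative_eq_rhs[OF has_derivative_add[OF C1_on_has_derivative[OF assms(1,3)]
        C1_on_has_derivative[OF assms(2,3)]]])
     (simp add: fun_eq_iff blinfun.add_left)

lemma C1_on_add:
  assumes "C1_on S f" "C1_on S g"
  shows "C1_on S (\<lambda>q. f q + g q)"
  by (rule C1_onI[OF has_derivative_C1_add[OF assms]], assumption)
     (intro continuous_on_add C1_on_continuous_fderiv assms)

lemma C2_on_add:
  assumes "C2_on S f" "C2_on S g" "open S"
  shows "C2_on S (\<lambda>q. f q + g q)"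
  using C2_onI[OF assms(3) has_derivative_C1_add[OF assms(1,2)[THEN C2_on_C1]]]
    C1_on_add assms(1,2)[THEN C2_on_fderiv] by blast

lemma fderiv_const [simp]: "fderiv (\<lambda>q. c) = (\<lambda>q. 0)"
  by (rule ext, rule fderiv_eq_blinfun) (auto intro!: derivative_eq_intros)

lemma C1_on_const: "C1_on S (\<lambda>q. c)"
  by (simp add: C1_on_def)

lemma C2_on_const: "C2_on S (\<lambda>q. c)"
  by (simp add: C2_on_def C1_on_const)

lemma C1_on_linear:
  assumes "bounded_linear L"
  shows "C1_on S L"
proof -
  have "(L has_derivative blinfun_apply (Blinfun L)) (at q)" for q
    using assms by (simp add: bounded_linear_Blinfun_apply bounded_linear_imp_has_derivative)
  then show ?thesis by (rule C1_onI) simp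
qed

lemma C2_on_linear:
  assumes "bounded_linear L" "open S"
  shows "C2_on S L"
proof -
  have "(L has_derivative blinfun_apply (Blinfun L)) (at q)" for q
    using assms by (simp add: bounded_linear_Blinfun_apply bounded_linear_imp_has_derivative)
  then show ?thesis by (rule C2_onI[OF assms(2)]) (rule C1_on_const)
qed

lemma C1_on_sum:
  assumes "\<And>i. i \<in> I \<Longrightarrow> C1_on S (f i)"
  shows "C1_on S (\<lambda>q. \<Sum>i\<in>I. f i q)"
  using assms by (induction I rule: infinite_finite_induct) (auto intro: C1_on_const C1_on_add)

lemma C2_on_sum:
  assumes "\<And>i. i \<in> I \<Longrightarrow> C2_on S (f i)" "open S"
  shows "C2_on S (\<lambda>q. \<Sum>i\<in>I. f i q)"
  using assms by (induction I rule: infinite_finite_induct) (auto intro: C2_on_const C2_on_add)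

lemma bounded_linear_inl: "bounded_linear (\<lambda>x. (x, 0))"
  and bounded_linear_inr: "bounded_linear (\<lambda>x. (0, x))"
  by (auto intro!: bounded_linear_Pair bounded_linear_ident bounded_linear_zero)

text \<open>A pair is the sum of its two embedded components, so the rules for sums and linear maps
  suffice.\<close>

lemma C1_on_Pair:
  assumes "C1_on S f" "C1_on S g"
  shows "C1_on S (\<lambda>q. (f q, g q))"
  using C1_on_add[OF C1_on_linear_comp[OF bounded_linear_inl assms(1)]
    C1_on_linear_comp[OF bounded_linear_inr assms(2)]] by simp

lemma C2_on_Pair:
  assumes "C2_on S f" "C2_on S g" "open S"
  shows "C2_on S (\<lambda>q. (f q, g q))"
  using C2_on_add[OF C2_on_linear_comp[OF bounded_linear_inl assms(1,3)]
    C2_on_linear_comp[OF bounded_linear_inr assms(2,3)] assms(3)] by simp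

lemma has_derivative_C1_compose:
  assumes "C1_on T g" "C1_on S f" "f ` S \<subseteq> T" "q \<in> S"
  shows "((\<lambda>q. g (f q)) has_derivative blinfun_apply (fderiv g (f q) o\<^sub>L fderiv f q)) (at q)"
proof -
  have "f q \<in> T" using assms(3,4) by blast
  then show ?thesis
    by (intro has_derivative_eq_rhs[OF has_derivative_compose[OF C1_on_has_derivative[OF assms(2,4)]
          C1_on_has_derivative[OF assms(1)]]]) (simp_all add: fun_eq_iff)
qed

lemma C1_on_compose:
  assumes "C1_on T g" "C1_on S f" "f ` S \<subseteq> T"
  shows "C1_on S (\<lambda>q. g (f q))"
proof (rule C1_onI[OF has_derivative_C1_compose[OF assms]])
  have "continuous_on S (\<lambda>q. fderiv g (f q))"
    by (rule continuous_on_compose2[OF C1_on_continuous_fderiv[OF assms(1)] C1_on_continuous[OF assms(2)] assms(3)])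
  then show "continuous_on S (\<lambda>q. fderiv g (f q) o\<^sub>L fderiv f q)"
    by (rule continuous_on_compose_blinfun[OF _ C1_on_continuous_fderiv[OF assms(2)]])
qed

lemma has_derivative_bilinear:
  assumes "bounded_bilinear pr"
  shows "((\<lambda>(x, y). pr x y) has_derivative
    blinfun_apply ((bounded_bilinear.prod_right pr (fst q) o\<^sub>L snd_blinfun)
                 + (bounded_bilinear.prod_left pr (snd q) o\<^sub>L fst_blinfun))) (at q)"
proof -
  interpret bounded_bilinear pr by fact
  show ?thesis unfolding case_prod_unfold
    by (rule has_derivative_eq_rhs[OF FDERIV[OF has_derivative_fst has_derivative_snd]])
       (auto intro!: derivative_eq_intros simp: blinfun.add_left)
qed

text \<open>The derivative of a bilinear map depends linearly on the base point. This makes every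
  bounded bilinear product C2, which drives the product and composition rules below.\<close>

lemma bounded_linear_fderiv_bilinear:
  assumes "bounded_bilinear pr"
  shows "bounded_linear (\<lambda>q. (bounded_bilinear.prod_right pr (fst q) o\<^sub>L snd_blinfun)
                 + (bounded_bilinear.prod_left pr (snd q) o\<^sub>L fst_blinfun))"
proof -
  interpret bounded_bilinear pr by fact
  show ?thesis
    by (intro bounded_linear_add
      bounded_linear_compose[OF bounded_bilinear.bounded_linear_left[OF bounded_bilinear_blinfun_compose]]
      bounded_linear_compose[OF bounded_linear_prod_right] bounded_linear_compose[OF bounded_linear_prod_left]
      bounded_linear_fst bounded_linear_snd)
qed

lemma C2_on_bilinear_Pair:
  assumes "bounded_bilinear pr"
  shows "C2_on UNIV (\<lambda>(x, y). pr x y)"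
  by (rule C2_onI[OF open_UNIV has_derivative_bilinear[OF assms]
     C1_on_linear[OF bounded_linear_fderiv_bilinear[OF assms]]])

lemma C1_on_bilinear:
  assumes "bounded_bilinear pr" "C1_on S f" "C1_on S g"
  shows "C1_on S (\<lambda>q. pr (f q) (g q))"
  using C1_on_compose[OF C2_on_C1[OF C2_on_bilinear_Pair[OF assms(1)]] C1_on_Pair[OF assms(2,3)]] by simp

text \<open>By the chain rule the derivative is an operator composition of two C1 maps. Operator
  composition is bounded bilinear, so the C1 product rule gives the second order.\<close>

lemma C2_on_compose:
  assumes "C2_on T g" "C2_on S f" "f ` S \<subseteq> T" "open S"
  shows "C2_on S (\<lambda>q. g (f q))"
  by (rule C2_onI[OF assms(4) has_derivative_C1_compose[OF C2_on_C1[OF assms(1)] C2_on_C1[OF assms(2)] assms(3)]], assumption)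
     (rule C1_on_bilinear[OF bounded_bilinear_blinfun_compose
        C1_on_compose[OF C2_on_fderiv[OF assms(1)] C2_on_C1[OF assms(2)] assms(3)] C2_on_fderiv[OF assms(2)]])

lemma C2_on_bilinear:
  assumes "bounded_bilinear pr" "C2_on S f" "C2_on S g" "open S"
  shows "C2_on S (\<lambda>q. pr (f q) (g q))"
  using C2_on_compose[OF C2_on_bilinear_Pair[OF assms(1)] C2_on_Pair[OF assms(2-4)] _ assms(4)] by simp

lemmas C1_on_scaleR = C1_on_bilinear[OF bounded_bilinear_scaleR]
lemmas C1_on_mult = C1_on_bilinear[OF bounded_bilinear_mult]
lemmas C2_on_mult = C2_on_bilinear[OF bounded_bilinear_mult]

lemma C1_on_apply:
  assumes "C1_on S f"
  shows "C1_on S (\<lambda>q. blinfun_apply (f q) v)"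
  by (rule C1_on_linear_comp[OF bounded_bilinear.bounded_linear_left[OF bounded_bilinear_blinfun_apply] assms])

lemma fderiv_apply_const:
  assumes "f differentiable (at q)"
  shows "((\<lambda>q. blinfun_apply (f q) v) has_derivative (\<lambda>h. blinfun_apply (fderiv f q h) v)) (at q)"
  using bounded_linear.has_derivative[OF
    bounded_bilinear.bounded_linear_left[OF bounded_bilinear_blinfun_apply] fderiv_works[OF assms]] .

lemma C2_on_power2: "open S \<Longrightarrow> C2_on S f \<Longrightarrow> C2_on S (\<lambda>q. (f q :: real)\<^sup>2)"
  unfolding power2_eq_square by (rule C2_on_mult)

lemma C2_on_cmult: "open S \<Longrightarrow> C2_on S f \<Longrightarrow> C2_on S (\<lambda>q. c * (f q :: real))"
  by (rule C2_on_mult[OF C2_on_const])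

lemma C2_on_uminus: "open S \<Longrightarrow> C2_on S f \<Longrightarrow> C2_on S (\<lambda>q. - f q)"
  by (rule C2_on_linear_comp[OF bounded_linear_minus[OF bounded_linear_ident]])

lemma C2_on_ln: "C2_on {0<..} (ln :: real \<Rightarrow> real)"
proof (rule C2_onI)
  show "(ln has_derivative blinfun_apply (blinfun_mult_left (inverse x))) (at x)" if "x \<in> {0<..}" for x :: real
    using that by (auto intro!: derivative_eq_intros simp: divide_inverse)
  have "C1_on {0<..} (\<lambda>x::real. inverse x)"
  proof (rule C1_onI)
    show "(inverse has_derivative blinfun_apply (blinfun_mult_left (- (inverse x)\<^sup>2))) (at x)"
      if "x \<in> {0<..}" for x :: real
      using that by (auto intro!: derivative_eq_intros simp: power2_eq_square)
    have "continuous_on {0<..} (inverse :: real \<Rightarrow> real)"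
      by (auto intro!: continuous_at_imp_continuous_on DERIV_isCont[OF DERIV_inverse])
    then show "continuous_on {0<..} (\<lambda>x::real. blinfun_mult_left (- (inverse x)\<^sup>2))"
      by (intro bounded_linear.continuous_on[OF bounded_linear_blinfun_mult_left]
          continuous_on_minus continuous_on_power)
  qed
  then show "C1_on {0<..} (\<lambda>x::real. blinfun_mult_left (inverse x))"
    by (rule C1_on_linear_comp[OF bounded_linear_blinfun_mult_left])
qed simp

section \<open>Comparison with regularity by directional derivatives\<close>

lemma Ck_on_SucD:
  assumes "Ck_on (Suc k) S f"
  shows "\<And>q. q \<in> S \<Longrightarrow> f differentiable (at q)"
    "Ck_on k S (\<lambda>z. frechet_derivative f (at z) v)"
  using assms by auto

text \<open>\<open>Ck_on\<close> asks for continuity of the derivative one direction at a time; on a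
  finite-dimensional domain this is continuity in operator norm.\<close>

lemma C1_on_iff_Ck_on: "C1_on S f \<longleftrightarrow> Ck_on 1 S f"
proof
  assume f: "C1_on S f"
  have "continuous_on S (\<lambda>z. blinfun_apply (fderiv f z) v)" for v
    by (rule continuous_on_apply_blinfun[OF C1_on_continuous_fderiv[OF f] continuous_on_const])
  then have "continuous_on S (\<lambda>z. frechet_derivative f (at z) v)" for v
    by (rule continuous_on_eq) (simp add: fderiv_apply C1_on_differentiable[OF f])
  then show "Ck_on 1 S f" using C1_on_differentiable[OF f] by simp
next
  assume f: "Ck_on 1 S f"
  have "continuous_on S (\<lambda>z. blinfun_apply (fderiv f z) v)" for v
    using Ck_on_SucD(2)[of 0 S f v] f
    by (auto intro: continuous_on_eq simp: fderiv_apply)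
  then have "continuous_on S (fderiv f)" by (intro continuous_on_blinfun_componentwise)
  then show "C1_on S f" using f by (simp add: C1_on_def)
qed

lemma blinfun_basis_expansion:
  fixes A :: "'a::euclidean_space \<Rightarrow>\<^sub>L 'b::real_normed_vector"
  shows "A = (\<Sum>i\<in>Basis. blinfun_scaleR_left (A i) o\<^sub>L blinfun_inner_right i)"
proof (rule blinfun_eqI)
  fix x
  have "A x = A (\<Sum>i\<in>Basis. (x \<bullet> i) *\<^sub>R i)" by (simp add: euclidean_representation)
  also have "\<dots> = (\<Sum>i\<in>Basis. blinfun_scaleR_left (A i) o\<^sub>L blinfun_inner_right i) x"
    by (simp add: blinfun.sum_right blinfun.scaleR_right blinfun.sum_left inner_commute)
  finally show "A x = \<dots>" .
qed

text \<open>An operator on a Euclidean space is a fixed linear expression in its values on the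
  basis, so regularity of these values passes to the operator.\<close>

lemma C1_on_blinfun_componentwise:
  fixes f :: "'a::real_normed_vector \<Rightarrow> 'b::euclidean_space \<Rightarrow>\<^sub>L 'c::real_normed_vector"
  assumes "\<And>v. C1_on S (\<lambda>q. blinfun_apply (f q) v)"
  shows "C1_on S f"
proof -
  have "C1_on S (\<lambda>q. \<Sum>i\<in>Basis. blinfun_scaleR_left (f q i) o\<^sub>L blinfun_inner_right i)"
    by (intro C1_on_sum C1_on_bilinear[OF bounded_bilinear_blinfun_compose] C1_on_const
        C1_on_linear_comp[OF bounded_linear_blinfun_scaleR_left] assms)
  then show ?thesis using blinfun_basis_expansion[of "f q" for q] by simp
qed

lemma Ck_on_2_C1:
  assumes "Ck_on 2 S f" "open S"
  shows "C1_on S f"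
proof -
  have *: "Ck_on (Suc 1) S f" using assms(1) by (simp add: numeral_2_eq_2)
  have "continuous_on S (\<lambda>z. frechet_derivative f (at z) v)" for v
    using C1_on_continuous[OF iffD2[OF C1_on_iff_Ck_on Ck_on_SucD(2)[OF *]]] .
  then show ?thesis using Ck_on_SucD(1)[OF *] C1_on_iff_Ck_on[of S f] by simp
qed

lemma Ck_on_2_C2:
  assumes "Ck_on 2 S f" "open S"
  shows "C2_on S f"
proof -
  have *: "Ck_on (Suc 1) S f" using assms(1) by (simp add: numeral_2_eq_2)
  have f: "C1_on S f" using Ck_on_2_C1[OF assms] .
  have "C1_on S (\<lambda>z. blinfun_apply (fderiv f z) v)" for v
    using C1_on_cong[OF assms(2) _ iffD2[OF C1_on_iff_Ck_on Ck_on_SucD(2)[OF *, of v]]]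
    by (simp add: fderiv_apply C1_on_differentiable[OF f])
  then show ?thesis unfolding C2_on_def using f C1_on_blinfun_componentwise by blast
qed

lemma Ck_on_3_C2:
  assumes "Ck_on 3 S f" "open S"
  shows "C2_on S f"
proof -
  have *: "Ck_on (Suc 2) S f" using assms(1) by (simp add: numeral_3_eq_3 numeral_2_eq_2)
  have 2: "C1_on S (\<lambda>z. frechet_derivative f (at z) v)" for v
    using Ck_on_2_C1[OF Ck_on_SucD(2)[OF *] assms(2)] .
  then have "Ck_on (Suc 1) S f" using Ck_on_SucD(1)[OF *]
    unfolding C1_on_iff_Ck_on Ck_on.simps(2)[of 1] by blast
  then show ?thesis using Ck_on_2_C2 assms(2) by (simp add: numeral_2_eq_2)
qed

text \<open>The mean value theorem in direction \<open>a\<close>, then in direction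
  \<open>b\<close>, turns the quotient into the second derivative at an intermediate point, and
  continuity of that derivative gives the limit.\<close>

lemma second_difference_tendsto:
  fixes f :: "'a::real_normed_vector \<Rightarrow> real"
  assumes f: "C2_on S f" and S: "open S" "q \<in> S"
  shows "((\<lambda>h. (f (q + h *\<^sub>R a + h *\<^sub>R b) - f (q + h *\<^sub>R a) - f (q + h *\<^sub>R b) + f q) / h\<^sup>2)
            \<longlongrightarrow> fderiv (fderiv f) q b a) (at_right 0)"
proof (rule tendstoI)
  fix e :: real assume e: "e > 0"
  let ?d = "\<lambda>p. fderiv (fderiv f) p b a"
  have "continuous_on S ?d"
    by (intro continuous_on_apply_blinfun C1_on_continuous_fderiv[OF C2_on_fderiv[OF f]] continuous_on_const)
  then have "isCont ?d q" using S continuous_on_eq_continuous_at by blast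
  then have "\<forall>\<^sub>F p in nhds q. dist (?d p) (?d q) < e"
    using e tendstoD[of ?d "?d q" "nhds q"] by (simp add: isCont_def tendsto_nhds_iff)
  then have "\<forall>\<^sub>F p in nhds q. dist (?d p) (?d q) < e \<and> p \<in> S"
    using eventually_nhds_in_open[OF S] eventually_conj by blast
  then obtain r where r: "r > 0" "\<And>p. dist p q < r \<Longrightarrow> dist (?d p) (?d q) < e \<and> p \<in> S"
    unfolding eventually_nhds_metric by blast
  \<comment> \<open>Step sizes below \<open>r / ?m\<close> keep the whole parallelogram inside the
    ball; the summand 1 keeps the divisor positive when both directions vanish.\<close>
  let ?m = "norm a + norm b + 1"
  have inr: "dist (q + s *\<^sub>R a + t *\<^sub>R b) q < r"
    if "0 \<le> s" "s \<le> h" "0 \<le> t" "t \<le> h" "h < r / ?m" for s t h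
  proof -
    have "dist (q + s *\<^sub>R a + t *\<^sub>R b) q \<le> s * norm a + t * norm b"
      using norm_triangle_ineq[of "s *\<^sub>R a" "t *\<^sub>R b"] that by (simp add: dist_norm add.assoc)
    also have "\<dots> \<le> h * norm a + h * norm b" using that by (intro add_mono mult_right_mono) auto
    also have "\<dots> \<le> h * ?m" using that by (simp add: algebra_simps)
    also have "\<dots> < r" using that(5) by (simp add: pos_less_divide_eq add_nonneg_pos)
    finally show ?thesis .
  qed
  have "dist ((f (q + h *\<^sub>R a + h *\<^sub>R b) - f (q + h *\<^sub>R a) - f (q + h *\<^sub>R b) + f q) / h\<^sup>2) (?d q) < e"
    if h: "0 < h" "h < r / ?m" for h
  proof -
    define \<psi> where "\<psi> s = f (q + s *\<^sub>R a + h *\<^sub>R b) - f (q + s *\<^sub>R a)" for s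
    have inS: "q + s *\<^sub>R a + t *\<^sub>R b \<in> S" if "0 \<le> s" "s \<le> h" "0 \<le> t" "t \<le> h" for s t
      using inr[OF that h(2)] r(2) by blast
    have df: "((\<lambda>s. f (q + s *\<^sub>R a + t *\<^sub>R b)) has_real_derivative fderiv f (q + s *\<^sub>R a + t *\<^sub>R b) a) (at s)"
      if "0 \<le> s" "s \<le> h" "0 \<le> t" "t \<le> h" for s t
      unfolding has_field_derivative_def
      by (rule has_derivative_eq_rhs[OF has_derivative_compose[where g = f and f = "\<lambda>s. q + s *\<^sub>R a + t *\<^sub>R b",
            OF _ C1_on_has_derivative[OF C2_on_C1[OF f] inS[OF that]]]])
         (auto intro!: derivative_eq_intros simp: blinfun.scaleR_right)
    have d\<psi>: "(\<psi> has_real_derivative fderiv f (q + s *\<^sub>R a + h *\<^sub>R b) a - fderiv f (q + s *\<^sub>R a) a) (at s)"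
      if "0 \<le> s" "s \<le> h" for s
      unfolding \<psi>_def using df[OF that, of h] df[OF that, of 0] h(1) by (auto intro!: DERIV_diff)
    obtain s where s: "0 < s" "s < h" and
      1: "\<psi> h - \<psi> 0 = h * (fderiv f (q + s *\<^sub>R a + h *\<^sub>R b) a - fderiv f (q + s *\<^sub>R a) a)"
      using MVT2[of 0 h \<psi> "\<lambda>s. fderiv f (q + s *\<^sub>R a + h *\<^sub>R b) a - fderiv f (q + s *\<^sub>R a) a", OF h(1) d\<psi>] by auto
    have d2: "((\<lambda>t. fderiv f (q + s *\<^sub>R a + t *\<^sub>R b) a) has_real_derivative ?d (q + s *\<^sub>R a + t *\<^sub>R b)) (at t)"
      if "0 \<le> t" "t \<le> h" for t
      unfolding has_field_derivative_def
      by (rule has_derivative_eq_rhs[OF has_derivative_compose[where f = "\<lambda>t. q + s *\<^sub>R a + t *\<^sub>R b"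
            and g = "\<lambda>p. fderiv f p a", OF _ fderiv_apply_const[OF C1_on_differentiable[OF C2_on_fderiv[OF f] inS]]]])
         (use that s in \<open>auto intro!: derivative_eq_intros simp: blinfun.scaleR_right blinfun.scaleR_left\<close>)
    obtain t where t: "0 < t" "t < h" and
      2: "fderiv f (q + s *\<^sub>R a + h *\<^sub>R b) a - fderiv f (q + s *\<^sub>R a + 0 *\<^sub>R b) a = h * ?d (q + s *\<^sub>R a + t *\<^sub>R b)"
      using MVT2[of 0 h "\<lambda>t. fderiv f (q + s *\<^sub>R a + t *\<^sub>R b) a" "\<lambda>t. ?d (q + s *\<^sub>R a + t *\<^sub>R b)", OF h(1) d2] by auto
    have "\<psi> h - \<psi> 0 = h\<^sup>2 * ?d (q + s *\<^sub>R a + t *\<^sub>R b)"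
      using 1 2 by (simp add: power2_eq_square)
    then have "(f (q + h *\<^sub>R a + h *\<^sub>R b) - f (q + h *\<^sub>R a) - f (q + h *\<^sub>R b) + f q) / h\<^sup>2
        = ?d (q + s *\<^sub>R a + t *\<^sub>R b)"
      using h(1) unfolding \<psi>_def by (simp add: field_simps)
    then show ?thesis using r(2)[OF inr[OF _ _ _ _ h(2)]] s t by simp
  qed
  moreover have "r / ?m > 0" using r(1) by (simp add: add_nonneg_pos)
  ultimately show "\<forall>\<^sub>F h in at_right 0. dist ((f (q + h *\<^sub>R a + h *\<^sub>R b) - f (q + h *\<^sub>R a) - f (q + h *\<^sub>R b) + f q) / h\<^sup>2) (?d q) < e"
    using eventually_at_right_less eventually_at_right_field by blast
qed

text \<open>The second difference does not change when \<open>a\<close> and \<open>b\<close> are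
  swapped, so both mixed derivatives are its limit.\<close>

lemma fderiv2_symmetric:
  fixes f :: "'a::real_normed_vector \<Rightarrow> real"
  assumes "C2_on S f" "open S" "q \<in> S"
  shows "fderiv (fderiv f) q a b = fderiv (fderiv f) q b a"
proof (rule tendsto_unique[OF _ second_difference_tendsto[OF assms, of b a]])
  show "((\<lambda>h. (f (q + h *\<^sub>R b + h *\<^sub>R a) - f (q + h *\<^sub>R b) - f (q + h *\<^sub>R a) + f q) / h\<^sup>2)
            \<longlongrightarrow> fderiv (fderiv f) q b a) (at_right 0)"
    by (rule tendsto_cong[THEN iffD1, OF _ second_difference_tendsto[OF assms, of a b]])
       (simp add: add.assoc add.commute[of "h *\<^sub>R b" "h *\<^sub>R a" for h])
qed simp

section \<open>The implicit function theorem in Banach spaces\<close>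

lemma blinfun_compose_id [simp]: "A o\<^sub>L id_blinfun = A" "id_blinfun o\<^sub>L A = A"
  by (auto intro: blinfun_eqI)

lemma blinfun_compose_assoc: "(A o\<^sub>L B) o\<^sub>L C = A o\<^sub>L (B o\<^sub>L C)"
  by (rule blinfun_eqI) simp

lemmas blinfun_compose_simps = bounded_bilinear.diff_left[OF bounded_bilinear_blinfun_compose]
  bounded_bilinear.diff_right[OF bounded_bilinear_blinfun_compose]
  bounded_bilinear.add_left[OF bounded_bilinear_blinfun_compose]
  bounded_bilinear.add_right[OF bounded_bilinear_blinfun_compose]

text \<open>A right inverse solves \<open>R = B0 + B0 (A0 - A) R\<close> and a left inverse the
  mirrored equation. Both maps are contractions with factor 1/2, and a left and a right inverse of
  one operator agree. The same factor yields the norm bound.\<close>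

lemma blinfun_perturb_inverse:
  fixes A A0 B0 :: "'a::banach \<Rightarrow>\<^sub>L 'a"
  assumes "A0 o\<^sub>L B0 = id_blinfun" "B0 o\<^sub>L A0 = id_blinfun" and le: "norm B0 * norm (A - A0) \<le> 1/2"
  obtains B where "A o\<^sub>L B = id_blinfun" "B o\<^sub>L A = id_blinfun" "norm B \<le> 2 * norm B0"
proof -
  have le': "norm (B0 o\<^sub>L (A0 - A)) \<le> 1/2" "norm ((A0 - A) o\<^sub>L B0) \<le> 1/2"
    using norm_blinfun_compose[of B0 "A0 - A"] norm_blinfun_compose[of "A0 - A" B0] le
    by (simp_all add: norm_minus_commute mult.commute)
  define D E where "D = B0 o\<^sub>L (A0 - A)" and "E = (A0 - A) o\<^sub>L B0"
  have le': "norm D \<le> 1/2" "norm E \<le> 1/2" using le' by (simp_all add: D_def E_def)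
  have "\<exists>!R. B0 + (D o\<^sub>L R) = R"
  proof (rule banach_fix_type[of "1/2"]; (intro allI)?)
    fix R R' :: "'a \<Rightarrow>\<^sub>L 'a"
    show "dist (B0 + (D o\<^sub>L R)) (B0 + (D o\<^sub>L R')) \<le> 1/2 * dist R R'"
      using order_trans[OF norm_blinfun_compose[of D "R - R'"] mult_right_mono[OF le'(1) norm_ge_zero]]
      by (simp add: dist_norm blinfun_compose_simps algebra_simps)
  qed auto
  then obtain R where R': "B0 + (D o\<^sub>L R) = R" by blast
  then have R: "B0 + ((B0 o\<^sub>L (A0 - A)) o\<^sub>L R) = R" by (simp add: D_def)
  have "\<exists>!L. B0 + (L o\<^sub>L E) = L"
  proof (rule banach_fix_type[of "1/2"]; (intro allI)?)
    fix R R' :: "'a \<Rightarrow>\<^sub>L 'a"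
    show "dist (B0 + (R o\<^sub>L E)) (B0 + (R' o\<^sub>L E)) \<le> 1/2 * dist R R'"
      using order_trans[OF norm_blinfun_compose[of "R - R'" E] mult_left_mono[OF le'(2) norm_ge_zero]]
      by (simp add: dist_norm blinfun_compose_simps algebra_simps)
  qed auto
  then obtain L where L: "B0 + (L o\<^sub>L ((A0 - A) o\<^sub>L B0)) = L" by (auto simp: E_def)
  have "A0 o\<^sub>L R = A0 o\<^sub>L (B0 + ((B0 o\<^sub>L (A0 - A)) o\<^sub>L R))" using R by simp
  also have "\<dots> = id_blinfun + ((A0 - A) o\<^sub>L R)"
    by (simp only: blinfun_compose_simps(4) blinfun_compose_assoc[symmetric] assms(1) blinfun_compose_id)
  finally have 1: "A o\<^sub>L R = id_blinfun" by (simp add: blinfun_compose_simps)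
  have "L o\<^sub>L A0 = (B0 + (L o\<^sub>L ((A0 - A) o\<^sub>L B0))) o\<^sub>L A0" using L by simp
  also have "\<dots> = id_blinfun + (L o\<^sub>L (A0 - A))"
    by (simp only: blinfun_compose_simps(3) blinfun_compose_assoc assms(2) blinfun_compose_id)
  finally have 2: "L o\<^sub>L A = id_blinfun" by (simp add: blinfun_compose_simps)
  have "L = L o\<^sub>L (A o\<^sub>L R)" using 1 by simp
  also have "\<dots> = R" using 2 by (simp add: blinfun_compose_assoc[symmetric])
  finally have "R o\<^sub>L A = id_blinfun" using 2 by simp
  moreover have "norm R \<le> norm B0 + 1/2 * norm R"
    using norm_triangle_ineq[of B0 "D o\<^sub>L R"] R'
      order_trans[OF norm_blinfun_compose[of D R] mult_right_mono[OF le'(1) norm_ge_zero]] by simp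
  ultimately show ?thesis using that 1 by simp
qed

text \<open>Newton's iteration with frozen derivative: \<open>S y x = x + B0 (y - \<Phi> x)\<close>
  is a contraction in \<open>x\<close> with factor 1/2 near \<open>x0\<close>, and its fixed point
  is the solution of \<open>\<Phi> x = y\<close>. The derivative of the inverse is the inverse
  operator, which exists nearby and depends continuously on the point by perturbation.\<close>

lemma inverse_function_banach:
  fixes \<Phi> :: "'a::banach \<Rightarrow> 'a"
  assumes W: "open W" "x0 \<in> W" and C1: "C1_on W \<Phi>"
    and inv: "fderiv \<Phi> x0 o\<^sub>L B0 = id_blinfun" "B0 o\<^sub>L fderiv \<Phi> x0 = id_blinfun"
  obtains r d g where "r > 0" "d > 0" "ball x0 r \<subseteq> W"
    "\<And>y. y \<in> ball (\<Phi> x0) d \<Longrightarrow> g y \<in> ball x0 r" "\<And>y. y \<in> ball (\<Phi> x0) d \<Longrightarrow> \<Phi> (g y) = y"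
    "\<And>x. x \<in> ball x0 r \<Longrightarrow> \<Phi> x \<in> ball (\<Phi> x0) d \<Longrightarrow> g (\<Phi> x) = x"
    "C1_on (ball (\<Phi> x0) d) g"
proof -
  let ?A = "fderiv \<Phi>"
  \<comment> \<open>A bound for the norm of \<open>B0\<close> that is positive even if
    \<open>B0\<close> is 0.\<close>
  define M where "M = norm B0 + 1"
  have M: "M > 0" "norm B0 \<le> M" by (auto simp: M_def add_nonneg_pos)
  have "isCont ?A x0"
    using C1_on_continuous_fderiv[OF C1] W continuous_on_eq_continuous_at by blast
  then have "\<forall>\<^sub>F x in nhds x0. dist (?A x) (?A x0) < 1 / (2 * M)"
    using M tendstoD[of ?A "?A x0" "nhds x0" "1 / (2 * M)"] by (simp add: isCont_def tendsto_nhds_iff)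
  then have "\<forall>\<^sub>F x in nhds x0. dist (?A x) (?A x0) < 1 / (2 * M) \<and> x \<in> W"
    using eventually_nhds_in_open[OF W] eventually_conj by blast
  then obtain r' where r': "r' > 0" "\<And>x. dist x x0 < r' \<Longrightarrow> dist (?A x) (?A x0) < 1 / (2 * M) \<and> x \<in> W"
    unfolding eventually_nhds_metric by blast
  define r where "r = r' / 2"
  have r: "r > 0" using r' by (simp add: r_def)
  have rW: "x \<in> W" and rA: "M * norm (?A x - ?A x0) \<le> 1/2" if "x \<in> cball x0 r" for x
  proof -
    have "dist x x0 < r'" using that r' by (simp add: r_def dist_commute)
    then have *: "dist (?A x) (?A x0) < 1 / (2 * M) \<and> x \<in> W" by (rule r')
    then show "x \<in> W" by simp
    have "M * norm (?A x - ?A x0) \<le> M * (1 / (2 * M))"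
      using * M by (intro mult_left_mono) (auto simp: dist_norm)
    then show "M * norm (?A x - ?A x0) \<le> 1/2" using M by simp
  qed
  define S where "S y x = x + B0 (y - \<Phi> x)" for y x
  have contr: "norm (S y x - S y x') \<le> 1/2 * norm (x - x')" if "x \<in> cball x0 r" "x' \<in> cball x0 r" for x x' y
  proof (rule differentiable_bound[OF convex_cball _ _ that])
    fix x assume x: "x \<in> cball x0 r"
    have eq: "h - B0 (?A x h) = - (B0 o\<^sub>L (?A x - ?A x0)) h" for h
      using arg_cong[OF inv(2), of "\<lambda>f. blinfun_apply f h"]
      by (simp add: blinfun.diff_left blinfun.diff_right)
    show "(S y has_derivative (\<lambda>h. h - B0 (?A x h))) (at x within cball x0 r)"
      unfolding S_def using has_derivative_at_withinI[OF C1_on_has_derivative[OF C1 rW[OF x]]]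
      by (auto intro!: derivative_eq_intros simp: blinfun.minus_right)
    have "norm (B0 o\<^sub>L (?A x - ?A x0)) \<le> norm B0 * norm (?A x - ?A x0)" by (rule norm_blinfun_compose)
    also have "\<dots> \<le> M * norm (?A x - ?A x0)" using M by (intro mult_right_mono) auto
    also have "\<dots> \<le> 1/2" using rA[OF x] .
    finally have "norm (B0 o\<^sub>L (?A x - ?A x0)) \<le> 1/2" .
    then have "norm (h - B0 (?A x h)) \<le> 1/2 * norm h" for h
      unfolding eq using order_trans[OF norm_blinfun[of "B0 o\<^sub>L (?A x - ?A x0)" h] mult_right_mono[of _ "1/2" "norm h"]]
      by simp
    then show "onorm (\<lambda>h. h - B0 (?A x h)) \<le> 1/2" by (intro onorm_bound) auto
  qed
  \<comment> \<open>With this radius \<open>M * d = r / 2\<close>. The contraction contributes at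
    most another \<open>r / 2\<close>, so \<open>S y\<close> maps the closed ball into the open
    one.\<close>
  define d where "d = r / (2 * M)"
  have d: "d > 0" using r M by (simp add: d_def)
  have B0y: "norm (B0 v) \<le> M * norm v" for v
    using order_trans[OF norm_blinfun[of B0 v] mult_right_mono[OF M(2) norm_ge_zero]] .
  have S_close: "norm (S y x - x0) < r" if "y \<in> ball (\<Phi> x0) d" "x \<in> cball x0 r" for x y
  proof -
    have "norm (S y x - x0) \<le> norm (S y x - S y x0) + norm (B0 (y - \<Phi> x0))"
      using norm_triangle_ineq[of "S y x - S y x0" "B0 (y - \<Phi> x0)"] by (simp add: S_def)
    also have "norm (S y x - S y x0) \<le> 1/2 * norm (x - x0)" using that r by (intro contr) auto
    also have "\<dots> \<le> 1/2 * r" using that by (simp add: dist_norm norm_minus_commute)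
    also have "norm (B0 (y - \<Phi> x0)) \<le> M * norm (y - \<Phi> x0)" by (rule B0y)
    also have "\<dots> < M * d" using that M by (simp add: dist_norm norm_minus_commute)
    also have "M * d = r / 2" using M by (simp add: d_def)
    finally show ?thesis by simp
  qed
  have fix_iff: "S y x = x \<longleftrightarrow> \<Phi> x = y" for x y
  proof
    assume "S y x = x"
    then have "(?A x0 o\<^sub>L B0) (y - \<Phi> x) = 0" by (simp add: S_def)
    then show "\<Phi> x = y" using inv(1) by simp
  qed (simp add: S_def)
  have ex1: "\<exists>!x. x \<in> cball x0 r \<and> S y x = x" if "y \<in> ball (\<Phi> x0) d" for y
    by (rule Banach_fix[of _ "1/2"])
       (use r S_close[OF that] contr in \<open>auto simp: complete_eq_closed dist_norm norm_minus_commute less_imp_le\<close>)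
  define g where "g y = (THE x. x \<in> cball x0 r \<and> S y x = x)" for y
  have g: "g y \<in> cball x0 r" "S y (g y) = g y" if "y \<in> ball (\<Phi> x0) d" for y
    using theI'[OF ex1[OF that]] unfolding g_def by blast+
  have gball: "g y \<in> ball x0 r" if "y \<in> ball (\<Phi> x0) d" for y
    using S_close[OF that g(1)[OF that]] g(2)[OF that] by (simp add: dist_norm norm_minus_commute)
  have \<Phi>g: "\<Phi> (g y) = y" if "y \<in> ball (\<Phi> x0) d" for y using g(2)[OF that] fix_iff by blast
  have g\<Phi>: "g (\<Phi> x) = x" if "x \<in> cball x0 r" "\<Phi> x \<in> ball (\<Phi> x0) d" for x
    using ex1[OF that(2)] g[OF that(2)] that(1) fix_iff by blast
  have lip: "norm (g y - g y') \<le> 2 * M * norm (y - y')" if "y \<in> ball (\<Phi> x0) d" "y' \<in> ball (\<Phi> x0) d" for y y'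
  proof -
    have "g y - g y' = (S y (g y) - S y (g y')) + B0 (y - y')"
      using g(2)[OF that(1)] g(2)[OF that(2)] by (simp add: S_def blinfun.diff_right algebra_simps)
    then have "norm (g y - g y') \<le> norm (S y (g y) - S y (g y')) + norm (B0 (y - y'))"
      by (simp only: norm_triangle_ineq)
    also have "\<dots> \<le> 1/2 * norm (g y - g y') + M * norm (y - y')"
      by (intro add_mono contr g that B0y)
    finally show ?thesis by simp
  qed
  have contg: "continuous_on (ball (\<Phi> x0) d) g"
    unfolding continuous_on_iff
  proof (intro ballI allI impI)
    fix y e assume y: "y \<in> ball (\<Phi> x0) d" and e: "(e::real) > 0"
    have "dist (g y') (g y) < e" if "y' \<in> ball (\<Phi> x0) d" "dist y' y < e / (2 * M)" for y'
    proof -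
      have "dist (g y') (g y) \<le> 2 * M * norm (y' - y)" using lip[OF that(1) y] by (simp add: dist_norm)
      also have "\<dots> < 2 * M * (e / (2 * M))" using that(2) M by (intro mult_strict_left_mono) (auto simp: dist_norm)
      finally show ?thesis using M by simp
    qed
    then show "\<exists>d'>0. \<forall>x'\<in>ball (\<Phi> x0) d. dist x' y < d' \<longrightarrow> dist (g x') (g y) < e"
      using e M by (intro exI[of _ "e / (2 * M)"]) auto
  qed
  have "\<exists>B. ?A x o\<^sub>L B = id_blinfun \<and> B o\<^sub>L ?A x = id_blinfun \<and> norm B \<le> 2 * norm B0" if "x \<in> cball x0 r" for x
  proof -
    have "norm B0 * norm (?A x - ?A x0) \<le> M * norm (?A x - ?A x0)" using M by (intro mult_right_mono) auto
    also have "\<dots> \<le> 1/2" by (rule rA[OF that])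
    finally have le: "norm B0 * norm (?A x - ?A x0) \<le> 1 / 2" .
    show ?thesis by (rule blinfun_perturb_inverse[OF inv le]) blast
  qed
  then obtain B where B: "\<And>x. x \<in> cball x0 r \<Longrightarrow> ?A x o\<^sub>L B x = id_blinfun"
    "\<And>x. x \<in> cball x0 r \<Longrightarrow> B x o\<^sub>L ?A x = id_blinfun"
    "\<And>x. x \<in> cball x0 r \<Longrightarrow> norm (B x) \<le> 2 * norm B0" by metis
  have dg: "(g has_derivative blinfun_apply (B (g y))) (at y)" if y: "y \<in> ball (\<Phi> x0) d" for y
  proof (rule has_derivative_inverse_basic[where g = g and T = "ball (\<Phi> x0) d", OF C1_on_has_derivative[OF C1 rW[OF g(1)[OF y]]]])
    show "blinfun_apply (B (g y)) \<circ> blinfun_apply (?A (g y)) = id"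
      using arg_cong[OF B(2)[OF g(1)[OF y]], of blinfun_apply] by (auto simp: fun_eq_iff)
    show "isCont g y" using contg y continuous_on_eq_continuous_at by blast
  qed (use y \<Phi>g in \<open>auto simp: blinfun.bounded_linear_right\<close>)
  have contB: "continuous_on (cball x0 r) B"
    unfolding continuous_on_iff
  proof (intro ballI allI impI)
    fix x e assume x: "x \<in> cball x0 r" and e: "(e::real) > 0"
    let ?m = "4 * norm B0 * norm B0 + 1"
    have m: "?m > 0" by (simp add: add_nonneg_pos)
    have "continuous_on (cball x0 r) ?A"
      using C1_on_continuous_fderiv[OF C1] rW continuous_on_subset by blast
    moreover have "e / ?m > 0" using e m by simp
    ultimately obtain d' where d': "d' > 0" "\<And>x'. x' \<in> cball x0 r \<Longrightarrow> dist x' x < d' \<Longrightarrow> dist (?A x') (?A x) < e / ?m"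
      using x unfolding continuous_on_iff by blast
    have "dist (B x') (B x) < e" if x': "x' \<in> cball x0 r" "dist x' x < d'" for x'
    proof -
      \<comment> \<open>Resolvent identity: continuity of the operators passes to their inverses,
        whose norms are uniformly bounded.\<close>
      have "B x' - B x = B x' o\<^sub>L ((?A x - ?A x') o\<^sub>L B x)"
        using B(1)[OF x] B(2)[OF x'(1)]
        by (simp add: blinfun_compose_simps blinfun_compose_assoc[symmetric])
      then have "norm (B x' - B x) \<le> norm (B x') * (norm (?A x - ?A x') * norm (B x))"
        using order_trans[OF norm_blinfun_compose[of "B x'" "(?A x - ?A x') o\<^sub>L B x"]
          mult_left_mono[OF norm_blinfun_compose norm_ge_zero]] by simp
      also have "\<dots> \<le> (2 * norm B0) * (norm (?A x - ?A x') * (2 * norm B0))"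
        by (intro mult_mono B x x') auto
      also have "\<dots> \<le> ?m * norm (?A x - ?A x')" by (simp add: algebra_simps)
      also have "\<dots> < ?m * (e / ?m)"
        using d'(2)[OF x'] m by (intro mult_strict_left_mono) (auto simp: dist_norm norm_minus_commute)
      finally show ?thesis using m by (simp add: dist_norm)
    qed
    then show "\<exists>d>0. \<forall>x'\<in>cball x0 r. dist x' x < d \<longrightarrow> dist (B x') (B x) < e" using d'(1) by blast
  qed
  have "C1_on (ball (\<Phi> x0) d) g"
    by (rule C1_onI[OF dg], assumption) (rule continuous_on_compose2[OF contB contg], use g in auto)
  then show ?thesis
    by (intro that[of r d g] r d gball \<Phi>g g\<Phi>) (use rW in auto)
qed

text \<open>The inverse function theorem is applied to \<open>\<Phi> (e, p) = (F (e, p), p)\<close>.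
  The implicit function is the first component of the inverse on the slice where the first
  coordinate is 0. Its derivative comes from differentiating \<open>F (g p, p) = 0\<close>.\<close>

theorem implicit_function_banach:
  fixes F :: "'e::banach \<times> 'p::banach \<Rightarrow> 'e" and A B :: "'e \<Rightarrow>\<^sub>L 'e"
  assumes W: "open W" "(e0, p0) \<in> W" and C1: "C1_on W F" and F0: "F (e0, p0) = 0"
    and A: "\<And>h. A h = fderiv F (e0, p0) (h, 0)"
    and inv: "A o\<^sub>L B = id_blinfun" "B o\<^sub>L A = id_blinfun"
  obtains r d g where "r > 0" "d > 0" "C1_on (ball p0 d) g" "g p0 = e0"
    "\<And>p. p \<in> ball p0 d \<Longrightarrow> g p \<in> ball e0 r" "\<And>p. p \<in> ball p0 d \<Longrightarrow> (g p, p) \<in> W"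
    "\<And>p. p \<in> ball p0 d \<Longrightarrow> F (g p, p) = 0"
    "\<And>e p. e \<in> ball e0 r \<Longrightarrow> p \<in> ball p0 d \<Longrightarrow> F (e, p) = 0 \<Longrightarrow> e = g p"
    "fderiv g p0 = - (B o\<^sub>L fderiv F (e0, p0) o\<^sub>L Blinfun (\<lambda>p. (0, p)))"
proof -
  define \<Phi> where "\<Phi> x = (F x, snd x)" for x
  let ?J = "Blinfun (\<lambda>p::'p. (0::'e, p))"
  have J: "blinfun_apply ?J = (\<lambda>p. (0, p))" by (rule bounded_linear_Blinfun_apply[OF bounded_linear_inr])
  have C1\<Phi>: "C1_on W \<Phi>" unfolding \<Phi>_def
    by (rule C1_on_Pair[OF C1 C1_on_linear[OF bounded_linear_snd]])
  let ?F' = "fderiv F (e0, p0)"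
  have d\<Phi>: "fderiv \<Phi> (e0, p0) (h, k) = (?F' (h, k), k)" for h k
  proof -
    have "(\<Phi> has_derivative (\<lambda>x. (?F' x, snd x))) (at (e0, p0))"
      unfolding \<Phi>_def using C1_on_has_derivative[OF C1 W(2)] by (auto intro!: derivative_intros)
    from fderiv_eq[OF this] show ?thesis by simp
  qed
  have F'split: "?F' (h, k) = A h + ?F' (0, k)" for h k
    using blinfun.add_right[of ?F' "(h, 0)" "(0, k)"] by (simp add: A)
  \<comment> \<open>The derivative of \<open>\<Phi>\<close> is block triangular with
    \<open>A\<close> on the diagonal; this is its inverse by back substitution.\<close>
  define C where "C = Blinfun (\<lambda>x. (B (fst x - ?F' (0, snd x)), snd x))"
  have C: "C (h, k) = (B (h - ?F' (0, k)), k)" for h k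
  proof -
    have "bounded_linear (\<lambda>x. ?F' (0, snd x))"
      by (rule bounded_linear_compose[OF blinfun.bounded_linear_right
            bounded_linear_Pair[OF bounded_linear_zero bounded_linear_snd]])
    then have "bounded_linear (\<lambda>x. (B (fst x - ?F' (0, snd x)), snd x))"
      by (rule bounded_linear_Pair[OF bounded_linear_compose[OF blinfun.bounded_linear_right
            bounded_linear_sub[OF bounded_linear_fst]] bounded_linear_snd])
    from bounded_linear_Blinfun_apply[OF this] show ?thesis by (simp add: C_def)
  qed
  have AB: "A (B h) = h" "B (A h) = h" for h
    using arg_cong[OF inv(1), of "\<lambda>f. blinfun_apply f h"] arg_cong[OF inv(2), of "\<lambda>f. blinfun_apply f h"] by auto
  have "fderiv \<Phi> (e0, p0) o\<^sub>L C = id_blinfun"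
    by (rule blinfun_eqI, clarsimp simp: C d\<Phi>, subst F'split, simp add: AB)
  moreover have "C o\<^sub>L fderiv \<Phi> (e0, p0) = id_blinfun"
    by (rule blinfun_eqI, clarsimp simp: C d\<Phi>, subst F'split, simp add: AB)
  ultimately have "\<exists>r1 d1 G. r1 > 0 \<and> d1 > 0 \<and> ball (e0, p0) r1 \<subseteq> W
    \<and> (\<forall>y\<in>ball (\<Phi> (e0, p0)) d1. G y \<in> ball (e0, p0) r1 \<and> \<Phi> (G y) = y)
    \<and> (\<forall>x\<in>ball (e0, p0) r1. \<Phi> x \<in> ball (\<Phi> (e0, p0)) d1 \<longrightarrow> G (\<Phi> x) = x)
    \<and> C1_on (ball (\<Phi> (e0, p0)) d1) G"
    by (rule inverse_function_banach[OF W C1\<Phi>]) blast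
  then obtain r1 d1 G where G: "r1 > 0" "d1 > 0" "ball (e0, p0) r1 \<subseteq> W"
    "\<And>y. y \<in> ball (\<Phi> (e0, p0)) d1 \<Longrightarrow> G y \<in> ball (e0, p0) r1"
    "\<And>y. y \<in> ball (\<Phi> (e0, p0)) d1 \<Longrightarrow> \<Phi> (G y) = y"
    "\<And>x. x \<in> ball (e0, p0) r1 \<Longrightarrow> \<Phi> x \<in> ball (\<Phi> (e0, p0)) d1 \<Longrightarrow> G (\<Phi> x) = x"
    "C1_on (ball (\<Phi> (e0, p0)) d1) G"
    by blast
  have \<Phi>0: "\<Phi> (e0, p0) = (0, p0)" by (simp add: \<Phi>_def F0)
  \<comment> \<open>The product norm is at most the sum of the component norms, so a product of two
    balls of half the radius fits into the ball.\<close>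
  define r where "r = r1 / 2"
  have prod_ball: "(e, p) \<in> ball (e0, p0) r1" if "e \<in> ball e0 r" "p \<in> ball p0 r" for e p
  proof -
    have "dist (e0, p0) (e, p) \<le> dist e0 e + dist p0 p"
      unfolding dist_Pair_Pair by (rule order_trans[OF sqrt_add_le_add_sqrt]) auto
    then show ?thesis using that by (simp add: r_def)
  qed
  define g where "g p = fst (G (0, p))" for p
  have inb: "(0, p) \<in> ball (\<Phi> (e0, p0)) d1" if "p \<in> ball p0 d1" for p
    using that by (simp add: \<Phi>0 dist_Pair_Pair)
  have Gp: "G (0, p) = (g p, p)" "F (g p, p) = 0" if "p \<in> ball p0 d1" for p
  proof -
    have "\<Phi> (G (0, p)) = (0, p)" by (rule G(5)[OF inb[OF that]])
    then show "G (0, p) = (g p, p)" "F (g p, p) = 0" by (cases "G (0, p)"; simp add: \<Phi>_def g_def)+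
  qed
  have C1g: "C1_on (ball p0 d1) g" unfolding g_def
    by (rule C1_on_linear_comp[OF bounded_linear_fst],
        rule C1_on_compose[OF G(7) C1_on_linear[OF bounded_linear_inr]]) (use inb in auto)
  have g0: "g p0 = e0"
    using G(6)[of "(e0, p0)"] G(1,2) \<Phi>0 by (simp add: g_def)
  have "isCont g p0" using C1_on_isCont[OF C1g] G(2) by simp
  then have "\<forall>\<^sub>F p in nhds p0. dist (g p) (g p0) < r"
    using G(1) tendstoD[of g "g p0" "nhds p0" r] by (simp add: isCont_def tendsto_nhds_iff r_def)
  then obtain d2 where d2: "d2 > 0" "\<And>p. dist p p0 < d2 \<Longrightarrow> dist (g p) e0 < r"
    unfolding eventually_nhds_metric g0 by blast
  define d where "d = min (min d1 d2) r"
  have d: "d > 0" "d \<le> d1" "d \<le> d2" "d \<le> r" using G(1,2) d2(1) by (auto simp: d_def r_def)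
  have dg: "fderiv g p0 = - (B o\<^sub>L ?F' o\<^sub>L ?J)"
  proof (rule blinfun_eqI)
    fix k
    have p0: "p0 \<in> ball p0 d1" using G(2) by simp
    have 1: "((\<lambda>p. (g p, p)) has_derivative (\<lambda>k. (fderiv g p0 k, k))) (at p0)"
      using C1_on_has_derivative[OF C1g p0] by (auto intro!: derivative_intros)
    have "((\<lambda>p. F (g p, p)) has_derivative (\<lambda>k. ?F' (fderiv g p0 k, k))) (at p0)"
      using has_derivative_compose[OF 1, of F "blinfun_apply ?F'"] C1_on_has_derivative[OF C1 W(2)] g0 by simp
    moreover have "((\<lambda>p. F (g p, p)) has_derivative (\<lambda>k. 0)) (at p0)"
      by (rule has_derivative_transform_within_open[where f = "\<lambda>p. 0", OF _ open_ball p0]) (auto simp: Gp(2))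
    ultimately have "(\<lambda>k. ?F' (fderiv g p0 k, k)) = (\<lambda>k. 0)" by (rule has_derivative_unique)
    then have "?F' (fderiv g p0 k, k) = 0" by (rule fun_cong)
    then have "A (fderiv g p0 k) = - ?F' (0, k)" using F'split[of "fderiv g p0 k" k] by (simp add: eq_neg_iff_add_eq_0)
    then have "B (A (fderiv g p0 k)) = - B (?F' (0, k))" by (simp add: blinfun.minus_right)
    then show "fderiv g p0 k = (- (B o\<^sub>L ?F' o\<^sub>L ?J)) k" by (simp add: AB J blinfun.minus_left)
  qed
  show ?thesis
  proof (rule that[of r d g])
    show "e = g p" if "e \<in> ball e0 r" "p \<in> ball p0 d" "F (e, p) = 0" for e p
    proof -
      have "(e, p) \<in> ball (e0, p0) r1" using that d by (intro prod_ball) auto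
      moreover have "\<Phi> (e, p) = (0, p)" by (simp add: \<Phi>_def that)
      ultimately show ?thesis using G(6)[of "(e, p)"] inb[of p] that(2) d by (simp add: g_def)
    qed
    show "(g p, p) \<in> W" if "p \<in> ball p0 d" for p
      using G(4)[OF inb, of p] Gp(1)[of p] that d G(3) by auto
    show "C1_on (ball p0 d) g" using C1_on_subset[OF C1g] d by (simp add: subset_ball)
  qed (use d G(1) g0 d2 Gp dg in \<open>auto simp: r_def dist_commute\<close>)
qed

section \<open>Finite-dimensional subspaces of normed spaces\<close>

text \<open>\<open>A\<close> maps the span of the \<open>b k\<close> into itself and is injective,
  hence onto there by counting dimensions. With \<open>A (s k) = b k\<close>, the inverse is
  \<open>y - (\<Sum>k\<in>K. \<kappa> k y *\<^sub>R s k)\<close>.\<close>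

lemma finite_rank_perturbation_invertible:
  fixes b :: "'k \<Rightarrow> 'e::real_normed_vector" and \<kappa> :: "'k \<Rightarrow> 'e \<Rightarrow>\<^sub>L real" and A :: "'e \<Rightarrow>\<^sub>L 'e"
  assumes K: "finite K" and A: "\<And>h. A h = h + (\<Sum>k\<in>K. \<kappa> k h *\<^sub>R b k)"
    and inj: "\<And>h. A h = 0 \<Longrightarrow> h = 0"
  obtains B where "A o\<^sub>L B = id_blinfun" "B o\<^sub>L A = id_blinfun"
proof -
  have linA: "linear (blinfun_apply A)" by (simp add: blinfun.bounded_linear_right bounded_linear.linear)
  have injA: "inj (blinfun_apply A)" using inj by (simp add: linear_injective_0[OF linA])
  obtain B0 where B0: "B0 \<subseteq> b ` K" "independent B0" "b ` K \<subseteq> span B0"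
    using maximal_independent_subset by blast
  have span: "span B0 = span (b ` K)" by (intro antisym span_mono B0(1) span_minimal[OF B0(3)] subspace_span)
  have finB0: "finite B0" using B0(1) K finite_subset by blast
  have ind: "independent (blinfun_apply A ` B0)"
    using linear_independent_injective_image[OF linA B0(2)] injA inj_on_subset by blast
  have AV: "A v \<in> span B0" if "v \<in> span B0" for v
    unfolding A span using that span by (intro span_add span_sum span_scale) (auto intro: span_base)
  have sub: "blinfun_apply A ` B0 \<subseteq> span B0" using AV span_base by blast
  have surj: "v \<in> blinfun_apply A ` span B0" if v: "v \<in> span B0" for v
  proof (rule ccontr)
    assume "v \<notin> blinfun_apply A ` span B0"
    then have nv: "v \<notin> span (blinfun_apply A ` B0)" unfolding linear_span_image[OF linA] .
    \<comment> \<open>A vector missed by \<open>A\<close> would extend the image of the basis to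
      more than \<open>card B0\<close> independent vectors in the span of \<open>B0\<close>.\<close>
    then have ind': "independent (insert v (blinfun_apply A ` B0))" using ind by (simp add: independent_insert)
    have "insert v (blinfun_apply A ` B0) \<subseteq> span B0" using sub v by blast
    from independent_span_bound[OF finB0 ind' this]
    have "card (insert v (blinfun_apply A ` B0)) \<le> card B0" by (rule conjunct2)
    moreover have "v \<notin> blinfun_apply A ` B0" using nv span_superset by (rule contra_subsetD[rotated])
    moreover have "finite (blinfun_apply A ` B0)" using finB0 by simp
    moreover have "card (blinfun_apply A ` B0) = card B0"
      by (rule card_image[OF inj_on_subset[OF injA subset_UNIV]])
    ultimately show False by simp
  qed
  have "\<exists>s. A s = b k" if "k \<in> K" for k
  proof -
    have "b k \<in> span B0" using B0(3) that by blast
    from surj[OF this] show ?thesis by (elim imageE) auto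
  qed
  then have "\<exists>s. \<forall>k\<in>K. A (s k) = b k" by (intro bchoice) simp
  then obtain s where s: "\<And>k. k \<in> K \<Longrightarrow> A (s k) = b k" by blast
  define B where "B = id_blinfun - (\<Sum>k\<in>K. blinfun_scaleR_left (s k) o\<^sub>L \<kappa> k)"
  have AB: "A (B y) = y" for y
  proof -
    have "A (B y) = A y - (\<Sum>k\<in>K. \<kappa> k y *\<^sub>R A (s k))"
      by (simp add: B_def blinfun.diff_left blinfun.sum_left blinfun.diff_right blinfun.sum_right blinfun.scaleR_right)
    also have "(\<Sum>k\<in>K. \<kappa> k y *\<^sub>R A (s k)) = (\<Sum>k\<in>K. \<kappa> k y *\<^sub>R b k)" using s by (intro sum.cong) auto
    finally show ?thesis by (simp add: A)
  qed
  have "B (A y) = y" for y using AB[of "A y"] injA by (simp add: inj_eq)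
  with AB show ?thesis by (intro that[of B] blinfun_eqI) simp_all
qed

text \<open>Induction over the functionals: on the kernel of \<open>g j\<close> the others suffice,
  and one vector outside this kernel fixes the coefficient of \<open>g j\<close>.\<close>

lemma functional_in_span:
  fixes f :: "'v::real_vector \<Rightarrow> real" and g :: "'j \<Rightarrow> 'v \<Rightarrow> real"
  assumes "finite J" "linear f" "\<And>j. j \<in> J \<Longrightarrow> linear (g j)" "subspace V"
    "\<And>d. d \<in> V \<Longrightarrow> (\<And>j. j \<in> J \<Longrightarrow> g j d = 0) \<Longrightarrow> f d = 0"
  shows "\<exists>c. \<forall>d\<in>V. f d = (\<Sum>j\<in>J. c j * g j d)"
  using assms
proof (induction J arbitrary: V rule: finite_induct)
  case (insert j J)
  let ?V = "{d \<in> V. g j d = 0}"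
  have lin: "linear (g i)" if "i \<in> insert j J" for i using insert.prems(2) that .
  have sub: "subspace ?V"
    using insert.prems(3) lin[of j] by (auto simp: subspace_def linear_add linear_cmul linear_0)
  have "\<exists>c. \<forall>d\<in>?V. f d = (\<Sum>j\<in>J. c j * g j d)"
    by (rule insert.IH[OF insert.prems(1) _ sub]) (use insert.prems(2,4) in auto)
  then obtain c where c: "\<And>d. d \<in> ?V \<Longrightarrow> f d = (\<Sum>j\<in>J. c j * g j d)" by blast
  show ?case
  proof (cases "\<forall>d\<in>V. g j d = 0")
    case True
    then have "\<forall>d\<in>V. f d = (\<Sum>i\<in>insert j J. c i * g i d)"
      using c insert.hyps by simp
    then show ?thesis by blast
  next
    case False
    then obtain e0 where e0: "e0 \<in> V" "g j e0 \<noteq> 0" by blast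
    define e where "e = (1 / g j e0) *\<^sub>R e0"
    have e: "e \<in> V" "g j e = 1"
      using e0 insert.prems(3) lin[of j] by (auto simp: e_def subspace_scale linear_cmul)
    \<comment> \<open>The coefficient of \<open>g j\<close> is the value that makes the identity
      true at \<open>e\<close>, where \<open>g j\<close> is 1.\<close>
    define c' where "c' i = (if i = j then f e - (\<Sum>i\<in>J. c i * g i e) else c i)" for i
    have "f d = (\<Sum>i\<in>insert j J. c' i * g i d)" if d: "d \<in> V" for d
    proof -
      have "d - g j d *\<^sub>R e \<in> ?V"
        using d e insert.prems(3) lin[of j] by (auto simp: subspace_diff subspace_scale linear_diff linear_cmul)
      from c[OF this] have "f d - g j d * f e = (\<Sum>i\<in>J. c i * g i (d - g j d *\<^sub>R e))"
        using insert.prems(1) by (simp add: linear_diff linear_cmul)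
      also have "\<dots> = (\<Sum>i\<in>J. c i * g i d - g j d * (c i * g i e))"
        using lin by (intro sum.cong refl) (simp add: linear_diff linear_cmul algebra_simps)
      also have "\<dots> = (\<Sum>i\<in>J. c i * g i d) - g j d * (\<Sum>i\<in>J. c i * g i e)"
        by (simp add: sum_subtractf sum_distrib_left)
      finally have "f d = (f e - (\<Sum>i\<in>J. c i * g i e)) * g j d + (\<Sum>i\<in>J. c i * g i d)"
        by (simp add: algebra_simps)
      also have "(\<Sum>i\<in>J. c i * g i d) = (\<Sum>i\<in>J. c' i * g i d)"
        using insert.hyps by (intro sum.cong) (auto simp: c'_def)
      finally show ?thesis using insert.hyps by (simp add: c'_def)
    qed
    then show ?thesis by blast
  qed
qed auto

text \<open>If \<open>g j\<close> vanished on the common kernel of the other functionals, it would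
  be a combination of them by \<open>functional_in_span\<close>, against independence. A vector of
  that kernel with \<open>g j\<close> nonzero is rescaled.\<close>

lemma dual_basis_exists:
  fixes g :: "'j \<Rightarrow> 'v::real_vector \<Rightarrow> real"
  assumes J: "finite J" and lin: "\<And>j. j \<in> J \<Longrightarrow> linear (g j)" and V: "subspace V"
    and ind: "\<And>a j. (\<And>d. d \<in> V \<Longrightarrow> (\<Sum>i\<in>J. a i * g i d) = 0) \<Longrightarrow> j \<in> J \<Longrightarrow> a j = 0"
  shows "\<exists>e. \<forall>j\<in>J. e j \<in> V \<and> (\<forall>i\<in>J. g i (e j) = (if i = j then 1 else 0))"
proof -
  have "\<exists>d\<in>V. \<forall>i\<in>J. g i d = (if i = j then 1 else 0)" if j: "j \<in> J" for j
  proof -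
    have "\<not> (\<forall>d\<in>V. (\<forall>i\<in>J - {j}. g i d = 0) \<longrightarrow> g j d = 0)"
    proof
      assume "\<forall>d\<in>V. (\<forall>i\<in>J - {j}. g i d = 0) \<longrightarrow> g j d = 0"
      then have "\<exists>c. \<forall>d\<in>V. g j d = (\<Sum>i\<in>J - {j}. c i * g i d)"
        using J lin j V by (intro functional_in_span) auto
      then obtain c where c: "\<And>d. d \<in> V \<Longrightarrow> g j d = (\<Sum>i\<in>J - {j}. c i * g i d)" by blast
      have "(\<Sum>i\<in>J. (if i = j then - 1 else c i) * g i d) = 0" if "d \<in> V" for d
      proof -
        have "(\<Sum>i\<in>J. (if i = j then - 1 else c i) * g i d)
            = - g j d + (\<Sum>i\<in>J - {j}. (if i = j then - 1 else c i) * g i d)"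
          by (subst sum.remove[OF J j]) simp
        also have "(\<Sum>i\<in>J - {j}. (if i = j then - 1 else c i) * g i d) = g j d"
          unfolding c[OF that] by (intro sum.cong) auto
        finally show ?thesis by simp
      qed
      from ind[OF this j] show False by simp
    qed
    then obtain d where d: "d \<in> V" "\<And>i. i \<in> J - {j} \<Longrightarrow> g i d = 0" "g j d \<noteq> 0" by blast
    then show ?thesis
      using V lin j by (intro bexI[of _ "(1 / g j d) *\<^sub>R d"]) (auto simp: subspace_scale linear_cmul)
  qed
  then show ?thesis by (intro bchoice) blast
qed

text \<open>A finite-dimensional subspace given by a basis together with coordinate functionals on
  the whole space. The coordinates are therefore continuous and defined off the subspace too, which
  \<open>zero_form_iff\<close> exploits.\<close>

locale biorthogonal =
  fixes K :: "'k set" and b :: "'k \<Rightarrow> 'z::real_normed_vector" and \<beta> :: "'k \<Rightarrow> 'z \<Rightarrow>\<^sub>L real"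
  assumes finK: "finite K"
    and biorth: "\<And>k l. k \<in> K \<Longrightarrow> l \<in> K \<Longrightarrow> \<beta> k (b l) = (if k = l then 1 else 0)"
begin

text \<open>The fixed points of the coordinate projection, that is, the span of the
  \<open>b k\<close>. In this form closedness is immediate.\<close>

definition S :: "'z set" where "S = {z. z = (\<Sum>k\<in>K. \<beta> k z *\<^sub>R b k)}"

lemma coord_sum: "l \<in> K \<Longrightarrow> \<beta> l (\<Sum>k\<in>K. a k *\<^sub>R b k) = a l"
proof -
  assume l: "l \<in> K"
  have "\<beta> l (\<Sum>k\<in>K. a k *\<^sub>R b k) = (\<Sum>k\<in>K. if l = k then a k else 0)"
    unfolding blinfun.sum_right using l biorth by (intro sum.cong) (auto simp: blinfun.scaleR_right)
  then show ?thesis using l finK by simp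
qed

lemma sum_in_S: "(\<Sum>k\<in>K. a k *\<^sub>R b k) \<in> S"
  unfolding S_def by (auto simp: coord_sum intro!: sum.cong)

lemma S_repr: "z \<in> S \<Longrightarrow> (\<Sum>k\<in>K. \<beta> k z *\<^sub>R b k) = z"
  by (simp add: S_def)

lemma subspace_S: "subspace S"
  unfolding subspace_def
proof (intro conjI ballI allI)
  show "0 \<in> S" by (simp add: S_def)
  fix x y :: 'z and c :: real assume x: "x \<in> S"
  show "c *\<^sub>R x \<in> S"
    using sum_in_S[of "\<lambda>k. c * \<beta> k x"] S_repr[OF x] by (simp add: scaleR_sum_right[symmetric] flip: scaleR_scaleR)
  assume y: "y \<in> S"
  show "x + y \<in> S"
    using sum_in_S[of "\<lambda>k. \<beta> k x + \<beta> k y"] S_repr[OF x] S_repr[OF y]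
    by (simp add: scaleR_add_left sum.distrib)
qed

lemma b_in_S: "k \<in> K \<Longrightarrow> b k \<in> S"
proof -
  assume k: "k \<in> K"
  have "(\<Sum>l\<in>K. \<beta> l (b k) *\<^sub>R b l) = (\<Sum>l\<in>K. if k = l then b l else 0)"
    using biorth k by (intro sum.cong) auto
  then show ?thesis using k finK by (simp add: S_def)
qed

lemma closed_S: "closed S"
proof -
  have "continuous_on UNIV (\<lambda>z. \<Sum>k\<in>K. \<beta> k z *\<^sub>R b k)"
    by (intro continuous_on_sum continuous_on_scaleR continuous_on_const
        bounded_linear.continuous_on[OF blinfun.bounded_linear_right] continuous_on_id)
  then show ?thesis unfolding S_def by (intro closed_Collect_eq continuous_on_id)
qed

lemma compact_box: "finite L \<Longrightarrow> compact {\<Sum>k\<in>L. a k *\<^sub>R b k | a. \<forall>k\<in>L. \<bar>a k\<bar> \<le> C}"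
proof (induction L rule: finite_induct)
  case (insert k L)
  let ?B = "\<lambda>L. {\<Sum>k\<in>L. a k *\<^sub>R b k | a. \<forall>k\<in>L. \<bar>a k\<bar> \<le> C}"
  have "?B (insert k L) = (\<lambda>(z, r). z + r *\<^sub>R b k) ` (?B L \<times> {-C..C})"
  proof (intro set_eqI iffI)
    fix z assume "z \<in> ?B (insert k L)"
    then obtain a where a: "z = (\<Sum>k\<in>insert k L. a k *\<^sub>R b k)" "\<forall>k\<in>insert k L. \<bar>a k\<bar> \<le> C" by blast
    then have "z = (\<Sum>k\<in>L. a k *\<^sub>R b k) + a k *\<^sub>R b k" using insert.hyps by (simp add: add.commute)
    then show "z \<in> (\<lambda>(z, r). z + r *\<^sub>R b k) ` (?B L \<times> {-C..C})"
      using a(2) by (intro image_eqI[of _ _ "(\<Sum>k\<in>L. a k *\<^sub>R b k, a k)"]) (auto simp: abs_le_iff)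
  next
    fix z assume "z \<in> (\<lambda>(z, r). z + r *\<^sub>R b k) ` (?B L \<times> {-C..C})"
    then obtain a r where a: "z = (\<Sum>k\<in>L. a k *\<^sub>R b k) + r *\<^sub>R b k" "\<forall>k\<in>L. \<bar>a k\<bar> \<le> C" "r \<in> {-C..C}" by auto
    have "(\<Sum>l\<in>L. a l *\<^sub>R b l) = (\<Sum>l\<in>L. (a(k := r)) l *\<^sub>R b l)"
      using insert.hyps by (intro sum.cong) auto
    then show "z \<in> ?B (insert k L)"
      using a insert.hyps by (intro CollectI exI[of _ "a(k := r)"]) (auto simp: add.commute)
  qed
  moreover have "continuous_on (?B L \<times> {-C..C}) (\<lambda>(z, r). z + r *\<^sub>R b k)"
    unfolding case_prod_unfold by (intro continuous_intros)
  ultimately show ?case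
    using compact_continuous_image[OF _ compact_Times[OF insert.IH compact_Icc[of "- C" C]]] by simp
qed simp

text \<open>The coordinates on the unit sphere are bounded by the norms of the
  \<open>\<beta> k\<close>, so the sphere is a closed part of a compact coordinate box.\<close>

lemma compact_sphere: "compact {d \<in> S. norm d = 1}"
proof -
  define C where "C = (\<Sum>k\<in>K. norm (\<beta> k))"
  have "{d \<in> S. norm d = 1} \<subseteq> {\<Sum>k\<in>K. a k *\<^sub>R b k | a. \<forall>k\<in>K. \<bar>a k\<bar> \<le> C}"
  proof
    fix d assume d: "d \<in> {d \<in> S. norm d = 1}"
    have "\<bar>\<beta> k d\<bar> \<le> C" if "k \<in> K" for k
    proof -
      have "\<bar>\<beta> k d\<bar> \<le> norm (\<beta> k)" using norm_blinfun[of "\<beta> k" d] d by simp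
      also have "\<dots> \<le> C" unfolding C_def by (rule member_le_sum[OF that _ finK]) auto
      finally show ?thesis .
    qed
    then show "d \<in> {\<Sum>k\<in>K. a k *\<^sub>R b k | a. \<forall>k\<in>K. \<bar>a k\<bar> \<le> C}"
      using S_repr[of d] d by (intro CollectI exI[of _ "\<lambda>k. \<beta> k d"]) auto
  qed
  moreover have "closed {d \<in> S. norm d = 1}"
    using closed_Int[OF closed_S closed_Collect_eq[OF continuous_on_norm[OF continuous_on_id] continuous_on_const]]
    by (simp add: Collect_conj_eq)
  ultimately show ?thesis
    using closed_Int_compact[OF _ compact_box[OF finK, of C], of "{d \<in> S. norm d = 1}"] by (simp only: Int_absorb2)
qed

text \<open>The open sets where \<open>q + m * n\<close> is positive increase with \<open>m\<close>
  and cover the unit sphere, because \<open>q\<close> is positive where \<open>n\<close> vanishes.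
  Compactness leaves one \<open>m\<close>.\<close>

lemma finsler:
  fixes q n :: "'z \<Rightarrow> real"
  assumes "continuous_on UNIV q" "continuous_on UNIV n" and n: "\<And>d. n d \<ge> 0"
    and pos: "\<And>d. d \<in> S \<Longrightarrow> norm d = 1 \<Longrightarrow> n d = 0 \<Longrightarrow> q d > 0"
  obtains M where "M > 0" "\<And>d. d \<in> S \<Longrightarrow> norm d = 1 \<Longrightarrow> q d + M * n d > 0"
proof -
  let ?K = "{d \<in> S. norm d = 1}"
  let ?U = "\<lambda>m::nat. {d. q d + real (Suc m) * n d > 0}"
  have "open (?U m)" for m
    using assms(1,2) by (intro open_Collect_less continuous_on_const continuous_on_add continuous_on_mult)
  moreover have "?K \<subseteq> (\<Union>m. ?U m)"
  proof
    fix d assume d: "d \<in> ?K"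
    show "d \<in> (\<Union>m. ?U m)"
    proof (cases "n d = 0")
      case False
      then have nd: "n d > 0" using n[of d] by simp
      obtain m where m: "- q d / n d < real m" using reals_Archimedean2 by blast
      then have "(- q d / n d) * n d < real m * n d" using nd by (intro mult_strict_right_mono)
      then have "- q d < real m * n d" using nd by simp
      also have "\<dots> \<le> real (Suc m) * n d" using nd by (intro mult_right_mono) auto
      finally have "d \<in> ?U m" by simp
      then show ?thesis by blast
    qed (use pos d in auto)
  qed
  ultimately obtain F where F: "finite F" "?K \<subseteq> (\<Union>m\<in>F. ?U m)"
    by (rule compactE_image[OF compact_sphere, of UNIV ?U]) auto
  define m where "m = Max (insert 0 F)"
  show ?thesis
  proof (rule that[of "real (Suc m)"])
    fix d assume "d \<in> S" "norm d = 1"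
    then obtain k where k: "k \<in> F" "q d + real (Suc k) * n d > 0" using F(2) by blast
    have "k \<le> m" using k(1) F(1) by (simp add: m_def)
    then have "real (Suc k) * n d \<le> real (Suc m) * n d" using n by (intro mult_right_mono) auto
    then show "q d + real (Suc m) * n d > 0" using k by linarith
  qed simp
qed

text \<open>On the compact sphere \<open>Q x0\<close> has a positive minimum, and \<open>Q\<close>
  varies by at most half of it, uniformly over the sphere, when \<open>x\<close> stays close to
  \<open>x0\<close>.\<close>

lemma pos_def_near:
  fixes Q :: "'x::topological_space \<Rightarrow> 'z \<Rightarrow> real"
  assumes cont: "continuous_on (X \<times> UNIV) (\<lambda>(x, d). Q x d)" and X: "open X" "x0 \<in> X"
    and pos: "\<And>d. d \<in> S \<Longrightarrow> norm d = 1 \<Longrightarrow> Q x0 d > 0"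
  shows "\<forall>\<^sub>F x in nhds x0. \<forall>d\<in>S. norm d = 1 \<longrightarrow> Q x d > 0"
proof (cases "{d \<in> S. norm d = 1} = {}")
  case False
  let ?K = "{d \<in> S. norm d = 1}"
  have c: "continuous_on ?K (Q x0)"
    using continuous_on_compose2[OF cont continuous_on_Pair[OF continuous_on_const continuous_on_id], of x0 ?K] X
    by auto
  obtain d0 where d0: "d0 \<in> ?K" "\<And>d. d \<in> ?K \<Longrightarrow> Q x0 d0 \<le> Q x0 d"
    using continuous_attains_inf[OF compact_sphere False c] by blast
  have m: "Q x0 d0 / 2 > 0" using pos d0 by simp
  have cont': "continuous_on (X \<times> ?K) (\<lambda>(x, d). Q x d)" by (rule continuous_on_subset[OF cont]) auto
  obtain X0 where X0: "x0 \<in> X0" "open X0" and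
    "\<forall>x\<in>X0 \<inter> X. \<forall>d\<in>?K. dist ((\<lambda>(x, d). Q x d) (x, d)) ((\<lambda>(x, d). Q x d) (x0, d)) \<le> Q x0 d0 / 2"
    by (rule continuous_on_prod_compactE[OF cont' compact_sphere X(2) m])
  then have X0': "\<And>x d. x \<in> X0 \<inter> X \<Longrightarrow> d \<in> ?K \<Longrightarrow> dist (Q x d) (Q x0 d) \<le> Q x0 d0 / 2" by simp
  have "Q x d > 0" if "x \<in> X0 \<inter> X" "d \<in> ?K" for x d
    using X0'[OF that] d0(2)[OF that(2)] m unfolding dist_real_def abs_le_iff by linarith
  moreover have "\<forall>\<^sub>F x in nhds x0. x \<in> X0 \<inter> X" using X0 X by (intro eventually_nhds_in_open) auto
  ultimately show ?thesis by (auto elim!: eventually_mono)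
qed auto

lemma bilinear_pos_scale:
  fixes Q :: "'v::real_normed_vector \<Rightarrow>\<^sub>L 'v \<Rightarrow>\<^sub>L real"
  assumes lin: "linear h" and pos: "\<And>d. d \<in> S \<Longrightarrow> norm d = 1 \<Longrightarrow> Q (h d) (h d) > 0"
    and d: "d \<in> S" "d \<noteq> 0"
  shows "Q (h d) (h d) > 0"
proof -
  let ?e = "(1 / norm d) *\<^sub>R d"
  have "0 < Q (h ?e) (h ?e)" using d subspace_scale[OF subspace_S] by (intro pos) auto
  also have "\<dots> = Q (h d) (h d) / (norm d)\<^sup>2"
    by (simp add: linear_cmul[OF lin] blinfun.scaleR_left blinfun.scaleR_right power2_eq_square)
  finally show ?thesis using d(2) by (simp add: zero_less_divide_iff)
qed

text \<open>Applying the coordinate functionals to the equation leaves \<open>f k = 0\<close>, and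
  then \<open>z\<close> equals its projection. So membership in \<open>S\<close> and finitely many
  scalar equations become one equation of the form identity plus finite rank.\<close>

lemma zero_form_iff: "z + (\<Sum>k\<in>K. (f k - \<beta> k z) *\<^sub>R b k) = 0 \<longleftrightarrow> z \<in> S \<and> (\<forall>k\<in>K. f k = 0)"
proof
  assume "z + (\<Sum>k\<in>K. (f k - \<beta> k z) *\<^sub>R b k) = 0"
  then have z: "z = (\<Sum>k\<in>K. (\<beta> k z - f k) *\<^sub>R b k)"
    unfolding eq_neg_iff_add_eq_0[symmetric] sum_negf[symmetric] by (simp add: scaleR_minus_left[symmetric])
  have "\<beta> k z = \<beta> k z - f k" if "k \<in> K" for k
    by (subst (1) z) (rule coord_sum[OF that])
  moreover have "z \<in> S" by (subst z) (rule sum_in_S)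
  ultimately show "z \<in> S \<and> (\<forall>k\<in>K. f k = 0)" by auto
next
  assume "z \<in> S \<and> (\<forall>k\<in>K. f k = 0)"
  then have "(\<Sum>k\<in>K. (f k - \<beta> k z) *\<^sub>R b k) = - z"
    by (simp add: sum_negf S_repr)
  then show "z + (\<Sum>k\<in>K. (f k - \<beta> k z) *\<^sub>R b k) = 0" by simp
qed

end

section \<open>Strict minima from a positive second derivative\<close>

lemma continuous_on_bilinear_form:
  fixes Q :: "'x::topological_space \<Rightarrow> 'v::real_normed_vector \<Rightarrow>\<^sub>L 'v \<Rightarrow>\<^sub>L real"
  assumes "continuous_on X Q" "bounded_linear (L :: 'z::real_normed_vector \<Rightarrow> 'v)"
  shows "continuous_on (X \<times> UNIV) (\<lambda>(x, d). Q x (L d) (L d))"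
proof -
  have 1: "continuous_on (X \<times> UNIV) (\<lambda>p. Q (fst p))"
    by (rule continuous_on_compose2[OF assms(1) continuous_on_fst[OF continuous_on_id]]) auto
  have 2: "continuous_on (X \<times> UNIV) (\<lambda>p. L (snd p))"
    by (intro bounded_linear.continuous_on[OF assms(2)] continuous_on_snd continuous_on_id)
  show ?thesis unfolding case_prod_unfold by (intro continuous_on_apply_blinfun 1 2)
qed

lemma fderiv_along_line:
  fixes f :: "'q::real_normed_vector \<Rightarrow> real"
  assumes "C2_on W f" "q + s *\<^sub>R d \<in> W"
  shows "((\<lambda>s. f (q + s *\<^sub>R d)) has_real_derivative fderiv f (q + s *\<^sub>R d) d) (at s)"
    "((\<lambda>s. fderiv f (q + s *\<^sub>R d) d) has_real_derivative fderiv (fderiv f) (q + s *\<^sub>R d) d d) (at s)"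
proof -
  have 0: "((\<lambda>s. q + s *\<^sub>R d) has_derivative (\<lambda>s. s *\<^sub>R d)) (at s)" by (auto intro!: derivative_eq_intros)
  show "((\<lambda>s. f (q + s *\<^sub>R d)) has_real_derivative fderiv f (q + s *\<^sub>R d) d) (at s)"
    unfolding has_field_derivative_def
    by (rule has_derivative_eq_rhs[OF has_derivative_compose[where g = f,
          OF 0 C1_on_has_derivative[OF C2_on_C1[OF assms(1)] assms(2)]]])
       (simp add: fun_eq_iff blinfun.scaleR_right)
  show "((\<lambda>s. fderiv f (q + s *\<^sub>R d) d) has_real_derivative fderiv (fderiv f) (q + s *\<^sub>R d) d d) (at s)"
    unfolding has_field_derivative_def
    by (rule has_derivative_eq_rhs[OF has_derivative_compose[where g = "\<lambda>q. fderiv f q d",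
          OF 0 fderiv_apply_const[OF C1_on_differentiable[OF C2_on_fderiv[OF assms(1)] assms(2)]]]])
       (simp add: fun_eq_iff blinfun.scaleR_right blinfun.scaleR_left)
qed

context biorthogonal
begin

text \<open>On the segment from \<open>z\<close> to \<open>z0\<close> the slope increases strictly
  and reaches 0 only at \<open>z0\<close>, so it is negative before. Descent along the entire
  segment yields both minimality of \<open>z0\<close> and the absence of other local minimizers
  nearby.\<close>

lemma strict_descent_near_minimum:
  fixes f :: "'z \<times> 'p::real_normed_vector \<Rightarrow> real"
  assumes f: "C2_on W f" and W: "open W" "(z0, \<theta>) \<in> W" and z0: "z0 \<in> S"
    and crit: "\<And>d. d \<in> S \<Longrightarrow> fderiv f (z0, \<theta>) (d, 0) = 0"
    and pos: "\<And>d. d \<in> S \<Longrightarrow> d \<noteq> 0 \<Longrightarrow> fderiv (fderiv f) (z0, \<theta>) (d, 0) (d, 0) > 0"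
  obtains r where "r > 0" "\<And>z. z \<in> ball z0 r \<Longrightarrow> (z, \<theta>) \<in> W"
    "\<And>z s. z \<in> S \<Longrightarrow> z \<in> ball z0 r \<Longrightarrow> z \<noteq> z0 \<Longrightarrow> 0 < s \<Longrightarrow> s \<le> 1 \<Longrightarrow>
       f (z + s *\<^sub>R (z0 - z), \<theta>) < f (z, \<theta>)"
proof -
  let ?L = "\<lambda>d::'z. (d, 0::'p)"
  have "\<forall>\<^sub>F q in nhds (z0, \<theta>). \<forall>d\<in>S. norm d = 1 \<longrightarrow> fderiv (fderiv f) q (?L d) (?L d) > 0"
  proof (rule pos_def_near[OF continuous_on_bilinear_form[OF C1_on_continuous_fderiv[OF C2_on_fderiv[OF f]]
          bounded_linear_inl] W])
    show "fderiv (fderiv f) (z0, \<theta>) (?L d) (?L d) > 0" if "d \<in> S" "norm d = 1" for d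
    proof -
      have "d \<noteq> 0" using that(2) by auto
      then show ?thesis by (rule pos[OF that(1)])
    qed
  qed
  then have "\<forall>\<^sub>F q in nhds (z0, \<theta>). q \<in> W \<and> (\<forall>d\<in>S. norm d = 1 \<longrightarrow> fderiv (fderiv f) q (?L d) (?L d) > 0)"
    using eventually_nhds_in_open[OF W] eventually_conj by blast
  then obtain r where r: "r > 0" and r2: "\<And>q. dist q (z0, \<theta>) < r \<Longrightarrow>
      q \<in> W \<and> (\<forall>d\<in>S. norm d = 1 \<longrightarrow> fderiv (fderiv f) q (?L d) (?L d) > 0)"
    unfolding eventually_nhds_metric by blast
  have inW: "(z, \<theta>) \<in> W" if "z \<in> ball z0 r" for z
    using r2[of "(z, \<theta>)"] that by (simp add: dist_Pair_Pair dist_commute)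
  have pd: "fderiv (fderiv f) (z, \<theta>) (?L d) (?L d) > 0" if "z \<in> ball z0 r" "d \<in> S" "d \<noteq> 0" for z d
    by (rule bilinear_pos_scale[OF bounded_linear.linear[OF bounded_linear_inl] _ that(2,3)])
       (use r2[of "(z, \<theta>)"] that(1) in \<open>simp add: dist_Pair_Pair dist_commute\<close>)
  show ?thesis
  proof (rule that[OF r inW])
    fix z s assume z: "z \<in> S" "z \<in> ball z0 r" "z \<noteq> z0" and s: "0 < s" "s \<le> (1::real)"
    define d where "d = z0 - z"
    have d: "d \<in> S" "d \<noteq> 0" using z z0 subspace_diff[OF subspace_S] by (auto simp: d_def)
    have seg: "z + t *\<^sub>R d \<in> ball z0 r" if "0 \<le> t" "t \<le> 1" for t
    proof -
      have "z0 - (z + t *\<^sub>R d) = (1 - t) *\<^sub>R d" by (simp add: d_def algebra_simps)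
      then have "dist z0 (z + t *\<^sub>R d) = (1 - t) * norm d" using that by (simp add: dist_norm)
      also have "\<dots> \<le> norm d" using that by (simp add: mult_left_le_one_le)
      finally show ?thesis using z(2) by (simp add: d_def dist_norm)
    qed
    let ?p = "\<lambda>t. (z, \<theta>) + t *\<^sub>R ?L d"
    have eq: "?p t = (z + t *\<^sub>R d, \<theta>)" for t by simp
    have pW: "?p t \<in> W" if "0 \<le> t" "t \<le> 1" for t using inW[OF seg[OF that]] by simp
    have neg: "fderiv f (?p t) (?L d) < 0" if t: "0 \<le> t" "t < 1" for t
    proof -
      have "fderiv f (?p t) (?L d) < fderiv f (?p 1) (?L d)"
      proof (rule DERIV_pos_imp_increasing[OF t(2)])
        fix x assume x: "t \<le> x" "x \<le> 1"
        have 1: "fderiv (fderiv f) (?p x) (?L d) (?L d) > 0"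
          unfolding eq using x t by (intro pd[OF seg d]) auto
        have "((\<lambda>t. fderiv f (?p t) (?L d)) has_real_derivative fderiv (fderiv f) (?p x) (?L d) (?L d)) (at x)"
          by (rule fderiv_along_line(2)[OF f pW]) (use x t in auto)
        with 1 show "\<exists>y. ((\<lambda>t. fderiv f (?p t) (?L d)) has_real_derivative y) (at x) \<and> 0 < y" by blast
      qed
      also have "?p 1 = (z0, \<theta>)" by (simp add: d_def)
      also have "fderiv f (z0, \<theta>) (?L d) = 0" by (rule crit[OF d(1)])
      finally show ?thesis .
    qed
    have "f (?p s) < f (?p 0)"
    proof (rule DERIV_neg_imp_decreasing_open[OF s(1)])
      fix x assume x: "0 < x" "x < s"
      have "((\<lambda>t. f (?p t)) has_real_derivative fderiv f (?p x) (?L d)) (at x)"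
        by (rule fderiv_along_line(1)[OF f pW]) (use x s in auto)
      moreover have "fderiv f (?p x) (?L d) < 0" by (rule neg) (use x s in auto)
      ultimately show "\<exists>y. ((\<lambda>t. f (?p t)) has_real_derivative y) (at x) \<and> y < 0" by blast
    next
      show "continuous_on {0..s} (\<lambda>t. f (?p t))"
      proof (rule continuous_at_imp_continuous_on, intro ballI)
        fix x assume "x \<in> {0..s}"
        then show "isCont (\<lambda>t. f (?p t)) x"
          by (intro DERIV_isCont[OF fderiv_along_line(1)[OF f pW]]) (use s in auto)
      qed
    qed
    then show "f (z + s *\<^sub>R (z0 - z), \<theta>) < f (z, \<theta>)" by (simp add: d_def)
  qed
qed

end

section \<open>Barrier trajectories of a parametric nonlinear program\<close>

text \<open>A Neumann estimate in the 1-norm: \<open>a\<close> equals \<open>r\<close> minus its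
  image under the deviation of \<open>M\<close> from the identity, which costs at most half of the
  norm of \<open>a\<close>. With \<open>r = 0\<close> it gives linear independence, otherwise a
  distance between multipliers.\<close>

lemma sum_delta_perturbation:
  fixes a r :: "'i \<Rightarrow> real" and M :: "'i \<Rightarrow> 'i \<Rightarrow> real"
  assumes A: "finite A" and eq: "\<And>j. j \<in> A \<Longrightarrow> (\<Sum>i\<in>A. a i * M i j) = r j"
    and M: "(\<Sum>j\<in>A. \<Sum>i\<in>A. \<bar>M i j - (if i = j then 1 else 0)\<bar>) \<le> 1/2"
  shows "(\<Sum>j\<in>A. \<bar>a j\<bar>) \<le> 2 * (\<Sum>j\<in>A. \<bar>r j\<bar>)"
proof -
  let ?D = "\<lambda>i j. M i j - (if i = j then 1 else 0)"
  let ?s = "\<Sum>i\<in>A. \<bar>a i\<bar>"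
  have "\<bar>a j\<bar> \<le> \<bar>r j\<bar> + (\<Sum>i\<in>A. ?s * \<bar>?D i j\<bar>)" if j: "j \<in> A" for j
  proof -
    have "(\<Sum>i\<in>A. a i * ?D i j) = (\<Sum>i\<in>A. a i * M i j) - (\<Sum>i\<in>A. if i = j then a i else 0)"
      unfolding sum_subtractf[symmetric] by (intro sum.cong) (auto simp: algebra_simps)
    then have "a j = r j - (\<Sum>i\<in>A. a i * ?D i j)" using eq[OF j] A j by simp
    then have "\<bar>a j\<bar> \<le> \<bar>r j\<bar> + \<bar>\<Sum>i\<in>A. a i * ?D i j\<bar>" by linarith
    also have "\<bar>\<Sum>i\<in>A. a i * ?D i j\<bar> \<le> (\<Sum>i\<in>A. ?s * \<bar>?D i j\<bar>)"
    proof (rule order_trans[OF sum_abs sum_mono])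
      fix i assume i: "i \<in> A"
      have "\<bar>a i\<bar> \<le> ?s" by (rule member_le_sum[OF i _ A]) auto
      then show "\<bar>a i * ?D i j\<bar> \<le> ?s * \<bar>?D i j\<bar>" unfolding abs_mult by (rule mult_right_mono) auto
    qed
    finally show ?thesis by simp
  qed
  then have "?s \<le> (\<Sum>j\<in>A. \<bar>r j\<bar> + (\<Sum>i\<in>A. ?s * \<bar>?D i j\<bar>))" by (rule sum_mono)
  also have "\<dots> = (\<Sum>j\<in>A. \<bar>r j\<bar>) + ?s * (\<Sum>j\<in>A. \<Sum>i\<in>A. \<bar>?D i j\<bar>)"
    unfolding sum.distrib sum_distrib_left ..
  also have "?s * (\<Sum>j\<in>A. \<Sum>i\<in>A. \<bar>?D i j\<bar>) \<le> ?s * (1/2)"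
    by (rule mult_left_mono[OF M]) (simp add: sum_nonneg)
  finally show ?thesis by simp
qed

text \<open>The decision variables and the multipliers each get a biorthogonal system;
  \<open>Y\<close> has one coordinate for each constraint in \<open>L\<close>.\<close>

locale nlp_data = Z: biorthogonal K b \<beta> + Y: biorthogonal L c \<eta>
  for K :: "'k set" and b :: "'k \<Rightarrow> 'z::banach" and \<beta> :: "'k \<Rightarrow> 'z \<Rightarrow>\<^sub>L real"
    and L :: "'i set" and c :: "'i \<Rightarrow> 'y::banach" and \<eta> :: "'i \<Rightarrow> 'y \<Rightarrow>\<^sub>L real" +
  fixes I J :: "'i set" and \<phi> :: "'z \<times> 'p::banach \<Rightarrow> real" and G :: "'i \<Rightarrow> 'z \<times> 'p \<Rightarrow> real"
  assumes L: "L = I \<union> J" and IJ: "I \<inter> J = {}"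
    and \<phi>: "C2_on UNIV \<phi>" and G: "\<And>i. i \<in> L \<Longrightarrow> C2_on UNIV (G i)"
begin

lemma finL: "finite L" by (rule Y.finK)
lemma finI: "finite I" and finJ: "finite J" using finL L by auto

lemma dG: "i \<in> L \<Longrightarrow> (G i has_derivative blinfun_apply (fderiv (G i) q)) (at q)"
  by (rule C1_on_has_derivative[OF C2_on_C1[OF G]]) auto

lemma d\<phi>: "(\<phi> has_derivative blinfun_apply (fderiv \<phi> q)) (at q)"
  by (rule C1_on_has_derivative[OF C2_on_C1[OF \<phi>]]) auto

lemma ddG: "i \<in> L \<Longrightarrow> ((\<lambda>q. fderiv (G i) q a) has_derivative (\<lambda>h. fderiv (fderiv (G i)) q h a)) (at q)"
  by (rule fderiv_apply_const[OF C1_on_differentiable[OF C2_on_fderiv[OF G]]]) auto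

lemma dd\<phi>: "((\<lambda>q. fderiv \<phi> q a) has_derivative (\<lambda>h. fderiv (fderiv \<phi>) q h a)) (at q)"
  by (rule fderiv_apply_const[OF C1_on_differentiable[OF C2_on_fderiv[OF \<phi>]]]) auto

lemma cont_G: "i \<in> L \<Longrightarrow> continuous_on UNIV (G i)"
  by (rule C1_on_continuous[OF C2_on_C1[OF G]])

lemma cont_dG: "i \<in> L \<Longrightarrow> continuous_on UNIV (fderiv (G i))"
  by (rule C1_on_continuous_fderiv[OF C2_on_C1[OF G]])

lemma cont_d\<phi>: "continuous_on UNIV (fderiv \<phi>)"
  by (rule C1_on_continuous_fderiv[OF C2_on_C1[OF \<phi>]])

subsection \<open>Lagrange multipliers\<close>

lemma linear_in_state: "linear (\<lambda>d. blinfun_apply T (d, 0))"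
proof
  show "T (x + y, 0) = T (x, 0) + T (y, 0)" for x y using blinfun.add_right[of T "(x, 0)" "(y, 0)"] by simp
  show "T (r *\<^sub>R x, 0) = r *\<^sub>R T (x, 0)" for r x using blinfun.scaleR_right[of T r "(x, 0)"] by simp
qed

text \<open>A tangent direction \<open>d\<close> is realized by a feasible curve: the line
  \<open>z1 + s *\<^sub>R d\<close> is corrected along the dual directions \<open>e j\<close>, with
  correction coefficients from the implicit function theorem. The correction has derivative 0, so
  \<open>\<phi>\<close> along the curve has slope \<open>fderiv \<phi> (z1, \<theta>) (d, 0)\<close>
  at a minimum.\<close>

lemma lagrange_tangent:
  assumes A: "A \<subseteq> L" and z1: "z1 \<in> Z.S"
    and e: "\<And>j. j \<in> A \<Longrightarrow> e j \<in> Z.S" "\<And>i j. i \<in> A \<Longrightarrow> j \<in> A \<Longrightarrow> fderiv (G i) (z1, \<theta>) (e j, 0) = (if i = j then 1 else 0)"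
    and zero: "\<And>i. i \<in> A \<Longrightarrow> G i (z1, \<theta>) = 0"
    and min: "\<rho> > 0" "\<And>z. z \<in> Z.S \<Longrightarrow> z \<in> ball z1 \<rho> \<Longrightarrow> (\<And>i. i \<in> A \<Longrightarrow> G i (z, \<theta>) = 0) \<Longrightarrow> \<phi> (z1, \<theta>) \<le> \<phi> (z, \<theta>)"
    and d: "d \<in> Z.S" "\<And>i. i \<in> A \<Longrightarrow> fderiv (G i) (z1, \<theta>) (d, 0) = 0"
  shows "fderiv \<phi> (z1, \<theta>) (d, 0) = 0"
proof -
  have finA: "finite A" using A finL finite_subset by blast
  define \<zeta> where "\<zeta> x = z1 + snd x *\<^sub>R d + (\<Sum>j\<in>A. \<eta> j (fst x) *\<^sub>R e j)" for x :: "'y \<times> real"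
  \<comment> \<open>Replacing the coordinates of \<open>y\<close> in \<open>A\<close> by constraint
    values makes \<open>H = 0\<close> enforce these constraints. Duality of the \<open>e j\<close>
    makes the partial derivative in \<open>y\<close> the identity.\<close>
  define H where "H x = fst x + (\<Sum>i\<in>A. (G i (\<zeta> x, \<theta>) - \<eta> i (fst x)) *\<^sub>R c i)" for x :: "'y \<times> real"
  have \<zeta>C1: "C1_on UNIV \<zeta>" unfolding \<zeta>_def
    by (intro C1_on_add C1_on_const C1_on_sum C1_on_scaleR C1_on_linear bounded_linear_snd
      C1_on_linear_comp[OF blinfun.bounded_linear_right] bounded_linear_fst)
  have \<zeta>\<theta>: "C1_on UNIV (\<lambda>x. (\<zeta> x, \<theta>))" by (intro C1_on_Pair \<zeta>C1 C1_on_const)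
  have HC1: "C1_on UNIV H" unfolding H_def diff_conv_add_uminus
    by (intro C1_on_add C1_on_const C1_on_sum C1_on_scaleR C1_on_linear bounded_linear_fst
        C1_on_linear_comp[OF bounded_linear_minus[OF bounded_linear_ident]]
        C1_on_linear_comp[OF blinfun.bounded_linear_right] C1_on_compose[OF C2_on_C1[OF G] \<zeta>\<theta>])
       (use A in auto)
  have \<zeta>0: "\<zeta> (0, 0) = z1" by (simp add: \<zeta>_def)
  have d\<zeta>: "(\<zeta> has_derivative (\<lambda>h. snd h *\<^sub>R d + (\<Sum>j\<in>A. \<eta> j (fst h) *\<^sub>R e j))) (at x)" for x
    unfolding \<zeta>_def by (auto intro!: derivative_eq_intros)
  have dG\<zeta>: "((\<lambda>x. G i (\<zeta> x, \<theta>)) has_derivative (\<lambda>h. \<eta> i (fst h))) (at (0, 0))" if i: "i \<in> A" for i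
  proof -
    have iL: "i \<in> L" using i A by auto
    have 1: "((\<lambda>x. (\<zeta> x, \<theta>)) has_derivative (\<lambda>h. (snd h *\<^sub>R d + (\<Sum>j\<in>A. \<eta> j (fst h) *\<^sub>R e j), 0))) (at (0, 0))"
      by (intro has_derivative_Pair d\<zeta> has_derivative_const)
    have eq: "fderiv (G i) (z1, \<theta>) (snd h *\<^sub>R d + (\<Sum>j\<in>A. \<eta> j (fst h) *\<^sub>R e j), 0) = \<eta> i (fst h)" for h
    proof -
      have "fderiv (G i) (z1, \<theta>) (snd h *\<^sub>R d + (\<Sum>j\<in>A. \<eta> j (fst h) *\<^sub>R e j), 0)
          = snd h * fderiv (G i) (z1, \<theta>) (d, 0) + (\<Sum>j\<in>A. \<eta> j (fst h) * fderiv (G i) (z1, \<theta>) (e j, 0))"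
        by (simp only: linear_add[OF linear_in_state] linear_sum[OF linear_in_state]
            linear_cmul[OF linear_in_state] real_scaleR_def)
      also have "\<dots> = (\<Sum>j\<in>A. \<eta> j (fst h) * (if i = j then 1 else 0))"
        using d(2)[OF i] e(2)[OF i] by simp
      also have "\<dots> = \<eta> i (fst h)" using i finA by (simp add: if_distrib cong: if_cong)
      finally show ?thesis .
    qed
    show ?thesis
      using has_derivative_compose[OF 1, of "G i" "blinfun_apply (fderiv (G i) (z1, \<theta>))"] dG[OF iL]
      by (simp add: \<zeta>0 eq)
  qed
  have dH: "(H has_derivative fst) (at (0, 0))"
  proof -
    have "(H has_derivative (\<lambda>h. fst h + (\<Sum>i\<in>A. (\<eta> i (fst h) - \<eta> i (fst h)) *\<^sub>R c i))) (at (0, 0))"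
      unfolding H_def by (auto intro!: derivative_eq_intros dG\<zeta>)
    then show ?thesis by simp
  qed
  have fH: "blinfun_apply (fderiv H (0, 0)) = fst" by (rule fderiv_eq[OF dH])
  have H0: "H (0, 0) = 0" using zero by (simp add: H_def \<zeta>0)
  have H_id: "id_blinfun h = fderiv H (0, 0) (h, 0)" for h by (simp add: fH)
  obtain r \<delta> g where "r > 0" and g: "\<delta> > 0" "C1_on (ball 0 \<delta>) g" "g (0::real) = 0"
    and "\<And>p. p \<in> ball 0 \<delta> \<Longrightarrow> g p \<in> ball 0 r" "\<And>p. p \<in> ball 0 \<delta> \<Longrightarrow> (g p, p) \<in> UNIV"
    and Hg: "\<And>p. p \<in> ball 0 \<delta> \<Longrightarrow> H (g p, p) = 0"
    and "\<And>y p. y \<in> ball 0 r \<Longrightarrow> p \<in> ball 0 \<delta> \<Longrightarrow> H (y, p) = 0 \<Longrightarrow> y = g p"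
    and dg: "fderiv g 0 = - (id_blinfun o\<^sub>L fderiv H (0, 0) o\<^sub>L Blinfun (\<lambda>p. (0, p)))"
    by (rule implicit_function_banach[OF open_UNIV UNIV_I HC1 H0 H_id blinfun_compose_id(1) blinfun_compose_id(1)]) (rule that)
  \<comment> \<open>Tangency of \<open>d\<close> removes the derivative of \<open>H\<close> in the
    curve parameter, so the correction starts with slope 0.\<close>
  have dg0: "(g has_derivative (\<lambda>_. 0)) (at 0)"
  proof -
    have "fderiv g 0 = 0"
      unfolding dg by (rule blinfun_eqI) (simp add: fH bounded_linear_Blinfun_apply[OF bounded_linear_inr] blinfun.minus_left)
    then show ?thesis using C1_on_has_derivative[OF g(2), of 0] g(1) by (simp add: zero_blinfun.rep_eq)
  qed
  define w where "w s = \<zeta> (g s, s)" for s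
  have w0: "w 0 = z1" by (simp add: w_def g(3) \<zeta>0)
  have "((\<lambda>s. (g s, s)) has_derivative (\<lambda>s. (0, s))) (at 0)"
    by (intro has_derivative_Pair dg0 has_derivative_ident)
  from has_derivative_compose[OF this d\<zeta>] have dw: "(w has_derivative (\<lambda>s. s *\<^sub>R d)) (at 0)"
    by (simp add: w_def[abs_def])
  have wS: "w s \<in> Z.S" for s unfolding w_def \<zeta>_def
    by (intro subspace_add[OF Z.subspace_S] subspace_scale[OF Z.subspace_S] subspace_sum[OF Z.subspace_S] z1 d e)
  have wG: "G i (w s, \<theta>) = 0" if "s \<in> ball 0 \<delta>" "i \<in> A" for s i
  proof -
    have iL: "i \<in> L" using that A by auto
    have "\<eta> i (\<Sum>j\<in>A. (G j (w s, \<theta>) - \<eta> j (g s)) *\<^sub>R c j)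
        = (\<Sum>j\<in>A. if i = j then G j (w s, \<theta>) - \<eta> j (g s) else 0)"
      unfolding blinfun.sum_right using A iL Y.biorth by (intro sum.cong) (auto simp: blinfun.scaleR_right)
    also have "\<dots> = G i (w s, \<theta>) - \<eta> i (g s)" using that finA by simp
    finally show ?thesis
      using arg_cong[OF Hg[OF that(1)], of "\<eta> i"] by (simp add: H_def w_def blinfun.add_right)
  qed
  have dw\<phi>: "((\<lambda>s. \<phi> (w s, \<theta>)) has_real_derivative fderiv \<phi> (z1, \<theta>) (d, 0)) (at 0)"
  proof -
    have "((\<lambda>s. (w s, \<theta>)) has_derivative (\<lambda>s. (s *\<^sub>R d, 0))) (at 0)"
      by (intro has_derivative_Pair dw has_derivative_const)
    from has_derivative_compose[OF this, of \<phi> "blinfun_apply (fderiv \<phi> (z1, \<theta>))"] d\<phi>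
    have "((\<lambda>s. \<phi> (w s, \<theta>)) has_derivative (\<lambda>s. fderiv \<phi> (z1, \<theta>) (s *\<^sub>R d, 0))) (at 0)"
      by (simp add: w0)
    moreover have "fderiv \<phi> (z1, \<theta>) (s *\<^sub>R d, 0) = s * fderiv \<phi> (z1, \<theta>) (d, 0)" for s
      using blinfun.scaleR_right[of "fderiv \<phi> (z1, \<theta>)" s "(d, 0)"] by simp
    ultimately show ?thesis by (simp add: has_field_derivative_def mult_commute_abs)
  qed
  have "isCont w 0" using dw has_derivative_continuous by blast
  then have "\<forall>\<^sub>F s in nhds 0. dist (w s) z1 < \<rho>"
    using min(1) tendstoD[of w "w 0" "nhds 0" \<rho>] by (simp add: isCont_def tendsto_nhds_iff w0)
  moreover have "\<forall>\<^sub>F s in nhds 0. s \<in> ball (0::real) \<delta>" using g(1) by (intro eventually_nhds_in_open) auto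
  ultimately have "\<forall>\<^sub>F s in nhds 0. \<phi> (z1, \<theta>) \<le> \<phi> (w s, \<theta>)"
    by eventually_elim (intro min(2) wS wG, auto simp: dist_commute)
  then obtain \<kappa> where "\<kappa> > 0" "\<And>s. dist s 0 < \<kappa> \<Longrightarrow> \<phi> (z1, \<theta>) \<le> \<phi> (w s, \<theta>)"
    unfolding eventually_nhds_metric by blast
  then show ?thesis using DERIV_local_min[OF dw\<phi>, of \<kappa>] by (simp add: w0 dist_real_def)
qed

text \<open>The derivative of \<open>\<phi>\<close> vanishes on the common kernel of the active
  derivatives, hence is a combination of them; the sign change puts it in Lagrangian form.\<close>

lemma lagrange_multipliers:
  assumes A: "A \<subseteq> L" and z1: "z1 \<in> Z.S"
    and ind: "\<And>a j. (\<And>d. d \<in> Z.S \<Longrightarrow> (\<Sum>i\<in>A. a i * fderiv (G i) (z1, \<theta>) (d, 0)) = 0) \<Longrightarrow> j \<in> A \<Longrightarrow> a j = 0"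
    and zero: "\<And>i. i \<in> A \<Longrightarrow> G i (z1, \<theta>) = 0"
    and min: "\<rho> > 0" "\<And>z. z \<in> Z.S \<Longrightarrow> z \<in> ball z1 \<rho> \<Longrightarrow> (\<And>i. i \<in> A \<Longrightarrow> G i (z, \<theta>) = 0) \<Longrightarrow> \<phi> (z1, \<theta>) \<le> \<phi> (z, \<theta>)"
  shows "\<exists>m. \<forall>d\<in>Z.S. fderiv \<phi> (z1, \<theta>) (d, 0) + (\<Sum>i\<in>A. m i * fderiv (G i) (z1, \<theta>) (d, 0)) = 0"
proof -
  have finA: "finite A" using A finL finite_subset by blast
  have "\<exists>e. \<forall>j\<in>A. e j \<in> Z.S \<and> (\<forall>i\<in>A. fderiv (G i) (z1, \<theta>) (e j, 0) = (if i = j then 1 else 0))"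
    by (rule dual_basis_exists[OF finA linear_in_state Z.subspace_S]) (rule ind)
  then obtain e where e: "\<And>j. j \<in> A \<Longrightarrow> e j \<in> Z.S"
    "\<And>i j. i \<in> A \<Longrightarrow> j \<in> A \<Longrightarrow> fderiv (G i) (z1, \<theta>) (e j, 0) = (if i = j then 1 else 0)" by blast
  have "\<exists>m. \<forall>d\<in>Z.S. fderiv \<phi> (z1, \<theta>) (d, 0) = (\<Sum>i\<in>A. m i * fderiv (G i) (z1, \<theta>) (d, 0))"
    by (rule functional_in_span[OF finA linear_in_state linear_in_state Z.subspace_S])
       (rule lagrange_tangent[OF A z1 e zero min])
  then obtain m where "\<And>d. d \<in> Z.S \<Longrightarrow> fderiv \<phi> (z1, \<theta>) (d, 0) = (\<Sum>i\<in>A. m i * fderiv (G i) (z1, \<theta>) (d, 0))" by blast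
  then show ?thesis by (intro exI[of _ "\<lambda>i. - m i"]) (simp add: sum_negf)
qed

end

subsection \<open>The barrier-penalty function\<close>

context nlp_data
begin

definition strict_region :: "('z \<times> 'p) set" where
  "strict_region = {q. \<forall>i\<in>I. G i q < 0}"

definition barrier :: "real \<Rightarrow> 'z \<times> 'p \<Rightarrow> real" where
  "barrier \<gamma> q = \<phi> q - \<gamma> * (\<Sum>i\<in>I. ln (- G i q)) + 1 / (2 * \<gamma>) * (\<Sum>j\<in>J. (G j q)\<^sup>2)"

definition local_minimizer :: "'p \<Rightarrow> 'z \<Rightarrow> bool" where
  "local_minimizer \<theta> z \<longleftrightarrow> z \<in> Z.S \<and> (\<forall>i\<in>I. G i (z, \<theta>) \<le> 0) \<and> (\<forall>j\<in>J. G j (z, \<theta>) = 0) \<and>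
     (\<exists>\<rho>>0. \<forall>z'\<in>Z.S \<inter> ball z \<rho>. (\<forall>i\<in>I. G i (z', \<theta>) \<le> 0) \<and> (\<forall>j\<in>J. G j (z', \<theta>) = 0)
        \<longrightarrow> \<phi> (z, \<theta>) \<le> \<phi> (z', \<theta>))"

lemma IL: "i \<in> I \<Longrightarrow> i \<in> L" and JL: "i \<in> J \<Longrightarrow> i \<in> L"
  by (simp_all add: L)

lemma open_strict_region: "open strict_region"
proof -
  have "strict_region = (\<Inter>i\<in>I. {q. G i q < 0})" by (auto simp: strict_region_def)
  moreover have "open {q. G i q < 0}" if "i \<in> I" for i
    by (intro open_Collect_less cont_G IL that continuous_on_const)
  ultimately show ?thesis using finI by (simp add: open_INT)
qed

lemma barrier_C2: "C2_on strict_region (barrier \<gamma>)"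
proof -
  note sub = C2_on_subset[OF _ subset_UNIV] and op = open_strict_region
  have "C2_on strict_region (\<lambda>q. ln (- G i q))" if "i \<in> I" for i
    by (rule C2_on_compose[OF C2_on_ln C2_on_uminus[OF op sub[OF G[OF IL[OF that]]]] _ op])
       (use that in \<open>auto simp: strict_region_def\<close>)
  then have "C2_on strict_region (\<lambda>q. \<phi> q + - (\<gamma> * (\<Sum>i\<in>I. ln (- G i q))) + 1 / (2 * \<gamma>) * (\<Sum>j\<in>J. (G j q)\<^sup>2))"
    by (intro C2_on_add C2_on_uminus C2_on_cmult C2_on_sum C2_on_power2 op sub[OF \<phi>] sub[OF G] JL)
  then show ?thesis by (simp add: barrier_def[abs_def])
qed

lemma barrier_has_derivative:
  assumes q: "q \<in> strict_region"
  shows "(barrier \<gamma> has_derivative (\<lambda>h. fderiv \<phi> q h - \<gamma> * (\<Sum>i\<in>I. fderiv (G i) q h / G i q)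
      + 1 / \<gamma> * (\<Sum>j\<in>J. G j q * fderiv (G j) q h))) (at q)"
proof -
  have 1: "((\<lambda>q. ln (- G i q)) has_derivative (\<lambda>h. fderiv (G i) q h / G i q)) (at q)" if i: "i \<in> I" for i
  proof -
    have neg: "G i q < 0" using q i by (simp add: strict_region_def)
    show ?thesis
      using neg by (auto intro!: derivative_eq_intros dG IL i simp: divide_inverse)
  qed
  have 2: "((\<lambda>q. (G j q)\<^sup>2) has_derivative (\<lambda>h. 2 * (G j q * fderiv (G j) q h))) (at q)" if j: "j \<in> J" for j
    by (auto intro!: derivative_eq_intros dG JL j)
  have 3: "1 / (2 * \<gamma>) * (\<Sum>j\<in>J. 2 * f j) = 1 / \<gamma> * (\<Sum>j\<in>J. f j)" for f :: "'i \<Rightarrow> real"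
    by (simp add: sum_distrib_left[symmetric])
  show ?thesis
    unfolding barrier_def[abs_def] 3[symmetric]
    by (intro has_derivative_add has_derivative_diff has_derivative_mult_right has_derivative_sum d\<phi> 1 2)
qed

lemma fderiv_barrier:
  assumes "q \<in> strict_region"
  shows "fderiv (barrier \<gamma>) q h = fderiv \<phi> q h - \<gamma> * (\<Sum>i\<in>I. fderiv (G i) q h / G i q)
      + 1 / \<gamma> * (\<Sum>j\<in>J. G j q * fderiv (G j) q h)"
  using fderiv_eq[OF barrier_has_derivative[OF assms]] by simp

lemma fderiv2_barrier:
  assumes q: "q \<in> strict_region"
  shows "fderiv (fderiv (barrier \<gamma>)) q h a = fderiv (fderiv \<phi>) q h a
      - \<gamma> * (\<Sum>i\<in>I. fderiv (fderiv (G i)) q h a / G i q - fderiv (G i) q h * fderiv (G i) q a / (G i q)\<^sup>2)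
      + 1 / \<gamma> * (\<Sum>j\<in>J. G j q * fderiv (fderiv (G j)) q h a + fderiv (G j) q h * fderiv (G j) q a)"
proof -
  have 1: "((\<lambda>q. fderiv (G i) q a / G i q) has_derivative
      (\<lambda>h. fderiv (fderiv (G i)) q h a / G i q - fderiv (G i) q h * fderiv (G i) q a / (G i q)\<^sup>2)) (at q)"
    if i: "i \<in> I" for i
  proof -
    have neg: "G i q \<noteq> 0" using q i by (auto simp: strict_region_def)
    show ?thesis
      by (rule has_derivative_eq_rhs[OF has_derivative_divide[OF ddG[OF IL[OF i]] dG[OF IL[OF i]] neg]])
         (use neg in \<open>simp add: fun_eq_iff field_simps power2_eq_square\<close>)
  qed
  have 2: "((\<lambda>q. G j q * fderiv (G j) q a) has_derivative
      (\<lambda>h. G j q * fderiv (fderiv (G j)) q h a + fderiv (G j) q h * fderiv (G j) q a)) (at q)"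
    if j: "j \<in> J" for j
    by (rule has_derivative_mult[OF dG[OF JL[OF j]] ddG[OF JL[OF j]]])
  have "((\<lambda>q. fderiv \<phi> q a - \<gamma> * (\<Sum>i\<in>I. fderiv (G i) q a / G i q)
      + 1 / \<gamma> * (\<Sum>j\<in>J. G j q * fderiv (G j) q a)) has_derivative (\<lambda>h. fderiv (fderiv \<phi>) q h a
      - \<gamma> * (\<Sum>i\<in>I. fderiv (fderiv (G i)) q h a / G i q - fderiv (G i) q h * fderiv (G i) q a / (G i q)\<^sup>2)
      + 1 / \<gamma> * (\<Sum>j\<in>J. G j q * fderiv (fderiv (G j)) q h a + fderiv (G j) q h * fderiv (G j) q a))) (at q)"
    by (intro has_derivative_add has_derivative_diff has_derivative_mult_right has_derivative_sum dd\<phi> 1 2)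
  then have "((\<lambda>q. fderiv (barrier \<gamma>) q a) has_derivative (\<lambda>h. fderiv (fderiv \<phi>) q h a
      - \<gamma> * (\<Sum>i\<in>I. fderiv (fderiv (G i)) q h a / G i q - fderiv (G i) q h * fderiv (G i) q a / (G i q)\<^sup>2)
      + 1 / \<gamma> * (\<Sum>j\<in>J. G j q * fderiv (fderiv (G j)) q h a + fderiv (G j) q h * fderiv (G j) q a))) (at q)"
    by (rule has_derivative_transform_within_open[OF _ open_strict_region q]) (simp add: fderiv_barrier)
  moreover have "((\<lambda>q. fderiv (barrier \<gamma>) q a) has_derivative (\<lambda>h. fderiv (fderiv (barrier \<gamma>)) q h a)) (at q)"
    by (rule fderiv_apply_const[OF C1_on_differentiable[OF C2_on_fderiv[OF barrier_C2] q]])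
  ultimately show ?thesis by (rule has_derivative_unique[THEN fun_cong, rotated])
qed

text \<open>The equations turn \<open>\<gamma> / (G i q)\<^sup>2\<close> into
  \<open>(m i)\<^sup>2 / \<gamma>\<close>. The barrier Hessian is thus the Hessian of the Lagrangian
  plus \<open>1 / \<gamma>\<close> times weighted squares of constraint derivatives, the shape to
  which Finsler's lemma applies.\<close>

lemma barrier_at_central_point:
  assumes \<gamma>: "\<gamma> > 0" and q: "q \<in> strict_region"
    and I: "\<And>i. i \<in> I \<Longrightarrow> m i * G i q + \<gamma> = 0" and J: "\<And>j. j \<in> J \<Longrightarrow> G j q - \<gamma> * m j = 0"
  shows "fderiv (barrier \<gamma>) q h = fderiv \<phi> q h + (\<Sum>i\<in>L. m i * fderiv (G i) q h)"
    and "fderiv (fderiv (barrier \<gamma>)) q h h = fderiv (fderiv \<phi>) q h h + (\<Sum>i\<in>L. m i * fderiv (fderiv (G i)) q h h)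
      + 1 / \<gamma> * (\<Sum>i\<in>L. (if i \<in> I then (m i)\<^sup>2 else 1) * (fderiv (G i) q h)\<^sup>2)"
proof -
  have GI: "- \<gamma> * (x / G i q) = m i * x" "\<gamma> / (G i q)\<^sup>2 = (m i)\<^sup>2 / \<gamma>" if "i \<in> I" for i x
  proof -
    have neg: "G i q \<noteq> 0" using q that by (auto simp: strict_region_def)
    have m: "- \<gamma> = m i * G i q" using I[OF that] by simp
    show "- \<gamma> * (x / G i q) = m i * x" unfolding m using neg by simp
    have "\<gamma>\<^sup>2 = (m i)\<^sup>2 * (G i q)\<^sup>2" using m by (metis power2_minus power_mult_distrib)
    then show "\<gamma> / (G i q)\<^sup>2 = (m i)\<^sup>2 / \<gamma>" using neg \<gamma> by (simp add: field_simps power2_eq_square)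
  qed
  have GJ: "1 / \<gamma> * (G j q * x) = m j * x" if "j \<in> J" for j x using J[OF that] \<gamma> by (simp add: field_simps)
  have split: "sum f L = sum f I + sum f J" for f :: "'i \<Rightarrow> real"
    unfolding L by (rule sum.union_disjoint[OF finI finJ IJ])
  have notI: "j \<notin> I" if "j \<in> J" for j using that IJ by auto
  have "- \<gamma> * (\<Sum>i\<in>I. fderiv (G i) q h / G i q) = (\<Sum>i\<in>I. m i * fderiv (G i) q h)"
    unfolding sum_distrib_left using GI by (intro sum.cong) auto
  moreover have "1 / \<gamma> * (\<Sum>j\<in>J. G j q * fderiv (G j) q h) = (\<Sum>j\<in>J. m j * fderiv (G j) q h)"
    unfolding sum_distrib_left using GJ by (intro sum.cong) auto
  ultimately show "fderiv (barrier \<gamma>) q h = fderiv \<phi> q h + (\<Sum>i\<in>L. m i * fderiv (G i) q h)"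
    unfolding fderiv_barrier[OF q] split by simp
  have E1: "- \<gamma> * (\<Sum>i\<in>I. fderiv (fderiv (G i)) q h h / G i q - fderiv (G i) q h * fderiv (G i) q h / (G i q)\<^sup>2)
     = (\<Sum>i\<in>I. m i * fderiv (fderiv (G i)) q h h) + 1 / \<gamma> * (\<Sum>i\<in>I. (m i)\<^sup>2 * (fderiv (G i) q h)\<^sup>2)"
    unfolding sum_distrib_left sum.distrib[symmetric]
  proof (intro sum.cong refl)
    fix i assume i: "i \<in> I"
    have "- \<gamma> * (fderiv (fderiv (G i)) q h h / G i q - fderiv (G i) q h * fderiv (G i) q h / (G i q)\<^sup>2)
      = - \<gamma> * (fderiv (fderiv (G i)) q h h / G i q) + \<gamma> / (G i q)\<^sup>2 * (fderiv (G i) q h)\<^sup>2"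
      by (simp add: algebra_simps power2_eq_square)
    also have "\<dots> = m i * fderiv (fderiv (G i)) q h h + (m i)\<^sup>2 / \<gamma> * (fderiv (G i) q h)\<^sup>2"
      unfolding GI[OF i] ..
    finally show "- \<gamma> * (fderiv (fderiv (G i)) q h h / G i q - fderiv (G i) q h * fderiv (G i) q h / (G i q)\<^sup>2)
      = m i * fderiv (fderiv (G i)) q h h + 1 / \<gamma> * ((m i)\<^sup>2 * (fderiv (G i) q h)\<^sup>2)" by simp
  qed
  have E2: "1 / \<gamma> * (\<Sum>j\<in>J. G j q * fderiv (fderiv (G j)) q h h + fderiv (G j) q h * fderiv (G j) q h)
     = (\<Sum>j\<in>J. m j * fderiv (fderiv (G j)) q h h) + 1 / \<gamma> * (\<Sum>j\<in>J. (fderiv (G j) q h)\<^sup>2)"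
    unfolding sum_distrib_left sum.distrib[symmetric] distrib_left
    using GJ by (intro sum.cong) (auto simp: power2_eq_square)
  have E3: "(\<Sum>i\<in>J. (if i \<in> I then (m i)\<^sup>2 else 1) * (fderiv (G i) q h)\<^sup>2) = (\<Sum>i\<in>J. (fderiv (G i) q h)\<^sup>2)"
    using notI by (intro sum.cong) auto
  have E4: "(\<Sum>i\<in>I. (if i \<in> I then (m i)\<^sup>2 else 1) * (fderiv (G i) q h)\<^sup>2) = (\<Sum>i\<in>I. (m i)\<^sup>2 * (fderiv (G i) q h)\<^sup>2)"
    by (intro sum.cong) auto
  show "fderiv (fderiv (barrier \<gamma>)) q h h = fderiv (fderiv \<phi>) q h h + (\<Sum>i\<in>L. m i * fderiv (fderiv (G i)) q h h)
      + 1 / \<gamma> * (\<Sum>i\<in>L. (if i \<in> I then (m i)\<^sup>2 else 1) * (fderiv (G i) q h)\<^sup>2)"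
    unfolding fderiv2_barrier[OF q] split E2 E3 E4 distrib_left using E1 by linarith
qed

subsection \<open>The perturbed optimality system\<close>

text \<open>Multiplying out the multiplier estimates of the barrier and penalty terms gives a system that
  stays regular at \<open>\<gamma> = 0\<close>, where it is the optimality system of the constrained problem.\<close>

definition pt :: "('z \<times> 'y) \<times> ('p \<times> real) \<Rightarrow> 'z \<times> 'p" where "pt x = (fst (fst x), fst (snd x))"

text \<open>The derivative of the Lagrangian in the input direction \<open>d\<close>, with the
  multipliers read off as coordinates of the second unknown.\<close>

definition stat :: "'z \<Rightarrow> ('z \<times> 'y) \<times> ('p \<times> real) \<Rightarrow> real" where
  "stat d x = fderiv \<phi> (pt x) (d, 0) + (\<Sum>i\<in>L. \<eta> i (snd (fst x)) * fderiv (G i) (pt x) (d, 0))"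

definition compl :: "'i \<Rightarrow> ('z \<times> 'y) \<times> ('p \<times> real) \<Rightarrow> real" where
  "compl i x = (if i \<in> I then \<eta> i (snd (fst x)) * G i (pt x) + snd (snd x)
     else G i (pt x) - snd (snd x) * \<eta> i (snd (fst x)))"

text \<open>Both components have the shape of \<open>zero_form_iff\<close>. One equation thus
  encodes stationarity, the perturbed constraints and membership in the two subspaces, and its
  partial derivative in the unknowns is the identity plus finite rank.\<close>

definition opt_sys :: "('z \<times> 'y) \<times> ('p \<times> real) \<Rightarrow> 'z \<times> 'y" where
  "opt_sys x = fst x + ((\<Sum>k\<in>K. (stat (b k) x - \<beta> k (fst (fst x))) *\<^sub>R b k),
     (\<Sum>i\<in>L. (compl i x - \<eta> i (snd (fst x))) *\<^sub>R c i))"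

lemma linear_stat: "linear (\<lambda>d. stat d x)"
proof -
  have "linear (\<lambda>d. (fderiv \<phi> (pt x) + (\<Sum>i\<in>L. \<eta> i (snd (fst x)) *\<^sub>R fderiv (G i) (pt x))) (d, 0))"
    by (rule linear_in_state)
  then show ?thesis by (simp add: stat_def blinfun.add_left blinfun.sum_left blinfun.scaleR_left)
qed

lemma linear_zero_on_S:
  fixes f :: "'z \<Rightarrow> real"
  assumes "linear f" "\<forall>k\<in>K. f (b k) = 0" "d \<in> Z.S"
  shows "f d = 0"
proof -
  have "f d = f (\<Sum>k\<in>K. \<beta> k d *\<^sub>R b k)" using Z.S_repr[OF assms(3)] by simp
  also have "\<dots> = 0" using assms(2) by (simp add: linear_sum[OF assms(1)] linear_cmul[OF assms(1)])
  finally show ?thesis .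
qed

lemma opt_sys_zero_iff:
  "opt_sys x = 0 \<longleftrightarrow> fst (fst x) \<in> Z.S \<and> snd (fst x) \<in> Y.S \<and> (\<forall>d\<in>Z.S. stat d x = 0) \<and> (\<forall>i\<in>L. compl i x = 0)"
proof -
  have "(\<forall>k\<in>K. stat (b k) x = 0) \<longleftrightarrow> (\<forall>d\<in>Z.S. stat d x = 0)"
    using linear_zero_on_S[OF linear_stat] Z.b_in_S by blast
  then show ?thesis
    unfolding opt_sys_def by (auto simp: prod_eq_iff Z.zero_form_iff Y.zero_form_iff)
qed

lemma C1_pt: "C1_on UNIV pt"
  unfolding pt_def[abs_def]
  by (intro C1_on_linear bounded_linear_Pair bounded_linear_compose[OF bounded_linear_fst bounded_linear_fst]
      bounded_linear_compose[OF bounded_linear_fst bounded_linear_snd])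

lemma bounded_linear_\<eta>: "bounded_linear (\<lambda>x :: ('z \<times> 'y) \<times> ('p \<times> real). \<eta> i (snd (fst x)))"
  by (rule bounded_linear_compose[OF blinfun.bounded_linear_right
        bounded_linear_compose[OF bounded_linear_snd bounded_linear_fst]])

lemma bounded_linear_\<beta>: "bounded_linear (\<lambda>x :: ('z \<times> 'y) \<times> ('p \<times> real). \<beta> k (fst (fst x)))"
  by (rule bounded_linear_compose[OF blinfun.bounded_linear_right
        bounded_linear_compose[OF bounded_linear_fst bounded_linear_fst]])

lemma C1_on_minus: "C1_on S f \<Longrightarrow> C1_on S g \<Longrightarrow> C1_on S (\<lambda>x. f x - g x)"
  unfolding diff_conv_add_uminus
  by (intro C1_on_add C1_on_linear_comp[OF bounded_linear_minus[OF bounded_linear_ident]])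

lemma C1_stat: "C1_on UNIV (stat d)"
  unfolding stat_def[abs_def]
  by (intro C1_on_add C1_on_sum C1_on_mult C1_on_linear[OF bounded_linear_\<eta>] C1_on_apply
      C1_on_compose[OF C2_on_fderiv[OF \<phi>] C1_pt] C1_on_compose[OF C2_on_fderiv[OF G] C1_pt]) auto

lemma C1_compl: "i \<in> L \<Longrightarrow> C1_on UNIV (compl i)"
  unfolding compl_def[abs_def]
  by (cases "i \<in> I"; simp only: if_True if_False;
      intro C1_on_add C1_on_minus C1_on_mult C1_on_linear[OF bounded_linear_\<eta>]
      C1_on_compose[OF C2_on_C1[OF G] C1_pt] C1_on_linear[OF bounded_linear_compose[OF bounded_linear_snd bounded_linear_snd]])
     auto

lemma C1_opt_sys: "C1_on UNIV opt_sys"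
  unfolding opt_sys_def[abs_def]
  by (intro C1_on_add C1_on_Pair C1_on_sum C1_on_scaleR C1_on_minus C1_on_const C1_stat C1_compl
      C1_on_linear[OF bounded_linear_fst] C1_on_linear[OF bounded_linear_\<eta>] C1_on_linear[OF bounded_linear_\<beta>])

lemma fderiv_opt_sys:
  "fderiv opt_sys x h = fst h + ((\<Sum>k\<in>K. (fderiv (stat (b k)) x h - \<beta> k (fst (fst h))) *\<^sub>R b k),
     (\<Sum>i\<in>L. (fderiv (compl i) x h - \<eta> i (snd (fst h))) *\<^sub>R c i))"
proof -
  have 1: "((\<lambda>x. (stat (b k) x - \<beta> k (fst (fst x))) *\<^sub>R b k) has_derivative
      (\<lambda>h. (fderiv (stat (b k)) x h - \<beta> k (fst (fst h))) *\<^sub>R b k)) (at x)" for k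
    by (intro has_derivative_scaleR_left has_derivative_diff C1_on_has_derivative[OF C1_stat]
        bounded_linear_imp_has_derivative[OF bounded_linear_\<beta>] UNIV_I)
  have 2: "((\<lambda>x. (compl i x - \<eta> i (snd (fst x))) *\<^sub>R c i) has_derivative
      (\<lambda>h. (fderiv (compl i) x h - \<eta> i (snd (fst h))) *\<^sub>R c i)) (at x)" if "i \<in> L" for i
    by (intro has_derivative_scaleR_left has_derivative_diff C1_on_has_derivative[OF C1_compl] that
        bounded_linear_imp_has_derivative[OF bounded_linear_\<eta>] UNIV_I)
  have "(opt_sys has_derivative (\<lambda>h. fst h + ((\<Sum>k\<in>K. (fderiv (stat (b k)) x h - \<beta> k (fst (fst h))) *\<^sub>R b k),
     (\<Sum>i\<in>L. (fderiv (compl i) x h - \<eta> i (snd (fst h))) *\<^sub>R c i)))) (at x)"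
    unfolding opt_sys_def[abs_def]
    by (intro has_derivative_add has_derivative_Pair has_derivative_sum 1 2
        bounded_linear_imp_has_derivative[OF bounded_linear_fst])
  from fderiv_eq[OF this] show ?thesis by simp
qed

lemma pt_has_derivative: "(pt has_derivative pt) (at x)"
  unfolding pt_def[abs_def]
  by (intro bounded_linear_imp_has_derivative bounded_linear_Pair bounded_linear_compose[OF bounded_linear_fst bounded_linear_fst]
      bounded_linear_compose[OF bounded_linear_fst bounded_linear_snd])

lemma fderiv_stat:
  "fderiv (stat d) x h = fderiv (fderiv \<phi>) (pt x) (pt h) (d, 0)
    + (\<Sum>i\<in>L. \<eta> i (snd (fst x)) * fderiv (fderiv (G i)) (pt x) (pt h) (d, 0)
        + \<eta> i (snd (fst h)) * fderiv (G i) (pt x) (d, 0))"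
proof -
  have "(stat d has_derivative (\<lambda>h. fderiv (fderiv \<phi>) (pt x) (pt h) (d, 0)
    + (\<Sum>i\<in>L. \<eta> i (snd (fst x)) * fderiv (fderiv (G i)) (pt x) (pt h) (d, 0)
        + \<eta> i (snd (fst h)) * fderiv (G i) (pt x) (d, 0)))) (at x)"
    unfolding stat_def[abs_def]
    by (intro has_derivative_add has_derivative_sum has_derivative_mult
        has_derivative_compose[OF pt_has_derivative, of "\<lambda>q. fderiv \<phi> q (d, 0)"] dd\<phi>
        has_derivative_compose[OF pt_has_derivative, of "\<lambda>q. fderiv (G i) q (d, 0)" for i] ddG
        bounded_linear_imp_has_derivative[OF bounded_linear_\<eta>])
  from fderiv_eq[OF this] show ?thesis by simp
qed

lemma fderiv_compl:
  assumes i: "i \<in> L"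
  shows "fderiv (compl i) x h = (if i \<in> I then \<eta> i (snd (fst x)) * fderiv (G i) (pt x) (pt h) + \<eta> i (snd (fst h)) * G i (pt x) + snd (snd h)
     else fderiv (G i) (pt x) (pt h) - (snd (snd x) * \<eta> i (snd (fst h)) + snd (snd h) * \<eta> i (snd (fst x))))"
proof -
  have 1: "((\<lambda>x. G i (pt x)) has_derivative (\<lambda>h. fderiv (G i) (pt x) (pt h))) (at x)"
    by (rule has_derivative_compose[OF pt_has_derivative dG[OF i]])
  have 2: "((\<lambda>x :: ('z \<times> 'y) \<times> ('p \<times> real). snd (snd x)) has_derivative (\<lambda>h. snd (snd h))) (at x)"
    by (rule bounded_linear_imp_has_derivative[OF bounded_linear_compose[OF bounded_linear_snd bounded_linear_snd]])
  note 3 = bounded_linear_imp_has_derivative[OF bounded_linear_\<eta>]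
  show ?thesis
  proof (cases "i \<in> I")
    case True
    then have "compl i = (\<lambda>x. \<eta> i (snd (fst x)) * G i (pt x) + snd (snd x))" by (simp add: compl_def[abs_def])
    then show ?thesis
      using fderiv_eq[OF has_derivative_add[OF has_derivative_mult[OF 3 1] 2]] True by simp
  next
    case False
    then have "compl i = (\<lambda>x. G i (pt x) - snd (snd x) * \<eta> i (snd (fst x)))" by (simp add: compl_def[abs_def])
    then show ?thesis
      using fderiv_eq[OF has_derivative_diff[OF 1 has_derivative_mult[OF 2 3]]] False by simp
  qed
qed

end

text \<open>Under strict complementarity the critical cone is the linear space on which all active
  derivatives vanish, and \<open>sosc\<close> is stated there.\<close>

locale nlp = nlp_data K b \<beta> L c \<eta> I J \<phi> G
  for K :: "'k set" and b :: "'k \<Rightarrow> 'z::banach" and \<beta> L and c :: "'i \<Rightarrow> 'y::banach" and \<eta> I J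
    and \<phi> :: "'z \<times> 'p::banach \<Rightarrow> real" and G +
  fixes zb :: 'z and \<theta>b :: 'p and \<mu> :: "'i \<Rightarrow> real"
  assumes zb: "zb \<in> Z.S"
    and feasI: "\<And>i. i \<in> I \<Longrightarrow> G i (zb, \<theta>b) \<le> 0" and feasJ: "\<And>i. i \<in> J \<Longrightarrow> G i (zb, \<theta>b) = 0"
    and \<mu>_inactive: "\<And>i. i \<in> I \<Longrightarrow> G i (zb, \<theta>b) < 0 \<Longrightarrow> \<mu> i = 0"
    and \<mu>_active: "\<And>i. i \<in> I \<Longrightarrow> G i (zb, \<theta>b) = 0 \<Longrightarrow> \<mu> i > 0"
    and stationary: "\<And>d. d \<in> Z.S \<Longrightarrow> fderiv \<phi> (zb, \<theta>b) (d, 0) + (\<Sum>i\<in>L. \<mu> i * fderiv (G i) (zb, \<theta>b) (d, 0)) = 0"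
    and sosc: "\<And>d. d \<in> Z.S \<Longrightarrow> d \<noteq> 0 \<Longrightarrow>
      (\<And>i. i \<in> L \<Longrightarrow> G i (zb, \<theta>b) = 0 \<Longrightarrow> fderiv (G i) (zb, \<theta>b) (d, 0) = 0) \<Longrightarrow>
      fderiv (fderiv \<phi>) (zb, \<theta>b) (d, 0) (d, 0) + (\<Sum>i\<in>L. \<mu> i * fderiv (fderiv (G i)) (zb, \<theta>b) (d, 0) (d, 0)) > 0"
    and licq: "\<And>a j. (\<And>d. d \<in> Z.S \<Longrightarrow>
        (\<Sum>i\<in>{i\<in>L. G i (zb, \<theta>b) = 0}. a i * fderiv (G i) (zb, \<theta>b) (d, 0)) = 0) \<Longrightarrow>
      j \<in> L \<Longrightarrow> G j (zb, \<theta>b) = 0 \<Longrightarrow> a j = 0"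
begin

section \<open>Regularity of the optimality system at the reference point\<close>

definition Act :: "'i set" where "Act = {i\<in>L. G i (zb, \<theta>b) = 0}"

definition y0 :: 'y where "y0 = (\<Sum>i\<in>L. \<mu> i *\<^sub>R c i)"

definition x0 :: "('z \<times> 'y) \<times> ('p \<times> real)" where "x0 = ((zb, y0), (\<theta>b, 0))"

lemma L_iff: "i \<in> L \<longleftrightarrow> i \<in> I \<or> i \<in> J" by (simp add: L)

lemma Act_L: "Act \<subseteq> L" by (auto simp: Act_def)
lemma finAct: "finite Act" using Act_L finL finite_subset by blast
lemma not_Act: "i \<in> L \<Longrightarrow> i \<notin> Act \<Longrightarrow> i \<in> I \<and> G i (zb, \<theta>b) < 0 \<and> \<mu> i = 0"
  using feasI[of i] feasJ[of i] \<mu>_inactive[of i] by (auto simp: Act_def L_iff)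

lemma \<eta>_y0: "i \<in> L \<Longrightarrow> \<eta> i y0 = \<mu> i"
  unfolding y0_def by (rule Y.coord_sum)

lemma x0_simps [simp]: "fst (fst x0) = zb" "snd (fst x0) = y0" "fst (snd x0) = \<theta>b" "snd (snd x0) = 0" "pt x0 = (zb, \<theta>b)"
  by (simp_all add: x0_def pt_def)

lemma opt_sys_x0: "opt_sys x0 = 0"
  unfolding opt_sys_zero_iff
proof (intro conjI ballI)
  show "snd (fst x0) \<in> Y.S" by (simp add: y0_def Y.sum_in_S)
  show "stat d x0 = 0" if "d \<in> Z.S" for d
    using stationary[OF that] by (simp add: stat_def \<eta>_y0)
  show "compl i x0 = 0" if "i \<in> L" for i
    using feasI[of i] feasJ[of i] \<mu>_inactive[of i] that by (auto simp: compl_def \<eta>_y0 L_iff less_le)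
qed (simp add: zb)

lemma sum_Act: "(\<And>i. i \<in> L \<Longrightarrow> i \<notin> Act \<Longrightarrow> f i = 0) \<Longrightarrow> sum f L = sum f Act" for f :: "'i \<Rightarrow> real"
  using sum.mono_neutral_right[OF finL Act_L, of f] by blast

text \<open>At \<gamma> = 0 the linearized complementarity equations make \<open>dz\<close> tangent
  to every active constraint and cancel the inactive coordinates of \<open>dy\<close>. Testing
  linearized stationarity with \<open>dz\<close> itself removes the multiplier terms and leaves the
  form of \<open>sosc\<close>, so \<open>dz = 0\<close>. What remains is a vanishing combination of
  active derivatives, and \<open>licq\<close> gives \<open>dy = 0\<close>.\<close>

lemma opt_sys_injective:
  assumes h: "fderiv opt_sys x0 ((dz, dy), 0) = 0"
  shows "dz = 0 \<and> dy = 0"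
proof -
  let ?h = "((dz, dy), (0::'p, 0::real))"
  have pt: "pt ?h = (dz, 0)" by (simp add: pt_def)
  from h have "dz + (\<Sum>k\<in>K. (fderiv (stat (b k)) x0 ?h - \<beta> k dz) *\<^sub>R b k) = 0"
    and "dy + (\<Sum>i\<in>L. (fderiv (compl i) x0 ?h - \<eta> i dy) *\<^sub>R c i) = 0"
    unfolding fderiv_opt_sys by (simp_all add: prod_eq_iff zero_prod_def)
  then have dz: "dz \<in> Z.S" and st: "\<And>k. k \<in> K \<Longrightarrow> fderiv (stat (b k)) x0 ?h = 0"
    and dy: "dy \<in> Y.S" and cp: "\<And>i. i \<in> L \<Longrightarrow> fderiv (compl i) x0 ?h = 0"
    unfolding Z.zero_form_iff Y.zero_form_iff by blast+
  let ?f = "\<lambda>d. fderiv (fderiv \<phi>) (zb, \<theta>b) (dz, 0) (d, 0)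
    + (\<Sum>i\<in>L. \<mu> i * fderiv (fderiv (G i)) (zb, \<theta>b) (dz, 0) (d, 0) + \<eta> i dy * fderiv (G i) (zb, \<theta>b) (d, 0))"
  have linf: "linear ?f"
  proof -
    have "linear (\<lambda>d. (fderiv (fderiv \<phi>) (zb, \<theta>b) (dz, 0) + (\<Sum>i\<in>L. \<mu> i *\<^sub>R fderiv (fderiv (G i)) (zb, \<theta>b) (dz, 0)
        + \<eta> i dy *\<^sub>R fderiv (G i) (zb, \<theta>b))) (d, 0))" by (rule linear_in_state)
    then show ?thesis by (simp add: blinfun.add_left blinfun.sum_left blinfun.scaleR_left)
  qed
  have f: "?f d = 0" if "d \<in> Z.S" for d
  proof (rule linear_zero_on_S[OF linf _ that], rule ballI)
    fix k assume "k \<in> K"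
    then show "?f (b k) = 0" using st[of k] by (simp add: fderiv_stat pt \<eta>_y0)
  qed
  have active: "fderiv (G i) (zb, \<theta>b) (dz, 0) = 0" if i: "i \<in> L" "G i (zb, \<theta>b) = 0" for i
    using cp[OF i(1)] \<mu>_active[of i] i by (auto simp: fderiv_compl pt \<eta>_y0 split: if_splits)
  have inactive: "\<eta> i dy = 0" if i: "i \<in> L" "i \<notin> Act" for i
    using cp[OF i(1)] not_Act[OF i] i by (auto simp: fderiv_compl pt \<eta>_y0)
  have "dz = 0"
  proof (rule ccontr)
    assume "dz \<noteq> 0"
    from sosc[OF dz this active] have "fderiv (fderiv \<phi>) (zb, \<theta>b) (dz, 0) (dz, 0)
      + (\<Sum>i\<in>L. \<mu> i * fderiv (fderiv (G i)) (zb, \<theta>b) (dz, 0) (dz, 0)) > 0" by blast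
    moreover have "(\<Sum>i\<in>L. \<eta> i dy * fderiv (G i) (zb, \<theta>b) (dz, 0)) = 0"
    proof (rule sum.neutral, rule ballI)
      fix i assume "i \<in> L"
      then show "\<eta> i dy * fderiv (G i) (zb, \<theta>b) (dz, 0) = 0"
        using active[of i] inactive[of i] by (cases "i \<in> Act") (auto simp: Act_def)
    qed
    ultimately show False using f[OF dz] by (simp add: sum.distrib)
  qed
  have "\<eta> j dy = 0" if j: "j \<in> L" for j
  proof (cases "j \<in> Act")
    case True
    have "(\<Sum>i\<in>Act. \<eta> i dy * fderiv (G i) (zb, \<theta>b) (d, 0)) = 0" if "d \<in> Z.S" for d
    proof -
      have "(\<Sum>i\<in>L. \<eta> i dy * fderiv (G i) (zb, \<theta>b) (d, 0)) = 0"
        using f[OF that] \<open>dz = 0\<close> by (simp add: zero_prod_def[symmetric])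
      then show ?thesis using sum_Act[of "\<lambda>i. \<eta> i dy * fderiv (G i) (zb, \<theta>b) (d, 0)"] inactive by simp
    qed
    then show ?thesis using licq[of "\<lambda>i. \<eta> i dy" j] j True by (simp add: Act_def)
  qed (use inactive j in blast)
  then have "dy = 0" using Y.S_repr[OF dy] by simp
  with \<open>dz = 0\<close> show ?thesis ..
qed

lemma opt_sys_invertible:
  obtains A B where "\<And>h. blinfun_apply A h = fderiv opt_sys (fst x0, snd x0) (h, 0)"
    "A o\<^sub>L B = id_blinfun" "B o\<^sub>L A = id_blinfun"
proof -
  let ?in = "Blinfun (\<lambda>h :: 'z \<times> 'y. (h, 0 :: 'p \<times> real))"
  have in_apply: "blinfun_apply ?in = (\<lambda>h. (h, 0))" by (rule bounded_linear_Blinfun_apply[OF bounded_linear_inl])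
  define A where "A = fderiv opt_sys x0 o\<^sub>L ?in"
  have A: "A h = fderiv opt_sys x0 (h, 0)" for h by (simp add: A_def in_apply)
  \<comment> \<open>The finite rank part has one term for each input coordinate (\<open>Inl\<close>)
    and one for each multiplier coordinate (\<open>Inr\<close>).\<close>
  let ?bb = "\<lambda>j. case j of Inl k \<Rightarrow> (b k, 0) | Inr i \<Rightarrow> (0, c i)"
  let ?\<kappa> = "\<lambda>j. case j of Inl k \<Rightarrow> (fderiv (stat (b k)) x0 - Blinfun (\<lambda>x. \<beta> k (fst (fst x)))) o\<^sub>L ?in
     | Inr i \<Rightarrow> (fderiv (compl i) x0 - Blinfun (\<lambda>x. \<eta> i (snd (fst x)))) o\<^sub>L ?in"
  have Ah: "A h = h + (\<Sum>j\<in>K <+> L. ?\<kappa> j h *\<^sub>R ?bb j)" for h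
  proof -
    have "(\<Sum>j\<in>K <+> L. ?\<kappa> j h *\<^sub>R ?bb j) = (\<Sum>k\<in>K. ?\<kappa> (Inl k) h *\<^sub>R ?bb (Inl k)) + (\<Sum>i\<in>L. ?\<kappa> (Inr i) h *\<^sub>R ?bb (Inr i))"
      unfolding sum.Plus[OF Z.finK finL] by (simp add: o_def)
    also have "\<dots> = ((\<Sum>k\<in>K. (fderiv (stat (b k)) x0 (h, 0) - \<beta> k (fst h)) *\<^sub>R b k),
       (\<Sum>i\<in>L. (fderiv (compl i) x0 (h, 0) - \<eta> i (snd h)) *\<^sub>R c i))"
      by (simp add: prod_eq_iff fst_sum snd_sum in_apply blinfun.diff_left
          bounded_linear_Blinfun_apply[OF bounded_linear_\<eta>] bounded_linear_Blinfun_apply[OF bounded_linear_\<beta>])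
    finally show ?thesis by (simp add: A fderiv_opt_sys)
  qed
  have "h = 0" if "A h = 0" for h
    using opt_sys_injective[of "fst h" "snd h"] that by (simp add: A prod_eq_iff)
  then obtain B where "A o\<^sub>L B = id_blinfun" "B o\<^sub>L A = id_blinfun"
    by (rule finite_rank_perturbation_invertible[OF finite_Plus[OF Z.finK finL] Ah])
  then show ?thesis using that[of A B] A by simp
qed

text \<open>The weights are those of the barrier Hessian. At \<open>x0\<close> they are positive on
  \<open>Act\<close> by strict complementarity, so the penalty vanishes only on tangent directions,
  where the Lagrangian Hessian is positive. \<open>finsler\<close> supplies \<open>M\<close> at
  \<open>x0\<close>, and compactness of the sphere extends the inequality to nearby points with the
  same \<open>M\<close>.\<close>

lemma penalized_hessian_positive:
  obtains M where "M > 0"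
    "\<forall>\<^sub>F x in nhds x0. \<forall>d\<in>Z.S. norm d = 1 \<longrightarrow>
      fderiv (fderiv \<phi>) (pt x) (d, 0) (d, 0)
      + (\<Sum>i\<in>L. \<eta> i (snd (fst x)) * fderiv (fderiv (G i)) (pt x) (d, 0) (d, 0))
      + M * (\<Sum>i\<in>Act. (if i \<in> I then (\<eta> i (snd (fst x)))\<^sup>2 else 1) * (fderiv (G i) (pt x) (d, 0))\<^sup>2) > 0"
proof -
  let ?q = "\<lambda>x d. fderiv (fderiv \<phi>) (pt x) (d, 0) (d, 0)
      + (\<Sum>i\<in>L. \<eta> i (snd (fst x)) * fderiv (fderiv (G i)) (pt x) (d, 0) (d, 0))"
  let ?n = "\<lambda>x d. \<Sum>i\<in>Act. (if i \<in> I then (\<eta> i (snd (fst x)))\<^sup>2 else 1) * (fderiv (G i) (pt x) (d, 0))\<^sup>2"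
  have cpt: "continuous_on (UNIV \<times> UNIV) (\<lambda>p. pt (fst p))" (is "continuous_on ?U _")
    by (rule continuous_on_compose2[OF C1_on_continuous[OF C1_pt] continuous_on_fst[OF continuous_on_id]]) auto
  have cin: "continuous_on ?U (\<lambda>p :: (('z \<times> 'y) \<times> ('p \<times> real)) \<times> 'z. (snd p, 0::'p))"
    by (intro continuous_on_Pair continuous_on_snd continuous_on_id continuous_on_const)
  have ceta: "continuous_on ?U (\<lambda>p. \<eta> i (snd (fst (fst p))))" for i
    by (rule continuous_on_compose2[OF linear_continuous_on[OF bounded_linear_\<eta>] continuous_on_fst[OF continuous_on_id]]) auto
  have cq: "continuous_on ?U (\<lambda>p. ?q (fst p) (snd p))"
    by (intro continuous_on_add continuous_on_sum continuous_on_mult ceta continuous_on_apply_blinfun cin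
       continuous_on_compose2[OF C1_on_continuous_fderiv[OF C2_on_fderiv[OF \<phi>]] cpt]
       continuous_on_compose2[OF C1_on_continuous_fderiv[OF C2_on_fderiv[OF G]] cpt]) auto
  have cn: "continuous_on ?U (\<lambda>p. ?n (fst p) (snd p))"
  proof (rule continuous_on_sum)
    fix i assume "i \<in> Act"
    then have i: "i \<in> L" using Act_L by blast
    have "continuous_on ?U (\<lambda>p. if i \<in> I then (\<eta> i (snd (fst (fst p))))\<^sup>2 else 1)"
      by (cases "i \<in> I"; simp only: if_True if_False; intro continuous_on_power ceta continuous_on_const)
    moreover have "continuous_on ?U (\<lambda>p. fderiv (G i) (pt (fst p)) (snd p, 0))"
      by (intro continuous_on_apply_blinfun cin continuous_on_compose2[OF cont_dG[OF i] cpt]) auto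
    ultimately show "continuous_on ?U (\<lambda>p. (if i \<in> I then (\<eta> i (snd (fst (fst p))))\<^sup>2 else 1) * (fderiv (G i) (pt (fst p)) (snd p, 0))\<^sup>2)"
      by (intro continuous_on_mult continuous_on_power)
  qed
  have at_x0: "continuous_on UNIV (\<lambda>d. f x0 d)" if "continuous_on ?U (\<lambda>p. f (fst p) (snd p))" for f :: "_ \<Rightarrow> 'z \<Rightarrow> real"
    using continuous_on_compose2[OF that continuous_on_Pair[OF continuous_on_const continuous_on_id], of x0 UNIV] by simp
  have nonneg: "?n x0 d \<ge> 0" for d by (intro sum_nonneg mult_nonneg_nonneg) auto
  have pos: "?q x0 d > 0" if d: "d \<in> Z.S" "norm d = 1" and n: "?n x0 d = 0" for d
  proof -
    have z: "(if i \<in> I then (\<eta> i (snd (fst x0)))\<^sup>2 else 1) * (fderiv (G i) (pt x0) (d, 0))\<^sup>2 = 0" if "i \<in> Act" for i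
      using n that by (subst (asm) sum_nonneg_eq_0_iff[OF finAct]) auto
    have "fderiv (G i) (zb, \<theta>b) (d, 0) = 0" if "i \<in> L" "G i (zb, \<theta>b) = 0" for i
      using z[of i] that \<mu>_active[of i] by (auto simp: Act_def \<eta>_y0 split: if_splits)
    moreover have "d \<noteq> 0" using d(2) by auto
    ultimately have "fderiv (fderiv \<phi>) (zb, \<theta>b) (d, 0) (d, 0) + (\<Sum>i\<in>L. \<mu> i * fderiv (fderiv (G i)) (zb, \<theta>b) (d, 0) (d, 0)) > 0"
      using sosc[OF d(1)] by blast
    then show ?thesis by (simp add: \<eta>_y0)
  qed
  obtain M where M: "M > 0" "\<And>d. d \<in> Z.S \<Longrightarrow> norm d = 1 \<Longrightarrow> ?q x0 d + M * ?n x0 d > 0"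
    by (rule Z.finsler[OF at_x0[OF cq] at_x0[OF cn] nonneg pos]) (assumption | rule that)+
  have "continuous_on ?U (\<lambda>(x, d). ?q x d + M * ?n x d)"
    unfolding case_prod_unfold by (intro continuous_on_add continuous_on_mult continuous_on_const cq cn)
  from Z.pos_def_near[OF this open_UNIV UNIV_I, of x0] M(2)
  have "\<forall>\<^sub>F x in nhds x0. \<forall>d\<in>Z.S. norm d = 1 \<longrightarrow> ?q x d + M * ?n x d > 0" by blast
  then show ?thesis by (rule that[OF M(1)])
qed

section \<open>The branch of solutions and the minimizers lying on it\<close>

lemma prod_in_ball: "(x, y) \<in> ball (x1, y1) r" if "dist x x1 < r / 2" "dist y y1 < r / 2"
proof -
  have "dist (x1, y1) (x, y) \<le> dist x1 x + dist y1 y"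
    unfolding dist_Pair_Pair by (rule order_trans[OF sqrt_add_le_add_sqrt]) auto
  then show ?thesis using that by (simp add: dist_commute)
qed

text \<open>Near the reference only constraints in \<open>Act\<close> can be active and their
  derivatives stay independent, so the minimizer has Lagrange multipliers. Tested on the fixed
  directions \<open>e j\<close>, stationarity is a linear system with matrix near the identity,
  which forces these multipliers close to \<mu>. The point thus enters the ball where the implicit
  function theorem asserts uniqueness.\<close>

lemma local_minimizer_solves_opt_sys:
  assumes \<zeta>: "isCont \<zeta> \<theta>b" "\<zeta> \<theta>b = zb" and min: "\<forall>\<^sub>F \<theta> in nhds \<theta>b. local_minimizer \<theta> (\<zeta> \<theta>)"
    and r: "r > 0"
  shows "\<forall>\<^sub>F \<theta> in nhds \<theta>b. \<exists>y. (\<zeta> \<theta>, y) \<in> ball (zb, y0) r \<and> opt_sys ((\<zeta> \<theta>, y), (\<theta>, 0)) = 0"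
proof -
  have "\<exists>e. \<forall>j\<in>Act. e j \<in> Z.S \<and> (\<forall>i\<in>Act. fderiv (G i) (zb, \<theta>b) (e j, 0) = (if i = j then 1 else 0))"
    by (rule dual_basis_exists[OF finAct linear_in_state Z.subspace_S])
       (use licq in \<open>auto simp: Act_def\<close>)
  then obtain e where e: "\<And>j. j \<in> Act \<Longrightarrow> e j \<in> Z.S"
    "\<And>i j. i \<in> Act \<Longrightarrow> j \<in> Act \<Longrightarrow> fderiv (G i) (zb, \<theta>b) (e j, 0) = (if i = j then 1 else 0)" by blast
  \<comment> \<open>The active derivatives at the moving point, tested on directions dual to those
    at the reference; the limit is the identity matrix.\<close>
  define M where "M \<theta> i j = fderiv (G i) (\<zeta> \<theta>, \<theta>) (e j, 0)" for \<theta> i j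
  \<comment> \<open>The amount by which the reference multipliers violate stationarity at the moving
    point; it tends to 0.\<close>
  define \<rho> where "\<rho> \<theta> j = - fderiv \<phi> (\<zeta> \<theta>, \<theta>) (e j, 0) - (\<Sum>i\<in>Act. \<mu> i * M \<theta> i j)" for \<theta> j
  define C where "C = (\<Sum>i\<in>L. norm (c i))"
  have q: "((\<lambda>\<theta>. (\<zeta> \<theta>, \<theta>)) \<longlongrightarrow> (zb, \<theta>b)) (nhds \<theta>b)"
    using \<zeta> by (intro tendsto_Pair) (auto simp: isCont_def tendsto_nhds_iff filterlim_ident)
  have tG: "((\<lambda>\<theta>. G i (\<zeta> \<theta>, \<theta>)) \<longlongrightarrow> G i (zb, \<theta>b)) (nhds \<theta>b)" if "i \<in> L" for i
    using continuous_on_tendsto_compose[OF cont_G[OF that] q] by simp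
  have tM: "((\<lambda>\<theta>. M \<theta> i j) \<longlongrightarrow> (if i = j then 1 else 0)) (nhds \<theta>b)" if "i \<in> Act" "j \<in> Act" for i j
  proof -
    have "((\<lambda>\<theta>. fderiv (G i) (\<zeta> \<theta>, \<theta>)) \<longlongrightarrow> fderiv (G i) (zb, \<theta>b)) (nhds \<theta>b)"
      using continuous_on_tendsto_compose[OF cont_dG q] that Act_L by auto
    from bounded_bilinear.tendsto[OF bounded_bilinear_blinfun_apply this tendsto_const] show ?thesis unfolding M_def e(2)[OF that, symmetric] .
  qed
  have t\<phi>: "((\<lambda>\<theta>. fderiv \<phi> (\<zeta> \<theta>, \<theta>) (e j, 0)) \<longlongrightarrow> fderiv \<phi> (zb, \<theta>b) (e j, 0)) (nhds \<theta>b)" for j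
    using bounded_bilinear.tendsto[OF bounded_bilinear_blinfun_apply continuous_on_tendsto_compose[OF cont_d\<phi> q] tendsto_const] by simp
  have t\<rho>: "((\<lambda>\<theta>. \<rho> \<theta> j) \<longlongrightarrow> 0) (nhds \<theta>b)" if j: "j \<in> Act" for j
  proof -
    have lim: "((\<lambda>\<theta>. \<rho> \<theta> j) \<longlongrightarrow> - fderiv \<phi> (zb, \<theta>b) (e j, 0) - (\<Sum>i\<in>Act. \<mu> i * (if i = j then 1 else 0))) (nhds \<theta>b)"
      unfolding \<rho>_def by (intro tendsto_diff tendsto_minus t\<phi> tendsto_sum tendsto_mult tendsto_const tM j)
    have "(\<Sum>i\<in>L. \<mu> i * fderiv (G i) (zb, \<theta>b) (e j, 0)) = (\<Sum>i\<in>Act. \<mu> i * fderiv (G i) (zb, \<theta>b) (e j, 0))"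
      by (rule sum_Act) (simp add: not_Act)
    moreover have "(\<Sum>i\<in>Act. \<mu> i * fderiv (G i) (zb, \<theta>b) (e j, 0)) = (\<Sum>i\<in>Act. \<mu> i * (if i = j then 1 else 0))"
      using e(2) j by (intro sum.cong) auto
    ultimately have "- fderiv \<phi> (zb, \<theta>b) (e j, 0) - (\<Sum>i\<in>Act. \<mu> i * (if i = j then 1 else 0)) = 0"
      using stationary[OF e(1)[OF j]] by linarith
    with lim show ?thesis by (simp only:)
  qed
  have tR: "((\<lambda>\<theta>. 2 * (\<Sum>j\<in>Act. \<bar>\<rho> \<theta> j\<bar>) * C) \<longlongrightarrow> 2 * (\<Sum>j\<in>Act. \<bar>0\<bar>) * C) (nhds \<theta>b)"
    by (intro tendsto_mult tendsto_const tendsto_sum tendsto_rabs t\<rho>)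
  have "((\<lambda>\<theta>. \<Sum>j\<in>Act. \<Sum>i\<in>Act. \<bar>M \<theta> i j - (if i = j then 1 else 0)\<bar>)
      \<longlongrightarrow> (\<Sum>j\<in>Act. \<Sum>i\<in>Act. \<bar>(if i = j then 1 else 0) - (if i = j then 1 else 0)\<bar>)) (nhds \<theta>b)"
    by (intro tendsto_sum tendsto_rabs tendsto_diff tM tendsto_const)
  then have tD: "((\<lambda>\<theta>. \<Sum>j\<in>Act. \<Sum>i\<in>Act. \<bar>M \<theta> i j - (if i = j then 1 else 0)\<bar>) \<longlongrightarrow> 0) (nhds \<theta>b)" by simp
  have E1: "\<forall>\<^sub>F \<theta> in nhds \<theta>b. 2 * (\<Sum>j\<in>Act. \<bar>\<rho> \<theta> j\<bar>) * C < r / 2"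
    using order_tendstoD(2)[OF tR, of "r / 2"] r by simp
  have E2: "\<forall>\<^sub>F \<theta> in nhds \<theta>b. (\<Sum>j\<in>Act. \<Sum>i\<in>Act. \<bar>M \<theta> i j - (if i = j then 1 else 0)\<bar>) < 1/2"
    using order_tendstoD(2)[OF tD, of "1/2"] by simp
  have E3: "\<forall>\<^sub>F \<theta> in nhds \<theta>b. \<forall>i\<in>L - Act. G i (\<zeta> \<theta>, \<theta>) < 0"
    using order_tendstoD(2)[OF tG] not_Act finL by (intro eventually_ball_finite) auto
  have E4: "\<forall>\<^sub>F \<theta> in nhds \<theta>b. dist (\<zeta> \<theta>) zb < r / 2"
    using \<zeta> r tendstoD[of \<zeta> zb "nhds \<theta>b" "r / 2"] by (simp add: isCont_def tendsto_nhds_iff)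
  show ?thesis
    using E1 E2 E3 E4 min
  proof eventually_elim
    case (elim \<theta>)
    let ?q = "(\<zeta> \<theta>, \<theta>)"
    have \<zeta>S: "\<zeta> \<theta> \<in> Z.S" and feas: "\<And>i. i \<in> I \<Longrightarrow> G i ?q \<le> 0" "\<And>j. j \<in> J \<Longrightarrow> G j ?q = 0"
      using elim(5) by (auto simp: local_minimizer_def)
    obtain \<tau> where \<tau>: "\<tau> > 0" "\<And>z'. z' \<in> Z.S \<inter> ball (\<zeta> \<theta>) \<tau> \<Longrightarrow>
        (\<forall>i\<in>I. G i (z', \<theta>) \<le> 0) \<and> (\<forall>j\<in>J. G j (z', \<theta>) = 0) \<Longrightarrow> \<phi> ?q \<le> \<phi> (z', \<theta>)"
      using elim(5) unfolding local_minimizer_def by blast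
    define A where "A = {i\<in>L. G i ?q = 0}"
    have A: "A \<subseteq> L" "J \<subseteq> A" using feas by (auto simp: A_def L_iff)
    have A': "A \<subseteq> Act"
    proof
      fix i assume "i \<in> A"
      then have "i \<in> L" "\<not> G i ?q < 0" by (simp_all add: A_def)
      then show "i \<in> Act" using elim(3) by blast
    qed
    have Mle: "(\<Sum>j\<in>Act. \<Sum>i\<in>Act. \<bar>M \<theta> i j - (if i = j then 1 else 0)\<bar>) \<le> 1/2" using elim(2) by simp
    have "\<exists>m. \<forall>d\<in>Z.S. fderiv \<phi> ?q (d, 0) + (\<Sum>i\<in>A. m i * fderiv (G i) ?q (d, 0)) = 0"
    proof -
      \<comment> \<open>Close to the minimizer the inactive inequalities stay negative, so points
        satisfying the active constraints with equality are feasible.\<close>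
      have nb: "\<forall>\<^sub>F z' in nhds (\<zeta> \<theta>). \<forall>i\<in>I - A. G i (z', \<theta>) < 0"
      proof (rule eventually_ball_finite)
        show "\<forall>i\<in>I - A. \<forall>\<^sub>F z' in nhds (\<zeta> \<theta>). G i (z', \<theta>) < 0"
        proof
          fix i assume i: "i \<in> I - A"
          have "((\<lambda>z'. G i (z', \<theta>)) \<longlongrightarrow> G i ?q) (nhds (\<zeta> \<theta>))"
            using continuous_on_tendsto_compose[OF cont_G[OF IL] tendsto_Pair[OF filterlim_ident tendsto_const]] i by auto
          moreover have "G i ?q < 0" using feas(1)[of i] i by (auto simp: A_def L_iff less_le)
          ultimately show "\<forall>\<^sub>F z' in nhds (\<zeta> \<theta>). G i (z', \<theta>) < 0" by (rule order_tendstoD)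
        qed
      qed (use finI in auto)
      then obtain \<tau>' where \<tau>': "\<tau>' > 0" "\<And>z'. dist z' (\<zeta> \<theta>) < \<tau>' \<Longrightarrow> \<forall>i\<in>I - A. G i (z', \<theta>) < 0"
        unfolding eventually_nhds_metric by blast
      show ?thesis
      proof (rule lagrange_multipliers[OF A(1) \<zeta>S])
        show "min \<tau> \<tau>' > 0" using \<tau>(1) \<tau>'(1) by simp
        show "\<phi> ?q \<le> \<phi> (z', \<theta>)" if z': "z' \<in> Z.S" "z' \<in> ball (\<zeta> \<theta>) (min \<tau> \<tau>')" "\<And>i. i \<in> A \<Longrightarrow> G i (z', \<theta>) = 0" for z'
        proof (rule \<tau>(2))
          have "G i (z', \<theta>) \<le> 0" if "i \<in> I" for i
            using z'(3)[of i] \<tau>'(2)[of z'] z'(2) that by (cases "i \<in> A") (auto simp: dist_commute less_imp_le)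
          then show "(\<forall>i\<in>I. G i (z', \<theta>) \<le> 0) \<and> (\<forall>j\<in>J. G j (z', \<theta>) = 0)" using z'(3) A(2) by blast
        qed (use z' in auto)
        show "a j = 0" if a: "\<And>d. d \<in> Z.S \<Longrightarrow> (\<Sum>i\<in>A. a i * fderiv (G i) ?q (d, 0)) = 0" and j: "j \<in> A" for a j
        proof -
          \<comment> \<open>Extending by 0 from \<open>A\<close> to \<open>Act\<close> gives a
            homogeneous system with matrix near the identity.\<close>
          let ?a = "\<lambda>i. if i \<in> A then a i else 0"
          have "(\<Sum>i\<in>Act. ?a i * M \<theta> i k) = 0" if "k \<in> Act" for k
          proof -
            have "(\<Sum>i\<in>Act. ?a i * M \<theta> i k) = (\<Sum>i\<in>A. ?a i * M \<theta> i k)"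
              by (rule sum.mono_neutral_right[OF finAct A']) auto
            also have "\<dots> = (\<Sum>i\<in>A. a i * fderiv (G i) ?q (e k, 0))" unfolding M_def by (intro sum.cong) auto
            also have "\<dots> = 0" by (rule a[OF e(1)[OF that]])
            finally show ?thesis .
          qed
          from sum_delta_perturbation[OF finAct this Mle] have "(\<Sum>j\<in>Act. \<bar>?a j\<bar>) \<le> 0" by simp
          then have "(\<Sum>j\<in>Act. \<bar>?a j\<bar>) = 0" by (intro antisym sum_nonneg) auto
          then have "\<forall>j\<in>Act. \<bar>?a j\<bar> = 0" using sum_nonneg_eq_0_iff[OF finAct, of "\<lambda>j. \<bar>?a j\<bar>"] by simp
          then have "\<bar>?a j\<bar> = 0" using j A' by blast
          then show ?thesis using j by simp
        qed
      qed (simp add: A_def)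
    qed
    then obtain m0 where m0: "\<And>d. d \<in> Z.S \<Longrightarrow> fderiv \<phi> ?q (d, 0) + (\<Sum>i\<in>A. m0 i * fderiv (G i) ?q (d, 0)) = 0"
      by blast
    \<comment> \<open>Zero off the current active set, which is exactly complementarity at \<gamma>
      = 0.\<close>
    define m where "m i = (if i \<in> A then m0 i else 0)" for i
    have m: "fderiv \<phi> ?q (d, 0) + (\<Sum>i\<in>B. m i * fderiv (G i) ?q (d, 0)) = 0"
      if d: "d \<in> Z.S" and B: "finite B" "A \<subseteq> B" for d B
    proof -
      have "(\<Sum>i\<in>B. m i * fderiv (G i) ?q (d, 0)) = (\<Sum>i\<in>A. m i * fderiv (G i) ?q (d, 0))"
        by (rule sum.mono_neutral_right[OF B]) (auto simp: m_def)
      also have "\<dots> = (\<Sum>i\<in>A. m0 i * fderiv (G i) ?q (d, 0))" by (intro sum.cong) (auto simp: m_def)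
      finally show ?thesis using m0[OF d] by simp
    qed
    have "(\<Sum>j\<in>Act. \<bar>m j - \<mu> j\<bar>) \<le> 2 * (\<Sum>j\<in>Act. \<bar>\<rho> \<theta> j\<bar>)"
    proof (rule sum_delta_perturbation[OF finAct _ Mle])
      show "(\<Sum>i\<in>Act. (m i - \<mu> i) * M \<theta> i j) = \<rho> \<theta> j" if "j \<in> Act" for j
        using m[OF e(1)[OF that] finAct A'] unfolding \<rho>_def M_def
        by (simp add: left_diff_distrib sum_subtractf)
    qed
    then have 1: "(\<Sum>j\<in>Act. \<bar>m j - \<mu> j\<bar>) * C < r / 2"
      using elim(1) mult_right_mono[of "\<Sum>j\<in>Act. \<bar>m j - \<mu> j\<bar>" "2 * (\<Sum>j\<in>Act. \<bar>\<rho> \<theta> j\<bar>)" C]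
      by (simp add: C_def sum_nonneg)
    define y where "y = (\<Sum>i\<in>L. m i *\<^sub>R c i)"
    have "norm (y - y0) \<le> (\<Sum>i\<in>L. norm ((m i - \<mu> i) *\<^sub>R c i))"
      unfolding y_def y0_def sum_subtractf[symmetric] scaleR_diff_left[symmetric] by (rule norm_sum)
    also have "\<dots> \<le> (\<Sum>i\<in>L. \<bar>m i - \<mu> i\<bar> * C)"
    proof (rule sum_mono)
      fix i assume "i \<in> L"
      then have "norm (c i) \<le> C" unfolding C_def by (rule member_le_sum[OF _ _ finL]) auto
      then show "norm ((m i - \<mu> i) *\<^sub>R c i) \<le> \<bar>m i - \<mu> i\<bar> * C" by (simp add: mult_left_mono)
    qed
    also have "\<dots> = (\<Sum>i\<in>L. \<bar>m i - \<mu> i\<bar>) * C" by (simp add: sum_distrib_right)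
    also have "(\<Sum>i\<in>L. \<bar>m i - \<mu> i\<bar>) = (\<Sum>i\<in>Act. \<bar>m i - \<mu> i\<bar>)"
      using A' not_Act by (intro sum_Act) (auto simp: m_def)
    finally have "dist y y0 < r / 2" using 1 by (simp add: dist_norm)
    then have "(\<zeta> \<theta>, y) \<in> ball (zb, y0) r" by (rule prod_in_ball[OF elim(4)])
    moreover have "opt_sys ((\<zeta> \<theta>, y), (\<theta>, 0)) = 0"
      unfolding opt_sys_zero_iff
    proof (intro conjI ballI)
      have \<eta>y: "\<eta> i y = m i" if "i \<in> L" for i unfolding y_def by (rule Y.coord_sum[OF that])
      show "stat d ((\<zeta> \<theta>, y), (\<theta>, 0)) = 0" if "d \<in> Z.S" for d
        using m[OF that finL A(1)] by (simp add: stat_def pt_def \<eta>y)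
      show "compl i ((\<zeta> \<theta>, y), (\<theta>, 0)) = 0" if "i \<in> L" for i
        using that feas(2)[of i] by (auto simp: compl_def pt_def \<eta>y m_def A_def L_iff)
    qed (simp_all add: \<zeta>S y_def Y.sum_in_S)
    ultimately show ?case by blast
  qed
qed

text \<open>The branch is the input part of the implicit function of \<open>opt_sys\<close>. For
  \<gamma> > 0 the equation says that multiplier times constraint equals \<open>- \<gamma>\<close>,
  so a positive multiplier puts the point strictly inside. Once \<open>1 / \<gamma>\<close> exceeds
  \<open>M\<close>, the barrier Hessian dominates the penalized Hessian.\<close>

theorem barrier_branch:
  obtains \<epsilon> z where "\<epsilon> > 0" "C1_on (ball \<theta>b \<epsilon> \<times> {-\<epsilon><..<\<epsilon>}) z" "z (\<theta>b, 0) = zb"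
    "\<And>\<theta> \<gamma>. \<theta> \<in> ball \<theta>b \<epsilon> \<Longrightarrow> \<gamma> \<in> {-\<epsilon><..<\<epsilon>} \<Longrightarrow> z (\<theta>, \<gamma>) \<in> Z.S"
    "\<And>\<theta> \<gamma>. \<theta> \<in> ball \<theta>b \<epsilon> \<Longrightarrow> 0 < \<gamma> \<Longrightarrow> \<gamma> < \<epsilon> \<Longrightarrow> (z (\<theta>, \<gamma>), \<theta>) \<in> strict_region"
    "\<And>\<theta> \<gamma> d. \<theta> \<in> ball \<theta>b \<epsilon> \<Longrightarrow> 0 < \<gamma> \<Longrightarrow> \<gamma> < \<epsilon> \<Longrightarrow> d \<in> Z.S \<Longrightarrow> fderiv (barrier \<gamma>) (z (\<theta>, \<gamma>), \<theta>) (d, 0) = 0"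
    "\<And>\<theta> \<gamma> d. \<theta> \<in> ball \<theta>b \<epsilon> \<Longrightarrow> 0 < \<gamma> \<Longrightarrow> \<gamma> < \<epsilon> \<Longrightarrow> d \<in> Z.S \<Longrightarrow> d \<noteq> 0 \<Longrightarrow>
       fderiv (fderiv (barrier \<gamma>)) (z (\<theta>, \<gamma>), \<theta>) (d, 0) (d, 0) > 0"
    "\<And>\<zeta>. isCont \<zeta> \<theta>b \<Longrightarrow> \<zeta> \<theta>b = zb \<Longrightarrow> \<forall>\<^sub>F \<theta> in nhds \<theta>b. local_minimizer \<theta> (\<zeta> \<theta>) \<Longrightarrow>
       \<forall>\<^sub>F \<theta> in nhds \<theta>b. \<zeta> \<theta> = z (\<theta>, 0)"
proof -
  let ?p0 = "(\<theta>b, 0::real)"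
  obtain A B where AB: "\<And>h. blinfun_apply A h = fderiv opt_sys (fst x0, snd x0) (h, 0)"
    "A o\<^sub>L B = id_blinfun" "B o\<^sub>L A = id_blinfun"
    by (rule opt_sys_invertible) (rule that)
  have zero: "opt_sys (fst x0, snd x0) = 0" using opt_sys_x0 by simp
  obtain r \<delta> g where r: "r > 0" and \<delta>: "\<delta> > 0" and g: "C1_on (ball (snd x0) \<delta>) g" "g (snd x0) = fst x0"
    and "\<And>p. p \<in> ball (snd x0) \<delta> \<Longrightarrow> g p \<in> ball (fst x0) r" "\<And>p. p \<in> ball (snd x0) \<delta> \<Longrightarrow> (g p, p) \<in> UNIV"
    and g0: "\<And>p. p \<in> ball (snd x0) \<delta> \<Longrightarrow> opt_sys (g p, p) = 0"
    and g_unique: "\<And>e p. e \<in> ball (fst x0) r \<Longrightarrow> p \<in> ball (snd x0) \<delta> \<Longrightarrow> opt_sys (e, p) = 0 \<Longrightarrow> e = g p"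
    and "fderiv g (snd x0) = - (B o\<^sub>L fderiv opt_sys (fst x0, snd x0) o\<^sub>L Blinfun (\<lambda>p. (0, p)))"
    by (rule implicit_function_banach[OF open_UNIV UNIV_I C1_opt_sys zero AB]) (rule that)
  have x0_eq: "fst x0 = (zb, y0)" "snd x0 = ?p0" by (simp_all add: x0_def)
  note g = g[unfolded x0_eq] and g0 = g0[unfolded x0_eq] and g_unique = g_unique[unfolded x0_eq]
  obtain M where M: "M > 0" and pd: "\<forall>\<^sub>F x in nhds x0. \<forall>d\<in>Z.S. norm d = 1 \<longrightarrow>
      fderiv (fderiv \<phi>) (pt x) (d, 0) (d, 0)
      + (\<Sum>i\<in>L. \<eta> i (snd (fst x)) * fderiv (fderiv (G i)) (pt x) (d, 0) (d, 0))
      + M * (\<Sum>i\<in>Act. (if i \<in> I then (\<eta> i (snd (fst x)))\<^sup>2 else 1) * (fderiv (G i) (pt x) (d, 0))\<^sup>2) > 0"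
    by (rule penalized_hessian_positive) (rule that)
  have t: "((\<lambda>x. x) \<longlongrightarrow> x0) (nhds x0)" by (rule filterlim_ident)
  \<comment> \<open>Near \<open>x0\<close> active inequalities keep a positive multiplier and
    inactive ones a negative value; either fact gives strict feasibility for \<gamma> > 0.\<close>
  have sgn: "\<forall>\<^sub>F x in nhds x0. \<forall>i\<in>I. if i \<in> Act then \<eta> i (snd (fst x)) > 0 else G i (pt x) < 0"
  proof (rule eventually_ball_finite[OF finI], rule ballI)
    fix i assume i: "i \<in> I"
    have "((\<lambda>x. \<eta> i (snd (fst x))) \<longlongrightarrow> \<mu> i) (nhds x0)"
      using continuous_on_tendsto_compose[OF linear_continuous_on[OF bounded_linear_\<eta>, of UNIV i] t] \<eta>_y0[OF IL[OF i]] by simp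
    moreover have "((\<lambda>x. G i (pt x)) \<longlongrightarrow> G i (zb, \<theta>b)) (nhds x0)"
      using continuous_on_tendsto_compose[OF cont_G[OF IL[OF i]] continuous_on_tendsto_compose[OF C1_on_continuous[OF C1_pt] t]] by simp
    ultimately show "\<forall>\<^sub>F x in nhds x0. if i \<in> Act then \<eta> i (snd (fst x)) > 0 else G i (pt x) < 0"
      using order_tendstoD[of _ _ "nhds x0" 0] \<mu>_active[OF i] not_Act[OF IL[OF i]] i by (cases "i \<in> Act") (auto simp: Act_def)
  qed
  have p0: "?p0 \<in> ball ?p0 \<delta>" using \<delta> by simp
  have "isCont g ?p0" by (rule C1_on_isCont[OF g(1) p0])
  then have "((\<lambda>p. (g p, p)) \<longlongrightarrow> x0) (nhds ?p0)"
    using tendsto_Pair[of g "(zb, y0)" "nhds ?p0" "\<lambda>p. p" ?p0] g(2)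
    by (simp add: isCont_def tendsto_nhds_iff filterlim_ident x0_def)
  from eventually_compose_filterlim[OF eventually_conj[OF sgn pd] this]
  have "\<forall>\<^sub>F p in nhds ?p0. (\<forall>i\<in>I. if i \<in> Act then \<eta> i (snd (g p)) > 0 else G i (pt (g p, p)) < 0) \<and>
     (\<forall>d\<in>Z.S. norm d = 1 \<longrightarrow>
      fderiv (fderiv \<phi>) (pt (g p, p)) (d, 0) (d, 0)
      + (\<Sum>i\<in>L. \<eta> i (snd (g p)) * fderiv (fderiv (G i)) (pt (g p, p)) (d, 0) (d, 0))
      + M * (\<Sum>i\<in>Act. (if i \<in> I then (\<eta> i (snd (g p)))\<^sup>2 else 1) * (fderiv (G i) (pt (g p, p)) (d, 0))\<^sup>2) > 0)"
    by (simp only: fst_conv)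
  then obtain \<epsilon>0 where \<epsilon>0: "\<epsilon>0 > 0"
    and sgn': "\<And>p i. dist p ?p0 < \<epsilon>0 \<Longrightarrow> i \<in> I \<Longrightarrow> if i \<in> Act then \<eta> i (snd (g p)) > 0 else G i (pt (g p, p)) < 0"
    and pd': "\<And>p d. dist p ?p0 < \<epsilon>0 \<Longrightarrow> d \<in> Z.S \<Longrightarrow> norm d = 1 \<Longrightarrow>
      fderiv (fderiv \<phi>) (pt (g p, p)) (d, 0) (d, 0)
      + (\<Sum>i\<in>L. \<eta> i (snd (g p)) * fderiv (fderiv (G i)) (pt (g p, p)) (d, 0) (d, 0))
      + M * (\<Sum>i\<in>Act. (if i \<in> I then (\<eta> i (snd (g p)))\<^sup>2 else 1) * (fderiv (G i) (pt (g p, p)) (d, 0))\<^sup>2) > 0"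
    unfolding eventually_nhds_metric by blast
  \<comment> \<open>Halving lets the product of a ball and an interval fit into the balls around the
    reference parameter; the bound \<open>1 / M\<close> gives
    \<open>M \<le> 1 / \<gamma>\<close>.\<close>
  define \<epsilon> where "\<epsilon> = min (min \<epsilon>0 \<delta> / 2) (1 / M)"
  have \<epsilon>: "\<epsilon> > 0" "\<epsilon> \<le> \<epsilon>0 / 2" "\<epsilon> \<le> \<delta> / 2" "\<epsilon> \<le> 1 / M" using \<epsilon>0 \<delta> M by (auto simp: \<epsilon>_def)
  define z where "z p = fst (g p)" for p
  have inb: "(\<theta>, \<gamma>) \<in> ball ?p0 \<delta>" "dist (\<theta>, \<gamma>) ?p0 < \<epsilon>0" if "\<theta> \<in> ball \<theta>b \<epsilon>" "\<gamma> \<in> {-\<epsilon><..<\<epsilon>}" for \<theta> \<gamma>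
    using prod_in_ball[of \<theta> \<theta>b \<delta> \<gamma> 0] prod_in_ball[of \<theta> \<theta>b \<epsilon>0 \<gamma> 0] that \<epsilon>
    by (auto simp: dist_commute dist_real_def)
  have pt_g: "pt (g (\<theta>, \<gamma>), (\<theta>, \<gamma>)) = (z (\<theta>, \<gamma>), \<theta>)" for \<theta> \<gamma> by (simp add: pt_def z_def)
  have sol: "z (\<theta>, \<gamma>) \<in> Z.S" "\<And>d. d \<in> Z.S \<Longrightarrow> stat d (g (\<theta>, \<gamma>), (\<theta>, \<gamma>)) = 0"
    "\<And>i. i \<in> L \<Longrightarrow> compl i (g (\<theta>, \<gamma>), (\<theta>, \<gamma>)) = 0"
    if "\<theta> \<in> ball \<theta>b \<epsilon>" "\<gamma> \<in> {-\<epsilon><..<\<epsilon>}" for \<theta> \<gamma>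
    using g0[OF inb(1)[OF that]] by (auto simp: opt_sys_zero_iff z_def)
  have central: "(z (\<theta>, \<gamma>), \<theta>) \<in> strict_region"
    "\<And>i. i \<in> I \<Longrightarrow> \<eta> i (snd (g (\<theta>, \<gamma>))) * G i (z (\<theta>, \<gamma>), \<theta>) + \<gamma> = 0"
    "\<And>j. j \<in> J \<Longrightarrow> G j (z (\<theta>, \<gamma>), \<theta>) - \<gamma> * \<eta> j (snd (g (\<theta>, \<gamma>))) = 0"
    if "\<theta> \<in> ball \<theta>b \<epsilon>" "0 < \<gamma>" "\<gamma> < \<epsilon>" for \<theta> \<gamma>
  proof -
    have \<gamma>: "\<gamma> \<in> {-\<epsilon><..<\<epsilon>}" using that by simp
    show I: "\<eta> i (snd (g (\<theta>, \<gamma>))) * G i (z (\<theta>, \<gamma>), \<theta>) + \<gamma> = 0" if "i \<in> I" for i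
      using sol(3)[OF \<open>\<theta> \<in> ball \<theta>b \<epsilon>\<close> \<gamma> IL[OF that]] that by (simp add: compl_def pt_g)
    show "G j (z (\<theta>, \<gamma>), \<theta>) - \<gamma> * \<eta> j (snd (g (\<theta>, \<gamma>))) = 0" if "j \<in> J" for j
    proof -
      have "j \<notin> I" using that IJ by blast
      then show ?thesis
        using sol(3)[OF \<open>\<theta> \<in> ball \<theta>b \<epsilon>\<close> \<gamma> JL[OF that]] by (simp add: compl_def pt_g)
    qed
    have "G i (z (\<theta>, \<gamma>), \<theta>) < 0" if i: "i \<in> I" for i
    proof (cases "i \<in> Act")
      case True
      then have "\<eta> i (snd (g (\<theta>, \<gamma>))) > 0" using sgn'[OF inb(2)[OF \<open>\<theta> \<in> ball \<theta>b \<epsilon>\<close> \<gamma>] i] by simp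
      moreover have "\<eta> i (snd (g (\<theta>, \<gamma>))) * G i (z (\<theta>, \<gamma>), \<theta>) < 0" using I[OF i] \<open>0 < \<gamma>\<close> by simp
      ultimately show ?thesis by (simp add: mult_less_0_iff)
    next
      case False
      then show ?thesis using sgn'[OF inb(2)[OF \<open>\<theta> \<in> ball \<theta>b \<epsilon>\<close> \<gamma>] i] by (simp add: pt_g)
    qed
    then show "(z (\<theta>, \<gamma>), \<theta>) \<in> strict_region" by (simp add: strict_region_def)
  qed
  show ?thesis
  proof (rule that[OF \<epsilon>(1) _ _ sol(1) central(1)])
    have "ball \<theta>b \<epsilon> \<times> {-\<epsilon><..<\<epsilon>} \<subseteq> ball ?p0 \<delta>" using inb(1) by auto
    then show "C1_on (ball \<theta>b \<epsilon> \<times> {-\<epsilon><..<\<epsilon>}) z"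
      unfolding z_def[abs_def] by (intro C1_on_linear_comp[OF bounded_linear_fst] C1_on_subset[OF g(1)])
    show "z (\<theta>b, 0) = zb" by (simp add: z_def g(2))
  next
    fix \<theta> \<gamma> d assume *: "\<theta> \<in> ball \<theta>b \<epsilon>" "0 < \<gamma>" "\<gamma> < \<epsilon>" and d: "d \<in> Z.S"
    have \<gamma>: "\<gamma> \<in> {-\<epsilon><..<\<epsilon>}" using * by simp
    let ?m = "\<lambda>i. \<eta> i (snd (g (\<theta>, \<gamma>)))"
    have bc: "fderiv (barrier \<gamma>) (z (\<theta>, \<gamma>), \<theta>) h = fderiv \<phi> (z (\<theta>, \<gamma>), \<theta>) h
        + (\<Sum>i\<in>L. ?m i * fderiv (G i) (z (\<theta>, \<gamma>), \<theta>) h)"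
      "fderiv (fderiv (barrier \<gamma>)) (z (\<theta>, \<gamma>), \<theta>) h h = fderiv (fderiv \<phi>) (z (\<theta>, \<gamma>), \<theta>) h h
        + (\<Sum>i\<in>L. ?m i * fderiv (fderiv (G i)) (z (\<theta>, \<gamma>), \<theta>) h h)
        + 1 / \<gamma> * (\<Sum>i\<in>L. (if i \<in> I then (?m i)\<^sup>2 else 1) * (fderiv (G i) (z (\<theta>, \<gamma>), \<theta>) h)\<^sup>2)" for h
      using central(2,3)[OF *] by (intro barrier_at_central_point[OF *(2) central(1)[OF *]]; simp)+
    show "fderiv (barrier \<gamma>) (z (\<theta>, \<gamma>), \<theta>) (d, 0) = 0"
      unfolding bc(1) using sol(2)[OF *(1) \<gamma> d] by (simp add: stat_def pt_g)
    assume "d \<noteq> 0"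
    show "fderiv (fderiv (barrier \<gamma>)) (z (\<theta>, \<gamma>), \<theta>) (d, 0) (d, 0) > 0"
    proof (rule Z.bilinear_pos_scale[OF bounded_linear.linear[OF bounded_linear_inl] _ d \<open>d \<noteq> 0\<close>])
      fix d assume d: "d \<in> Z.S" "norm d = 1"
      let ?w = "\<lambda>i. (if i \<in> I then (\<eta> i (snd (g (\<theta>, \<gamma>))))\<^sup>2 else 1) * (fderiv (G i) (z (\<theta>, \<gamma>), \<theta>) (d, 0))\<^sup>2"
      have "\<gamma> \<le> 1 / M" using * \<epsilon>(4) by simp
      then have "M \<le> 1 / \<gamma>" using * M by (simp add: pos_le_divide_eq mult.commute)
      then have "M * sum ?w Act \<le> 1 / \<gamma> * sum ?w L"
        by (intro mult_mono sum_mono2[OF finL Act_L] sum_nonneg mult_nonneg_nonneg) (use * in auto)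
      then show "fderiv (fderiv (barrier \<gamma>)) (z (\<theta>, \<gamma>), \<theta>) (d, 0) (d, 0) > 0"
        unfolding bc(2) using pd'[OF inb(2)[OF *(1) \<gamma>] d] unfolding pt_g by linarith
    qed
  next
    fix \<zeta> assume \<zeta>: "isCont \<zeta> \<theta>b" "\<zeta> \<theta>b = zb" "\<forall>\<^sub>F \<theta> in nhds \<theta>b. local_minimizer \<theta> (\<zeta> \<theta>)"
    have "\<forall>\<^sub>F \<theta> in nhds \<theta>b. \<theta> \<in> ball \<theta>b \<epsilon>" using \<epsilon>(1) by (intro eventually_nhds_in_open) auto
    with local_minimizer_solves_opt_sys[OF \<zeta> r] show "\<forall>\<^sub>F \<theta> in nhds \<theta>b. \<zeta> \<theta> = z (\<theta>, 0)"
    proof eventually_elim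
      case (elim \<theta>)
      then obtain y where y: "(\<zeta> \<theta>, y) \<in> ball (zb, y0) r" "opt_sys ((\<zeta> \<theta>, y), (\<theta>, 0)) = 0" by blast
      have "(\<zeta> \<theta>, y) = g (\<theta>, 0)" using \<epsilon>(1) by (intro g_unique y inb elim(2)) auto
      then show ?case by (simp add: z_def) (metis fst_conv)
    qed
  qed
qed

end

section \<open>Gradients and Hessians of stage functions\<close>

lemma fderiv_compose:
  assumes "g differentiable (at (f q))" "f differentiable (at q)"
  shows "fderiv (\<lambda>q. g (f q)) q a = fderiv g (f q) (fderiv f q a)"
  using fderiv_eq[OF has_derivative_compose[OF fderiv_works[OF assms(2)] fderiv_works[OF assms(1)]]] by simp

lemma vec_basis_sum: "(\<Sum>j\<in>UNIV. h $ j *\<^sub>R axis j 1) = (h :: real^'k)"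
  using basis_expansion[of h] by (simp add: scalar_mult_eq_scaleR)

lemma inner_vec_lambda_linear:
  fixes f :: "real^'k \<Rightarrow> real"
  assumes "linear f"
  shows "d \<bullet> (\<chi> j. f (axis j 1)) = f d"
proof -
  have "f d = f (\<Sum>j\<in>UNIV. d $ j *\<^sub>R axis j 1)" by (simp add: vec_basis_sum)
  also have "\<dots> = (\<Sum>j\<in>UNIV. d $ j * f (axis j 1))" by (simp add: linear_sum[OF assms] linear_cmul[OF assms])
  finally show ?thesis by (simp add: inner_vec_def)
qed

lemma jac_mult:
  assumes "(F has_derivative F') (at z)"
  shows "jac F z *v h = F' h"
proof -
  have "(F has_derivative (\<lambda>h. jac F z *v h)) (at z)"
    using assms jacobian_works[of F "at z"] differentiableI unfolding jac_def by blast
  from has_derivative_unique[OF this assms] show ?thesis by (simp add: fun_eq_iff)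
qed

lemma has_derivative_slots:
  "((\<lambda>x'. (x', u, \<theta>)) has_derivative (\<lambda>h. (h, 0, 0))) (at x)"
  "((\<lambda>u'. (x, u', \<theta>)) has_derivative (\<lambda>h. (0, h, 0))) (at u)"
  "((\<lambda>\<theta>'. (x, u, \<theta>')) has_derivative (\<lambda>h. (0, 0, h))) (at \<theta>)"
  by (auto intro!: has_derivative_Pair has_derivative_const has_derivative_ident)

lemma linear_slots:
  "linear (\<lambda>d. blinfun_apply A (d, 0, 0))" "linear (\<lambda>d. blinfun_apply A (0, d, 0))"
proof -
  have "linear (\<lambda>d. (d, 0, 0))" "linear (\<lambda>d. (0, d, 0))"
    by (auto intro!: linearI)
  from this[THEN linear_compose[OF _ bounded_linear.linear[OF blinfun.bounded_linear_right]]]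
  show "linear (\<lambda>d. blinfun_apply A (d, 0, 0))" "linear (\<lambda>d. blinfun_apply A (0, d, 0))"
    by (simp_all add: o_def)
qed

text \<open>Below, a stage function \<open>f x u \<theta>\<close> is identified with its uncurried form on the product space.\<close>

abbreviation uncurry3 :: "('a \<Rightarrow> 'b \<Rightarrow> 'c \<Rightarrow> 'd) \<Rightarrow> 'a \<times> 'b \<times> 'c \<Rightarrow> 'd" where
  "uncurry3 f \<equiv> \<lambda>(x, u, \<theta>). f x u \<theta>"

lemma
  assumes f: "uncurry3 f differentiable (at (x, u, \<theta>))"
  shows Dx_eq: "Dx f x u \<theta> = (\<chi> j. fderiv (uncurry3 f) (x, u, \<theta>) (axis j 1, 0, 0))"
    and Du_eq: "Du f x u \<theta> = (\<chi> j. fderiv (uncurry3 f) (x, u, \<theta>) (0, axis j 1, 0))"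
    and Dx_inner: "Dx f x u \<theta> \<bullet> d = fderiv (uncurry3 f) (x, u, \<theta>) (d, 0, 0)"
    and Du_inner: "Du f x u \<theta> \<bullet> e = fderiv (uncurry3 f) (x, u, \<theta>) (0, e, 0)"
proof -
  have 1: "((\<lambda>x'. f x' u \<theta>) has_derivative (\<lambda>h. fderiv (uncurry3 f) (x, u, \<theta>) (h, 0, 0))) (at x)"
    using has_derivative_compose[OF has_derivative_slots(1) fderiv_works[OF f]] by simp
  have 2: "((\<lambda>u'. f x u' \<theta>) has_derivative (\<lambda>h. fderiv (uncurry3 f) (x, u, \<theta>) (0, h, 0))) (at u)"
    using has_derivative_compose[OF has_derivative_slots(2) fderiv_works[OF f]] by simp
  show *: "Dx f x u \<theta> = (\<chi> j. fderiv (uncurry3 f) (x, u, \<theta>) (axis j 1, 0, 0))"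
    "Du f x u \<theta> = (\<chi> j. fderiv (uncurry3 f) (x, u, \<theta>) (0, axis j 1, 0))"
    unfolding Dx_def Du_def grad_def frechet_derivative_at[OF 1, symmetric] frechet_derivative_at[OF 2, symmetric] by simp_all
  show "Dx f x u \<theta> \<bullet> d = fderiv (uncurry3 f) (x, u, \<theta>) (d, 0, 0)"
    unfolding * using inner_vec_lambda_linear[OF linear_slots(1), of d] by (simp add: inner_commute)
  show "Du f x u \<theta> \<bullet> e = fderiv (uncurry3 f) (x, u, \<theta>) (0, e, 0)"
    unfolding * using inner_vec_lambda_linear[OF linear_slots(2), of e] by (simp add: inner_commute)
qed

lemma
  assumes f: "uncurry3 f differentiable (at (x, u, \<theta>))"
  shows Fx_mult: "Fx f x u \<theta> *v d = fderiv (uncurry3 f) (x, u, \<theta>) (d, 0, 0)"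
    and Fu_mult: "Fu f x u \<theta> *v e = fderiv (uncurry3 f) (x, u, \<theta>) (0, e, 0)"
    and Ft_mult: "Ft f x u \<theta> *v r = fderiv (uncurry3 f) (x, u, \<theta>) (0, 0, r)"
  unfolding Fx_def Fu_def Ft_def
  using has_derivative_compose[OF has_derivative_slots(1) fderiv_works[OF f]]
    has_derivative_compose[OF has_derivative_slots(2) fderiv_works[OF f]]
    has_derivative_compose[OF has_derivative_slots(3) fderiv_works[OF f]]
  by (simp_all add: jac_mult)

lemma has_derivative_vec_lambda:
  fixes f :: "'j::finite \<Rightarrow> 'a::real_normed_vector \<Rightarrow> real"
  assumes "\<And>j. (f j has_derivative f' j) (at y)"
  shows "((\<lambda>y. \<chi> j. f j y) has_derivative (\<lambda>h. \<chi> j. f' j h)) (at y)"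
proof -
  have "((\<lambda>y. \<Sum>j\<in>UNIV. f j y *\<^sub>R axis j 1) has_derivative (\<lambda>h. \<Sum>j\<in>UNIV. f' j h *\<^sub>R (axis j 1 :: real^'j))) (at y)"
    by (intro has_derivative_sum has_derivative_scaleR_left assms)
  then show ?thesis using vec_basis_sum[of "\<chi> j. f j y" for y] vec_basis_sum[of "\<chi> j. f' j h" for h] by simp
qed

lemma
  assumes f: "C2_on W (uncurry3 f)" and W: "open W" "(x, u, \<theta>) \<in> W"
  shows Dx_has_derivative: "((\<lambda>(x, u, \<theta>). Dx f x u \<theta>) has_derivative
      (\<lambda>h. \<chi> j. fderiv (fderiv (uncurry3 f)) (x, u, \<theta>) h (axis j 1, 0, 0))) (at (x, u, \<theta>))"
    and Du_has_derivative: "((\<lambda>(x, u, \<theta>). Du f x u \<theta>) has_derivative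
      (\<lambda>h. \<chi> j. fderiv (fderiv (uncurry3 f)) (x, u, \<theta>) h (0, axis j 1, 0))) (at (x, u, \<theta>))"
proof -
  note fd = C1_on_differentiable[OF C2_on_C1[OF f]] C1_on_differentiable[OF C2_on_fderiv[OF f]]
  have "((\<lambda>y. \<chi> j. fderiv (uncurry3 f) y (v j)) has_derivative
      (\<lambda>h. \<chi> j. fderiv (fderiv (uncurry3 f)) (x, u, \<theta>) h (v j))) (at (x, u, \<theta>))" for v :: "'j::finite \<Rightarrow> _"
    by (rule has_derivative_vec_lambda[OF fderiv_apply_const[OF fd(2)[OF W(2)]]])
  note D = this[THEN has_derivative_transform_within_open, OF W]
  show "((\<lambda>(x, u, \<theta>). Dx f x u \<theta>) has_derivative
      (\<lambda>h. \<chi> j. fderiv (fderiv (uncurry3 f)) (x, u, \<theta>) h (axis j 1, 0, 0))) (at (x, u, \<theta>))"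
    by (rule D) (auto simp: Dx_eq fd)
  show "((\<lambda>(x, u, \<theta>). Du f x u \<theta>) has_derivative
      (\<lambda>h. \<chi> j. fderiv (fderiv (uncurry3 f)) (x, u, \<theta>) h (0, axis j 1, 0))) (at (x, u, \<theta>))"
    by (rule D) (auto simp: Du_eq fd)
qed

lemma
  assumes f: "C2_on W (uncurry3 f)" and W: "open W" "(x, u, \<theta>) \<in> W"
  shows Dxx_form: "d \<bullet> (Dxx f x u \<theta> *v h) = fderiv (fderiv (uncurry3 f)) (x, u, \<theta>) (h, 0, 0) (d, 0, 0)"
    and Dxu_form: "d \<bullet> (Dxu f x u \<theta> *v k) = fderiv (fderiv (uncurry3 f)) (x, u, \<theta>) (0, k, 0) (d, 0, 0)"
    and Dxt_form: "d \<bullet> (Dxt f x u \<theta> *v r) = fderiv (fderiv (uncurry3 f)) (x, u, \<theta>) (0, 0, r) (d, 0, 0)"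
    and Dux_form: "e \<bullet> (Dux f x u \<theta> *v h) = fderiv (fderiv (uncurry3 f)) (x, u, \<theta>) (h, 0, 0) (0, e, 0)"
    and Duu_form: "e \<bullet> (Duu f x u \<theta> *v k) = fderiv (fderiv (uncurry3 f)) (x, u, \<theta>) (0, k, 0) (0, e, 0)"
    and Dut_form: "e \<bullet> (Dut f x u \<theta> *v r) = fderiv (fderiv (uncurry3 f)) (x, u, \<theta>) (0, 0, r) (0, e, 0)"
  unfolding Dxx_def Dxu_def Dxt_def Dux_def Duu_def Dut_def
  using has_derivative_compose[OF has_derivative_slots(1) Dx_has_derivative[OF assms]]
    has_derivative_compose[OF has_derivative_slots(2) Dx_has_derivative[OF assms]]
    has_derivative_compose[OF has_derivative_slots(3) Dx_has_derivative[OF assms]]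
    has_derivative_compose[OF has_derivative_slots(1) Du_has_derivative[OF assms]]
    has_derivative_compose[OF has_derivative_slots(2) Du_has_derivative[OF assms]]
    has_derivative_compose[OF has_derivative_slots(3) Du_has_derivative[OF assms]]
  by (simp_all add: jac_mult inner_vec_lambda_linear[OF linear_slots(1)] inner_vec_lambda_linear[OF linear_slots(2)])

lemma stage_split: "(d, e, r) = (d, 0, 0) + (0, e, 0) + (0, 0, r)" for d :: "'a::real_vector" and e :: "'b::real_vector" and r :: "'c::real_vector"
  by simp

lemma hessian_form:
  assumes f: "C2_on W (uncurry3 f)" and W: "open W" "(x, u, \<theta>) \<in> W"
  shows "d \<bullet> (Dxx f x u \<theta> *v d) + d \<bullet> (Dxu f x u \<theta> *v e) + e \<bullet> (Dux f x u \<theta> *v d) + e \<bullet> (Duu f x u \<theta> *v e)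
    = fderiv (fderiv (uncurry3 f)) (x, u, \<theta>) (d, e, 0) (d, e, 0)"
  unfolding Dxx_form[OF assms] Dxu_form[OF assms] Dux_form[OF assms] Duu_form[OF assms]
  unfolding stage_split[of d e 0] blinfun.add_left blinfun.add_right
  by (simp add: zero_prod_def[symmetric] blinfun.zero_left blinfun.zero_right)

text \<open>Completing the parametric direction turns the linear terms of the auxiliary cost into part of a full second derivative.\<close>

lemma augmented_hessian_form:
  assumes f: "C2_on W (uncurry3 f)" and W: "open W" "(x, u, \<theta>) \<in> W"
  shows "1/2 * (d \<bullet> (Dxx f x u \<theta> *v d) + d \<bullet> (Dxu f x u \<theta> *v e) + e \<bullet> (Dux f x u \<theta> *v d) + e \<bullet> (Duu f x u \<theta> *v e))
      + d \<bullet> (Dxt f x u \<theta> *v r) + e \<bullet> (Dut f x u \<theta> *v r)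
    = 1/2 * fderiv (fderiv (uncurry3 f)) (x, u, \<theta>) (d, e, r) (d, e, r)
      - 1/2 * fderiv (fderiv (uncurry3 f)) (x, u, \<theta>) (0, 0, r) (0, 0, r)"
proof -
  let ?H = "fderiv (fderiv (uncurry3 f)) (x, u, \<theta>)"
  have sym: "?H (d, e, 0) (0, 0, r) = ?H (0, 0, r) (d, e, 0)" by (rule fderiv2_symmetric[OF assms])
  have "(d, e, r) = (d, e, 0) + (0, 0, r)" by simp
  then have "?H (d, e, r) (d, e, r) = ?H (d, e, 0) (d, e, 0) + 2 * ?H (0, 0, r) (d, e, 0) + ?H (0, 0, r) (0, 0, r)"
    by (simp only: blinfun.add_left blinfun.add_right sym)
  moreover have "(d, e, 0) = (d, 0, 0) + (0, e, 0 :: real^'c)" by simp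
  then have "?H (0, 0, r) (d, e, 0) = d \<bullet> (Dxt f x u \<theta> *v r) + e \<bullet> (Dut f x u \<theta> *v r)"
    unfolding Dxt_form[OF assms] Dut_form[OF assms] by (simp only: blinfun.add_right)
  ultimately show ?thesis unfolding hessian_form[OF assms] by (simp add: field_simps)
qed

text \<open>The input \<open>u\<close> is arbitrary, so the terminal stage can use the lemmas on
  stage functions at whatever input the sequence has at time \<open>T\<close>.\<close>

lemma terminal_as_stage:
  "TDx f x \<theta> = Dx (\<lambda>x u \<theta>. f x \<theta>) x u \<theta>" "TDxx f x \<theta> = Dxx (\<lambda>x u \<theta>. f x \<theta>) x u \<theta>"
  "TDxt f x \<theta> = Dxt (\<lambda>x u \<theta>. f x \<theta>) x u \<theta>"
  by (simp_all add: TDx_def TDxx_def TDxt_def Dx_def Dxx_def Dxt_def)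

text \<open>The Frobenius product column by column; this splits a trace cost into one quadratic
  expression for each parameter direction.\<close>

lemma trace_transpose_mult:
  fixes A B :: "real^'r^'n"
  shows "trace (transpose A ** B) = (\<Sum>j\<in>UNIV. (A *v axis j 1) \<bullet> (B *v axis j 1))"
  by (simp add: trace_def matrix_matrix_mult_def transpose_def matrix_vector_mul_component inner_vec_def
      matrix_vector_mult_basis column_def)

section \<open>Finitely supported input sequences\<close>

text \<open>The library knows completeness of \<open>bcontfun\<close> only over metric domains, so \<open>nat\<close> gets its metric.\<close>

instantiation nat :: metric_space
begin

definition dist_nat :: "nat \<Rightarrow> nat \<Rightarrow> real" where "dist_nat m n = \<bar>real m - real n\<bar>"

definition uniformity_nat :: "(nat \<times> nat) filter" where
  "uniformity_nat = (INF e\<in>{0<..}. principal {(x, y). dist x y < e})"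

instance
proof
  show "uniformity = (INF e\<in>{0<..}. principal {(x, y :: nat). dist x y < e})" by (rule uniformity_nat_def)
  have "\<forall>\<^sub>F (x', y) in uniformity. x' = x \<longrightarrow> y \<in> U" if "x \<in> U" for x :: nat and U
  proof -
    have "a = b" if "\<bar>real a - real b\<bar> < 1" for a b using that by linarith
    then have "eventually (\<lambda>(x', y). x' = x \<longrightarrow> y \<in> U) (principal {(x, y :: nat). dist x y < 1})"
      using that by (fastforce simp: eventually_principal dist_nat_def)
    then show ?thesis
      unfolding uniformity_nat_def by (rule eventually_INF1[rotated]) simp
  qed
  then show "open U \<longleftrightarrow> (\<forall>x\<in>U. \<forall>\<^sub>F (x', y) in uniformity. x' = x \<longrightarrow> y \<in> U)" for U :: "nat set"
    by (simp add: open_discrete)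
qed (auto simp: dist_nat_def)

end

instance bcontfun :: (metric_space, banach) banach ..

text \<open>Truncation to the first \<open>n\<close> entries makes any sequence bounded.\<close>

definition finseq :: "nat \<Rightarrow> (nat \<Rightarrow> 'b::real_normed_vector) \<Rightarrow> nat \<Rightarrow>\<^sub>C 'b" where
  "finseq n f = Bcontfun (\<lambda>t. if t < n then f t else 0)"

lemma finseq_apply [simp]: "apply_bcontfun (finseq n f) t = (if t < n then f t else 0)"
proof -
  have "range (\<lambda>t. if t < n then f t else 0) \<subseteq> insert 0 (f ` {..<n})" by auto
  then have "bounded (range (\<lambda>t. if t < n then f t else 0))"
    using finite_subset finite_imp_bounded by blast
  then have "(\<lambda>t. if t < n then f t else 0) \<in> bcontfun" by (simp add: bcontfun_def)
  then show ?thesis by (simp add: finseq_def Bcontfun_inverse)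
qed

lemma bounded_linear_eval: "bounded_linear (\<lambda>z :: nat \<Rightarrow>\<^sub>C 'b::real_normed_vector. apply_bcontfun z t)"
  by (rule bounded_linear_intro[where K = 1]) (simp_all add: plus_bcontfun.rep_eq scaleR_bcontfun.rep_eq norm_bounded)

lemma sum_bcontfun_apply: "apply_bcontfun (sum f A) t = (\<Sum>i\<in>A. apply_bcontfun (f i :: nat \<Rightarrow>\<^sub>C 'b::real_normed_vector) t)"
  using linear_sum[OF bounded_linear.linear[OF bounded_linear_eval]] by blast

definition unit_seq :: "nat \<Rightarrow> 'b::real_normed_vector \<Rightarrow> nat \<Rightarrow>\<^sub>C 'b" where
  "unit_seq t v = finseq (Suc t) (\<lambda>s. if s = t then v else 0)"

lemma unit_seq_apply [simp]: "apply_bcontfun (unit_seq t v) s = (if s = t then v else 0)"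
  by (simp add: unit_seq_def)

lemma biorthogonal_inputs:
  "biorthogonal ({..<T} \<times> UNIV) (\<lambda>(t, j::'m::finite). unit_seq t (axis j 1 :: real^'m))
     (\<lambda>(t, j). Blinfun (\<lambda>z. apply_bcontfun z t $ j))"
proof
  have 1: "bounded_linear (\<lambda>z :: nat \<Rightarrow>\<^sub>C (real^'m). apply_bcontfun z t $ j)" for t j
    by (rule bounded_linear_compose[OF bounded_linear_vec_nth bounded_linear_eval])
  show "(case k of (t, j) \<Rightarrow> Blinfun (\<lambda>z. apply_bcontfun z t $ j)) (case l of (t, j::'m) \<Rightarrow> unit_seq t (axis j 1 :: real^'m))
     = (if k = l then 1 else 0)" for k l
    by (cases k; cases l) (auto simp: bounded_linear_Blinfun_apply[OF 1] axis_def)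
qed auto

text \<open>Constraint indices are countable, so multiplier vectors can be stored as bounded
  sequences through \<open>to_nat\<close>.\<close>

lemma biorthogonal_multipliers:
  assumes "finite (A :: 'i::countable set)"
  shows "biorthogonal A (\<lambda>i. unit_seq (to_nat i) (1::real)) (\<lambda>i. Blinfun (\<lambda>y. apply_bcontfun y (to_nat i)))"
  using assms by unfold_locales (auto simp: bounded_linear_Blinfun_apply[OF bounded_linear_eval])

abbreviation "input_space T \<equiv> biorthogonal.S ({..<T} \<times> UNIV) (\<lambda>(t, j::'m::finite). unit_seq t (axis j 1 :: real^'m))
     (\<lambda>(t, j). Blinfun (\<lambda>z. apply_bcontfun z t $ j))"

lemma input_space_iff: "z \<in> input_space T \<longleftrightarrow> (\<forall>t\<ge>T. apply_bcontfun z t = (0 :: real^'m::finite))"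
proof -
  have 1: "bounded_linear (\<lambda>z :: nat \<Rightarrow>\<^sub>C (real^'m). apply_bcontfun z t $ j)" for t j
    by (rule bounded_linear_compose[OF bounded_linear_vec_nth bounded_linear_eval])
  let ?s = "\<Sum>k\<in>{..<T} \<times> UNIV. (case k of (t, j) \<Rightarrow> Blinfun (\<lambda>z. apply_bcontfun z t $ j)) z *\<^sub>R
      (case k of (t, j) \<Rightarrow> unit_seq t (axis j 1 :: real^'m))"
  have "apply_bcontfun ?s s = (if s < T then apply_bcontfun z s else 0)" for s
  proof -
    have "apply_bcontfun ?s s = (\<Sum>(t, j)\<in>{..<T} \<times> UNIV. if s = t then apply_bcontfun z t $ j *\<^sub>R axis j 1 else 0)"
      unfolding sum_bcontfun_apply
      by (intro sum.cong) (auto simp: bounded_linear_Blinfun_apply[OF 1] scaleR_bcontfun.rep_eq)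
    also have "\<dots> = (\<Sum>t<T. if s = t then apply_bcontfun z t else 0)"
      unfolding sum.cartesian_product[symmetric] by (intro sum.cong) (auto simp: vec_basis_sum)
    finally show ?thesis by simp
  qed
  moreover have "z = z' \<longleftrightarrow> (\<forall>s. apply_bcontfun z s = apply_bcontfun z' s)" for z' by (auto intro: bcontfun_eqI)
  ultimately have "z = ?s \<longleftrightarrow> (\<forall>s. apply_bcontfun z s = (if s < T then apply_bcontfun z s else 0))" by (simp only:)
  also have "\<dots> \<longleftrightarrow> (\<forall>t\<ge>T. apply_bcontfun z t = 0)" by (auto simp: not_less)
  finally show ?thesis
    unfolding biorthogonal.S_def[OF biorthogonal_inputs] by simp
qed

lemma dist_inputs_less:
  assumes "z \<in> input_space T" "z' \<in> input_space T" "\<epsilon> > 0"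
    "\<And>t. t < T \<Longrightarrow> dist (apply_bcontfun z' t) (apply_bcontfun z t :: real^'m::finite) < \<epsilon>"
  shows "dist z' z \<le> \<epsilon>"
proof (rule dist_bound)
  show "dist (apply_bcontfun z' t) (apply_bcontfun z t) \<le> \<epsilon>" for t
    using assms by (cases "t < T") (auto simp: input_space_iff less_imp_le)
qed

section \<open>Elimination of the states\<close>

locale control =
  fixes P :: "('n::finite, 'm::finite, 'r::finite) ocp" and T :: nat
  assumes smooth: "smooth_data P T"
begin

text \<open>Time \<open>T\<close> is treated as one more stage whose functions ignore the input.\<close>

definition stage_cost :: "nat \<Rightarrow> real^'n \<Rightarrow> real^'m \<Rightarrow> real^'r \<Rightarrow> real" where
  "stage_cost t = (if t < T then cst P t else (\<lambda>x u. cstT P x))"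

definition ineq :: "nat \<Rightarrow> nat \<Rightarrow> real^'n \<Rightarrow> real^'m \<Rightarrow> real^'r \<Rightarrow> real" where
  "ineq t i = (if t < T then gc P t i else (\<lambda>x u. gT P i x))"

definition equ :: "nat \<Rightarrow> nat \<Rightarrow> real^'n \<Rightarrow> real^'m \<Rightarrow> real^'r \<Rightarrow> real" where
  "equ t i = (if t < T then hc P t i else (\<lambda>x u. hT P i x))"

definition nI :: "nat \<Rightarrow> nat" where "nI t = (if t < T then nq P t else nqT P)"
definition nE :: "nat \<Rightarrow> nat" where "nE t = (if t < T then ns P t else nsT P)"

text \<open>Inequalities and equalities of all stages share one index type, \<open>Inl\<close> for
  the former and \<open>Inr\<close> for the latter, so that multipliers and active sets are families
  over a single set.\<close>

fun con :: "(nat \<times> nat) + (nat \<times> nat) \<Rightarrow> real^'n \<Rightarrow> real^'m \<Rightarrow> real^'r \<Rightarrow> real" where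
  "con (Inl (t, i)) = ineq t i"
| "con (Inr (t, i)) = equ t i"

fun con_time :: "(nat \<times> nat) + (nat \<times> nat) \<Rightarrow> nat" where
  "con_time (Inl (t, i)) = t"
| "con_time (Inr (t, i)) = t"

definition Ix :: "((nat \<times> nat) + (nat \<times> nat)) set" where "Ix = Inl ` (SIGMA t:{..T}. {..<nI t})"
definition Ex :: "((nat \<times> nat) + (nat \<times> nat)) set" where "Ex = Inr ` (SIGMA t:{..T}. {..<nE t})"

lemma finite_Ix: "finite Ix" and finite_Ex: "finite Ex"
  by (auto simp: Ix_def Ex_def)

lemma sum_Ix: "(\<Sum>k\<in>Ix. f k) = (\<Sum>t\<le>T. \<Sum>i<nI t. f (Inl (t, i)))" for f :: "_ \<Rightarrow> real"
  unfolding Ix_def by (subst sum.reindex) (auto simp: sum.Sigma o_def case_prod_unfold)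

lemma sum_Ex: "(\<Sum>k\<in>Ex. f k) = (\<Sum>t\<le>T. \<Sum>i<nE t. f (Inr (t, i)))" for f :: "_ \<Rightarrow> real"
  unfolding Ex_def by (subst sum.reindex) (auto simp: sum.Sigma o_def case_prod_unfold)

lemma sum_con: "(\<Sum>k\<in>Ix \<union> Ex. f k) = (\<Sum>t\<le>T. (\<Sum>i<nI t. f (Inl (t, i))) + (\<Sum>i<nE t. f (Inr (t, i))))"
  for f :: "_ \<Rightarrow> real"
  unfolding sum.distrib sum_Ix[symmetric] sum_Ex[symmetric]
  by (rule sum.union_disjoint[OF finite_Ix finite_Ex]) (auto simp: Ix_def Ex_def)

lemma C2_terminal:
  assumes "C2_on UNIV (\<lambda>(x, \<theta>). f x \<theta>)"
  shows "C2_on UNIV (uncurry3 (\<lambda>x (u::real^'m) \<theta>. f (x::real^'n) (\<theta>::real^'r)))"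
proof -
  have "bounded_linear (\<lambda>y :: (real^'n) \<times> (real^'m) \<times> (real^'r). (fst y, snd (snd y)))"
    by (intro bounded_linear_Pair bounded_linear_fst bounded_linear_compose[OF bounded_linear_snd bounded_linear_snd])
  from C2_on_compose[OF assms C2_on_linear[OF this open_UNIV]] show ?thesis
    by (simp add: case_prod_unfold)
qed

lemma
  shows C2_dyn: "C2_on UNIV (uncurry3 (dyn P))" and C2_init: "C2_on UNIV (init P)"
    and C2_cost: "t \<le> T \<Longrightarrow> C2_on UNIV (uncurry3 (stage_cost t))"
    and C2_ineq: "t \<le> T \<Longrightarrow> i < nI t \<Longrightarrow> C2_on UNIV (uncurry3 (ineq t i))"
    and C2_equ: "t \<le> T \<Longrightarrow> i < nE t \<Longrightarrow> C2_on UNIV (uncurry3 (equ t i))"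
  using smooth unfolding smooth_data_def stage_cost_def ineq_def equ_def nI_def nE_def
  by (auto intro!: Ck_on_3_C2 C2_terminal)

lemma C2_con: "k \<in> Ix \<union> Ex \<Longrightarrow> C2_on UNIV (uncurry3 (con k))"
  using C2_ineq C2_equ by (auto simp: Ix_def Ex_def)

section \<open>States as functions of inputs and parameter\<close>

primrec st :: "nat \<Rightarrow> (nat \<Rightarrow>\<^sub>C (real^'m)) \<times> (real^'r) \<Rightarrow> real^'n" where
  "st 0 q = init P (snd q)"
| "st (Suc t) q = dyn P (st t q) (apply_bcontfun (fst q) t) (snd q)"

definition pnt :: "nat \<Rightarrow> (nat \<Rightarrow>\<^sub>C (real^'m)) \<times> (real^'r) \<Rightarrow> (real^'n) \<times> (real^'m) \<times> (real^'r)" where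
  "pnt t q = (st t q, apply_bcontfun (fst q) t, snd q)"

lemma bounded_linear_input: "bounded_linear (\<lambda>q :: (nat \<Rightarrow>\<^sub>C (real^'m)) \<times> (real^'r). apply_bcontfun (fst q) t)"
  by (rule bounded_linear_compose[OF bounded_linear_eval bounded_linear_fst])

lemma C2_st: "C2_on UNIV (st t)"
proof (induction t)
  case 0
  have "st 0 = (\<lambda>q. init P (snd q))" by auto
  then show ?case using C2_on_compose[OF C2_init C2_on_linear[OF bounded_linear_snd open_UNIV]] by simp
next
  case (Suc t)
  have "C2_on UNIV (\<lambda>q. uncurry3 (dyn P) (pnt t q))"
    unfolding pnt_def
    by (intro C2_on_compose[OF C2_dyn] C2_on_Pair Suc C2_on_linear[OF bounded_linear_input]
        C2_on_linear[OF bounded_linear_snd] open_UNIV subset_UNIV)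
  moreover have "st (Suc t) = (\<lambda>q. uncurry3 (dyn P) (pnt t q))" by (simp add: fun_eq_iff pnt_def)
  ultimately show ?case by (simp only:)
qed

lemma C2_pnt: "C2_on UNIV (pnt t)"
  unfolding pnt_def[abs_def]
  by (intro C2_on_Pair C2_st C2_on_linear[OF bounded_linear_input] C2_on_linear[OF bounded_linear_snd] open_UNIV)

lemma st_differentiable: "st t differentiable (at q)" "fderiv (st t) differentiable (at q)"
  and pnt_differentiable: "pnt t differentiable (at q)" "fderiv (pnt t) differentiable (at q)"
  by (rule C1_on_differentiable[OF C2_on_C1[OF C2_st] UNIV_I] C1_on_differentiable[OF C2_on_fderiv[OF C2_st] UNIV_I]
      C1_on_differentiable[OF C2_on_C1[OF C2_pnt] UNIV_I] C1_on_differentiable[OF C2_on_fderiv[OF C2_pnt] UNIV_I])+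

lemma fderiv_pnt: "fderiv (pnt t) q a = (fderiv (st t) q a, apply_bcontfun (fst a) t, snd a)"
proof -
  have "(pnt t has_derivative (\<lambda>a. (fderiv (st t) q a, apply_bcontfun (fst a) t, snd a))) (at q)"
    unfolding pnt_def[abs_def]
    by (intro has_derivative_Pair fderiv_works[OF st_differentiable(1)] bounded_linear_imp_has_derivative
        bounded_linear_input bounded_linear_snd)
  from fderiv_eq[OF this] show ?thesis by simp
qed

lemma fderiv2_pnt: "fderiv (fderiv (pnt t)) q a b = (fderiv (fderiv (st t)) q a b, 0, 0)"
proof -
  have "((\<lambda>q. fderiv (pnt t) q b) has_derivative (\<lambda>a. (fderiv (fderiv (st t)) q a b, 0, 0))) (at q)"
    unfolding fderiv_pnt
    by (intro has_derivative_Pair fderiv_apply_const[OF st_differentiable(2)] has_derivative_const)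
  from fun_cong[OF has_derivative_unique[OF this fderiv_apply_const[OF pnt_differentiable(2)]], of a]
  show ?thesis by (rule sym)
qed

lemma fderiv_st_0: "fderiv (st 0) q a = fderiv (init P) (snd q) (snd a)"
proof -
  have "st 0 = (\<lambda>q. init P (snd q))" by auto
  then show ?thesis
    by (simp add: fderiv_compose[OF C1_on_differentiable[OF C2_on_C1[OF C2_init] UNIV_I] bounded_linear_imp_differentiable[OF bounded_linear_snd]]
        fderiv_eq[OF bounded_linear_imp_has_derivative[OF bounded_linear_snd]])
qed

lemma fderiv2_st_0: "fderiv (fderiv (st 0)) q (d, 0) b = 0" "fderiv (fderiv (st 0)) q a b = fderiv (fderiv (init P)) (snd q) (snd a) (snd b)"
proof -
  have "((\<lambda>q. fderiv (st 0) q b) has_derivative (\<lambda>a. fderiv (fderiv (init P)) (snd q) (snd a) (snd b))) (at q)" for b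
    unfolding fderiv_st_0
    by (rule has_derivative_compose[OF bounded_linear_imp_has_derivative[OF bounded_linear_snd]
          fderiv_apply_const[OF C1_on_differentiable[OF C2_on_fderiv[OF C2_init] UNIV_I]]])
  then have *: "fderiv (fderiv (st 0)) q a b = fderiv (fderiv (init P)) (snd q) (snd a) (snd b)" for a b
    using fun_cong[OF has_derivative_unique[OF _ fderiv_apply_const[OF st_differentiable(2)]]] by metis
  show "fderiv (fderiv (st 0)) q a b = fderiv (fderiv (init P)) (snd q) (snd a) (snd b)" by (rule *)
  show "fderiv (fderiv (st 0)) q (d, 0) b = 0" by (simp add: * blinfun.zero_right blinfun.zero_left)
qed

lemma fderiv_st_Suc:
  "fderiv (st (Suc t)) q a = fderiv (uncurry3 (dyn P)) (pnt t q) (fderiv (pnt t) q a)"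
proof -
  have "st (Suc t) = (\<lambda>q. uncurry3 (dyn P) (pnt t q))" by (simp add: fun_eq_iff pnt_def)
  then show ?thesis
    using fderiv_compose[OF C1_on_differentiable[OF C2_on_C1[OF C2_dyn] UNIV_I] pnt_differentiable(1)] by simp
qed

subsection \<open>Derivatives of total costs through Hamiltonians\<close>

text \<open>Time \<open>T\<close> has no successor state, so the last Hamiltonian is the stage
  function alone.\<close>

definition hamf :: "(nat \<Rightarrow> real^'n \<Rightarrow> real^'m \<Rightarrow> real^'r \<Rightarrow> real) \<Rightarrow> (nat \<Rightarrow> real^'n) \<Rightarrow> nat
    \<Rightarrow> real^'n \<Rightarrow> real^'m \<Rightarrow> real^'r \<Rightarrow> real" where
  "hamf l lam t x u \<theta> = l t x u \<theta> + (if t < T then lam (Suc t) \<bullet> dyn P x u \<theta> else 0)"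

lemma C2_hamf:
  assumes "C2_on W (uncurry3 (l t))" "open W"
  shows "C2_on W (uncurry3 (hamf l lam t))"
proof -
  have "C2_on W (\<lambda>y. uncurry3 (l t) y + (if t < T then lam (Suc t) \<bullet> uncurry3 (dyn P) y else 0))"
    using C2_on_subset[OF C2_on_linear_comp[OF bounded_linear_inner_right[of "lam (Suc t)"] C2_dyn open_UNIV] subset_UNIV, of W]
    by (cases "t < T") (auto intro!: C2_on_add assms C2_on_const)
  then show ?thesis unfolding hamf_def case_prod_unfold .
qed

definition total :: "(nat \<Rightarrow> real^'n \<Rightarrow> real^'m \<Rightarrow> real^'r \<Rightarrow> real) \<Rightarrow> (nat \<Rightarrow>\<^sub>C (real^'m)) \<times> (real^'r) \<Rightarrow> real" where
  "total l q = (\<Sum>t\<le>T. uncurry3 (l t) (pnt t q))"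

text \<open>The added costate terms equal the subtracted ones because \<open>st\<close> satisfies
  the dynamics. The identity holds for every \<open>lam\<close>, so a costate can be chosen at one
  point and kept fixed under differentiation.\<close>

lemma total_hamf: "total l q = (\<Sum>t\<le>T. uncurry3 (hamf l lam t) (pnt t q)) - (\<Sum>t<T. lam (Suc t) \<bullet> st (Suc t) q)"
proof -
  have "(\<Sum>t<T. lam (Suc t) \<bullet> st (Suc t) q) = (\<Sum>t\<le>T. if t < T then lam (Suc t) \<bullet> st (Suc t) q else 0)"
    unfolding lessThan_Suc_atMost[symmetric] by simp
  then show ?thesis
    unfolding total_def hamf_def pnt_def by (simp add: sum_subtractf[symmetric]) (intro sum.cong, auto)
qed

text \<open>The costate equation in weak form. It starts at time 1, so a contribution of the initial
  state survives in \<open>adjoint_telescope\<close>.\<close>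

definition adjoint :: "(nat \<Rightarrow> real^'n \<Rightarrow> real^'m \<Rightarrow> real^'r \<Rightarrow> real) \<Rightarrow> (nat \<Rightarrow>\<^sub>C (real^'m)) \<times> (real^'r) \<Rightarrow> (nat \<Rightarrow> real^'n) \<Rightarrow> bool" where
  "adjoint l q lam \<longleftrightarrow> (\<forall>t. 1 \<le> t \<and> t \<le> T \<longrightarrow> (\<forall>d. fderiv (uncurry3 (hamf l lam t)) (pnt t q) (d, 0, 0) = lam t \<bullet> d))"

text \<open>From time 1 on the costate equation cancels the state terms against the costate
  pairings. The remaining term at time 0 vanishes for variations of the inputs alone, as the initial
  state depends only on the parameter.\<close>

lemma adjoint_telescope:
  assumes "adjoint l q lam"
  shows "(\<Sum>t\<le>T. fderiv (uncurry3 (hamf l lam t)) (pnt t q) (\<xi> t, 0, 0)) - (\<Sum>t<T. lam (Suc t) \<bullet> \<xi> (Suc t))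
    = fderiv (uncurry3 (hamf l lam 0)) (pnt 0 q) (\<xi> 0, 0, 0)"
proof -
  have "(\<Sum>t<T. fderiv (uncurry3 (hamf l lam (Suc t))) (pnt (Suc t) q) (\<xi> (Suc t), 0, 0)) = (\<Sum>t<T. lam (Suc t) \<bullet> \<xi> (Suc t))"
    using assms by (intro sum.cong) (auto simp: adjoint_def)
  then show ?thesis unfolding lessThan_Suc_atMost[symmetric] sum.lessThan_Suc_shift by simp
qed

definition stage_dom :: "(nat \<Rightarrow> ((real^'n) \<times> (real^'m) \<times> (real^'r)) set) \<Rightarrow> ((nat \<Rightarrow>\<^sub>C (real^'m)) \<times> (real^'r)) set" where
  "stage_dom W = {q. \<forall>t\<le>T. pnt t q \<in> W t}"

context
  fixes l :: "nat \<Rightarrow> real^'n \<Rightarrow> real^'m \<Rightarrow> real^'r \<Rightarrow> real" and W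
  assumes l: "\<And>t. t \<le> T \<Longrightarrow> C2_on (W t) (uncurry3 (l t))" and W: "\<And>t. t \<le> T \<Longrightarrow> open (W t)"
begin

lemma open_stage_dom: "open (stage_dom W)"
proof -
  have "(stage_dom W) = (\<Inter>t\<in>{..T}. pnt t -` W t)" by (auto simp: stage_dom_def)
  moreover have "open (pnt t -` W t)" if "t \<le> T" for t
    by (rule open_vimage[OF W[OF that] C1_on_continuous[OF C2_on_C1[OF C2_pnt]]])
  ultimately show ?thesis by (simp add: open_INT)
qed

lemma C2_total: "C2_on (stage_dom W) (total l)"
  unfolding total_def[abs_def]
  by (intro C2_on_sum open_stage_dom C2_on_compose[OF l C2_on_subset[OF C2_pnt subset_UNIV]]) (auto simp: stage_dom_def)

lemma fderiv_total_hamf: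
  assumes q: "q \<in> (stage_dom W)"
  shows "fderiv (total l) q a = (\<Sum>t\<le>T. fderiv (uncurry3 (hamf l lam t)) (pnt t q) (fderiv (pnt t) q a))
      - (\<Sum>t<T. lam (Suc t) \<bullet> fderiv (st (Suc t)) q a)"
proof -
  have 1: "((\<lambda>q. uncurry3 (hamf l lam t) (pnt t q)) has_derivative
      (\<lambda>a. fderiv (uncurry3 (hamf l lam t)) (pnt t q) (fderiv (pnt t) q a))) (at q)" if t: "t \<in> {..T}" for t
    using q t by (intro has_derivative_compose[OF fderiv_works[OF pnt_differentiable(1)]]
        C1_on_has_derivative[OF C2_on_C1[OF C2_hamf[OF l W]]]) (auto simp: stage_dom_def)
  have 2: "((\<lambda>q. lam (Suc t) \<bullet> st (Suc t) q) has_derivative (\<lambda>a. lam (Suc t) \<bullet> fderiv (st (Suc t)) q a)) (at q)" for t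
    by (rule has_derivative_inner_right[OF fderiv_works[OF st_differentiable(1)]])
  have "(total l has_derivative (\<lambda>a. (\<Sum>t\<le>T. fderiv (uncurry3 (hamf l lam t)) (pnt t q) (fderiv (pnt t) q a))
      - (\<Sum>t<T. lam (Suc t) \<bullet> fderiv (st (Suc t)) q a))) (at q)"
    unfolding total_hamf[where l = l and lam = lam, abs_def] by (intro has_derivative_diff has_derivative_sum 1 2)
  from fderiv_eq[OF this] show ?thesis by simp
qed

lemma fderiv_total:
  assumes q: "q \<in> (stage_dom W)" and adj: "adjoint l q lam"
  shows "fderiv (total l) q a = (\<Sum>t\<le>T. fderiv (uncurry3 (hamf l lam t)) (pnt t q) (0, apply_bcontfun (fst a) t, snd a))
      + fderiv (uncurry3 (hamf l lam 0)) (pnt 0 q) (fderiv (st 0) q a, 0, 0)"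
proof -
  have split: "fderiv (uncurry3 (hamf l lam t)) (pnt t q) (fderiv (pnt t) q a)
     = fderiv (uncurry3 (hamf l lam t)) (pnt t q) (0, apply_bcontfun (fst a) t, snd a)
     + fderiv (uncurry3 (hamf l lam t)) (pnt t q) (fderiv (st t) q a, 0, 0)" for t
    unfolding blinfun.add_right[symmetric] fderiv_pnt by simp
  show ?thesis
    unfolding fderiv_total_hamf[OF q, of a lam] split sum.distrib
    using adjoint_telescope[OF adj, of "\<lambda>t. fderiv (st t) q a"] by linarith
qed

text \<open>Differentiating \<open>fderiv_total_hamf\<close> with \<open>lam\<close> frozen produces
  second derivatives of the states linearly, and these telescope away like the first derivatives.
  The Hessian is a sum of Hamiltonian Hessians along the linearized trajectory, plus the curvature
  of the initial state.\<close>

lemma fderiv2_total: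
  assumes q: "q \<in> (stage_dom W)" and adj: "adjoint l q lam"
  shows "fderiv (fderiv (total l)) q a b
     = (\<Sum>t\<le>T. fderiv (fderiv (uncurry3 (hamf l lam t))) (pnt t q) (fderiv (pnt t) q a) (fderiv (pnt t) q b))
      + fderiv (uncurry3 (hamf l lam 0)) (pnt 0 q) (fderiv (fderiv (st 0)) q a b, 0, 0)"
proof -
  let ?H = "\<lambda>t. uncurry3 (hamf l lam t)"
  have HC2: "C2_on (W t) (?H t)" if "t \<le> T" for t by (rule C2_hamf[OF l W]) (use that in auto)
  have pW: "pnt t q \<in> W t" if "t \<le> T" for t using q that by (simp add: stage_dom_def)
  have 1: "((\<lambda>q. fderiv (?H t) (pnt t q) (fderiv (pnt t) q b)) has_derivative
      (\<lambda>a. fderiv (?H t) (pnt t q) (fderiv (fderiv (pnt t)) q a b)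
        + fderiv (fderiv (?H t)) (pnt t q) (fderiv (pnt t) q a) (fderiv (pnt t) q b))) (at q)" if t: "t \<in> {..T}" for t
    using t by (intro bounded_bilinear.FDERIV[OF bounded_bilinear_blinfun_apply] fderiv_apply_const[OF pnt_differentiable(2)]
      has_derivative_compose[OF fderiv_works[OF pnt_differentiable(1)] C1_on_has_derivative[OF C2_on_fderiv[OF HC2]]] pW) auto
  have 2: "((\<lambda>q. lam (Suc t) \<bullet> fderiv (st (Suc t)) q b) has_derivative (\<lambda>a. lam (Suc t) \<bullet> fderiv (fderiv (st (Suc t))) q a b)) (at q)" for t
    by (rule has_derivative_inner_right[OF fderiv_apply_const[OF st_differentiable(2)]])
  have "((\<lambda>q. (\<Sum>t\<le>T. fderiv (?H t) (pnt t q) (fderiv (pnt t) q b)) - (\<Sum>t<T. lam (Suc t) \<bullet> fderiv (st (Suc t)) q b))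
     has_derivative (\<lambda>a. (\<Sum>t\<le>T. fderiv (?H t) (pnt t q) (fderiv (fderiv (pnt t)) q a b)
        + fderiv (fderiv (?H t)) (pnt t q) (fderiv (pnt t) q a) (fderiv (pnt t) q b))
        - (\<Sum>t<T. lam (Suc t) \<bullet> fderiv (fderiv (st (Suc t))) q a b))) (at q)"
    by (intro has_derivative_diff has_derivative_sum 1 2)
  then have "((\<lambda>q. fderiv (total l) q b)
     has_derivative (\<lambda>a. (\<Sum>t\<le>T. fderiv (?H t) (pnt t q) (fderiv (fderiv (pnt t)) q a b)
        + fderiv (fderiv (?H t)) (pnt t q) (fderiv (pnt t) q a) (fderiv (pnt t) q b))
        - (\<Sum>t<T. lam (Suc t) \<bullet> fderiv (fderiv (st (Suc t))) q a b))) (at q)"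
    by (rule has_derivative_transform_within_open[OF _ open_stage_dom q]) (simp add: fderiv_total_hamf[of _ _ lam])
  from fun_cong[OF has_derivative_unique[OF this
    fderiv_apply_const[OF C1_on_differentiable[OF C2_on_fderiv[OF C2_total] q]]], of a]
  show ?thesis
    using adjoint_telescope[OF adj, of "\<lambda>t. fderiv (fderiv (st t)) q a b"]
    unfolding fderiv2_pnt sum.distrib by linarith
qed

end

lemma adjoint_exists: "\<exists>lam. adjoint l q lam"
proof -
  define gx where "gx f t = (\<chi> j. fderiv f (pnt t q) (axis j 1, 0, 0))" for f :: "(real^'n) \<times> (real^'m) \<times> (real^'r) \<Rightarrow> real" and t
  \<comment> \<open>The costate with \<open>k\<close> stages to go: the recursion runs backwards
    from \<open>T\<close>.\<close>
  define \<nu> where "\<nu> = rec_nat (gx (uncurry3 (l T)) T)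
    (\<lambda>k v. gx (\<lambda>y. uncurry3 (l (T - Suc k)) y + v \<bullet> uncurry3 (dyn P) y) (T - Suc k))"
  define lam where "lam t = \<nu> (T - t)" for t
  have lam: "lam t = gx (uncurry3 (hamf l lam t)) t" if "t \<le> T" for t
  proof (cases "t < T")
    case True
    have eq: "T - t = Suc (T - Suc t)" "T - Suc (T - Suc t) = t" using True by auto
    have "lam t = gx (\<lambda>y. uncurry3 (l t) y + lam (Suc t) \<bullet> uncurry3 (dyn P) y) t"
      unfolding lam_def eq(1) unfolding \<nu>_def by (simp add: True eq(2))
    then show ?thesis using True by (simp add: hamf_def case_prod_unfold)
  next
    case False
    then have "t = T" using that by simp
    then show ?thesis by (simp add: lam_def \<nu>_def hamf_def case_prod_unfold)
  qed
  have "fderiv (uncurry3 (hamf l lam t)) (pnt t q) (d, 0, 0) = lam t \<bullet> d" if "t \<le> T" for t d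
  proof -
    have "lam t \<bullet> d = d \<bullet> lam t" by (rule inner_commute)
    also have "\<dots> = d \<bullet> gx (uncurry3 (hamf l lam t)) t" by (rule arg_cong[OF lam[OF that]])
    also have "\<dots> = fderiv (uncurry3 (hamf l lam t)) (pnt t q) (d, 0, 0)"
      unfolding gx_def by (rule inner_vec_lambda_linear[OF linear_slots(1)])
    finally show ?thesis by (rule sym)
  qed
  then show ?thesis by (auto simp: adjoint_def)
qed

end

section \<open>The reduced nonlinear program\<close>

lemma linear_eqI_inner: "(\<And>d. a \<bullet> d = 0) \<Longrightarrow> a = (0 :: 'a::real_inner)"
  using inner_eq_zero_iff by blast

context control
begin

definition red_con :: "(nat \<times> nat) + (nat \<times> nat) \<Rightarrow> (nat \<Rightarrow>\<^sub>C (real^'m)) \<times> (real^'r) \<Rightarrow> real" where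
  "red_con k q = uncurry3 (con k) (pnt (con_time k) q)"

text \<open>The weight \<kappa> = 1 gives the Lagrangian; \<kappa> = 0 gives a combination of
  constraints alone, as needed for linear independence.\<close>

definition comb :: "real \<Rightarrow> ((nat \<times> nat) + (nat \<times> nat) \<Rightarrow> real) \<Rightarrow> nat \<Rightarrow> real^'n \<Rightarrow> real^'m \<Rightarrow> real^'r \<Rightarrow> real" where
  "comb \<kappa> m t x u \<theta> = \<kappa> * stage_cost t x u \<theta> + (\<Sum>i<nI t. m (Inl (t, i)) * ineq t i x u \<theta>)
     + (\<Sum>i<nE t. m (Inr (t, i)) * equ t i x u \<theta>)"

lemma comb_uncurry: "uncurry3 (comb \<kappa> m t) = (\<lambda>y. \<kappa> * uncurry3 (stage_cost t) y
    + (\<Sum>i<nI t. m (Inl (t, i)) * uncurry3 (ineq t i) y) + (\<Sum>i<nE t. m (Inr (t, i)) * uncurry3 (equ t i) y))"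
  by (simp add: comb_def fun_eq_iff)

lemma C2_comb: "t \<le> T \<Longrightarrow> C2_on UNIV (uncurry3 (comb \<kappa> m t))"
  unfolding comb_uncurry by (intro C2_on_add C2_on_sum C2_on_cmult C2_cost C2_ineq C2_equ open_UNIV) auto

lemma total_comb: "total (comb \<kappa> m) q = \<kappa> * total stage_cost q + (\<Sum>k\<in>Ix \<union> Ex. m k * red_con k q)"
  unfolding sum_con total_def comb_uncurry red_con_def
  by (simp add: sum.distrib sum_distrib_left)

lemma C2_stage_total: "C2_on UNIV (total stage_cost)"
  using C2_total[of "\<lambda>_. UNIV" stage_cost] C2_cost by (simp add: stage_dom_def)

lemma C2_red_con: "k \<in> Ix \<union> Ex \<Longrightarrow> C2_on UNIV (red_con k)"
  unfolding red_con_def[abs_def] by (rule C2_on_compose[OF C2_con C2_pnt]) auto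

lemma fderiv_total_comb:
  "fderiv (total (comb \<kappa> m)) q a = \<kappa> * fderiv (total stage_cost) q a + (\<Sum>k\<in>Ix \<union> Ex. m k * fderiv (red_con k) q a)"
proof -
  have "(total (comb \<kappa> m) has_derivative (\<lambda>a. \<kappa> * fderiv (total stage_cost) q a + (\<Sum>k\<in>Ix \<union> Ex. m k * fderiv (red_con k) q a))) (at q)"
    unfolding total_comb[abs_def]
    by (intro has_derivative_add has_derivative_sum has_derivative_mult_right C1_on_has_derivative[OF C2_on_C1[OF C2_stage_total]]
        C1_on_has_derivative[OF C2_on_C1[OF C2_red_con]] UNIV_I)
  from fderiv_eq[OF this] show ?thesis by simp
qed

lemma C2_total_comb: "C2_on UNIV (total (comb \<kappa> m))"
  unfolding total_comb[abs_def]
  by (intro C2_on_add C2_on_sum C2_on_cmult C2_stage_total C2_red_con open_UNIV)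

lemma fderiv2_total_comb:
  "fderiv (fderiv (total (comb \<kappa> m))) q a b
     = \<kappa> * fderiv (fderiv (total stage_cost)) q a b + (\<Sum>k\<in>Ix \<union> Ex. m k * fderiv (fderiv (red_con k)) q a b)"
proof -
  have "((\<lambda>q. fderiv (total (comb \<kappa> m)) q b) has_derivative
     (\<lambda>a. \<kappa> * fderiv (fderiv (total stage_cost)) q a b + (\<Sum>k\<in>Ix \<union> Ex. m k * fderiv (fderiv (red_con k)) q a b))) (at q)"
    unfolding fderiv_total_comb
    by (intro has_derivative_add has_derivative_sum has_derivative_mult_right
        fderiv_apply_const[OF C1_on_differentiable[OF C2_on_fderiv[OF C2_stage_total]]]
        fderiv_apply_const[OF C1_on_differentiable[OF C2_on_fderiv[OF C2_red_con]]] UNIV_I)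
  from fun_cong[OF has_derivative_unique[OF this
     fderiv_apply_const[OF C1_on_differentiable[OF C2_on_fderiv[OF C2_total_comb] UNIV_I]]], of a]
  show ?thesis by (rule sym)
qed

lemma fderiv_hamf_comb:
  assumes t: "t \<le> T"
  shows "fderiv (uncurry3 (hamf (comb \<kappa> m) lam t)) y v = \<kappa> * fderiv (uncurry3 (stage_cost t)) y v
     + (\<Sum>i<nI t. m (Inl (t, i)) * fderiv (uncurry3 (ineq t i)) y v)
     + (\<Sum>i<nE t. m (Inr (t, i)) * fderiv (uncurry3 (equ t i)) y v)
     + (if t < T then lam (Suc t) \<bullet> fderiv (uncurry3 (dyn P)) y v else 0)"
proof -
  note D = C1_on_has_derivative[OF C2_on_C1 UNIV_I]
  have 1: "((\<lambda>y. if t < T then lam (Suc t) \<bullet> uncurry3 (dyn P) y else 0) has_derivative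
     (\<lambda>v. if t < T then lam (Suc t) \<bullet> fderiv (uncurry3 (dyn P)) y v else 0)) (at y)"
    using has_derivative_inner_right[OF D[OF C2_dyn]] by (cases "t < T") auto
  have eq: "uncurry3 (hamf (comb \<kappa> m) lam t) = (\<lambda>y. (\<kappa> * uncurry3 (stage_cost t) y
    + (\<Sum>i<nI t. m (Inl (t, i)) * uncurry3 (ineq t i) y) + (\<Sum>i<nE t. m (Inr (t, i)) * uncurry3 (equ t i) y))
    + (if t < T then lam (Suc t) \<bullet> uncurry3 (dyn P) y else 0))"
    by (simp add: hamf_def comb_def fun_eq_iff)
  have "(uncurry3 (hamf (comb \<kappa> m) lam t) has_derivative (\<lambda>v. (\<kappa> * fderiv (uncurry3 (stage_cost t)) y v
     + (\<Sum>i<nI t. m (Inl (t, i)) * fderiv (uncurry3 (ineq t i)) y v)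
     + (\<Sum>i<nE t. m (Inr (t, i)) * fderiv (uncurry3 (equ t i)) y v))
     + (if t < T then lam (Suc t) \<bullet> fderiv (uncurry3 (dyn P)) y v else 0))) (at y)"
    unfolding eq
    by (intro has_derivative_add[OF _ 1] has_derivative_add has_derivative_sum has_derivative_mult_right D C2_cost C2_ineq C2_equ t)
       auto
  from fderiv_eq[OF this] show ?thesis by simp
qed

sublocale data: nlp_data "{..<T} \<times> (UNIV :: 'm set)" "\<lambda>(t, j). unit_seq t (axis j 1 :: real^'m)"
  "\<lambda>(t, j). Blinfun (\<lambda>z. apply_bcontfun z t $ j)" "Ix \<union> Ex"
  "\<lambda>i. unit_seq (to_nat i) (1::real)" "\<lambda>i. Blinfun (\<lambda>y. apply_bcontfun y (to_nat i))" Ix Ex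
  "total stage_cost" red_con
proof -
  interpret Z: biorthogonal "{..<T} \<times> (UNIV :: 'm set)" "\<lambda>(t, j). unit_seq t (axis j 1 :: real^'m)"
     "\<lambda>(t, j). Blinfun (\<lambda>z. apply_bcontfun z t $ j)" by (rule biorthogonal_inputs)
  interpret Y: biorthogonal "Ix \<union> Ex" "\<lambda>i. unit_seq (to_nat i) (1::real)" "\<lambda>i. Blinfun (\<lambda>y. apply_bcontfun y (to_nat i))"
    by (rule biorthogonal_multipliers) (simp add: finite_Ix finite_Ex)
  show "nlp_data ({..<T} \<times> (UNIV :: 'm set)) (\<lambda>(t, j). unit_seq t (axis j 1 :: real^'m))
     (\<lambda>(t, j). Blinfun (\<lambda>z. apply_bcontfun z t $ j)) (Ix \<union> Ex)
     (\<lambda>i. unit_seq (to_nat i) (1::real)) (\<lambda>i. Blinfun (\<lambda>y. apply_bcontfun y (to_nat i))) Ix Ex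
     (total stage_cost) red_con"
    by unfold_locales (auto simp: Ix_def Ex_def C2_stage_total intro: C2_red_con)
qed

lemma unit_seq_input: "t < T \<Longrightarrow> unit_seq t e \<in> data.Z.S"
  by (simp add: input_space_iff)

lemma finseq_input: "finseq T u \<in> data.Z.S"
  by (simp add: input_space_iff)

lemma finseq_of_input: "z \<in> data.Z.S \<Longrightarrow> finseq T (apply_bcontfun z) = z"
  by (rule bcontfun_eqI) (simp add: input_space_iff)

lemma dyn_feas_iff: "dyn_feas P T \<theta> x u \<longleftrightarrow> (\<forall>t\<le>T. x t = st t (finseq T u, \<theta>))"
proof
  assume x: "dyn_feas P T \<theta> x u"
  have "t \<le> T \<longrightarrow> x t = st t (finseq T u, \<theta>)" for t
    using x by (induction t) (auto simp: dyn_feas_def)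
  then show "\<forall>t\<le>T. x t = st t (finseq T u, \<theta>)" by blast
next
  assume "\<forall>t\<le>T. x t = st t (finseq T u, \<theta>)"
  then show "dyn_feas P T \<theta> x u" by (auto simp: dyn_feas_def)
qed

lemma all_con_iff:
  "(\<forall>k\<in>Ix. R (red_con k q)) \<longleftrightarrow> (\<forall>t<T. \<forall>i<nq P t. R (gc P t i (st t q) (apply_bcontfun (fst q) t) (snd q)))
     \<and> (\<forall>i<nqT P. R (gT P i (st T q) (snd q)))" (is "?l \<longleftrightarrow> ?r")
  "(\<forall>k\<in>Ex. R (red_con k q)) \<longleftrightarrow> (\<forall>t<T. \<forall>i<ns P t. R (hc P t i (st t q) (apply_bcontfun (fst q) t) (snd q)))
     \<and> (\<forall>i<nsT P. R (hT P i (st T q) (snd q)))"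
proof -
  have 1: "(\<forall>k\<in>Ix. R (red_con k q)) \<longleftrightarrow> (\<forall>t\<le>T. \<forall>i<nI t. R (uncurry3 (ineq t i) (pnt t q)))"
    "(\<forall>k\<in>Ex. R (red_con k q)) \<longleftrightarrow> (\<forall>t\<le>T. \<forall>i<nE t. R (uncurry3 (equ t i) (pnt t q)))"
    by (auto simp: Ix_def Ex_def red_con_def)
  have 2: "(\<forall>t\<le>T. Q t) \<longleftrightarrow> (\<forall>t<T. Q t) \<and> Q T" for Q by (auto simp: le_less)
  show "?l \<longleftrightarrow> ?r" "(\<forall>k\<in>Ex. R (red_con k q)) \<longleftrightarrow> (\<forall>t<T. \<forall>i<ns P t. R (hc P t i (st t q) (apply_bcontfun (fst q) t) (snd q)))
     \<and> (\<forall>i<nsT P. R (hT P i (st T q) (snd q)))"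
    unfolding 1 2 by (simp_all add: nI_def nE_def ineq_def equ_def pnt_def)
qed

end

section \<open>Translation of the hypotheses at the reference trajectory\<close>

locale reference = control P T
  for P :: "('n::finite, 'm::finite, 'r::finite) ocp" and T +
  fixes \<theta>b :: "real^'r" and xb :: "nat \<Rightarrow> real^'n" and ub :: "nat \<Rightarrow> real^'m"
    and lamb :: "nat \<Rightarrow> real^'n" and vb wb :: "nat \<Rightarrow> nat \<Rightarrow> real"
  assumes sosc: "SOSC P T \<theta>b xb ub lamb vb wb"
    and licq: "LICQ P T \<theta>b xb ub"
    and sc: "strict_compl P T \<theta>b xb ub vb"
begin

definition zb :: "nat \<Rightarrow>\<^sub>C (real^'m)" where "zb = finseq T ub"
definition qb :: "(nat \<Rightarrow>\<^sub>C (real^'m)) \<times> (real^'r)" where "qb = (zb, \<theta>b)"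
definition mult :: "(nat \<times> nat) + (nat \<times> nat) \<Rightarrow> real" where "mult = case_sum (\<lambda>(t, i). vb t i) (\<lambda>(t, i). wb t i)"

lemma kkt: "KKT P T \<theta>b xb ub lamb vb wb" using sosc by (simp add: SOSC_def)

lemma st_qb: "t \<le> T \<Longrightarrow> st t qb = xb t"
  using kkt dyn_feas_iff[of \<theta>b xb ub] by (simp add: KKT_def B_feas_def qb_def zb_def)

lemma qb_simps: "snd qb = \<theta>b" "t < T \<Longrightarrow> apply_bcontfun (fst qb) t = ub t"
  by (simp_all add: qb_def zb_def)

text \<open>At time \<open>T\<close> the input coordinate is 0 because \<open>finseq T\<close> cuts
  off there.\<close>

lemma pnt_qb: "t < T \<Longrightarrow> pnt t qb = (xb t, ub t, \<theta>b)" "pnt T qb = (xb T, 0, \<theta>b)"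
  using st_qb by (simp_all add: pnt_def) (simp_all add: qb_def zb_def)

lemma hamf_mult: "t < T \<Longrightarrow> hamf (comb 1 mult) lamb t = ham P t (lamb (Suc t)) (vb t) (wb t)"
  "hamf (comb 1 mult) lamb T = (\<lambda>x u. hamT P (vb T) (wb T) x)"
  by (simp_all add: fun_eq_iff hamf_def comb_def ham_def hamT_def mult_def stage_cost_def ineq_def equ_def nI_def nE_def algebra_simps)

lemma C2_hamf_comb: "t \<le> T \<Longrightarrow> C2_on UNIV (uncurry3 (hamf (comb \<kappa> m) lam t))"
  by (rule C2_hamf[OF _ open_UNIV]) (rule C2_comb)

lemma hamf_comb_differentiable: "t \<le> T \<Longrightarrow> uncurry3 (hamf (comb \<kappa> m) lam t) differentiable (at y)"
  using C1_on_differentiable[OF C2_on_C1[OF C2_hamf_comb] UNIV_I] .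

lemma adjoint_mult: "adjoint (comb 1 mult) qb lamb"
  unfolding adjoint_def
proof (intro allI impI)
  fix t d assume t: "1 \<le> t \<and> t \<le> T"
  show "fderiv (uncurry3 (hamf (comb 1 mult) lamb t)) (pnt t qb) (d, 0, 0) = lamb t \<bullet> d"
  proof (cases "t < T")
    case True
    then have "lamb t = Dx (hamf (comb 1 mult) lamb t) (xb t) (ub t) \<theta>b"
      using kkt t by (simp add: KKT_def hamf_mult)
    then show ?thesis
      using Dx_inner[OF hamf_comb_differentiable, of t 1 mult lamb "xb t" "ub t" \<theta>b d] t by (simp add: pnt_qb True)
  next
    case False
    then have [simp]: "t = T" using t by simp
    have "lamb T = Dx (hamf (comb 1 mult) lamb T) (xb T) 0 \<theta>b"
      using kkt by (simp add: KKT_def hamf_mult terminal_as_stage(1)[where u = "0 :: real^'m"])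
    then show ?thesis
      using Dx_inner[OF hamf_comb_differentiable, of T 1 mult lamb "xb T" 0 \<theta>b d] by (simp add: pnt_qb)
  qed
qed

lemma in_dom: "q \<in> stage_dom (\<lambda>_. UNIV)" by (simp add: stage_dom_def)

text \<open>A variation of the inputs leaves the initial state fixed and vanishes at time
  \<open>T\<close>, so only the input derivatives of the Hamiltonians before \<open>T\<close>
  survive.\<close>

lemma fderiv_comb_input:
  assumes adj: "adjoint (comb \<kappa> m) qb lam" and d: "d \<in> data.Z.S"
  shows "fderiv (total (comb \<kappa> m)) qb (d, 0)
    = (\<Sum>t<T. fderiv (uncurry3 (hamf (comb \<kappa> m) lam t)) (pnt t qb) (0, apply_bcontfun d t, 0))"
proof -
  have dT: "apply_bcontfun d T = 0" using d by (simp add: input_space_iff)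
  have st0: "fderiv (st 0) qb (d, 0) = 0" by (simp add: fderiv_st_0 blinfun.zero_right)
  have "fderiv (total (comb \<kappa> m)) qb (d, 0)
    = (\<Sum>t\<le>T. fderiv (uncurry3 (hamf (comb \<kappa> m) lam t)) (pnt t qb) (0, apply_bcontfun (fst (d, 0::real^'r)) t, snd (d, 0::real^'r)))
      + fderiv (uncurry3 (hamf (comb \<kappa> m) lam 0)) (pnt 0 qb) (fderiv (st 0) qb (d, 0), 0, 0)"
    by (rule fderiv_total[where W = "\<lambda>_. UNIV", OF _ open_UNIV in_dom adj]) (rule C2_comb)
  then show ?thesis
    unfolding lessThan_Suc_atMost[symmetric] sum.lessThan_Suc
    by (simp add: dT st0 zero_prod_def[symmetric] blinfun.zero_right)
qed

lemma stationary_mult: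
  assumes "d \<in> data.Z.S"
  shows "fderiv (total stage_cost) qb (d, 0) + (\<Sum>k\<in>Ix \<union> Ex. mult k * fderiv (red_con k) qb (d, 0)) = 0"
proof -
  have "fderiv (uncurry3 (hamf (comb 1 mult) lamb t)) (pnt t qb) (0, apply_bcontfun d t, 0) = 0" if t: "t < T" for t
  proof -
    have "Du (hamf (comb 1 mult) lamb t) (xb t) (ub t) \<theta>b = 0" using kkt t by (simp add: KKT_def hamf_mult)
    then show ?thesis
      using Du_inner[OF hamf_comb_differentiable, of t 1 mult lamb "xb t" "ub t" \<theta>b "apply_bcontfun d t"] t by (simp add: pnt_qb)
  qed
  then show ?thesis
    using fderiv_comb_input[OF adjoint_mult assms] fderiv_total_comb[of 1 mult qb "(d, 0)"] by simp
qed

lemma fderiv_red_con: "k \<in> Ix \<union> Ex \<Longrightarrow>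
    fderiv (red_con k) qb a = fderiv (uncurry3 (con k)) (pnt (con_time k) qb) (fderiv (pnt (con_time k)) qb a)"
  unfolding red_con_def[abs_def]
  by (rule fderiv_compose[OF C1_on_differentiable[OF C2_on_C1[OF C2_con] UNIV_I] pnt_differentiable(1)])

lemma red_con_stage:
  "t < T \<Longrightarrow> i < nq P t \<Longrightarrow> Inl (t, i) \<in> Ix \<and> red_con (Inl (t, i)) qb = gc P t i (xb t) (ub t) \<theta>b"
  "i < nqT P \<Longrightarrow> Inl (T, i) \<in> Ix \<and> red_con (Inl (T, i)) qb = gT P i (xb T) \<theta>b"
  "t < T \<Longrightarrow> i < ns P t \<Longrightarrow> Inr (t, i) \<in> Ex \<and> red_con (Inr (t, i)) qb = hc P t i (xb t) (ub t) \<theta>b"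
  "i < nsT P \<Longrightarrow> Inr (T, i) \<in> Ex \<and> red_con (Inr (T, i)) qb = hT P i (xb T) \<theta>b"
  by (auto simp: Ix_def Ex_def red_con_def pnt_qb ineq_def equ_def nI_def nE_def)

lemma Dx_con:
  "t < T \<Longrightarrow> i < nq P t \<Longrightarrow> Dx (gc P t i) (xb t) (ub t) \<theta>b \<bullet> d + Du (gc P t i) (xb t) (ub t) \<theta>b \<bullet> e
     = fderiv (uncurry3 (ineq t i)) (pnt t qb) (d, e, 0)"
  "i < nqT P \<Longrightarrow> TDx (gT P i) (xb T) \<theta>b \<bullet> d = fderiv (uncurry3 (ineq T i)) (pnt T qb) (d, 0, 0)"
  "t < T \<Longrightarrow> i < ns P t \<Longrightarrow> Dx (hc P t i) (xb t) (ub t) \<theta>b \<bullet> d + Du (hc P t i) (xb t) (ub t) \<theta>b \<bullet> e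
     = fderiv (uncurry3 (equ t i)) (pnt t qb) (d, e, 0)"
  "i < nsT P \<Longrightarrow> TDx (hT P i) (xb T) \<theta>b \<bullet> d = fderiv (uncurry3 (equ T i)) (pnt T qb) (d, 0, 0)"
proof -
  have *: "Dx f x u \<theta> \<bullet> d + Du f x u \<theta> \<bullet> e = fderiv (uncurry3 f) (x, u, \<theta>) (d, e, 0)"
    if "C2_on UNIV (uncurry3 f)" for f :: "real^'n \<Rightarrow> real^'m \<Rightarrow> real^'r \<Rightarrow> real" and x u \<theta> e
    unfolding Dx_inner[OF C1_on_differentiable[OF C2_on_C1[OF that] UNIV_I]] Du_inner[OF C1_on_differentiable[OF C2_on_C1[OF that] UNIV_I]]
    by (simp add: blinfun.add_right[symmetric])
  show "Dx (gc P t i) (xb t) (ub t) \<theta>b \<bullet> d + Du (gc P t i) (xb t) (ub t) \<theta>b \<bullet> e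
     = fderiv (uncurry3 (ineq t i)) (pnt t qb) (d, e, 0)" if "t < T" "i < nq P t"
    using *[OF C2_ineq[of t i]] that by (simp add: pnt_qb ineq_def nI_def)
  show "Dx (hc P t i) (xb t) (ub t) \<theta>b \<bullet> d + Du (hc P t i) (xb t) (ub t) \<theta>b \<bullet> e
     = fderiv (uncurry3 (equ t i)) (pnt t qb) (d, e, 0)" if "t < T" "i < ns P t"
    using *[OF C2_equ[of t i]] that by (simp add: pnt_qb equ_def nE_def)
  show "TDx (gT P i) (xb T) \<theta>b \<bullet> d = fderiv (uncurry3 (ineq T i)) (pnt T qb) (d, 0, 0)" if "i < nqT P"
    using *[OF C2_ineq[of T i], of "xb T" 0 \<theta>b 0] that by (simp add: pnt_qb ineq_def nI_def terminal_as_stage(1)[where u = "0 :: real^'m"])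
  show "TDx (hT P i) (xb T) \<theta>b \<bullet> d = fderiv (uncurry3 (equ T i)) (pnt T qb) (d, 0, 0)" if "i < nsT P"
    using *[OF C2_equ[of T i], of "xb T" 0 \<theta>b 0] that by (simp add: pnt_qb equ_def nE_def terminal_as_stage(1)[where u = "0 :: real^'m"])
qed

text \<open>By \<open>fderiv2_total\<close> with the KKT costates, the reduced Hessian of the
  Lagrangian is the quadratic form in \<open>SOSC\<close>, evaluated on the linearized trajectory
  \<open>dx\<close>, \<open>du\<close>. This trajectory is admissible there because every active
  constraint has derivative 0 along it.\<close>

lemma second_order_mult:
  assumes d: "d \<in> data.Z.S" "d \<noteq> 0"
    and active: "\<And>k. k \<in> Ix \<union> Ex \<Longrightarrow> red_con k qb = 0 \<Longrightarrow> fderiv (red_con k) qb (d, 0) = 0"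
  shows "fderiv (fderiv (total stage_cost)) qb (d, 0) (d, 0)
    + (\<Sum>k\<in>Ix \<union> Ex. mult k * fderiv (fderiv (red_con k)) qb (d, 0) (d, 0)) > 0"
proof -
  define dx where "dx t = fderiv (st t) qb (d, 0)" for t
  define du where "du t = apply_bcontfun d t" for t
  have dT: "du T = 0" using d by (simp add: input_space_iff du_def)
  have pd: "fderiv (pnt t) qb (d, 0) = (dx t, du t, 0)" for t by (simp add: fderiv_pnt dx_def du_def)
  let ?H = "\<lambda>t. uncurry3 (hamf (comb 1 mult) lamb t)"
  have "fderiv (fderiv (total (comb 1 mult))) qb (d, 0) (d, 0)
     = (\<Sum>t\<le>T. fderiv (fderiv (?H t)) (pnt t qb) (dx t, du t, 0) (dx t, du t, 0))"
  proof -
    have "fderiv (fderiv (total (comb 1 mult))) qb (d, 0) (d, 0)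
      = (\<Sum>t\<le>T. fderiv (fderiv (?H t)) (pnt t qb) (fderiv (pnt t) qb (d, 0)) (fderiv (pnt t) qb (d, 0)))
        + fderiv (?H 0) (pnt 0 qb) (fderiv (fderiv (st 0)) qb (d, 0) (d, 0), 0, 0)"
      by (rule fderiv2_total[where W = "\<lambda>_. UNIV", OF _ open_UNIV in_dom adjoint_mult]) (rule C2_comb)
    then show ?thesis
      unfolding pd fderiv2_st_0(1) by (simp add: zero_prod_def[symmetric] blinfun.zero_right)
  qed
  also have "\<dots> = (\<Sum>t<T. fderiv (fderiv (?H t)) (pnt t qb) (dx t, du t, 0) (dx t, du t, 0))
      + fderiv (fderiv (?H T)) (pnt T qb) (dx T, 0, 0) (dx T, 0, 0)"
    unfolding lessThan_Suc_atMost[symmetric] by (simp add: dT)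
  also have "\<dots> = (\<Sum>t<T. (let L = ham P t (lamb (Suc t)) (vb t) (wb t) in
                  dx t \<bullet> (Dxx L (xb t) (ub t) \<theta>b *v dx t) + dx t \<bullet> (Dxu L (xb t) (ub t) \<theta>b *v du t)
                + du t \<bullet> (Dux L (xb t) (ub t) \<theta>b *v dx t) + du t \<bullet> (Duu L (xb t) (ub t) \<theta>b *v du t)))
        + dx T \<bullet> (TDxx (hamT P (vb T) (wb T)) (xb T) \<theta>b *v dx T)"
  proof (intro arg_cong2[of _ _ _ _ "(+)"] sum.cong refl)
    fix t assume "t \<in> {..<T}"
    then have t: "t < T" by simp
    show "fderiv (fderiv (?H t)) (pnt t qb) (dx t, du t, 0) (dx t, du t, 0)
      = (let L = ham P t (lamb (Suc t)) (vb t) (wb t) in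
                  dx t \<bullet> (Dxx L (xb t) (ub t) \<theta>b *v dx t) + dx t \<bullet> (Dxu L (xb t) (ub t) \<theta>b *v du t)
                + du t \<bullet> (Dux L (xb t) (ub t) \<theta>b *v dx t) + du t \<bullet> (Duu L (xb t) (ub t) \<theta>b *v du t))"
      unfolding Let_def hamf_mult(1)[OF t, symmetric] pnt_qb(1)[OF t]
      by (rule hessian_form[OF C2_hamf_comb open_UNIV UNIV_I, symmetric]) (use t in simp)
  next
    show "fderiv (fderiv (?H T)) (pnt T qb) (dx T, 0, 0) (dx T, 0, 0) = dx T \<bullet> (TDxx (hamT P (vb T) (wb T)) (xb T) \<theta>b *v dx T)"
      unfolding terminal_as_stage(2)[where u = "0 :: real^'m"] hamf_mult(2)[symmetric] pnt_qb(2)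
      by (rule Dxx_form[OF C2_hamf_comb open_UNIV UNIV_I, symmetric]) simp
  qed
  also have "\<dots> > 0"
  proof -
    have con0: "fderiv (uncurry3 (con k)) (pnt (con_time k) qb) (dx (con_time k), du (con_time k), 0) = 0"
      if "k \<in> Ix \<union> Ex" "red_con k qb = 0" for k
      using active[OF that] fderiv_red_con[OF that(1), of "(d, 0)"] by (simp add: pd)
    have hzero: "red_con k qb = 0" if "k \<in> Ex" for k
    proof -
      have "\<forall>k\<in>Ex. red_con k qb = 0"
        by (rule iffD2[OF all_con_iff(2)[of "\<lambda>x. x = 0" qb]])
           (use kkt in \<open>simp add: KKT_def B_feas_def st_qb qb_simps\<close>)
      then show ?thesis using that by blast
    qed
    have compl: "\<forall>t<T. \<forall>i<nq P t. vb t i * gc P t i (xb t) (ub t) \<theta>b = 0" "\<forall>i<nqT P. vb T i * gT P i (xb T) \<theta>b = 0"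
      using kkt unfolding KKT_def by blast+
    \<comment> \<open>By complementarity a positive multiplier forces the constraint to be
      active.\<close>
    have vzero: "gc P t i (xb t) (ub t) \<theta>b = 0" if "vb t i > 0" "t < T" "i < nq P t" for t i
    proof -
      have "vb t i * gc P t i (xb t) (ub t) \<theta>b = 0" using compl(1) that by blast
      then show ?thesis using that(1) by simp
    qed
    have vTzero: "gT P i (xb T) \<theta>b = 0" if "vb T i > 0" "i < nqT P" for i
    proof -
      have "vb T i * gT P i (xb T) \<theta>b = 0" using compl(2) that by blast
      then show ?thesis using that(1) by simp
    qed
    have g0: "Dx (gc P t i) (xb t) (ub t) \<theta>b \<bullet> dx t + Du (gc P t i) (xb t) (ub t) \<theta>b \<bullet> du t = 0"
      if "t < T" "i < nq P t" "gc P t i (xb t) (ub t) \<theta>b = 0" for t i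
      using con0[of "Inl (t, i)"] red_con_stage(1)[OF that(1,2)] that Dx_con(1)[OF that(1,2)] by simp
    have gT0: "TDx (gT P i) (xb T) \<theta>b \<bullet> dx T = 0" if "i < nqT P" "gT P i (xb T) \<theta>b = 0" for i
      using con0[of "Inl (T, i)"] red_con_stage(2)[OF that(1)] that Dx_con(2)[OF that(1)] dT by simp
    have h0: "Dx (hc P t i) (xb t) (ub t) \<theta>b \<bullet> dx t + Du (hc P t i) (xb t) (ub t) \<theta>b \<bullet> du t = 0"
      if "t < T" "i < ns P t" for t i
      using con0[of "Inr (t, i)"] red_con_stage(3)[OF that] hzero[of "Inr (t, i)"] Dx_con(3)[OF that] by simp
    have hT0: "TDx (hT P i) (xb T) \<theta>b \<bullet> dx T = 0" if "i < nsT P" for i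
      using con0[of "Inr (T, i)"] red_con_stage(4)[OF that] hzero[of "Inr (T, i)"] Dx_con(4)[OF that] dT by simp
    have dyn: "dx (Suc t) = Fx (dyn P) (xb t) (ub t) \<theta>b *v dx t + Fu (dyn P) (xb t) (ub t) \<theta>b *v du t" if "t < T" for t
    proof -
      have D: "uncurry3 (dyn P) differentiable (at y)" for y by (rule C1_on_differentiable[OF C2_on_C1[OF C2_dyn] UNIV_I])
      have "dx (Suc t) = fderiv (uncurry3 (dyn P)) (pnt t qb) (dx t, du t, 0)"
        unfolding dx_def fderiv_st_Suc by (simp add: fderiv_pnt du_def)
      then show ?thesis by (simp add: Fx_mult[OF D] Fu_mult[OF D] pnt_qb that blinfun.add_right[symmetric])
    qed
    have "\<exists>t<T. du t \<noteq> 0"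
    proof (rule ccontr)
      assume "\<not> (\<exists>t<T. du t \<noteq> 0)"
      then have "apply_bcontfun d t = apply_bcontfun 0 t" for t
        using d(1) by (cases "t < T") (auto simp: du_def input_space_iff)
      then show False using d(2) bcontfun_eqI by blast
    qed
    then have ex: "(\<exists>t\<le>T. dx t \<noteq> 0) \<or> (\<exists>t<T. du t \<noteq> 0)" by (rule disjI2)
    have dx0: "dx 0 = 0" by (simp add: dx_def fderiv_st_0 blinfun.zero_right)
    show ?thesis
    proof (rule mp[OF spec[OF spec[OF conjunct2[OF sosc[unfolded SOSC_def]], of dx], of du]], intro conjI allI impI)
      show "(\<exists>t\<le>T. dx t \<noteq> 0) \<or> (\<exists>t<T. du t \<noteq> 0)" by (rule ex)
    qed (simp_all add: dx0 dyn h0 hT0 g0 gT0 vzero vTzero)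
  qed
  finally show ?thesis unfolding fderiv2_total_comb by simp
qed

text \<open>Negated adjoint variables serve as the coefficients of the dynamics constraints.\<close>

fun coef :: "((nat \<times> nat) + (nat \<times> nat) \<Rightarrow> real) \<Rightarrow> (nat \<Rightarrow> real^'n) \<Rightarrow> real^'n \<Rightarrow> 'n bcon \<Rightarrow> real" where
  "coef m lam e (DynC t j) = - (lam (Suc t) $ j)"
| "coef m lam e (InitC j) = - (e $ j)"
| "coef m lam e (EqC t i) = m (Inr (t, i))"
| "coef m lam e (EqCT i) = m (Inr (T, i))"
| "coef m lam e (InC t i) = m (Inl (t, i))"
| "coef m lam e (InCT i) = m (Inl (T, i))"

text \<open>Summands of inactive inequalities vanish by assumption, so the sum may run over full
  index ranges, where it splits by kind of constraint.\<close>

lemma sum_binding: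
  fixes f :: "'n bcon \<Rightarrow> real"
  assumes 1: "\<And>t i. t < T \<Longrightarrow> i < nq P t \<Longrightarrow> gc P t i (xb t) (ub t) \<theta>b \<noteq> 0 \<Longrightarrow> f (InC t i) = 0"
    and 2: "\<And>i. i < nqT P \<Longrightarrow> gT P i (xb T) \<theta>b \<noteq> 0 \<Longrightarrow> f (InCT i) = 0"
  shows "sum f (binding P T \<theta>b xb ub) = (\<Sum>t<T. \<Sum>j\<in>UNIV. f (DynC t j)) + (\<Sum>j\<in>UNIV. f (InitC j))
    + (\<Sum>t<T. \<Sum>i<ns P t. f (EqC t i)) + (\<Sum>i<nsT P. f (EqCT i))
    + (\<Sum>t<T. \<Sum>i<nq P t. f (InC t i)) + (\<Sum>i<nqT P. f (InCT i))"
proof -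
  let ?D = "case_prod DynC ` ({..<T} \<times> (UNIV :: 'n set))"
  let ?E = "case_prod EqC ` (SIGMA t:{..<T}. {..<ns P t}) :: 'n bcon set"
  let ?I = "case_prod InC ` (SIGMA t:{..<T}. {..<nq P t}) :: 'n bcon set"
  let ?B = "?D \<union> range InitC \<union> ?E \<union> EqCT ` {..<nsT P} \<union> ?I \<union> InCT ` {..<nqT P}"
  have sub: "binding P T \<theta>b xb ub \<subseteq> ?B" by (auto simp: binding_def)
  have fin: "finite ?D" "finite ?E" "finite ?I" by auto
  have "sum f (binding P T \<theta>b xb ub) = sum f ?B"
    by (rule sum.mono_neutral_left[OF _ sub]) (use 1 2 in \<open>auto simp: binding_def\<close>)
  also have "\<dots> = sum f ?D + sum f (range InitC) + sum f ?E + sum f (EqCT ` {..<nsT P}) + sum f ?I + sum f (InCT ` {..<nqT P})"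
    by (subst sum.union_disjoint; (use fin in auto)?)+
  also have "sum f ?D = (\<Sum>t<T. \<Sum>j\<in>UNIV. f (DynC t j))"
    by (subst sum.reindex) (auto simp: inj_on_def sum.cartesian_product o_def case_prod_unfold)
  also have "sum f (range InitC) = (\<Sum>j\<in>UNIV. f (InitC j))" by (subst sum.reindex) (auto simp: inj_on_def)
  also have "sum f ?E = (\<Sum>t<T. \<Sum>i<ns P t. f (EqC t i))"
    by (subst sum.reindex) (auto simp: inj_on_def sum.Sigma o_def case_prod_unfold)
  also have "sum f ?I = (\<Sum>t<T. \<Sum>i<nq P t. f (InC t i))"
    by (subst sum.reindex) (auto simp: inj_on_def sum.Sigma o_def case_prod_unfold)
  also have "sum f (EqCT ` {..<nsT P}) = (\<Sum>i<nsT P. f (EqCT i))" by (subst sum.reindex) (auto simp: inj_on_def)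
  also have "sum f (InCT ` {..<nqT P}) = (\<Sum>i<nqT P. f (InCT i))" by (subst sum.reindex) (auto simp: inj_on_def)
  finally show ?thesis .
qed

lemma inner_as_sum: "(\<Sum>j\<in>UNIV. v $ j * w $ j) = v \<bullet> (w :: real^'k)"
  by (simp add: inner_vec_def)

lemma dyn_component_grad:
  "t < T \<Longrightarrow> (\<Sum>j\<in>UNIV. v $ j * (Dx (\<lambda>x u \<theta>. dyn P x u \<theta> $ j) (xb t) (ub t) \<theta>b \<bullet> d)) = v \<bullet> fderiv (uncurry3 (dyn P)) (pnt t qb) (d, 0, 0)"
  "t < T \<Longrightarrow> (\<Sum>j\<in>UNIV. v $ j * (Du (\<lambda>x u \<theta>. dyn P x u \<theta> $ j) (xb t) (ub t) \<theta>b \<bullet> e)) = v \<bullet> fderiv (uncurry3 (dyn P)) (pnt t qb) (0, e, 0)"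
proof -
  have D: "(uncurry3 (\<lambda>x u \<theta>. dyn P x u \<theta> $ j) has_derivative (\<lambda>h. fderiv (uncurry3 (dyn P)) y h $ j)) (at y)" for j y
    using bounded_linear.has_derivative[OF bounded_linear_vec_nth C1_on_has_derivative[OF C2_on_C1[OF C2_dyn] UNIV_I]]
    by (simp add: case_prod_unfold)
  show "(\<Sum>j\<in>UNIV. v $ j * (Dx (\<lambda>x u \<theta>. dyn P x u \<theta> $ j) (xb t) (ub t) \<theta>b \<bullet> d)) = v \<bullet> fderiv (uncurry3 (dyn P)) (pnt t qb) (d, 0, 0)"
    if "t < T" by (simp add: Dx_inner[OF differentiableI[OF D]] fderiv_eq[OF D] inner_as_sum pnt_qb that)
  show "(\<Sum>j\<in>UNIV. v $ j * (Du (\<lambda>x u \<theta>. dyn P x u \<theta> $ j) (xb t) (ub t) \<theta>b \<bullet> e)) = v \<bullet> fderiv (uncurry3 (dyn P)) (pnt t qb) (0, e, 0)"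
    if "t < T" by (simp add: Du_inner[OF differentiableI[OF D]] fderiv_eq[OF D] inner_as_sum pnt_qb that)
qed

lemma Dx_con_x:
  "t < T \<Longrightarrow> i < nq P t \<Longrightarrow> Dx (gc P t i) (xb t) (ub t) \<theta>b \<bullet> d = fderiv (uncurry3 (ineq t i)) (pnt t qb) (d, 0, 0)"
  "t < T \<Longrightarrow> i < nq P t \<Longrightarrow> Du (gc P t i) (xb t) (ub t) \<theta>b \<bullet> e = fderiv (uncurry3 (ineq t i)) (pnt t qb) (0, e, 0)"
  "t < T \<Longrightarrow> i < ns P t \<Longrightarrow> Dx (hc P t i) (xb t) (ub t) \<theta>b \<bullet> d = fderiv (uncurry3 (equ t i)) (pnt t qb) (d, 0, 0)"
  "t < T \<Longrightarrow> i < ns P t \<Longrightarrow> Du (hc P t i) (xb t) (ub t) \<theta>b \<bullet> e = fderiv (uncurry3 (equ t i)) (pnt t qb) (0, e, 0)"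
  using Dx_con(1)[of t i d 0] Dx_con(1)[of t i 0 e] Dx_con(3)[of t i d 0] Dx_con(3)[of t i 0 e] by simp_all

lemma sum_at_stage: "(\<Sum>t<T. if \<tau> = t then f t else 0) = (if \<tau> < T then f \<tau> else 0)" for f :: "nat \<Rightarrow> real"
  by simp

text \<open>A vanishing combination of reduced derivatives lifts to a vanishing combination of full
  gradients. The adjoint of the combination supplies the coefficients of the dynamics: the costate
  equation then annihilates the state parts, and the reduced identity annihilates the input parts.
  \<open>LICQ\<close> makes all coefficients 0.\<close>

lemma licq_red:
  assumes a: "\<And>d. d \<in> data.Z.S \<Longrightarrow> (\<Sum>k\<in>{k \<in> Ix \<union> Ex. red_con k qb = 0}. a k * fderiv (red_con k) qb (d, 0)) = 0"
    and k: "k \<in> Ix \<union> Ex" "red_con k qb = 0"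
  shows "a k = 0"
proof -
  \<comment> \<open>Extension by 0 turns the sum over active constraints into one over all of them,
    as \<open>comb\<close> requires.\<close>
  define m where "m k = (if k \<in> Ix \<union> Ex \<and> red_con k qb = 0 then a k else 0)" for k
  obtain lam where adj: "adjoint (comb 0 m) qb lam" using adjoint_exists by blast
  let ?H = "\<lambda>t. uncurry3 (hamf (comb 0 m) lam t)"
  \<comment> \<open>The missing costate at time 0; up to sign it is the coefficient of the initial
    condition.\<close>
  define e where "e = (\<chi> j. fderiv (?H 0) (pnt 0 qb) (axis j 1, 0, 0))"
  have e: "e \<bullet> d = fderiv (?H 0) (pnt 0 qb) (d, 0, 0)" for d
    using inner_vec_lambda_linear[OF linear_slots(1), of d] by (simp add: e_def inner_commute)
  let ?c = "coef m lam e"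
  have zero: "fderiv (total (comb 0 m)) qb (d, 0) = 0" if "d \<in> data.Z.S" for d
  proof -
    have "(\<Sum>k\<in>Ix \<union> Ex. m k * fderiv (red_con k) qb (d, 0))
        = (\<Sum>k\<in>{k \<in> Ix \<union> Ex. red_con k qb = 0}. m k * fderiv (red_con k) qb (d, 0))"
      by (rule sum.mono_neutral_right) (auto simp: finite_Ix finite_Ex m_def)
    also have "\<dots> = (\<Sum>k\<in>{k \<in> Ix \<union> Ex. red_con k qb = 0}. a k * fderiv (red_con k) qb (d, 0))"
      by (intro sum.cong) (auto simp: m_def)
    finally show ?thesis using a[OF that] fderiv_total_comb[of 0 m qb "(d, 0)"] by simp
  qed
  \<comment> \<open>Testing with an input supported at the single time \<tau> isolates one
    stage.\<close>
  have Hu: "fderiv (?H \<tau>) (pnt \<tau> qb) (0, w, 0) = 0" if \<tau>: "\<tau> < T" for \<tau> w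
  proof -
    have "(\<Sum>t<T. fderiv (?H t) (pnt t qb) (0, apply_bcontfun (unit_seq \<tau> w) t, 0)) = 0"
      using fderiv_comb_input[OF adj unit_seq_input[OF \<tau>]] zero[OF unit_seq_input[OF \<tau>]] by simp
    also have "(\<Sum>t<T. fderiv (?H t) (pnt t qb) (0, apply_bcontfun (unit_seq \<tau> w) t, 0))
        = (\<Sum>t<T. if \<tau> = t then fderiv (?H t) (pnt t qb) (0, w, 0) else 0)"
      by (intro sum.cong) (auto simp: zero_prod_def[symmetric] blinfun.zero_right)
    finally show ?thesis using \<tau> by simp
  qed
  have mI: "t < T \<Longrightarrow> i < nq P t \<Longrightarrow> gc P t i (xb t) (ub t) \<theta>b \<noteq> 0 \<Longrightarrow> m (Inl (t, i)) = 0"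
    "j < nqT P \<Longrightarrow> gT P j (xb T) \<theta>b \<noteq> 0 \<Longrightarrow> m (Inl (T, j)) = 0" for t i j
    using red_con_stage(1)[of t i] red_con_stage(2)[of j] by (auto simp: m_def)
  have X: "(\<Sum>k\<in>binding P T \<theta>b xb ub. ?c k *\<^sub>R con_grad_x P T \<theta>b xb ub k \<tau>) = 0" if \<tau>: "\<tau> \<le> T" for \<tau>
  proof (rule linear_eqI_inner)
    fix d :: "real^'n"
    have "(\<Sum>k\<in>binding P T \<theta>b xb ub. ?c k *\<^sub>R con_grad_x P T \<theta>b xb ub k \<tau>) \<bullet> d
      = (\<Sum>k\<in>binding P T \<theta>b xb ub. ?c k * (con_grad_x P T \<theta>b xb ub k \<tau> \<bullet> d))"
      by (simp add: inner_sum_left)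
    also have "\<dots> = (\<Sum>t<T. \<Sum>j\<in>UNIV. ?c (DynC t j) * (con_grad_x P T \<theta>b xb ub (DynC t j) \<tau> \<bullet> d))
        + (\<Sum>j\<in>UNIV. ?c (InitC j) * (con_grad_x P T \<theta>b xb ub (InitC j) \<tau> \<bullet> d))
        + (\<Sum>t<T. \<Sum>i<ns P t. ?c (EqC t i) * (con_grad_x P T \<theta>b xb ub (EqC t i) \<tau> \<bullet> d))
        + (\<Sum>i<nsT P. ?c (EqCT i) * (con_grad_x P T \<theta>b xb ub (EqCT i) \<tau> \<bullet> d))
        + (\<Sum>t<T. \<Sum>i<nq P t. ?c (InC t i) * (con_grad_x P T \<theta>b xb ub (InC t i) \<tau> \<bullet> d))
        + (\<Sum>i<nqT P. ?c (InCT i) * (con_grad_x P T \<theta>b xb ub (InCT i) \<tau> \<bullet> d))"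
      by (rule sum_binding) (auto simp: mI)
    \<comment> \<open>The constraint \<open>DynC t\<close> has state gradients at the two times
      \<open>t + 1\<close> and \<open>t\<close>: the first yields the costate with negative sign,
      the second the dynamics term of the Hamiltonian.\<close>
    also have "(\<Sum>t<T. \<Sum>j\<in>UNIV. ?c (DynC t j) * (con_grad_x P T \<theta>b xb ub (DynC t j) \<tau> \<bullet> d))
        = (\<Sum>t<T. (if \<tau> = Suc t then - (lam (Suc t) \<bullet> d) else 0)
            + (if \<tau> = t then lam (Suc t) \<bullet> fderiv (uncurry3 (dyn P)) (pnt t qb) (d, 0, 0) else 0))"
    proof (rule sum.cong[OF refl])
      fix t assume t: "t \<in> {..<T}"
      have "(\<Sum>j\<in>UNIV. ?c (DynC t j) * (con_grad_x P T \<theta>b xb ub (DynC t j) \<tau> \<bullet> d))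
         = (\<Sum>j\<in>UNIV. (if \<tau> = Suc t then - (lam (Suc t) $ j * d $ j) else 0)
            + (if \<tau> = t then lam (Suc t) $ j * (Dx (\<lambda>x u \<theta>. dyn P x u \<theta> $ j) (xb t) (ub t) \<theta>b \<bullet> d) else 0))"
        by (rule sum.cong) (auto simp: inner_axis' inner_diff_left algebra_simps)
      also have "\<dots> = (if \<tau> = Suc t then - (lam (Suc t) \<bullet> d) else 0)
            + (if \<tau> = t then lam (Suc t) \<bullet> fderiv (uncurry3 (dyn P)) (pnt t qb) (d, 0, 0) else 0)"
        using dyn_component_grad(1)[of t "lam (Suc t)" d] t
        by (simp add: sum.distrib sum_negf inner_as_sum)
      finally show "(\<Sum>j\<in>UNIV. ?c (DynC t j) * (con_grad_x P T \<theta>b xb ub (DynC t j) \<tau> \<bullet> d)) = \<dots>" .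
    qed
    also have "\<dots> = (if 1 \<le> \<tau> then - (lam \<tau> \<bullet> d) else 0)
       + (if \<tau> < T then lam (Suc \<tau>) \<bullet> fderiv (uncurry3 (dyn P)) (pnt \<tau> qb) (d, 0, 0) else 0)"
    proof -
      have "(\<Sum>t<T. if \<tau> = Suc t then - (lam (Suc t) \<bullet> d) else 0) = (if 1 \<le> \<tau> then - (lam \<tau> \<bullet> d) else 0)"
        using \<tau> by (cases \<tau>) auto
      then show ?thesis by (simp add: sum.distrib)
    qed
    also have "(\<Sum>j\<in>UNIV. ?c (InitC j) * (con_grad_x P T \<theta>b xb ub (InitC j) \<tau> \<bullet> d)) = (if \<tau> = 0 then - (e \<bullet> d) else 0)"
      by (simp add: inner_axis' sum_negf inner_as_sum)
    also have "(\<Sum>t<T. \<Sum>i<ns P t. ?c (EqC t i) * (con_grad_x P T \<theta>b xb ub (EqC t i) \<tau> \<bullet> d))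
        = (\<Sum>t<T. if \<tau> = t then \<Sum>i<ns P t. m (Inr (t, i)) * fderiv (uncurry3 (equ t i)) (pnt t qb) (d, 0, 0) else 0)"
      by (intro sum.cong refl) (auto simp: Dx_con_x)
    also have "(\<Sum>t<T. \<Sum>i<nq P t. ?c (InC t i) * (con_grad_x P T \<theta>b xb ub (InC t i) \<tau> \<bullet> d))
        = (\<Sum>t<T. if \<tau> = t then \<Sum>i<nq P t. m (Inl (t, i)) * fderiv (uncurry3 (ineq t i)) (pnt t qb) (d, 0, 0) else 0)"
      by (intro sum.cong refl) (auto simp: Dx_con_x)
    also have "(\<Sum>i<nsT P. ?c (EqCT i) * (con_grad_x P T \<theta>b xb ub (EqCT i) \<tau> \<bullet> d))
        = (if \<tau> = T then \<Sum>i<nsT P. m (Inr (T, i)) * fderiv (uncurry3 (equ T i)) (pnt T qb) (d, 0, 0) else 0)"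
      by (auto simp: Dx_con)
    also have "(\<Sum>i<nqT P. ?c (InCT i) * (con_grad_x P T \<theta>b xb ub (InCT i) \<tau> \<bullet> d))
        = (if \<tau> = T then \<Sum>i<nqT P. m (Inl (T, i)) * fderiv (uncurry3 (ineq T i)) (pnt T qb) (d, 0, 0) else 0)"
      by (auto simp: Dx_con)
    finally have "(\<Sum>k\<in>binding P T \<theta>b xb ub. ?c k *\<^sub>R con_grad_x P T \<theta>b xb ub k \<tau>) \<bullet> d
        = fderiv (?H \<tau>) (pnt \<tau> qb) (d, 0, 0) + (if 1 \<le> \<tau> then - (lam \<tau> \<bullet> d) else - (e \<bullet> d))"
      unfolding sum_at_stage fderiv_hamf_comb[OF \<tau>] using \<tau> by (auto simp: nI_def nE_def)
    then show "(\<Sum>k\<in>binding P T \<theta>b xb ub. ?c k *\<^sub>R con_grad_x P T \<theta>b xb ub k \<tau>) \<bullet> d = 0"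
      using adj \<tau> e[of d] by (cases "1 \<le> \<tau>") (auto simp: adjoint_def not_le)
  qed
  have U: "(\<Sum>k\<in>binding P T \<theta>b xb ub. ?c k *\<^sub>R con_grad_u P T \<theta>b xb ub k \<tau>) = 0" if \<tau>: "\<tau> < T" for \<tau>
  proof (rule linear_eqI_inner)
    fix d :: "real^'m"
    have "(\<Sum>k\<in>binding P T \<theta>b xb ub. ?c k *\<^sub>R con_grad_u P T \<theta>b xb ub k \<tau>) \<bullet> d
      = (\<Sum>k\<in>binding P T \<theta>b xb ub. ?c k * (con_grad_u P T \<theta>b xb ub k \<tau> \<bullet> d))"
      by (simp add: inner_sum_left)
    also have "\<dots> = (\<Sum>t<T. \<Sum>j\<in>UNIV. ?c (DynC t j) * (con_grad_u P T \<theta>b xb ub (DynC t j) \<tau> \<bullet> d))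
        + (\<Sum>j\<in>UNIV. ?c (InitC j) * (con_grad_u P T \<theta>b xb ub (InitC j) \<tau> \<bullet> d))
        + (\<Sum>t<T. \<Sum>i<ns P t. ?c (EqC t i) * (con_grad_u P T \<theta>b xb ub (EqC t i) \<tau> \<bullet> d))
        + (\<Sum>i<nsT P. ?c (EqCT i) * (con_grad_u P T \<theta>b xb ub (EqCT i) \<tau> \<bullet> d))
        + (\<Sum>t<T. \<Sum>i<nq P t. ?c (InC t i) * (con_grad_u P T \<theta>b xb ub (InC t i) \<tau> \<bullet> d))
        + (\<Sum>i<nqT P. ?c (InCT i) * (con_grad_u P T \<theta>b xb ub (InCT i) \<tau> \<bullet> d))"
      by (rule sum_binding) (auto simp: mI)
    also have "(\<Sum>t<T. \<Sum>j\<in>UNIV. ?c (DynC t j) * (con_grad_u P T \<theta>b xb ub (DynC t j) \<tau> \<bullet> d))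
        = (\<Sum>t<T. if \<tau> = t then lam (Suc t) \<bullet> fderiv (uncurry3 (dyn P)) (pnt t qb) (0, d, 0) else 0)"
      by (intro sum.cong refl) (auto simp: dyn_component_grad(2)[symmetric])
    also have "(\<Sum>t<T. \<Sum>i<ns P t. ?c (EqC t i) * (con_grad_u P T \<theta>b xb ub (EqC t i) \<tau> \<bullet> d))
        = (\<Sum>t<T. if \<tau> = t then \<Sum>i<ns P t. m (Inr (t, i)) * fderiv (uncurry3 (equ t i)) (pnt t qb) (0, d, 0) else 0)"
      by (intro sum.cong refl) (auto simp: Dx_con_x)
    also have "(\<Sum>t<T. \<Sum>i<nq P t. ?c (InC t i) * (con_grad_u P T \<theta>b xb ub (InC t i) \<tau> \<bullet> d))
        = (\<Sum>t<T. if \<tau> = t then \<Sum>i<nq P t. m (Inl (t, i)) * fderiv (uncurry3 (ineq t i)) (pnt t qb) (0, d, 0) else 0)"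
      by (intro sum.cong refl) (auto simp: Dx_con_x)
    finally have "(\<Sum>k\<in>binding P T \<theta>b xb ub. ?c k *\<^sub>R con_grad_u P T \<theta>b xb ub k \<tau>) \<bullet> d = fderiv (?H \<tau>) (pnt \<tau> qb) (0, d, 0)"
      unfolding sum_at_stage fderiv_hamf_comb[OF less_imp_le[OF \<tau>]] using \<tau> by (simp add: nI_def nE_def)
    then show "(\<Sum>k\<in>binding P T \<theta>b xb ub. ?c k *\<^sub>R con_grad_u P T \<theta>b xb ub k \<tau>) \<bullet> d = 0" using Hu[OF \<tau>] by simp
  qed
  have c0: "\<forall>k\<in>binding P T \<theta>b xb ub. ?c k = 0"
    using licq X U unfolding LICQ_def by blast
  have "m k = 0"
  proof (cases k)
    case (Inl p)
    obtain t i where p: "p = (t, i)" by (cases p)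
    show ?thesis
    proof (cases "t < T")
      case True
      then have "InC t i \<in> binding P T \<theta>b xb ub"
        using k red_con_stage(1)[of t i] by (auto simp: Inl p binding_def Ix_def Ex_def nI_def)
      from bspec[OF c0 this] show ?thesis by (simp add: Inl p)
    next
      case False
      then have t: "t = T" using k by (auto simp: Inl p Ix_def Ex_def)
      then have "InCT i \<in> binding P T \<theta>b xb ub"
        using k red_con_stage(2)[of i] by (auto simp: Inl p binding_def Ix_def Ex_def nI_def)
      from bspec[OF c0 this] show ?thesis by (simp add: Inl p t)
    qed
  next
    case (Inr p)
    obtain t i where p: "p = (t, i)" by (cases p)
    show ?thesis
    proof (cases "t < T")
      case True
      then have "EqC t i \<in> binding P T \<theta>b xb ub" using k by (auto simp: Inr p binding_def Ix_def Ex_def nE_def)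
      from bspec[OF c0 this] show ?thesis by (simp add: Inr p)
    next
      case False
      then have t: "t = T" using k by (auto simp: Inr p Ix_def Ex_def)
      then have "EqCT i \<in> binding P T \<theta>b xb ub" using k by (auto simp: Inr p binding_def Ix_def Ex_def nE_def)
      from bspec[OF c0 this] show ?thesis by (simp add: Inr p t)
    qed
  qed
  then show ?thesis using k by (simp add: m_def)
qed

end

context reference
begin

lemma nlp_reference: "nlp ({..<T} \<times> (UNIV :: 'm set)) (\<lambda>(t, j). unit_seq t (axis j 1 :: real^'m))
  (\<lambda>(t, j). Blinfun (\<lambda>z. apply_bcontfun z t $ j)) (Ix \<union> Ex)
  (\<lambda>i. unit_seq (to_nat i) (1::real)) (\<lambda>i. Blinfun (\<lambda>y. apply_bcontfun y (to_nat i))) Ix Ex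
  (total stage_cost) red_con zb \<theta>b mult"
proof (rule nlp.intro[OF data.nlp_data_axioms], rule nlp_axioms.intro)
  have feas: "B_feas P T \<theta>b xb ub" using kkt by (simp add: KKT_def)
  have I: "\<forall>k\<in>Ix. red_con k qb \<le> 0"
    by (rule iffD2[OF all_con_iff(1)[of "\<lambda>x. x \<le> 0" qb]]) (use feas in \<open>simp add: B_feas_def st_qb qb_simps\<close>)
  have E: "\<forall>k\<in>Ex. red_con k qb = 0"
    by (rule iffD2[OF all_con_iff(2)[of "\<lambda>x. x = 0" qb]]) (use feas in \<open>simp add: B_feas_def st_qb qb_simps\<close>)
  have mult: "(red_con k qb < 0 \<longrightarrow> mult k = 0) \<and> (red_con k qb = 0 \<longrightarrow> mult k > 0)" if k: "k \<in> Ix" for k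
  proof -
    obtain t i where ti: "k = Inl (t, i)" "t \<le> T" "i < nI t" using k by (auto simp: Ix_def)
    show ?thesis
    proof (cases "t < T")
      case True
      then have i: "i < nq P t" using ti by (simp add: nI_def)
      have "vb t i * gc P t i (xb t) (ub t) \<theta>b = 0" "gc P t i (xb t) (ub t) \<theta>b = 0 \<longrightarrow> vb t i > 0"
        using kkt sc True i unfolding KKT_def strict_compl_def by blast+
      then show ?thesis using red_con_stage(1)[OF True i] by (auto simp: ti(1) mult_def)
    next
      case False
      then have t: "t = T" using ti by simp
      then have i: "i < nqT P" using ti by (simp add: nI_def)
      have "vb T i * gT P i (xb T) \<theta>b = 0" "gT P i (xb T) \<theta>b = 0 \<longrightarrow> vb T i > 0"
        using kkt sc i unfolding KKT_def strict_compl_def by blast+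
      then show ?thesis using red_con_stage(2)[OF i] by (auto simp: ti(1) t mult_def)
    qed
  qed
  show "zb \<in> data.Z.S" by (simp add: zb_def finseq_input)
  show "red_con k (zb, \<theta>b) \<le> 0" if "k \<in> Ix" for k using I that by (simp add: qb_def)
  show "red_con k (zb, \<theta>b) = 0" if "k \<in> Ex" for k using E that by (simp add: qb_def)
  show "mult k = 0" if "k \<in> Ix" "red_con k (zb, \<theta>b) < 0" for k using mult that by (simp add: qb_def)
  show "mult k > 0" if "k \<in> Ix" "red_con k (zb, \<theta>b) = 0" for k using mult that by (simp add: qb_def)
  show "fderiv (total stage_cost) (zb, \<theta>b) (d, 0) + (\<Sum>k\<in>Ix \<union> Ex. mult k * fderiv (red_con k) (zb, \<theta>b) (d, 0)) = 0"
    if "d \<in> data.Z.S" for d using stationary_mult[OF that] by (simp add: qb_def)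
  show "fderiv (fderiv (total stage_cost)) (zb, \<theta>b) (d, 0) (d, 0)
    + (\<Sum>k\<in>Ix \<union> Ex. mult k * fderiv (fderiv (red_con k)) (zb, \<theta>b) (d, 0) (d, 0)) > 0"
    if "d \<in> data.Z.S" "d \<noteq> 0" "\<And>k. k \<in> Ix \<union> Ex \<Longrightarrow> red_con k (zb, \<theta>b) = 0 \<Longrightarrow> fderiv (red_con k) (zb, \<theta>b) (d, 0) = 0" for d
    using second_order_mult[OF that(1,2)] that(3) by (simp add: qb_def)
  show "a k = 0" if "\<And>d. d \<in> data.Z.S \<Longrightarrow> (\<Sum>k\<in>{k \<in> Ix \<union> Ex. red_con k (zb, \<theta>b) = 0}. a k * fderiv (red_con k) (zb, \<theta>b) (d, 0)) = 0"
    "k \<in> Ix \<union> Ex" "red_con k (zb, \<theta>b) = 0" for a k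
    by (rule licq_red[OF _ that(2)]) (use that in \<open>auto simp: qb_def\<close>)
qed

end

section \<open>The barrier problem in reduced form\<close>

context control
begin

definition bcost :: "real \<Rightarrow> nat \<Rightarrow> real^'n \<Rightarrow> real^'m \<Rightarrow> real^'r \<Rightarrow> real" where
  "bcost \<gamma> t x u \<theta> = stage_cost t x u \<theta> - \<gamma> * (\<Sum>i<nI t. ln (- ineq t i x u \<theta>)) + 1 / (2 * \<gamma>) * (\<Sum>i<nE t. (equ t i x u \<theta>)\<^sup>2)"

definition interior_stage :: "nat \<Rightarrow> ((real^'n) \<times> (real^'m) \<times> (real^'r)) set" where
  "interior_stage t = {y. \<forall>i<nI t. uncurry3 (ineq t i) y < 0}"

lemma barrier_total: "data.barrier \<gamma> = total (bcost \<gamma>)"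
proof
  fix q
  show "data.barrier \<gamma> q = total (bcost \<gamma>) q"
    unfolding data.barrier_def sum_Ix sum_Ex total_def
    by (simp add: bcost_def pnt_def red_con_def sum.distrib sum_subtractf sum_distrib_left)
qed

lemma strict_region_stage: "data.strict_region = stage_dom interior_stage"
  unfolding data.strict_region_def stage_dom_def interior_stage_def by (auto simp: Ix_def red_con_def)

lemma open_interior_stage: "t \<le> T \<Longrightarrow> open (interior_stage t)"
proof -
  assume t: "t \<le> T"
  have "interior_stage t = (\<Inter>i\<in>{..<nI t}. {y. uncurry3 (ineq t i) y < 0})" by (auto simp: interior_stage_def)
  moreover have "open {y. uncurry3 (ineq t i) y < 0}" if "i < nI t" for i
    by (intro open_Collect_less C1_on_continuous[OF C2_on_C1[OF C2_ineq[OF t that]]] continuous_on_const)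
  ultimately show ?thesis by (simp add: open_INT)
qed

lemma C2_bcost: "t \<le> T \<Longrightarrow> C2_on (interior_stage t) (uncurry3 (bcost \<gamma> t))"
proof -
  assume t: "t \<le> T"
  note op = open_interior_stage[OF t] and sub = C2_on_subset[OF _ subset_UNIV]
  have ln: "C2_on (interior_stage t) (\<lambda>y. ln (- uncurry3 (ineq t i) y))" if "i < nI t" for i
    by (rule C2_on_compose[OF C2_on_ln C2_on_uminus[OF op sub[OF C2_ineq[OF t that]]] _ op])
       (use that in \<open>auto simp: interior_stage_def\<close>)
  have "C2_on (interior_stage t) (\<lambda>y. uncurry3 (stage_cost t) y + - (\<gamma> * (\<Sum>i<nI t. ln (- uncurry3 (ineq t i) y)))
      + 1 / (2 * \<gamma>) * (\<Sum>i<nE t. (uncurry3 (equ t i) y)\<^sup>2))"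
    by (intro C2_on_add C2_on_uminus C2_on_cmult C2_on_sum C2_on_power2 op ln sub[OF C2_cost[OF t]] sub[OF C2_equ[OF t]]) auto
  then show ?thesis by (simp add: bcost_def case_prod_unfold)
qed

lemma hamf_bcost: "t < T \<Longrightarrow> hamf (bcost \<gamma>) lam t = bham P t \<gamma> (lam (Suc t))"
  "hamf (bcost \<gamma>) lam T = (\<lambda>x u. bhamT P \<gamma> x)"
  by (simp_all add: fun_eq_iff hamf_def bcost_def bham_def bhamT_def stage_cost_def ineq_def equ_def nI_def nE_def)

lemma SB_feas_iff:
  "SB_feas P T \<theta> x u \<longleftrightarrow> (\<forall>t\<le>T. x t = st t (finseq T u, \<theta>)) \<and> (finseq T u, \<theta>) \<in> data.strict_region"
proof -
  have "(finseq T u, \<theta>) \<in> data.strict_region \<longleftrightarrow> (\<forall>k\<in>Ix. red_con k (finseq T u, \<theta>) < 0)"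
    by (simp add: data.strict_region_def)
  also have "\<dots> \<longleftrightarrow> (\<forall>t<T. \<forall>i<nq P t. gc P t i (st t (finseq T u, \<theta>)) (u t) \<theta> < 0)
     \<and> (\<forall>i<nqT P. gT P i (st T (finseq T u, \<theta>)) \<theta> < 0)"
    using all_con_iff(1)[of "\<lambda>x. x < 0" "(finseq T u, \<theta>)"] by simp
  finally show ?thesis unfolding SB_feas_def dyn_feas_iff by auto
qed

lemma SB_cost_eq: "(\<And>t. t \<le> T \<Longrightarrow> x t = st t (finseq T u, \<theta>)) \<Longrightarrow> SB_cost P T \<theta> \<gamma> x u = data.barrier \<gamma> (finseq T u, \<theta>)"
  unfolding barrier_total total_def lessThan_Suc_atMost[symmetric] SB_cost_def
  by (simp add: pnt_def bcost_def stage_cost_def ineq_def equ_def nI_def nE_def)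

lemma B_feas_iff:
  "B_feas P T \<theta> x u \<longleftrightarrow> (\<forall>t\<le>T. x t = st t (finseq T u, \<theta>)) \<and> (\<forall>k\<in>Ix. red_con k (finseq T u, \<theta>) \<le> 0)
     \<and> (\<forall>k\<in>Ex. red_con k (finseq T u, \<theta>) = 0)"
proof -
  have "(\<forall>k\<in>Ix. red_con k (finseq T u, \<theta>) \<le> 0) \<longleftrightarrow> (\<forall>t<T. \<forall>i<nq P t. gc P t i (st t (finseq T u, \<theta>)) (u t) \<theta> \<le> 0)
     \<and> (\<forall>i<nqT P. gT P i (st T (finseq T u, \<theta>)) \<theta> \<le> 0)"
    using all_con_iff(1)[of "\<lambda>x. x \<le> 0" "(finseq T u, \<theta>)"] by simp
  moreover have "(\<forall>k\<in>Ex. red_con k (finseq T u, \<theta>) = 0) \<longleftrightarrow> (\<forall>t<T. \<forall>i<ns P t. hc P t i (st t (finseq T u, \<theta>)) (u t) \<theta> = 0)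
     \<and> (\<forall>i<nsT P. hT P i (st T (finseq T u, \<theta>)) \<theta> = 0)"
    using all_con_iff(2)[of "\<lambda>x. x = 0" "(finseq T u, \<theta>)"] by simp
  ultimately show ?thesis unfolding B_feas_def dyn_feas_iff by auto
qed

lemma B_cost_eq: "(\<And>t. t \<le> T \<Longrightarrow> x t = st t (finseq T u, \<theta>)) \<Longrightarrow> B_cost P T \<theta> x u = total stage_cost (finseq T u, \<theta>)"
  unfolding total_def lessThan_Suc_atMost[symmetric] B_cost_def by (simp add: pnt_def stage_cost_def)

text \<open>The states depend continuously on the inputs, so neighbourhoods of trajectories can be
  replaced by neighbourhoods of input sequences.\<close>

lemma eventually_traj_near:
  assumes "\<epsilon> > 0"
  shows "\<forall>\<^sub>F z' in nhds z. traj_near T \<epsilon> (\<lambda>t. st t (z, \<theta>)) (apply_bcontfun z) (\<lambda>t. st t (z', \<theta>)) (apply_bcontfun z')"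
proof -
  have 1: "((\<lambda>z'. st t (z', \<theta>)) \<longlongrightarrow> st t (z, \<theta>)) (nhds z)" for t
    using continuous_on_tendsto_compose[OF C1_on_continuous[OF C2_on_C1[OF C2_st]] tendsto_Pair[OF filterlim_ident tendsto_const]] by simp
  have 2: "((\<lambda>z'. apply_bcontfun z' t) \<longlongrightarrow> apply_bcontfun z t) (nhds z)" for t
    by (rule bounded_linear.tendsto[OF bounded_linear_eval filterlim_ident])
  have "\<forall>\<^sub>F z' in nhds z. \<forall>t\<in>{..T}. dist (st t (z', \<theta>)) (st t (z, \<theta>)) < \<epsilon>"
    by (intro eventually_ball_finite ballI tendstoD[OF 1 assms]) simp
  moreover have "\<forall>\<^sub>F z' in nhds z. \<forall>t\<in>{..<T}. dist (apply_bcontfun z' t) (apply_bcontfun z t) < \<epsilon>"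
    by (intro eventually_ball_finite ballI tendstoD[OF 2 assms]) simp
  ultimately show ?thesis by eventually_elim (simp add: traj_near_def)
qed

lemma local_minimizer_B:
  assumes "local_min T (B_feas P T \<theta>) (B_cost P T \<theta>) x u"
  shows "data.local_minimizer \<theta> (finseq T u)"
proof -
  let ?\<zeta> = "finseq T u"
  obtain \<epsilon> where feas: "B_feas P T \<theta> x u" and \<epsilon>: "\<epsilon> > 0"
    "\<And>x' u'. B_feas P T \<theta> x' u' \<Longrightarrow> traj_near T \<epsilon> x u x' u' \<Longrightarrow> B_cost P T \<theta> x u \<le> B_cost P T \<theta> x' u'"
    using assms unfolding local_min_def by blast
  have x: "\<And>t. t \<le> T \<Longrightarrow> x t = st t (?\<zeta>, \<theta>)" using feas by (simp add: B_feas_iff)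
  obtain \<rho> where \<rho>: "\<rho> > 0" "\<And>z'. dist z' ?\<zeta> < \<rho> \<Longrightarrow>
      traj_near T \<epsilon> (\<lambda>t. st t (?\<zeta>, \<theta>)) (apply_bcontfun ?\<zeta>) (\<lambda>t. st t (z', \<theta>)) (apply_bcontfun z')"
    using eventually_traj_near[OF \<epsilon>(1), of ?\<zeta> \<theta>] unfolding eventually_nhds_metric by blast
  have "total stage_cost (?\<zeta>, \<theta>) \<le> total stage_cost (z', \<theta>)"
    if z': "z' \<in> data.Z.S \<inter> ball ?\<zeta> \<rho>" "(\<forall>k\<in>Ix. red_con k (z', \<theta>) \<le> 0) \<and> (\<forall>k\<in>Ex. red_con k (z', \<theta>) = 0)" for z'
  proof -
    have fz: "finseq T (apply_bcontfun z') = z'" using z' finseq_of_input by blast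
    have "traj_near T \<epsilon> x u (\<lambda>t. st t (z', \<theta>)) (apply_bcontfun z')"
      using \<rho>(2)[of z'] z' x by (simp add: dist_commute traj_near_def)
    then have "B_cost P T \<theta> x u \<le> B_cost P T \<theta> (\<lambda>t. st t (z', \<theta>)) (apply_bcontfun z')"
      using z' by (intro \<epsilon>(2)) (simp_all add: B_feas_iff fz)
    then show ?thesis using B_cost_eq[of x u \<theta>] B_cost_eq[of "\<lambda>t. st t (z', \<theta>)" "apply_bcontfun z'" \<theta>] x by (simp add: fz)
  qed
  then show ?thesis
    using feas \<rho>(1) unfolding data.local_minimizer_def by (auto simp: finseq_input B_feas_iff)
qed

text \<open>Both claims come from the descent along segments towards \<open>z\<close>: the full step
  \<open>s = 1\<close> shows minimality, and arbitrarily small steps show that no other nearby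
  feasible point is a local minimizer.\<close>

lemma isolated_minimum_SB:
  assumes z: "z \<in> data.Z.S" "(z, \<theta>) \<in> data.strict_region"
    and crit: "\<And>d. d \<in> data.Z.S \<Longrightarrow> fderiv (data.barrier \<gamma>) (z, \<theta>) (d, 0) = 0"
    and pos: "\<And>d. d \<in> data.Z.S \<Longrightarrow> d \<noteq> 0 \<Longrightarrow> fderiv (fderiv (data.barrier \<gamma>)) (z, \<theta>) (d, 0) (d, 0) > 0"
  shows "isolated_local_min T (SB_feas P T \<theta>) (SB_cost P T \<theta> \<gamma>) (\<lambda>t. st t (z, \<theta>)) (apply_bcontfun z)"
proof -
  obtain r where r: "r > 0" and inW: "\<And>z'. z' \<in> ball z r \<Longrightarrow> (z', \<theta>) \<in> data.strict_region"
    and desc: "\<And>z' s. z' \<in> data.Z.S \<Longrightarrow> z' \<in> ball z r \<Longrightarrow> z' \<noteq> z \<Longrightarrow> 0 < s \<Longrightarrow> s \<le> 1 \<Longrightarrow>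
       data.barrier \<gamma> (z' + s *\<^sub>R (z - z'), \<theta>) < data.barrier \<gamma> (z', \<theta>)"
    using data.Z.strict_descent_near_minimum[OF data.barrier_C2 data.open_strict_region z(2) z(1) crit pos] by blast
  let ?x = "\<lambda>t. st t (z, \<theta>)" and ?u = "apply_bcontfun z"
  have cost: "SB_cost P T \<theta> \<gamma> (\<lambda>t. st t (z', \<theta>)) (apply_bcontfun z') = data.barrier \<gamma> (z', \<theta>)" if "z' \<in> data.Z.S" for z'
    using SB_cost_eq[of "\<lambda>t. st t (z', \<theta>)" "apply_bcontfun z'" \<theta> \<gamma>] by (simp add: finseq_of_input[OF that])
  have feas: "SB_feas P T \<theta> (\<lambda>t. st t (z', \<theta>)) (apply_bcontfun z')" if "z' \<in> data.Z.S" "(z', \<theta>) \<in> data.strict_region" for z'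
    using that by (simp add: SB_feas_iff finseq_of_input)
  \<comment> \<open>Half the radius, since \<open>dist_inputs_less\<close> yields only a weak
    inequality.\<close>
  have near: "finseq T u' \<in> ball z r" if "traj_near T (r / 2) ?x ?u x' u'" for x' u'
    using dist_inputs_less[OF z(1) finseq_input[of u'], of "r / 2"] that r by (simp add: traj_near_def dist_commute)
  have min: "local_min T (SB_feas P T \<theta>) (SB_cost P T \<theta> \<gamma>) ?x ?u"
    unfolding local_min_def
  proof (intro conjI exI[of _ "r / 2"] allI impI)
    fix x' u' assume *: "SB_feas P T \<theta> x' u' \<and> traj_near T (r / 2) ?x ?u x' u'"
    let ?z' = "finseq T u'"
    have "data.barrier \<gamma> (z, \<theta>) \<le> data.barrier \<gamma> (?z', \<theta>)"
      using desc[OF finseq_input near[of x' u'], of 1] * by (cases "?z' = z") auto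
    moreover have "SB_cost P T \<theta> \<gamma> x' u' = data.barrier \<gamma> (?z', \<theta>)" using * by (intro SB_cost_eq) (simp add: SB_feas_iff)
    ultimately show "SB_cost P T \<theta> \<gamma> ?x ?u \<le> SB_cost P T \<theta> \<gamma> x' u'" using cost[OF z(1)] by simp
  qed (use r feas[OF z] in auto)
  have "same_traj T ?x ?u x' u'"
    if nr: "traj_near T (r / 2) ?x ?u x' u'" and lm: "local_min T (SB_feas P T \<theta>) (SB_cost P T \<theta> \<gamma>) x' u'" for x' u'
  proof -
    let ?z' = "finseq T u'"
    obtain \<epsilon> where f': "SB_feas P T \<theta> x' u'" and \<epsilon>: "\<epsilon> > 0"
      "\<And>x'' u''. SB_feas P T \<theta> x'' u'' \<Longrightarrow> traj_near T \<epsilon> x' u' x'' u'' \<Longrightarrow> SB_cost P T \<theta> \<gamma> x' u' \<le> SB_cost P T \<theta> \<gamma> x'' u''"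
      using lm unfolding local_min_def by blast
    have x': "\<And>t. t \<le> T \<Longrightarrow> x' t = st t (?z', \<theta>)" using f' by (simp add: SB_feas_iff)
    have "?z' = z"
    proof (rule ccontr)
      assume ne: "?z' \<noteq> z"
      let ?w = "\<lambda>s. ?z' + s *\<^sub>R (z - ?z')"
      have "(?w \<longlongrightarrow> ?z' + 0 *\<^sub>R (z - ?z')) (at_right 0)" by (intro tendsto_intros)
      then have lim: "(?w \<longlongrightarrow> ?z') (at_right 0)" by simp
      have "\<forall>\<^sub>F s in at_right 0. traj_near T \<epsilon> (\<lambda>t. st t (?z', \<theta>)) (apply_bcontfun ?z') (\<lambda>t. st t (?w s, \<theta>)) (apply_bcontfun (?w s))"
        using eventually_compose_filterlim[OF eventually_traj_near[OF \<epsilon>(1)] lim] .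
      moreover have "\<forall>\<^sub>F s in at_right 0. ?w s \<in> ball z r"
        using eventually_compose_filterlim[OF eventually_nhds_in_open[OF open_ball near[OF nr]] lim] .
      moreover have "\<forall>\<^sub>F s in at_right (0::real). 0 < s" by (rule eventually_at_right_less)
      moreover have "\<forall>\<^sub>F s in at_right (0::real). s < 1" by (rule eventually_at_rightI[of 0 1]) auto
      \<comment> \<open>Local minimality and strict descent contradict each other for small
        \<open>s\<close>; the conclusion \<open>s < 0\<close> records this contradiction and clashes
        with \<open>0 < s\<close>.\<close>
      ultimately have "\<forall>\<^sub>F s in at_right (0::real). s < 0"
      proof eventually_elim
        case (elim s)
        have wS: "?w s \<in> data.Z.S"
          by (intro subspace_add[OF data.Z.subspace_S] subspace_scale[OF data.Z.subspace_S] subspace_diff[OF data.Z.subspace_S] finseq_input z)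
        have "traj_near T \<epsilon> x' u' (\<lambda>t. st t (?w s, \<theta>)) (apply_bcontfun (?w s))"
          using elim(1) x' by (simp add: traj_near_def)
        then have "SB_cost P T \<theta> \<gamma> x' u' \<le> SB_cost P T \<theta> \<gamma> (\<lambda>t. st t (?w s, \<theta>)) (apply_bcontfun (?w s))"
          by (intro \<epsilon>(2) feas wS inW elim(2))
        moreover have "SB_cost P T \<theta> \<gamma> x' u' = data.barrier \<gamma> (?z', \<theta>)" by (intro SB_cost_eq x')
        ultimately show "s < 0" using desc[OF finseq_input near[OF nr] ne elim(3)] elim(4) cost[OF wS] by simp
      qed
      then have "\<forall>\<^sub>F s in at_right (0::real). s < 0 \<and> 0 < s"
        using eventually_at_right_less by (rule eventually_conj)
      then show False using eventually_happens'[OF trivial_limit_at_right_real] by fastforce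
    qed
    then have "apply_bcontfun z t = u' t" if "t < T" for t using that by (metis finseq_apply)
    then show ?thesis using x' \<open>?z' = z\<close> by (simp add: same_traj_def)
  qed
  then show ?thesis unfolding isolated_local_min_def using min r by (intro conjI exI[of _ "r / 2"]) auto
qed

end

section \<open>The auxiliary problem\<close>

lemma matrix_eq_columns: "(\<And>j. A *v axis j 1 = B *v axis j 1) \<Longrightarrow> A = (B :: real^'r^'n)"
  by (simp add: vec_eq_iff matrix_vector_mult_basis column_def)

lemma trace_scaleR: "trace (c *\<^sub>R A) = c * trace (A :: real^'n^'n)"
  by (simp add: trace_def sum_distrib_left)

text \<open>The trace splits over columns, and on column \<open>j\<close> the linear terms are
  absorbed by \<open>augmented_hessian_form\<close> with the \<open>j\<close>-th unit vector as
  parametric direction.\<close>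

lemma trace_stage_form:
  fixes X :: "real^'r^'n" and U :: "real^'r^'m"
  assumes f: "C2_on W (uncurry3 f)" and W: "open W" "(x, u, \<theta>) \<in> W"
  shows "trace ((1/2) *\<^sub>R (transpose X ** Dxx f x u \<theta> ** X + transpose X ** Dxu f x u \<theta> ** U
        + transpose U ** Dux f x u \<theta> ** X + transpose U ** Duu f x u \<theta> ** U)
        + transpose (Dxt f x u \<theta>) ** X + transpose (Dut f x u \<theta>) ** U)
    = (\<Sum>j\<in>UNIV. 1/2 * fderiv (fderiv (uncurry3 f)) (x, u, \<theta>) (X *v axis j 1, U *v axis j 1, axis j 1) (X *v axis j 1, U *v axis j 1, axis j 1)
        - 1/2 * fderiv (fderiv (uncurry3 f)) (x, u, \<theta>) (0, 0, axis j 1) (0, 0, axis j 1))"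
  unfolding augmented_hessian_form[OF assms, symmetric]
  unfolding trace_add trace_scaleR matrix_mul_assoc[symmetric] trace_transpose_mult matrix_vector_mul_assoc[symmetric]
  by (simp add: sum.distrib sum_distrib_left inner_commute algebra_simps)

context control
begin

text \<open>Column \<open>j\<close> of the matrix inputs joined with the \<open>j\<close>-th
  parameter direction: a variation of inputs and parameter together.\<close>

definition aux_dir :: "(nat \<Rightarrow> real^'r^'m) \<Rightarrow> 'r \<Rightarrow> (nat \<Rightarrow>\<^sub>C (real^'m)) \<times> (real^'r)" where
  "aux_dir U j = (finseq T (\<lambda>t. U t *v axis j 1), axis j 1)"

lemma fderiv_st_Suc_jac:
  "fderiv (st (Suc t)) q a = Fx (dyn P) (st t q) (apply_bcontfun (fst q) t) (snd q) *v fderiv (st t) q a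
     + Fu (dyn P) (st t q) (apply_bcontfun (fst q) t) (snd q) *v apply_bcontfun (fst a) t
     + Ft (dyn P) (st t q) (apply_bcontfun (fst q) t) (snd q) *v snd a"
proof -
  note D = C1_on_differentiable[OF C2_on_C1[OF C2_dyn] UNIV_I]
  show ?thesis
    unfolding fderiv_st_Suc Fx_mult[OF D] Fu_mult[OF D] Ft_mult[OF D] blinfun.add_right[symmetric] fderiv_pnt
    by (simp add: pnt_def)
qed

text \<open>The auxiliary dynamics are the linearization of \<open>st\<close>, so feasibility means
  that each column of \<open>X\<close> is the state sensitivity along
  \<open>aux_dir\<close>.\<close>

lemma aux_feas_iff:
  "aux_feas P T \<theta> (\<lambda>t. st t (z, \<theta>)) (apply_bcontfun z) X U \<longleftrightarrow>
     (\<forall>t\<le>T. \<forall>j. X t *v axis j 1 = fderiv (st t) (z, \<theta>) (aux_dir U j))"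
proof
  let ?F = "\<lambda>t. Fx (dyn P) (st t (z, \<theta>)) (apply_bcontfun z t) \<theta> ** X t
     + Fu (dyn P) (st t (z, \<theta>)) (apply_bcontfun z t) \<theta> ** U t + Ft (dyn P) (st t (z, \<theta>)) (apply_bcontfun z t) \<theta>"
  have init: "jac (init P) \<theta> *v axis j 1 = fderiv (st 0) (z, \<theta>) (aux_dir U j)" for j
    unfolding fderiv_st_0 using jac_mult[OF C1_on_has_derivative[OF C2_on_C1[OF C2_init] UNIV_I]]
    by (simp add: aux_dir_def)
  have step: "?F t *v axis j 1 = fderiv (st (Suc t)) (z, \<theta>) (aux_dir U j)"
    if "t < T" "X t *v axis j 1 = fderiv (st t) (z, \<theta>) (aux_dir U j)" for t j
    using that unfolding fderiv_st_Suc_jac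
    by (simp add: matrix_vector_mult_add_rdistrib matrix_vector_mul_assoc[symmetric] aux_dir_def)
  {
    assume f: "aux_feas P T \<theta> (\<lambda>t. st t (z, \<theta>)) (apply_bcontfun z) X U"
    have "t \<le> T \<longrightarrow> (\<forall>j. X t *v axis j 1 = fderiv (st t) (z, \<theta>) (aux_dir U j))" for t
    proof (induction t)
      case 0
      have "X 0 = jac (init P) \<theta>" using f by (simp add: aux_feas_def)
      then show ?case by (simp add: init del: st.simps)
    next
      case (Suc t)
      have "X (Suc t) *v axis j 1 = fderiv (st (Suc t)) (z, \<theta>) (aux_dir U j)" if "Suc t \<le> T" for j
      proof -
        have "X (Suc t) = ?F t" using f that by (simp add: aux_feas_def)
        then show ?thesis using step[of t j] Suc that by simp
      qed
      then show ?case by blast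
    qed
    then show "\<forall>t\<le>T. \<forall>j. X t *v axis j 1 = fderiv (st t) (z, \<theta>) (aux_dir U j)" by blast
  next
    assume X: "\<forall>t\<le>T. \<forall>j. X t *v axis j 1 = fderiv (st t) (z, \<theta>) (aux_dir U j)"
    have "X 0 = jac (init P) \<theta>"
      by (rule matrix_eq_columns) (simp only: init X[rule_format, OF le0])
    moreover have "X (Suc t) = ?F t" if "t < T" for t
      by (rule matrix_eq_columns) (use X that step in \<open>simp add: Suc_le_eq\<close>)
    ultimately show "aux_feas P T \<theta> (\<lambda>t. st t (z, \<theta>)) (apply_bcontfun z) X U" by (simp add: aux_feas_def)
  }
qed

lemma adjoint_barrier_costate:
  assumes q: "(z, \<theta>) \<in> data.strict_region"
    and lam: "barrier_costate P T \<theta> \<gamma> (\<lambda>t. st t (z, \<theta>)) (apply_bcontfun z) lam"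
  shows "adjoint (bcost \<gamma>) (z, \<theta>) lam"
  unfolding adjoint_def
proof (intro allI impI)
  fix t d assume t: "1 \<le> t \<and> t \<le> T"
  have pW: "pnt t (z, \<theta>) \<in> interior_stage t" using q t by (simp add: strict_region_stage stage_dom_def)
  have D: "uncurry3 (hamf (bcost \<gamma>) lam t) differentiable (at (st t (z, \<theta>), apply_bcontfun z t, \<theta>))"
    using C1_on_differentiable[OF C2_on_C1[OF C2_hamf[where l = "bcost \<gamma>" and t = t, OF C2_bcost open_interior_stage]] pW] t
    by (simp add: pnt_def)
  have "lam t = Dx (hamf (bcost \<gamma>) lam t) (st t (z, \<theta>)) (apply_bcontfun z t) \<theta>"
  proof (cases "t < T")
    case True
    then show ?thesis using lam t by (simp add: barrier_costate_def hamf_bcost)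
  next
    case False
    then have "t = T" using t by simp
    then show ?thesis using lam by (simp add: barrier_costate_def hamf_bcost terminal_as_stage(1)[where u = "apply_bcontfun z T"])
  qed
  then show "fderiv (uncurry3 (hamf (bcost \<gamma>) lam t)) (pnt t (z, \<theta>)) (d, 0, 0) = lam t \<bullet> d"
    using Dx_inner[OF D, of d] by (simp add: pnt_def)
qed

text \<open>The constant collects the purely parametric second-order terms, which no variation of the inputs affects.\<close>

lemma aux_cost_eq:
  assumes q: "(z, \<theta>) \<in> data.strict_region"
    and lam: "barrier_costate P T \<theta> \<gamma> (\<lambda>t. st t (z, \<theta>)) (apply_bcontfun z) lam"
  obtains C where "\<And>X U. aux_feas P T \<theta> (\<lambda>t. st t (z, \<theta>)) (apply_bcontfun z) X U \<Longrightarrow>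
     aux_cost P T \<theta> \<gamma> (\<lambda>t. st t (z, \<theta>)) (apply_bcontfun z) lam X U
     = (\<Sum>j\<in>UNIV. 1/2 * fderiv (fderiv (data.barrier \<gamma>)) (z, \<theta>) (aux_dir U j) (aux_dir U j)) - C"
proof -
  let ?q = "(z, \<theta>)"
  let ?H = "\<lambda>t. uncurry3 (hamf (bcost \<gamma>) lam t)"
  let ?D = "\<lambda>t. fderiv (fderiv (?H t)) (pnt t ?q)"
  let ?c = "\<lambda>j. fderiv (?H 0) (pnt 0 ?q) (fderiv (fderiv (init P)) \<theta> (axis j 1) (axis j 1), 0, 0)"
  let ?C = "\<Sum>j\<in>UNIV. 1/2 * (\<Sum>t\<le>T. ?D t (0, 0, axis j 1) (0, 0, axis j 1)) + 1/2 * ?c j"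
  have qW: "?q \<in> stage_dom interior_stage" using q by (simp add: strict_region_stage)
  have pW: "(st t ?q, apply_bcontfun z t, \<theta>) \<in> interior_stage t" if "t \<le> T" for t
    using qW that by (simp add: stage_dom_def pnt_def)
  have HC2: "C2_on (interior_stage t) (?H t)" if "t \<le> T" for t
    using C2_hamf[where l = "bcost \<gamma>" and t = t, OF C2_bcost open_interior_stage] that by blast
  have D2: "fderiv (fderiv (data.barrier \<gamma>)) ?q (aux_dir U j) (aux_dir U j)
      = (\<Sum>t\<le>T. ?D t (fderiv (pnt t) ?q (aux_dir U j)) (fderiv (pnt t) ?q (aux_dir U j))) + ?c j" for U j
  proof -
    have "fderiv (fderiv (total (bcost \<gamma>))) ?q (aux_dir U j) (aux_dir U j)
      = (\<Sum>t\<le>T. ?D t (fderiv (pnt t) ?q (aux_dir U j)) (fderiv (pnt t) ?q (aux_dir U j)))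
        + fderiv (?H 0) (pnt 0 ?q) (fderiv (fderiv (st 0)) ?q (aux_dir U j) (aux_dir U j), 0, 0)"
      by (rule fderiv2_total[where W = interior_stage])
         (rule C2_bcost open_interior_stage qW adjoint_barrier_costate[OF q lam] | assumption)+
    then show ?thesis unfolding barrier_total fderiv2_st_0(2) by (simp only: aux_dir_def snd_conv)
  qed
  have "aux_cost P T \<theta> \<gamma> (\<lambda>t. st t ?q) (apply_bcontfun z) lam X U
     = (\<Sum>j\<in>UNIV. 1/2 * fderiv (fderiv (data.barrier \<gamma>)) ?q (aux_dir U j) (aux_dir U j)) - ?C"
    if f: "aux_feas P T \<theta> (\<lambda>t. st t ?q) (apply_bcontfun z) X U" for X U
  proof -
    let ?g = "\<lambda>t j. 1/2 * ?D t (fderiv (pnt t) ?q (aux_dir U j)) (fderiv (pnt t) ?q (aux_dir U j))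
      - 1/2 * ?D t (0, 0, axis j 1) (0, 0, axis j 1)"
    have X: "X t *v axis j 1 = fderiv (st t) ?q (aux_dir U j)" if "t \<le> T" for t j
      using f that unfolding aux_feas_iff by blast
    have dir: "fderiv (pnt t) ?q (aux_dir U j) = (X t *v axis j 1, U t *v axis j 1, axis j 1)" if "t < T" for t j
      using that X[of t j] by (simp add: fderiv_pnt) (simp add: aux_dir_def)
    \<comment> \<open>The zero input variation at time \<open>T\<close> is written as a zero matrix
      applied to a unit vector, so that \<open>trace_stage_form\<close> applies with zero
      \<open>U\<close>.\<close>
    have dirT: "fderiv (pnt T) ?q (aux_dir U j) = (X T *v axis j 1, 0 *v axis j 1, axis j 1)" for j
      using X[of T j] by (simp add: fderiv_pnt) (simp add: aux_dir_def)
    have stage: "(let L = bham P t \<gamma> (lam (Suc t)); xt = st t ?q; ut = apply_bcontfun z t in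
        trace ((1/2) *\<^sub>R (transpose (X t) ** Dxx L xt ut \<theta> ** X t + transpose (X t) ** Dxu L xt ut \<theta> ** U t
                         + transpose (U t) ** Dux L xt ut \<theta> ** X t + transpose (U t) ** Duu L xt ut \<theta> ** U t)
               + transpose (Dxt L xt ut \<theta>) ** X t + transpose (Dut L xt ut \<theta>) ** U t)) = (\<Sum>j\<in>UNIV. ?g t j)" if "t < T" for t
      unfolding Let_def dir[OF that] hamf_bcost(1)[OF that, symmetric]
      unfolding pnt_def fst_conv snd_conv
      by (rule trace_stage_form[OF HC2 open_interior_stage pW]) (use that in auto)
    have "trace ((1/2) *\<^sub>R (transpose (X T) ** TDxx (bhamT P \<gamma>) (st T ?q) \<theta> ** X T)
              + transpose (TDxt (bhamT P \<gamma>) (st T ?q) \<theta>) ** X T) = (\<Sum>j\<in>UNIV. ?g T j)"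
      using trace_stage_form[OF HC2[OF order_refl] open_interior_stage[OF order_refl] pW[OF order_refl], of "X T" 0]
      unfolding dirT pnt_def fst_conv snd_conv
      by (simp add: hamf_bcost(2) terminal_as_stage(2,3)[where u = "apply_bcontfun z T"] transpose_def matrix_matrix_mult_def flip: zero_vec_def)
    then have "aux_cost P T \<theta> \<gamma> (\<lambda>t. st t ?q) (apply_bcontfun z) lam X U = (\<Sum>t\<le>T. \<Sum>j\<in>UNIV. ?g t j)"
      unfolding aux_cost_def lessThan_Suc_atMost[symmetric] using stage by simp
    also have "\<dots> = (\<Sum>j\<in>UNIV. \<Sum>t\<le>T. ?g t j)" by (rule sum.swap)
    also have "\<dots> = (\<Sum>j\<in>UNIV. 1/2 * fderiv (fderiv (data.barrier \<gamma>)) ?q (aux_dir U j) (aux_dir U j)) - ?C"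
      unfolding sum_subtractf[symmetric] D2 by (intro sum.cong) (simp_all add: sum_subtractf sum_distrib_left algebra_simps)
    finally show ?thesis .
  qed
  then show ?thesis by (rule that)
qed

text \<open>By \<open>cross\<close> the mixed terms between the candidate and any input variation
  vanish. The cost of a competitor therefore exceeds that of the candidate by exactly half the
  barrier Hessian evaluated on the input differences, which is positive unless these vanish.\<close>

lemma aux_unique_minI:
  assumes q: "(z, \<theta>) \<in> data.strict_region"
    and lam: "barrier_costate P T \<theta> \<gamma> (\<lambda>t. st t (z, \<theta>)) (apply_bcontfun z) lam"
    and feas: "aux_feas P T \<theta> (\<lambda>t. st t (z, \<theta>)) (apply_bcontfun z) X U"
    and cross: "\<And>d j. d \<in> data.Z.S \<Longrightarrow> fderiv (fderiv (data.barrier \<gamma>)) (z, \<theta>) (aux_dir U j) (d, 0) = 0"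
    and pos: "\<And>d. d \<in> data.Z.S \<Longrightarrow> d \<noteq> 0 \<Longrightarrow> fderiv (fderiv (data.barrier \<gamma>)) (z, \<theta>) (d, 0) (d, 0) > 0"
  shows "aux_unique_min P T \<theta> \<gamma> (\<lambda>t. st t (z, \<theta>)) (apply_bcontfun z) lam X U"
proof -
  let ?D = "fderiv (fderiv (data.barrier \<gamma>)) (z, \<theta>)"
  let ?feas = "aux_feas P T \<theta> (\<lambda>t. st t (z, \<theta>)) (apply_bcontfun z)"
  let ?cost = "aux_cost P T \<theta> \<gamma> (\<lambda>t. st t (z, \<theta>)) (apply_bcontfun z) lam"
  obtain C where C: "\<And>X U. ?feas X U \<Longrightarrow> ?cost X U = (\<Sum>j\<in>UNIV. 1/2 * ?D (aux_dir U j) (aux_dir U j)) - C"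
    by (rule aux_cost_eq[OF q lam]) (rule that)
  define \<delta> where "\<delta> U' j = finseq T (\<lambda>t. U' t *v axis j 1) - finseq T (\<lambda>t. U t *v axis j 1)" for U' j
  have \<delta>S: "\<delta> U' j \<in> data.Z.S" for U' j
    unfolding \<delta>_def by (intro subspace_diff[OF data.Z.subspace_S] finseq_input)
  have diff: "?cost X' U' = ?cost X U + 1/2 * (\<Sum>j\<in>UNIV. ?D (\<delta> U' j, 0) (\<delta> U' j, 0))" if "?feas X' U'" for X' U'
  proof -
    have "?D (aux_dir U' j) (aux_dir U' j) = ?D (aux_dir U j) (aux_dir U j) + ?D (\<delta> U' j, 0) (\<delta> U' j, 0)" for j
    proof -
      have sym: "?D (\<delta> U' j, 0) (aux_dir U j) = ?D (aux_dir U j) (\<delta> U' j, 0)"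
        by (rule fderiv2_symmetric[OF data.barrier_C2 data.open_strict_region q])
      have "aux_dir U' j = aux_dir U j + (\<delta> U' j, 0)" by (simp add: aux_dir_def \<delta>_def)
      then show ?thesis by (simp add: blinfun.add_left blinfun.add_right sym cross[OF \<delta>S])
    qed
    then show ?thesis by (simp add: C[OF that] C[OF feas] sum.distrib sum_distrib_left add_divide_distrib)
  qed
  have nn: "?D (\<delta> U' j, 0) (\<delta> U' j, 0) \<ge> 0" for U' j
    using pos[OF \<delta>S, of U' j] by (cases "\<delta> U' j = 0") (auto simp: blinfun.zero_right simp flip: zero_prod_def)
  have le: "?cost X U \<le> ?cost X' U'" if "?feas X' U'" for X' U'
    using diff[OF that] sum_nonneg[of UNIV "\<lambda>j. ?D (\<delta> U' j, 0) (\<delta> U' j, 0)"] nn by simp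
  have "same_traj T X U X' U'" if f': "?feas X' U'" and le': "?cost X' U' \<le> ?cost X U" for X' U'
  proof -
    have "(\<Sum>j\<in>UNIV. ?D (\<delta> U' j, 0) (\<delta> U' j, 0)) \<le> 0" using diff[OF f'] le' by simp
    then have "(\<Sum>j\<in>UNIV. ?D (\<delta> U' j, 0) (\<delta> U' j, 0)) = 0" using sum_nonneg[of UNIV "\<lambda>j. ?D (\<delta> U' j, 0) (\<delta> U' j, 0)"] nn by (intro antisym) auto
    then have "\<forall>j\<in>UNIV. ?D (\<delta> U' j, 0) (\<delta> U' j, 0) = 0" by (subst (asm) sum_nonneg_eq_0_iff) (use nn in auto)
    then have \<delta>0: "\<delta> U' j = 0" for j using pos[OF \<delta>S, of U' j] by fastforce
    then have dir: "aux_dir U' j = aux_dir U j" for j by (simp add: \<delta>_def aux_dir_def)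
    have "U' t = U t" if "t < T" for t
    proof (rule matrix_eq_columns)
      fix j
      have "finseq T (\<lambda>t. U' t *v axis j 1) = finseq T (\<lambda>t. U t *v axis j 1)" using \<delta>0[of j] by (simp add: \<delta>_def)
      then have "apply_bcontfun (finseq T (\<lambda>t. U' t *v axis j 1)) t = apply_bcontfun (finseq T (\<lambda>t. U t *v axis j 1)) t" by simp
      then show "U' t *v axis j 1 = U t *v axis j 1" using that by simp
    qed
    moreover have "X' t = X t" if "t \<le> T" for t
      using f' feas that unfolding aux_feas_iff by (intro matrix_eq_columns) (simp add: dir)
    ultimately show ?thesis by (simp add: same_traj_def)
  qed
  then show ?thesis unfolding aux_unique_min_def using feas le by blast
qed

lemma aux_unique_min_derivative:
  assumes V: "open V" "\<theta> \<in> V"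
    and z: "\<And>\<theta>'. \<theta>' \<in> V \<Longrightarrow> z \<theta>' \<in> data.Z.S \<and> (z \<theta>', \<theta>') \<in> data.strict_region"
    and z': "(z has_derivative z') (at \<theta>)"
    and crit: "\<And>\<theta>' d. \<theta>' \<in> V \<Longrightarrow> d \<in> data.Z.S \<Longrightarrow> fderiv (data.barrier \<gamma>) (z \<theta>', \<theta>') (d, 0) = 0"
    and pos: "\<And>d. d \<in> data.Z.S \<Longrightarrow> d \<noteq> 0 \<Longrightarrow> fderiv (fderiv (data.barrier \<gamma>)) (z \<theta>, \<theta>) (d, 0) (d, 0) > 0"
    and lam: "barrier_costate P T \<theta> \<gamma> (\<lambda>t. st t (z \<theta>, \<theta>)) (apply_bcontfun (z \<theta>)) lam"
  shows "aux_unique_min P T \<theta> \<gamma> (\<lambda>t. st t (z \<theta>, \<theta>)) (apply_bcontfun (z \<theta>)) lam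
     (\<lambda>t. jac (\<lambda>\<theta>'. st t (z \<theta>', \<theta>')) \<theta>) (\<lambda>t. jac (\<lambda>\<theta>'. apply_bcontfun (z \<theta>') t) \<theta>)"
proof -
  let ?U = "\<lambda>t. jac (\<lambda>\<theta>'. apply_bcontfun (z \<theta>') t) \<theta>"
  have q': "((\<lambda>\<theta>'. (z \<theta>', \<theta>')) has_derivative (\<lambda>h. (z' h, h))) (at \<theta>)"
    by (intro has_derivative_Pair z' has_derivative_ident)
  have u': "((\<lambda>\<theta>'. apply_bcontfun (z \<theta>') t) has_derivative (\<lambda>h. apply_bcontfun (z' h) t)) (at \<theta>)" for t
    by (rule bounded_linear.has_derivative[OF bounded_linear_eval z'])
  \<comment> \<open>Entries from time \<open>T\<close> on are constantly 0 along the curve, so their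
    derivatives are 0.\<close>
  have z'S: "z' h \<in> data.Z.S" for h
    unfolding input_space_iff
  proof (intro allI impI)
    fix t assume t: "t \<ge> T"
    have "((\<lambda>\<theta>'. 0) has_derivative (\<lambda>h. apply_bcontfun (z' h) t)) (at \<theta>)"
      by (rule has_derivative_transform_within_open[OF u' V]) (use z t in \<open>simp add: input_space_iff\<close>)
    from fun_cong[OF has_derivative_unique[OF this has_derivative_const], of h]
    show "apply_bcontfun (z' h) t = 0" by simp
  qed
  have dir: "aux_dir ?U j = (z' (axis j 1), axis j 1)" for j
  proof -
    have "finseq T (\<lambda>t. ?U t *v axis j 1) = finseq T (apply_bcontfun (z' (axis j 1)))"
      by (rule bcontfun_eqI) (simp add: jac_mult[OF u'])
    then show ?thesis unfolding aux_dir_def using finseq_of_input[OF z'S] by simp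
  qed
  have "((\<lambda>\<theta>'. st t (z \<theta>', \<theta>')) has_derivative (\<lambda>h. fderiv (st t) (z \<theta>, \<theta>) (z' h, h))) (at \<theta>)" for t
    by (rule has_derivative_compose[OF q' fderiv_works[OF st_differentiable(1)]])
  then have "jac (\<lambda>\<theta>'. st t (z \<theta>', \<theta>')) \<theta> *v h = fderiv (st t) (z \<theta>, \<theta>) (z' h, h)" for t h
    by (rule jac_mult)
  then have feas: "aux_feas P T \<theta> (\<lambda>t. st t (z \<theta>, \<theta>)) (apply_bcontfun (z \<theta>)) (\<lambda>t. jac (\<lambda>\<theta>'. st t (z \<theta>', \<theta>')) \<theta>) ?U"
    unfolding aux_feas_iff dir by (simp del: st.simps)
  \<comment> \<open>Stationarity holds for every parameter in \<open>V\<close>, so its derivative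
    along the curve is 0.\<close>
  have cross: "fderiv (fderiv (data.barrier \<gamma>)) (z \<theta>, \<theta>) (z' h, h) (d, 0) = 0" if d: "d \<in> data.Z.S" for d h
  proof -
    have 1: "((\<lambda>\<theta>'. fderiv (data.barrier \<gamma>) (z \<theta>', \<theta>') (d, 0)) has_derivative
        (\<lambda>h. fderiv (fderiv (data.barrier \<gamma>)) (z \<theta>, \<theta>) (z' h, h) (d, 0))) (at \<theta>)"
      by (rule has_derivative_compose[OF q' fderiv_apply_const[OF C1_on_differentiable[OF C2_on_fderiv[OF data.barrier_C2]]]])
         (use z V in blast)
    have "((\<lambda>\<theta>'. 0) has_derivative (\<lambda>h. fderiv (fderiv (data.barrier \<gamma>)) (z \<theta>, \<theta>) (z' h, h) (d, 0))) (at \<theta>)"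
      by (rule has_derivative_transform_within_open[OF 1 V]) (simp add: crit d)
    from fun_cong[OF has_derivative_unique[OF this has_derivative_const], of h] show ?thesis .
  qed
  show ?thesis
    by (rule aux_unique_minI[OF _ lam feas _ pos]) (use z V in \<open>auto simp: dir cross\<close>)
qed

end

section \<open>The barrier trajectories\<close>

lemma C1_on_slice:
  fixes F :: "'a::real_normed_vector \<times> real \<Rightarrow> 'b::real_normed_vector"
  assumes "C1_on (A \<times> I) F" "\<theta> \<in> A" "\<gamma> \<in> I"
  shows "((\<lambda>\<theta>'. F (\<theta>', \<gamma>)) has_derivative (\<lambda>h. fderiv F (\<theta>, \<gamma>) (h, 0))) (at \<theta>)"
proof -
  have "((\<lambda>\<theta>'. (\<theta>', \<gamma>)) has_derivative (\<lambda>h. (h, 0))) (at \<theta>)"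
    by (intro has_derivative_Pair has_derivative_ident has_derivative_const)
  from has_derivative_compose[OF this C1_on_has_derivative[OF assms(1)]] assms(2,3) show ?thesis by simp
qed

text \<open>Since 0 is interior to \<open>I\<close>, both limits are continuity at
  \<open>(\<theta>, 0)\<close>: of \<open>F\<close>, and of its total derivative, whose parametric
  part gives the columns of the Jacobian.\<close>

lemma C1_on_limit_at_right:
  fixes F :: "(real^'r) \<times> real \<Rightarrow> real^'k"
  assumes F: "C1_on (A \<times> I) F" and A: "\<theta> \<in> A" "open A" and I: "0 \<in> I" "open I"
  shows "((\<lambda>\<gamma>. F (\<theta>, \<gamma>)) \<longlongrightarrow> F (\<theta>, 0)) (at_right 0)"
    and "((\<lambda>\<gamma>. jac (\<lambda>\<theta>'. F (\<theta>', \<gamma>)) \<theta>) \<longlongrightarrow> jac (\<lambda>\<theta>'. F (\<theta>', 0)) \<theta>) (at_right 0)"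
proof -
  have pair: "((\<lambda>\<gamma>. (\<theta>, \<gamma>)) \<longlongrightarrow> (\<theta>, 0)) (at_right (0::real))" by (intro tendsto_Pair tendsto_const tendsto_ident_at)
  have mem: "(\<theta>, 0) \<in> A \<times> I" using A I by simp
  show "((\<lambda>\<gamma>. F (\<theta>, \<gamma>)) \<longlongrightarrow> F (\<theta>, 0)) (at_right 0)"
    by (rule isCont_tendsto_compose[OF C1_on_isCont[OF F mem] pair])
  have "isCont (fderiv F) (\<theta>, 0)"
    using C1_on_continuous_fderiv[OF F] mem open_Times[OF A(2) I(2)] continuous_on_eq_continuous_at by blast
  from isCont_tendsto_compose[OF this pair]
  have D: "((\<lambda>\<gamma>. fderiv F (\<theta>, \<gamma>) (axis j 1, 0) $ i) \<longlongrightarrow> fderiv F (\<theta>, 0) (axis j 1, 0) $ i) (at_right 0)" for i j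
    by (intro tendsto_vec_nth blinfun.tendsto tendsto_const)
  have entry: "jac (\<lambda>\<theta>'. F (\<theta>', \<gamma>)) \<theta> $ i $ j = fderiv F (\<theta>, \<gamma>) (axis j 1, 0) $ i" if "\<gamma> \<in> I" for \<gamma> i j
    using jac_mult[OF C1_on_slice[OF F A(1) that], of "axis j 1"] by (simp add: matrix_vector_mult_basis column_def vec_eq_iff)
  have "\<forall>\<^sub>F \<gamma> in at_right 0. \<gamma> \<in> I"
    using eventually_nhds_in_open[OF I(2,1)] by (rule eventually_at_filter[THEN iffD2, OF eventually_mono]) simp
  then have "\<forall>\<^sub>F \<gamma> in at_right 0. fderiv F (\<theta>, \<gamma>) (axis j 1, 0) $ i = jac (\<lambda>\<theta>'. F (\<theta>', \<gamma>)) \<theta> $ i $ j" for i j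
    by eventually_elim (simp add: entry)
  from Lim_transform_eventually[OF D this]
  show "((\<lambda>\<gamma>. jac (\<lambda>\<theta>'. F (\<theta>', \<gamma>)) \<theta>) \<longlongrightarrow> jac (\<lambda>\<theta>'. F (\<theta>', 0)) \<theta>) (at_right 0)"
    by (intro vec_tendstoI) (simp add: entry I(1))
qed

lemma jac_cong_open:
  assumes "open S" "\<theta> \<in> S" "\<And>\<theta>'. \<theta>' \<in> S \<Longrightarrow> f \<theta>' = g \<theta>'" "(f has_derivative D) (at \<theta>)"
  shows "jac f \<theta> = jac g \<theta>"
proof (rule matrix_eq_columns)
  fix j
  have "(g has_derivative D) (at \<theta>)"
    by (rule has_derivative_transform_within_open[OF assms(4,1,2)]) (simp add: assms(3))
  then show "jac f \<theta> *v axis j 1 = jac g \<theta> *v axis j 1" by (simp add: jac_mult assms(4) jac_mult)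
qed

section \<open>Identification of the branch with the given minimizing trajectories\<close>

context reference
begin

text \<open>These are the conditions under which \<open>barrier_branch\<close> places a curve on the
  branch. Continuity of the finitely many input components gives continuity in the supremum
  norm.\<close>

lemma minimizing_curve:
  assumes U: "open U" "\<theta>b \<in> U" and C1: "\<And>t. t < T \<Longrightarrow> Ck_on 1 U (\<lambda>\<theta>. \<xi>u \<theta> t)"
    and at: "same_traj T xb ub (\<xi>x \<theta>b) (\<xi>u \<theta>b)"
    and min: "\<And>\<theta>. \<theta> \<in> U \<Longrightarrow> local_min T (B_feas P T \<theta>) (B_cost P T \<theta>) (\<xi>x \<theta>) (\<xi>u \<theta>)"
  shows "isCont (\<lambda>\<theta>. finseq T (\<xi>u \<theta>)) \<theta>b" "finseq T (\<xi>u \<theta>b) = zb"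
    "\<forall>\<^sub>F \<theta> in nhds \<theta>b. data.local_minimizer \<theta> (finseq T (\<xi>u \<theta>))"
proof -
  show "finseq T (\<xi>u \<theta>b) = zb"
    by (rule bcontfun_eqI) (use at in \<open>simp add: zb_def same_traj_def\<close>)
  show "\<forall>\<^sub>F \<theta> in nhds \<theta>b. data.local_minimizer \<theta> (finseq T (\<xi>u \<theta>))"
    using eventually_nhds_in_open[OF U] by eventually_elim (rule local_minimizer_B[OF min])
  have lim: "((\<lambda>\<theta>. \<xi>u \<theta> t) \<longlongrightarrow> \<xi>u \<theta>b t) (at \<theta>b)" if "t < T" for t
    using C1_on_isCont[OF C1[OF that, unfolded C1_on_iff_Ck_on[symmetric]] U(2)] by (simp add: isCont_def)
  show "isCont (\<lambda>\<theta>. finseq T (\<xi>u \<theta>)) \<theta>b"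
    unfolding isCont_def
  proof (rule tendstoI)
    fix e :: real assume e: "e > 0"
    have "\<forall>\<^sub>F \<theta> in at \<theta>b. \<forall>t\<in>{..<T}. dist (\<xi>u \<theta> t) (\<xi>u \<theta>b t) < e / 2"
      by (intro eventually_ball_finite ballI tendstoD[OF lim]) (use e in auto)
    then show "\<forall>\<^sub>F \<theta> in at \<theta>b. dist (finseq T (\<xi>u \<theta>)) (finseq T (\<xi>u \<theta>b)) < e"
    proof eventually_elim
      case (elim \<theta>)
      have "dist (finseq T (\<xi>u \<theta>)) (finseq T (\<xi>u \<theta>b)) \<le> e / 2"
        by (rule dist_inputs_less[OF finseq_input finseq_input]) (use e elim in auto)
      then show ?case using e by simp
    qed
  qed
qed

theorem barrier_trajectories:
  assumes U: "open U" "\<theta>b \<in> U" and C1: "\<And>t. t < T \<Longrightarrow> Ck_on 1 U (\<lambda>\<theta>. \<xi>u \<theta> t)"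
    and at: "same_traj T xb ub (\<xi>x \<theta>b) (\<xi>u \<theta>b)"
    and min: "\<And>\<theta>. \<theta> \<in> U \<Longrightarrow> local_min T (B_feas P T \<theta>) (B_cost P T \<theta>) (\<xi>x \<theta>) (\<xi>u \<theta>)"
  obtains \<epsilon> xs us where "\<epsilon> > 0" "ball \<theta>b \<epsilon> \<subseteq> U"
    "\<And>\<theta> \<gamma>. \<theta> \<in> ball \<theta>b \<epsilon> \<Longrightarrow> 0 < \<gamma> \<Longrightarrow> \<gamma> < \<epsilon> \<Longrightarrow>
       isolated_local_min T (SB_feas P T \<theta>) (SB_cost P T \<theta> \<gamma>) (xs \<theta> \<gamma>) (us \<theta> \<gamma>)"
    "\<And>\<theta> \<gamma> lam. \<theta> \<in> ball \<theta>b \<epsilon> \<Longrightarrow> 0 < \<gamma> \<Longrightarrow> \<gamma> < \<epsilon> \<Longrightarrow> barrier_costate P T \<theta> \<gamma> (xs \<theta> \<gamma>) (us \<theta> \<gamma>) lam \<Longrightarrow>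
       aux_unique_min P T \<theta> \<gamma> (xs \<theta> \<gamma>) (us \<theta> \<gamma>) lam
         (\<lambda>t. jac (\<lambda>\<theta>'. xs \<theta>' \<gamma> t) \<theta>) (\<lambda>t. jac (\<lambda>\<theta>'. us \<theta>' \<gamma> t) \<theta>)"
    "\<And>t. C1_on (ball \<theta>b \<epsilon> \<times> {-\<epsilon><..<\<epsilon>}) (\<lambda>(\<theta>, \<gamma>). xs \<theta> \<gamma> t)"
    "\<And>t. C1_on (ball \<theta>b \<epsilon> \<times> {-\<epsilon><..<\<epsilon>}) (\<lambda>(\<theta>, \<gamma>). us \<theta> \<gamma> t)"
    "\<And>\<theta> t. \<theta> \<in> ball \<theta>b \<epsilon> \<Longrightarrow> t \<le> T \<Longrightarrow> xs \<theta> 0 t = \<xi>x \<theta> t"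
    "\<And>\<theta> t. \<theta> \<in> ball \<theta>b \<epsilon> \<Longrightarrow> t < T \<Longrightarrow> us \<theta> 0 t = \<xi>u \<theta> t"
proof -
  obtain \<epsilon> z where \<epsilon>: "\<epsilon> > 0" and zC1: "C1_on (ball \<theta>b \<epsilon> \<times> {-\<epsilon><..<\<epsilon>}) z" and "z (\<theta>b, 0) = zb"
    and zS: "\<And>\<theta> \<gamma>. \<theta> \<in> ball \<theta>b \<epsilon> \<Longrightarrow> \<gamma> \<in> {-\<epsilon><..<\<epsilon>} \<Longrightarrow> z (\<theta>, \<gamma>) \<in> data.Z.S"
    and zW: "\<And>\<theta> \<gamma>. \<theta> \<in> ball \<theta>b \<epsilon> \<Longrightarrow> 0 < \<gamma> \<Longrightarrow> \<gamma> < \<epsilon> \<Longrightarrow> (z (\<theta>, \<gamma>), \<theta>) \<in> data.strict_region"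
    and crit: "\<And>\<theta> \<gamma> d. \<theta> \<in> ball \<theta>b \<epsilon> \<Longrightarrow> 0 < \<gamma> \<Longrightarrow> \<gamma> < \<epsilon> \<Longrightarrow> d \<in> data.Z.S \<Longrightarrow> fderiv (data.barrier \<gamma>) (z (\<theta>, \<gamma>), \<theta>) (d, 0) = 0"
    and pos: "\<And>\<theta> \<gamma> d. \<theta> \<in> ball \<theta>b \<epsilon> \<Longrightarrow> 0 < \<gamma> \<Longrightarrow> \<gamma> < \<epsilon> \<Longrightarrow> d \<in> data.Z.S \<Longrightarrow> d \<noteq> 0 \<Longrightarrow>
       fderiv (fderiv (data.barrier \<gamma>)) (z (\<theta>, \<gamma>), \<theta>) (d, 0) (d, 0) > 0"
    and uniq: "\<And>\<zeta>. isCont \<zeta> \<theta>b \<Longrightarrow> \<zeta> \<theta>b = zb \<Longrightarrow> \<forall>\<^sub>F \<theta> in nhds \<theta>b. data.local_minimizer \<theta> (\<zeta> \<theta>) \<Longrightarrow>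
       \<forall>\<^sub>F \<theta> in nhds \<theta>b. \<zeta> \<theta> = z (\<theta>, 0)"
    by (rule nlp.barrier_branch[OF nlp_reference]) (rule that)
  have "\<forall>\<^sub>F \<theta> in nhds \<theta>b. finseq T (\<xi>u \<theta>) = z (\<theta>, 0)"
    by (rule uniq) (rule minimizing_curve[OF U C1 at min]; assumption)+
  then have "\<forall>\<^sub>F \<theta> in nhds \<theta>b. \<theta> \<in> U \<and> finseq T (\<xi>u \<theta>) = z (\<theta>, 0)"
    by (rule eventually_conj[OF eventually_nhds_in_open[OF U]])
  then obtain \<rho> where \<rho>: "\<rho> > 0" "\<And>\<theta>. dist \<theta> \<theta>b < \<rho> \<Longrightarrow> \<theta> \<in> U \<and> finseq T (\<xi>u \<theta>) = z (\<theta>, 0)"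
    unfolding eventually_nhds_metric by blast
  \<comment> \<open>Small enough for the branch to exist and for its part at \<gamma> = 0 to
    coincide with the given minimizers.\<close>
  define \<epsilon>' where "\<epsilon>' = min \<epsilon> \<rho>"
  have \<epsilon>': "\<epsilon>' > 0" "\<epsilon>' \<le> \<epsilon>" "\<epsilon>' \<le> \<rho>" using \<epsilon> \<rho> by (auto simp: \<epsilon>'_def)
  have sub: "\<theta> \<in> ball \<theta>b \<epsilon>" if "\<theta> \<in> ball \<theta>b \<epsilon>'" for \<theta> using that \<epsilon>' by auto
  have near: "\<theta> \<in> U" "finseq T (\<xi>u \<theta>) = z (\<theta>, 0)" if "\<theta> \<in> ball \<theta>b \<epsilon>'" for \<theta>
    using \<rho>(2)[of \<theta>] that \<epsilon>' by (auto simp: dist_commute)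
  define xs where "xs \<theta> \<gamma> t = st t (z (\<theta>, \<gamma>), \<theta>)" for \<theta> \<gamma> t
  define us where "us \<theta> \<gamma> t = apply_bcontfun (z (\<theta>, \<gamma>)) t" for \<theta> \<gamma> t
  have traj: "xs \<theta> \<gamma> = (\<lambda>t. st t (z (\<theta>, \<gamma>), \<theta>))" "us \<theta> \<gamma> = apply_bcontfun (z (\<theta>, \<gamma>))" for \<theta> \<gamma>
    by (simp_all add: fun_eq_iff xs_def us_def)
  have zC1': "C1_on (ball \<theta>b \<epsilon>' \<times> {-\<epsilon>'<..<\<epsilon>'}) z"
    by (rule C1_on_subset[OF zC1]) (use sub \<epsilon>' in \<open>auto simp del: mem_ball\<close>)
  show ?thesis
  proof (rule that[of \<epsilon>' xs us])
    show "ball \<theta>b \<epsilon>' \<subseteq> U" using near(1) by blast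
    show "isolated_local_min T (SB_feas P T \<theta>) (SB_cost P T \<theta> \<gamma>) (xs \<theta> \<gamma>) (us \<theta> \<gamma>)"
      if "\<theta> \<in> ball \<theta>b \<epsilon>'" "0 < \<gamma>" "\<gamma> < \<epsilon>'" for \<theta> \<gamma>
      unfolding traj by (rule isolated_minimum_SB[OF zS zW crit pos]) (use that sub \<epsilon>' in \<open>auto simp del: mem_ball\<close>)
    show "aux_unique_min P T \<theta> \<gamma> (xs \<theta> \<gamma>) (us \<theta> \<gamma>) lam
         (\<lambda>t. jac (\<lambda>\<theta>'. xs \<theta>' \<gamma> t) \<theta>) (\<lambda>t. jac (\<lambda>\<theta>'. us \<theta>' \<gamma> t) \<theta>)"
      if \<theta>: "\<theta> \<in> ball \<theta>b \<epsilon>'" and \<gamma>: "0 < \<gamma>" "\<gamma> < \<epsilon>'" and lam: "barrier_costate P T \<theta> \<gamma> (xs \<theta> \<gamma>) (us \<theta> \<gamma>) lam" for \<theta> \<gamma> lam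
    proof -
      have I: "\<gamma> \<in> {-\<epsilon><..<\<epsilon>}" "\<gamma> < \<epsilon>" using \<gamma> \<epsilon>' by auto
      show ?thesis
        unfolding traj
        by (rule aux_unique_min_derivative[where z = "\<lambda>\<theta>. z (\<theta>, \<gamma>)", OF open_ball sub[OF \<theta>] _ C1_on_slice[OF zC1 sub[OF \<theta>] I(1)]])
           (use zS[OF _ I(1)] zW[OF _ \<gamma>(1) I(2)] crit[OF _ \<gamma>(1) I(2)] pos[OF sub[OF \<theta>] \<gamma>(1) I(2)] lam[unfolded traj] in auto)
    qed
    show "C1_on (ball \<theta>b \<epsilon>' \<times> {-\<epsilon>'<..<\<epsilon>'}) (\<lambda>(\<theta>, \<gamma>). xs \<theta> \<gamma> t)" for t
    proof -
      have "C1_on (ball \<theta>b \<epsilon>' \<times> {-\<epsilon>'<..<\<epsilon>'}) (\<lambda>p. st t (z p, fst p))"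
        by (rule C1_on_compose[OF C2_on_C1[OF C2_st] C1_on_Pair[OF zC1' C1_on_linear[OF bounded_linear_fst]]]) simp
      then show ?thesis by (simp add: xs_def case_prod_unfold)
    qed
    show "C1_on (ball \<theta>b \<epsilon>' \<times> {-\<epsilon>'<..<\<epsilon>'}) (\<lambda>(\<theta>, \<gamma>). us \<theta> \<gamma> t)" for t
      using C1_on_linear_comp[OF bounded_linear_eval zC1', of t] by (simp add: us_def case_prod_unfold)
    \<comment> \<open>The inputs agree, and feasibility determines the states from the
      inputs.\<close>
    show "xs \<theta> 0 t = \<xi>x \<theta> t" if "\<theta> \<in> ball \<theta>b \<epsilon>'" "t \<le> T" for \<theta> t
      using min[OF near(1)[OF that(1)]] that(2) near(2)[OF that(1)] by (simp add: xs_def local_min_def B_feas_iff)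
    show "us \<theta> 0 t = \<xi>u \<theta> t" if "\<theta> \<in> ball \<theta>b \<epsilon>'" "t < T" for \<theta> t
      unfolding us_def near(2)[OF that(1), symmetric] using that(2) by simp
  qed (rule \<epsilon>')
qed

end

theorem theorem2:
  fixes P :: "('n::finite, 'm::finite, 'r::finite) ocp"
    and T :: nat
    and \<theta>b :: "real^'r"
    and xb :: "nat \<Rightarrow> real^'n" and ub :: "nat \<Rightarrow> real^'m"
    and lamb :: "nat \<Rightarrow> real^'n" and vb :: "nat \<Rightarrow> nat \<Rightarrow> real" and wb :: "nat \<Rightarrow> nat \<Rightarrow> real"
    and U :: "(real^'r) set"
    and \<xi>x :: "real^'r \<Rightarrow> nat \<Rightarrow> real^'n" and \<xi>u :: "real^'r \<Rightarrow> nat \<Rightarrow> real^'m"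
  assumes smooth: "smooth_data P T"
    and sosc: "SOSC P T \<theta>b xb ub lamb vb wb"
    and licq: "LICQ P T \<theta>b xb ub"
    and sc: "strict_compl P T \<theta>b xb ub vb"
    and U_open: "open U" and U_mem: "\<theta>b \<in> U"
    and xi_C1: "(\<forall>t\<le>T. Ck_on 1 U (\<lambda>\<theta>. \<xi>x \<theta> t)) \<and> (\<forall>t<T. Ck_on 1 U (\<lambda>\<theta>. \<xi>u \<theta> t))"
    and xi_at: "same_traj T xb ub (\<xi>x \<theta>b) (\<xi>u \<theta>b)"
    and xi_min: "\<forall>\<theta>\<in>U. isolated_local_min T (B_feas P T \<theta>) (B_cost P T \<theta>) (\<xi>x \<theta>) (\<xi>u \<theta>)"
  shows "\<exists>\<epsilon>>0. \<exists>(xs :: real^'r \<Rightarrow> real \<Rightarrow> nat \<Rightarrow> real^'n) (us :: real^'r \<Rightarrow> real \<Rightarrow> nat \<Rightarrow> real^'m).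
           ball \<theta>b \<epsilon> \<subseteq> U \<and>
           (\<forall>\<theta>\<in>ball \<theta>b \<epsilon>. \<forall>\<gamma>. 0 < \<gamma> \<and> \<gamma> < \<epsilon> \<longrightarrow>
              isolated_local_min T (SB_feas P T \<theta>) (SB_cost P T \<theta> \<gamma>) (xs \<theta> \<gamma>) (us \<theta> \<gamma>) \<and>
              (\<forall>t<T. \<forall>i<nq P t. gc P t i (xs \<theta> \<gamma> t) (us \<theta> \<gamma> t) \<theta> < 0) \<and>
              (\<forall>i<nqT P. gT P i (xs \<theta> \<gamma> T) \<theta> < 0) \<and>
              (\<forall>lam. barrier_costate P T \<theta> \<gamma> (xs \<theta> \<gamma>) (us \<theta> \<gamma>) lam \<longrightarrow>
                 aux_unique_min P T \<theta> \<gamma> (xs \<theta> \<gamma>) (us \<theta> \<gamma>) lam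
                   (\<lambda>t. jac (\<lambda>\<theta>'. xs \<theta>' \<gamma> t) \<theta>) (\<lambda>t. jac (\<lambda>\<theta>'. us \<theta>' \<gamma> t) \<theta>))) \<and>
           (\<forall>t\<le>T. Ck_on 1 (ball \<theta>b \<epsilon> \<times> {0<..<\<epsilon>}) (\<lambda>(\<theta>, \<gamma>). xs \<theta> \<gamma> t)) \<and>
           (\<forall>t<T. Ck_on 1 (ball \<theta>b \<epsilon> \<times> {0<..<\<epsilon>}) (\<lambda>(\<theta>, \<gamma>). us \<theta> \<gamma> t)) \<and>
           (\<forall>\<theta>\<in>ball \<theta>b \<epsilon>.
              (\<forall>t\<le>T. ((\<lambda>\<gamma>. xs \<theta> \<gamma> t) \<longlongrightarrow> \<xi>x \<theta> t) (at_right 0) \<and>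
                     ((\<lambda>\<gamma>. jac (\<lambda>\<theta>'. xs \<theta>' \<gamma> t) \<theta>) \<longlongrightarrow> jac (\<lambda>\<theta>'. \<xi>x \<theta>' t) \<theta>) (at_right 0)) \<and>
              (\<forall>t<T. ((\<lambda>\<gamma>. us \<theta> \<gamma> t) \<longlongrightarrow> \<xi>u \<theta> t) (at_right 0) \<and>
                     ((\<lambda>\<gamma>. jac (\<lambda>\<theta>'. us \<theta>' \<gamma> t) \<theta>) \<longlongrightarrow> jac (\<lambda>\<theta>'. \<xi>u \<theta>' t) \<theta>) (at_right 0)))"
proof -
  interpret reference P T \<theta>b xb ub lamb vb wb
    using smooth sosc licq sc by unfold_locales
  have min: "local_min T (B_feas P T \<theta>) (B_cost P T \<theta>) (\<xi>x \<theta>) (\<xi>u \<theta>)" if "\<theta> \<in> U" for \<theta>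
    using xi_min that by (simp add: isolated_local_min_def)
  have C1u: "Ck_on 1 U (\<lambda>\<theta>. \<xi>u \<theta> t)" if "t < T" for t using xi_C1 that by blast
  obtain \<epsilon> xs us where \<epsilon>: "\<epsilon> > 0" and sub: "ball \<theta>b \<epsilon> \<subseteq> U"
    and iso: "\<And>\<theta> \<gamma>. \<theta> \<in> ball \<theta>b \<epsilon> \<Longrightarrow> 0 < \<gamma> \<Longrightarrow> \<gamma> < \<epsilon> \<Longrightarrow>
       isolated_local_min T (SB_feas P T \<theta>) (SB_cost P T \<theta> \<gamma>) (xs \<theta> \<gamma>) (us \<theta> \<gamma>)"
    and aux: "\<And>\<theta> \<gamma> lam. \<theta> \<in> ball \<theta>b \<epsilon> \<Longrightarrow> 0 < \<gamma> \<Longrightarrow> \<gamma> < \<epsilon> \<Longrightarrow> barrier_costate P T \<theta> \<gamma> (xs \<theta> \<gamma>) (us \<theta> \<gamma>) lam \<Longrightarrow>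
       aux_unique_min P T \<theta> \<gamma> (xs \<theta> \<gamma>) (us \<theta> \<gamma>) lam
         (\<lambda>t. jac (\<lambda>\<theta>'. xs \<theta>' \<gamma> t) \<theta>) (\<lambda>t. jac (\<lambda>\<theta>'. us \<theta>' \<gamma> t) \<theta>)"
    and C1: "\<And>t. C1_on (ball \<theta>b \<epsilon> \<times> {-\<epsilon><..<\<epsilon>}) (\<lambda>(\<theta>, \<gamma>). xs \<theta> \<gamma> t)"
      "\<And>t. C1_on (ball \<theta>b \<epsilon> \<times> {-\<epsilon><..<\<epsilon>}) (\<lambda>(\<theta>, \<gamma>). us \<theta> \<gamma> t)"
    and xi: "\<And>\<theta> t. \<theta> \<in> ball \<theta>b \<epsilon> \<Longrightarrow> t \<le> T \<Longrightarrow> xs \<theta> 0 t = \<xi>x \<theta> t"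
      "\<And>\<theta> t. \<theta> \<in> ball \<theta>b \<epsilon> \<Longrightarrow> t < T \<Longrightarrow> us \<theta> 0 t = \<xi>u \<theta> t"
    by (rule barrier_trajectories[where U = U and \<xi>x = \<xi>x and \<xi>u = \<xi>u, OF U_open U_mem _ xi_at]) (erule C1u min | rule that)+
  have feas: "SB_feas P T \<theta> (xs \<theta> \<gamma>) (us \<theta> \<gamma>)" if "\<theta> \<in> ball \<theta>b \<epsilon>" "0 < \<gamma>" "\<gamma> < \<epsilon>" for \<theta> \<gamma>
    using iso[OF that] by (simp add: isolated_local_min_def local_min_def)
  have half: "ball \<theta>b \<epsilon> \<times> {0<..<\<epsilon>} \<subseteq> ball \<theta>b \<epsilon> \<times> {-\<epsilon><..<\<epsilon>}" using \<epsilon> by auto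
  have I: "0 \<in> {-\<epsilon><..<\<epsilon>}" using \<epsilon> by simp
  have lim: "((\<lambda>\<gamma>. F \<theta> \<gamma>) \<longlongrightarrow> g \<theta>) (at_right 0) \<and> ((\<lambda>\<gamma>. jac (\<lambda>\<theta>'. F \<theta>' \<gamma>) \<theta>) \<longlongrightarrow> jac g \<theta>) (at_right 0)"
    if F: "C1_on (ball \<theta>b \<epsilon> \<times> {-\<epsilon><..<\<epsilon>}) (\<lambda>(\<theta>, \<gamma>). F \<theta> \<gamma>)" and g: "\<And>\<theta>. \<theta> \<in> ball \<theta>b \<epsilon> \<Longrightarrow> F \<theta> 0 = g \<theta>"
      and \<theta>: "\<theta> \<in> ball \<theta>b \<epsilon>" for F :: "real^'r \<Rightarrow> real \<Rightarrow> real^'k::finite" and g \<theta>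
  proof -
    \<comment> \<open>The two maps agree on the whole ball, so their Jacobians agree as
      well.\<close>
    have "jac (\<lambda>\<theta>'. F \<theta>' 0) \<theta> = jac g \<theta>"
      by (rule jac_cong_open[OF open_ball \<theta> g]) (use C1_on_slice[OF F \<theta> I] in simp_all)
    then show ?thesis using C1_on_limit_at_right[OF F \<theta> open_ball I open_greaterThanLessThan] g[OF \<theta>] by simp
  qed
  show ?thesis
  proof (intro exI[of _ \<epsilon>] exI[of _ xs] exI[of _ us] conjI ballI allI impI)
    show "Ck_on 1 (ball \<theta>b \<epsilon> \<times> {0<..<\<epsilon>}) (\<lambda>(\<theta>, \<gamma>). xs \<theta> \<gamma> t)"
      "Ck_on 1 (ball \<theta>b \<epsilon> \<times> {0<..<\<epsilon>}) (\<lambda>(\<theta>, \<gamma>). us \<theta> \<gamma> t)" for t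
      unfolding C1_on_iff_Ck_on[symmetric] by (rule C1_on_subset[OF C1(1) half] C1_on_subset[OF C1(2) half])+
  qed (use \<epsilon> sub iso aux feas[unfolded SB_feas_def] lim[OF C1(1) xi(1)] lim[OF C1(2) xi(2)] in \<open>simp_all del: mem_ball\<close>)
qed

end
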